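(* Let $G$ be a real Lie group and $K$ a connected subgroup of $G$ of the form (center of $G$) times (compact subgroup). Let $\mathfrak{g},\mathfrak{k}$ be the Lie algebras of $G,K$ and $\mathfrak{g}_{\mathbb{C}},\mathfrak{k}_{\mathbb{C}}$ their complexifications. Assume there is a direct sum decomposition $$\mathfrak{g}_{\mathbb{C}}=\mathfrak{p}_{\mathbb{C}}^{+}+\mathfrak{k}_{\mathbb{C}}+\mathfrak{p}_{\mathbb{C}}^{-}$$ with Lie subalgebras $\mathfrak{p}_{\mathbb{C}}^{\pm}$ of $\mathfrak{g}_{\mathbb{C}}$ such that $[\mathfrak{k}_{\mathbb{C}},\mathfrak{p}_{\mathbb{C}}^{\pm}]\subset\mathfrak{p}_{\mathbb{C}}^{\pm}$. Let $(\pi,V)$ be a $(\mathfrak{g},K)$-module such that every invariant subspace has an invariant complement. Let $v_0$ be a vector in $V$ with the following properties. (i) $V$ is spanned by the vectors $\pi(X)v_0$, where $X$ runs through $\mathcal{U}(\mathfrak{g}_{\mathbb{C}})$. (ii) The span of the vectors $\pi(k)v_0$, where $k$ runs through $K$, is an irreducible representation $\tau$ of $K$. (iii) The $K$-type $\tau$ occurs exactly once in the $\mathfrak{g}_{\mathbb{C}}$-module $$L_\tau:=\mathcal{U}(\mathfrak{g}_{\mathbb{C}})\otimes_{\mathcal{U}(\mathfrak{k}_{\mathbb{C}}+\mathfrak{p}_{\mathbb{C}}^{-})}\tau,$$ where $\tau$ is extended to a representation of $\mathfrak{k}_{\mathbb{C}}+\mathfrak{p}_{\mathbb{C}}^{-}$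 on which $\mathfrak{p}_{\mathbb{C}}^{-}$ acts trivially (i.e. by zero). (iv) $\pi(\mathfrak{p}_{\mathbb{C}}^{-})v_0=0$. Then $\pi$ is irreducible.
   Context: A $K$-type is an equivalence class of irreducible finite-dimensional complex representations of $K$; since $K$ is connected, a $K$-type is determined by the corresponding irreducible representation of $\mathfrak{k}_{\mathbb{C}}$, and occurrence of $\tau$ in $L_\tau$ is understood through the $\mathfrak{k}_{\mathbb{C}}$-action; "exactly once" means with multiplicity one. $\mathcal{U}(\cdot)$ is the universal enveloping algebra. A $(\mathfrak{g},K)$-module is a complex vector space with actions of $\mathfrak{g}$ and $K$ satisfying the usual compatibility conditions (the $K$-action is locally finite and smooth, its differential is the restriction of the $\mathfrak{g}$-action to $\mathfrak{k}$, and $\pi(k)\pi(X)\pi(k)^{-1}=\pi(\mathrm{Ad}(k)X)$). Invariant means invariant under both $\mathfrak{g}$ and $K$; irreducible means non-zero with no proper non-zero invariant subspaces. *)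

theory Defs
  imports
    "HOL-Analysis.Analysis"
    "HOL-Algebra.QuotRing"
    "HOL-Algebra.Free_Abelian_Groups"
begin

section \<open>Lie groups\<close>

text \<open>
  \<open>C\<^sup>n\<close> functions on an open subset of a finite-dimensional normed space: all iterated
  directional derivatives up to order \<open>n\<close> exist as Frechet derivatives and are continuous.
\<close>

primrec Ck_on ::
    "nat \<Rightarrow> 'a::real_normed_vector set \<Rightarrow> ('a \<Rightarrow> 'b::real_normed_vector) \<Rightarrow> bool" where
  "Ck_on 0 S f \<longleftrightarrow> continuous_on S f"
| "Ck_on (Suc n) S f \<longleftrightarrow>
     (\<forall>x\<in>S. f differentiable (at x)) \<and> (\<forall>v. Ck_on n S (\<lambda>x. frechet_derivative f (at x) v))"

definition smooth_on ::
    "'a::real_normed_vector set \<Rightarrow> ('a \<Rightarrow> 'b::real_normed_vector) \<Rightarrow> bool" where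
  "smooth_on S f \<longleftrightarrow> (\<forall>n. Ck_on n S f)"

type_synonym ('g, 'e) chart = "'g set \<times> ('g \<Rightarrow> 'e)"

definition chart_inv :: "('g, 'e) chart \<Rightarrow> 'e \<Rightarrow> 'g" where
  "chart_inv c = inv_into (fst c) (snd c)"

record ('g, 'e) lgroup = "'g monoid" +
  topo :: "'g topology"
  atlas :: "('g, 'e) chart set"

text \<open>
  The model space is a real normed space that is assumed finite-dimensional, rather than a
  \<^class>\<open>euclidean_space\<close>, because the latter class excludes dimension 0.
\<close>

locale lie_group = group G
  for G :: "('g, 'e::real_normed_vector) lgroup" (structure) +
  assumes finite_dimensional: "\<exists>B :: 'e set. finite B \<and> span B = UNIV"
    and topspace_eq: "topspace (topo G) = carrier G"
    and hausdorff: "Hausdorff_space (topo G)"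
    and second_countable: "second_countable (topo G)"
    and atlas_covers: "(\<Union>c\<in>atlas G. fst c) = carrier G"
    and charts: "\<And>U \<phi>. (U, \<phi>) \<in> atlas G \<Longrightarrow>
          openin (topo G) U \<and> open (\<phi> ` U) \<and>
          homeomorphic_map (subtopology (topo G) U) (top_of_set (\<phi> ` U)) \<phi>"
    and transitions_smooth: "\<And>U \<phi> W \<psi>. (U, \<phi>) \<in> atlas G \<Longrightarrow> (W, \<psi>) \<in> atlas G \<Longrightarrow>
          smooth_on (\<phi> ` (U \<inter> W)) (\<lambda>a. \<psi> (inv_into U \<phi> a))"
    and mult_continuous:
          "continuous_map (prod_topology (topo G) (topo G)) (topo G) (\<lambda>(x, y). x \<otimes> y)"
    and mult_smooth: "\<And>U \<phi> W \<psi> Q \<theta>.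
          (U, \<phi>) \<in> atlas G \<Longrightarrow> (W, \<psi>) \<in> atlas G \<Longrightarrow> (Q, \<theta>) \<in> atlas G \<Longrightarrow>
          smooth_on {(\<phi> x, \<psi> y) | x y. x \<in> U \<and> y \<in> W \<and> x \<otimes> y \<in> Q}
            (\<lambda>(a, b). \<theta> (inv_into U \<phi> a \<otimes> inv_into W \<psi> b))"
    and inv_continuous: "continuous_map (topo G) (topo G) (\<lambda>x. inv x)"
    and inv_smooth: "\<And>U \<phi> W \<psi>. (U, \<phi>) \<in> atlas G \<Longrightarrow> (W, \<psi>) \<in> atlas G \<Longrightarrow>
          smooth_on (\<phi> ` {x \<in> U. inv x \<in> W}) (\<lambda>a. \<psi> (inv (inv_into U \<phi> a)))"

definition smooth_fun_on ::
    "('g, 'e::real_normed_vector) lgroup \<Rightarrow> 'g set \<Rightarrow> ('g \<Rightarrow> 'b::real_normed_vector) \<Rightarrow> bool" where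
  "smooth_fun_on G U f \<longleftrightarrow>
     (\<forall>(W, \<psi>)\<in>atlas G. smooth_on (\<psi> ` (U \<inter> W)) (\<lambda>a. f (inv_into W \<psi> a)))"

text \<open>
  A function on a subset is smooth if it locally extends to a smooth function on an open subset
  of \<open>G\<close>; for a closed subgroup this is smoothness for its submanifold structure.
\<close>

definition smooth_fun_on_subset ::
    "('g, 'e::real_normed_vector) lgroup \<Rightarrow> 'g set \<Rightarrow> ('g \<Rightarrow> 'b::real_normed_vector) \<Rightarrow> bool" where
  "smooth_fun_on_subset G K f \<longleftrightarrow>
     (\<forall>x\<in>K. \<exists>U F. openin (topo G) U \<and> x \<in> U \<and> smooth_fun_on G U F \<and> (\<forall>y\<in>U \<inter> K. F y = f y))"

definition group_center :: "('g, 'z) monoid_scheme \<Rightarrow> 'g set" where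
  "group_center G = {z \<in> carrier G. \<forall>x\<in>carrier G. z \<otimes>\<^bsub>G\<^esub> x = x \<otimes>\<^bsub>G\<^esub> z}"


section \<open>The Lie algebra of a Lie group\<close>

text \<open>
  The Lie algebra of \<open>G\<close> is the tangent space at \<open>\<one>\<close> with the bracket of left-invariant vector
  fields. A chart \<open>c\<close> around \<open>\<one>\<close> identifies this tangent space with the model space \<open>'e\<close>; this is
  how the type \<open>'e\<close> plays the role of the Lie algebra below.
\<close>

definition left_inv_field ::
    "('g, 'e::real_normed_vector) lgroup \<Rightarrow> ('g, 'e) chart \<Rightarrow> 'e \<Rightarrow> ('g \<Rightarrow> real) \<Rightarrow> 'g \<Rightarrow> real" where
  "left_inv_field G c X f x =
     frechet_derivative (\<lambda>u. f (x \<otimes>\<^bsub>G\<^esub> chart_inv c u)) (at (snd c \<one>\<^bsub>G\<^esub>)) X"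

definition lie_bracket ::
    "('g, 'e::real_normed_vector) lgroup \<Rightarrow> ('g, 'e) chart \<Rightarrow> 'e \<Rightarrow> 'e \<Rightarrow> 'e" where
  "lie_bracket G c X Y = (THE Z. \<forall>U f. openin (topo G) U \<and> smooth_fun_on G U f \<longrightarrow>
     (\<forall>x\<in>U. left_inv_field G c X (left_inv_field G c Y f) x
            - left_inv_field G c Y (left_inv_field G c X f) x = left_inv_field G c Z f x))"

definition Ad ::
    "('g, 'e::real_normed_vector) lgroup \<Rightarrow> ('g, 'e) chart \<Rightarrow> 'g \<Rightarrow> 'e \<Rightarrow> 'e" where
  "Ad G c x X =
     frechet_derivative (\<lambda>u. snd c (x \<otimes>\<^bsub>G\<^esub> chart_inv c u \<otimes>\<^bsub>G\<^esub> inv\<^bsub>G\<^esub> x)) (at (snd c \<one>\<^bsub>G\<^esub>)) X"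

text \<open>
  \<open>\<gamma> t = exp (t X)\<close>. A continuous homomorphism is automatically smooth, hence determined by its
  velocity at 0.
\<close>

definition one_param_subgroup ::
    "('g, 'e::real_normed_vector) lgroup \<Rightarrow> ('g, 'e) chart \<Rightarrow> 'e \<Rightarrow> (real \<Rightarrow> 'g) \<Rightarrow> bool" where
  "one_param_subgroup G c X \<gamma> \<longleftrightarrow>
     continuous_map euclideanreal (topo G) \<gamma> \<and> (\<forall>s t. \<gamma> (s + t) = \<gamma> s \<otimes>\<^bsub>G\<^esub> \<gamma> t) \<and>
     ((\<lambda>t. snd c (\<gamma> t)) has_vector_derivative X) (at 0)"

text \<open>
  The Lie algebra \<open>{X. \<forall>t. exp (t X) \<in> K}\<close> of a closed subgroup \<open>K\<close>. The product of the center and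
  a compact subgroup is closed.
\<close>

definition subgroup_lie_algebra ::
    "('g, 'e::real_normed_vector) lgroup \<Rightarrow> ('g, 'e) chart \<Rightarrow> 'g set \<Rightarrow> 'e set" where
  "subgroup_lie_algebra G c K = {X. \<exists>\<gamma>. one_param_subgroup G c X \<gamma> \<and> range \<gamma> \<subseteq> K}"


section \<open>Complexification\<close>

text \<open>The pair \<open>(X, Y)\<close> stands for \<open>X + \<i> Y\<close>.\<close>

definition cscale :: "complex \<Rightarrow> 'e::real_vector \<times> 'e \<Rightarrow> 'e \<times> 'e" where
  "cscale z Z = (Re z *\<^sub>R fst Z - Im z *\<^sub>R snd Z, Re z *\<^sub>R snd Z + Im z *\<^sub>R fst Z)"

definition cbracket ::
    "('e::real_vector \<Rightarrow> 'e \<Rightarrow> 'e) \<Rightarrow> 'e \<times> 'e \<Rightarrow> 'e \<times> 'e \<Rightarrow> 'e \<times> 'e" where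
  "cbracket br Z W =
     (br (fst Z) (fst W) - br (snd Z) (snd W), br (fst Z) (snd W) + br (snd Z) (fst W))"

definition crep ::
    "(complex \<Rightarrow> 'v::ab_group_add \<Rightarrow> 'v) \<Rightarrow> ('e \<Rightarrow> 'v \<Rightarrow> 'v) \<Rightarrow> 'e \<times> 'e \<Rightarrow> 'v \<Rightarrow> 'v" where
  "crep sc \<rho> Z v = \<rho> (fst Z) v + sc \<i> (\<rho> (snd Z) v)"

definition clie_subalgebra ::
    "('e::real_vector \<Rightarrow> 'e \<Rightarrow> 'e) \<Rightarrow> ('e \<times> 'e) set \<Rightarrow> bool" where
  "clie_subalgebra br S \<longleftrightarrow>
     module.subspace cscale S \<and> (\<forall>X\<in>S. \<forall>Y\<in>S. cbracket br X Y \<in> S)"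


section \<open>Universal enveloping algebras\<close>

datatype 'a free_monoid = Word (letters: "'a list")

instantiation free_monoid :: (type) monoid_add
begin

definition "0 = Word []"

definition "u + v = Word (letters u @ letters v)"

instance
  by standard (simp_all add: zero_free_monoid_def plus_free_monoid_def)

end

type_synonym 'a free_alg = "'a free_monoid \<Rightarrow>\<^sub>0 complex"

text \<open>The free associative unital complex algebra on a set \<open>H\<close> of noncommuting variables.\<close>

definition free_algebra :: "'a set \<Rightarrow> 'a free_alg ring" where
  "free_algebra H =
     \<lparr>carrier = {p. \<forall>w\<in>Poly_Mapping.keys p. set (letters w) \<subseteq> H},
      monoid.mult = (*), one = 1, ring.zero = 0, ring.add = (+)\<rparr>"

definition free_var :: "'a \<Rightarrow> 'a free_alg" where
  "free_var X = Poly_Mapping.single (Word [X]) 1"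

definition free_const :: "complex \<Rightarrow> 'a free_alg" where
  "free_const z = Poly_Mapping.single 0 z"

text \<open>
  The enveloping algebra of a complex Lie algebra with carrier \<open>H\<close>, scalar multiplication \<open>s\<close> and
  bracket \<open>br\<close>. The first two families of relations turn the free algebra on the set \<open>H\<close> into the
  tensor algebra of the vector space \<open>H\<close>.
\<close>

definition uea_ideal ::
    "(complex \<Rightarrow> 'a::ab_group_add \<Rightarrow> 'a) \<Rightarrow> ('a \<Rightarrow> 'a \<Rightarrow> 'a) \<Rightarrow> 'a set \<Rightarrow> 'a free_alg set" where
  "uea_ideal s br H = genideal (free_algebra H)
     ({free_var (X + Y) - free_var X - free_var Y | X Y. X \<in> H \<and> Y \<in> H} \<union>
      {free_var (s z X) - free_const z * free_var X | z X. X \<in> H} \<union>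
      {free_var X * free_var Y - free_var Y * free_var X - free_var (br X Y) | X Y. X \<in> H \<and> Y \<in> H})"

definition uea ::
    "(complex \<Rightarrow> 'a::ab_group_add \<Rightarrow> 'a) \<Rightarrow> ('a \<Rightarrow> 'a \<Rightarrow> 'a) \<Rightarrow> 'a set \<Rightarrow> 'a free_alg set ring" where
  "uea s br H = free_algebra H Quot uea_ideal s br H"

definition uea_class ::
    "(complex \<Rightarrow> 'a::ab_group_add \<Rightarrow> 'a) \<Rightarrow> ('a \<Rightarrow> 'a \<Rightarrow> 'a) \<Rightarrow> 'a set \<Rightarrow> 'a free_alg \<Rightarrow> 'a free_alg set"
  where
  "uea_class s br H p = uea_ideal s br H +>\<^bsub>free_algebra H\<^esub> p"

text \<open>
  The action of the enveloping algebra extending a Lie algebra representation \<open>\<rho>\<close>; the result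
  does not depend on the chosen representative.
\<close>

definition free_act ::
    "(complex \<Rightarrow> 'v::ab_group_add \<Rightarrow> 'v) \<Rightarrow> ('a \<Rightarrow> 'v \<Rightarrow> 'v) \<Rightarrow> 'a free_alg \<Rightarrow> 'v \<Rightarrow> 'v" where
  "free_act sc \<rho> p v =
     (\<Sum>w\<in>Poly_Mapping.keys p. sc (Poly_Mapping.lookup p w) (foldr \<rho> (letters w) v))"

definition uea_act ::
    "(complex \<Rightarrow> 'v::ab_group_add \<Rightarrow> 'v) \<Rightarrow> ('a \<Rightarrow> 'v \<Rightarrow> 'v) \<Rightarrow> 'a free_alg set \<Rightarrow> 'v \<Rightarrow> 'v" where
  "uea_act sc \<rho> u v = free_act sc \<rho> (SOME p. p \<in> u) v"


section \<open>Tensor products over a ring\<close>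

text \<open>
  The tensor product of a right module \<open>M\<close> (with action \<open>ra\<close>) and a left module \<open>N\<close> (with action
  \<open>la\<close>) over a ring with carrier \<open>R\<close>. As in \<^const>\<open>free_Abelian_group\<close>, the group operation of the
  resulting commutative group is the field \<^const>\<open>monoid.mult\<close> of the record.
\<close>

definition tensor_relations ::
    "('m, 'z) ring_scheme \<Rightarrow> 'n::ab_group_add set \<Rightarrow> 'r set \<Rightarrow> ('m \<Rightarrow> 'r \<Rightarrow> 'm) \<Rightarrow> ('r \<Rightarrow> 'n \<Rightarrow> 'n)
      \<Rightarrow> ('m \<times> 'n \<Rightarrow>\<^sub>0 int) set" where
  "tensor_relations M N R ra la = generate (free_Abelian_group (carrier M \<times> N))
     ({frag_of (m \<oplus>\<^bsub>M\<^esub> m', n) - frag_of (m, n) - frag_of (m', n) | m m' n.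
         m \<in> carrier M \<and> m' \<in> carrier M \<and> n \<in> N} \<union>
      {frag_of (m, n + n') - frag_of (m, n) - frag_of (m, n') | m n n'.
         m \<in> carrier M \<and> n \<in> N \<and> n' \<in> N} \<union>
      {frag_of (ra m r, n) - frag_of (m, la r n) | m r n. m \<in> carrier M \<and> r \<in> R \<and> n \<in> N})"

definition tensor_product ::
    "('m, 'z) ring_scheme \<Rightarrow> 'n::ab_group_add set \<Rightarrow> 'r set \<Rightarrow> ('m \<Rightarrow> 'r \<Rightarrow> 'm) \<Rightarrow> ('r \<Rightarrow> 'n \<Rightarrow> 'n)
      \<Rightarrow> ('m \<times> 'n \<Rightarrow>\<^sub>0 int) set monoid" where
  "tensor_product M N R ra la =
     free_Abelian_group (carrier M \<times> N) Mod tensor_relations M N R ra la"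

text \<open>The endomorphism \<open>f \<otimes> id\<close> induced by an endomorphism \<open>f\<close> of the right module \<open>M\<close>.\<close>

definition tensor_map ::
    "('m, 'z) ring_scheme \<Rightarrow> 'n::ab_group_add set \<Rightarrow> 'r set \<Rightarrow> ('m \<Rightarrow> 'r \<Rightarrow> 'm) \<Rightarrow> ('r \<Rightarrow> 'n \<Rightarrow> 'n)
      \<Rightarrow> ('m \<Rightarrow> 'm) \<Rightarrow> ('m \<times> 'n \<Rightarrow>\<^sub>0 int) set \<Rightarrow> ('m \<times> 'n \<Rightarrow>\<^sub>0 int) set" where
  "tensor_map M N R ra la f A =
     (\<Union>a\<in>A. tensor_relations M N R ra la #>\<^bsub>free_Abelian_group (carrier M \<times> N)\<^esub>
        frag_extend (\<lambda>(m, n). frag_of (f m, n)) a)"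


section \<open>\<open>(\<gg>, K)\<close>-modules\<close>

text \<open>
  \<open>V\<close> carries no topology, so smoothness of the locally finite \<open>K\<close>-action and its differential are
  expressed by applying linear functionals; on the finite-dimensional span of an orbit this is the
  usual notion.
\<close>

locale gK_module = lie_group G + vector_space sc
  for G :: "('g, 'e::real_normed_vector) lgroup" (structure)
    and sc :: "complex \<Rightarrow> 'v::ab_group_add \<Rightarrow> 'v" +
  fixes c :: "('g, 'e) chart"
    and K :: "'g set"
    and \<pi> :: "'e \<Rightarrow> 'v \<Rightarrow> 'v"
    and \<Phi> :: "'g \<Rightarrow> 'v \<Rightarrow> 'v"
  assumes lie_linear: "\<And>X. Vector_Spaces.linear sc sc (\<pi> X)"
    and lie_add: "\<And>X Y v. \<pi> (X + Y) v = \<pi> X v + \<pi> Y v"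
    and lie_scaleR: "\<And>r X v. \<pi> (r *\<^sub>R X) v = sc (complex_of_real r) (\<pi> X v)"
    and lie_bracket: "\<And>X Y v. \<pi> (lie_bracket G c X Y) v = \<pi> X (\<pi> Y v) - \<pi> Y (\<pi> X v)"
    and K_linear: "\<And>k. k \<in> K \<Longrightarrow> Vector_Spaces.linear sc sc (\<Phi> k)"
    and K_one: "\<And>v. \<Phi> \<one> v = v"
    and K_mult: "\<And>k l v. k \<in> K \<Longrightarrow> l \<in> K \<Longrightarrow> \<Phi> (k \<otimes> l) v = \<Phi> k (\<Phi> l v)"
    and K_locally_finite: "\<And>v. \<exists>B. finite B \<and> (\<lambda>k. \<Phi> k v) ` K \<subseteq> module.span sc B"
    and K_smooth: "\<And>v L. Vector_Spaces.linear sc (*) L \<Longrightarrow>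
          smooth_fun_on_subset G K (\<lambda>k. L (\<Phi> k v))"
    and K_differential: "\<And>X \<gamma> v L. one_param_subgroup G c X \<gamma> \<Longrightarrow> range \<gamma> \<subseteq> K \<Longrightarrow>
          Vector_Spaces.linear sc (*) L \<Longrightarrow>
          ((\<lambda>t. L (\<Phi> (\<gamma> t) v)) has_vector_derivative L (\<pi> X v)) (at 0)"
    and K_compatible: "\<And>k X v. k \<in> K \<Longrightarrow> \<Phi> k (\<pi> X (\<Phi> (inv k) v)) = \<pi> (Ad G c k X) v"

definition K_invariant ::
    "(complex \<Rightarrow> 'v::ab_group_add \<Rightarrow> 'v) \<Rightarrow> 'g set \<Rightarrow> ('g \<Rightarrow> 'v \<Rightarrow> 'v) \<Rightarrow> 'v set \<Rightarrow> bool" where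
  "K_invariant sc K \<Phi> W \<longleftrightarrow> module.subspace sc W \<and> (\<forall>k\<in>K. \<Phi> k ` W \<subseteq> W)"

definition K_irreducible ::
    "(complex \<Rightarrow> 'v::ab_group_add \<Rightarrow> 'v) \<Rightarrow> 'g set \<Rightarrow> ('g \<Rightarrow> 'v \<Rightarrow> 'v) \<Rightarrow> 'v set \<Rightarrow> bool" where
  "K_irreducible sc K \<Phi> S \<longleftrightarrow> K_invariant sc K \<Phi> S \<and> S \<noteq> {0} \<and>
     (\<forall>W. K_invariant sc K \<Phi> W \<and> W \<subseteq> S \<longrightarrow> W = {0} \<or> W = S)"

definition gK_invariant ::
    "(complex \<Rightarrow> 'v::ab_group_add \<Rightarrow> 'v) \<Rightarrow> 'g set \<Rightarrow> ('e \<Rightarrow> 'v \<Rightarrow> 'v) \<Rightarrow> ('g \<Rightarrow> 'v \<Rightarrow> 'v) \<Rightarrow> 'v set \<Rightarrow> bool"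
  where
  "gK_invariant sc K \<pi> \<Phi> W \<longleftrightarrow> K_invariant sc K \<Phi> W \<and> (\<forall>X. \<pi> X ` W \<subseteq> W)"

definition gK_irreducible ::
    "(complex \<Rightarrow> 'v::ab_group_add \<Rightarrow> 'v) \<Rightarrow> 'g set \<Rightarrow> ('e \<Rightarrow> 'v \<Rightarrow> 'v) \<Rightarrow> ('g \<Rightarrow> 'v \<Rightarrow> 'v) \<Rightarrow> bool" where
  "gK_irreducible sc K \<pi> \<Phi> \<longleftrightarrow> (UNIV :: 'v set) \<noteq> {0} \<and>
     (\<forall>W. gK_invariant sc K \<pi> \<Phi> W \<longrightarrow> W = {0} \<or> W = UNIV)"


section \<open>The induced module\<close>

text \<open>
  In this section \<open>br\<close> is the bracket of the real Lie algebra \<open>'e\<close>, \<open>\<kappa>\<close> and \<open>q\<close> are the complex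
  subalgebras denoted \<open>\<kk>\<^sub>\<complex>\<close> and \<open>\<pp>\<^sub>\<complex>\<^sup>-\<close> in the literature, and \<open>\<tau>\<close> is a subspace of \<open>V\<close> stable under
  \<open>\<kappa>\<close>.
\<close>

text \<open>The action of \<open>\<kappa> + q\<close> (a direct sum) on \<open>\<tau>\<close>, with \<open>q\<close> acting by zero.\<close>

definition inflated_rep ::
    "(complex \<Rightarrow> 'v::ab_group_add \<Rightarrow> 'v) \<Rightarrow> ('e::real_vector \<Rightarrow> 'v \<Rightarrow> 'v) \<Rightarrow>
      ('e \<times> 'e) set \<Rightarrow> ('e \<times> 'e) set \<Rightarrow> 'e \<times> 'e \<Rightarrow> 'v \<Rightarrow> 'v" where
  "inflated_rep sc \<pi> \<kappa> q Z = crep sc \<pi> (THE X. X \<in> \<kappa> \<and> Z - X \<in> q)"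

definition sum_carrier :: "'a::ab_group_add set \<Rightarrow> 'a set \<Rightarrow> 'a set" where
  "sum_carrier A B = {a + b | a b. a \<in> A \<and> b \<in> B}"

text \<open>Right multiplication on \<open>U(\<gg>\<^sub>\<complex>)\<close> via the canonical homomorphism \<open>U(\<kappa> + q) \<rightarrow> U(\<gg>\<^sub>\<complex>)\<close>.\<close>

definition uea_right_mult ::
    "('e::real_vector \<Rightarrow> 'e \<Rightarrow> 'e) \<Rightarrow>
      ('e \<times> 'e) free_alg set \<Rightarrow> ('e \<times> 'e) free_alg set \<Rightarrow> ('e \<times> 'e) free_alg set" where
  "uea_right_mult br u a =
     u \<otimes>\<^bsub>uea cscale (cbracket br) UNIV\<^esub> uea_class cscale (cbracket br) UNIV (SOME p. p \<in> a)"

type_synonym ('e, 'v) induced = "(('e \<times> 'e) free_alg set \<times> 'v \<Rightarrow>\<^sub>0 int) set"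

definition induced_module ::
    "('e::real_vector \<Rightarrow> 'e \<Rightarrow> 'e) \<Rightarrow> (complex \<Rightarrow> 'v::ab_group_add \<Rightarrow> 'v) \<Rightarrow> ('e \<Rightarrow> 'v \<Rightarrow> 'v) \<Rightarrow>
      ('e \<times> 'e) set \<Rightarrow> ('e \<times> 'e) set \<Rightarrow> 'v set \<Rightarrow> ('e, 'v) induced monoid" where
  "induced_module br sc \<pi> \<kappa> q \<tau> =
     tensor_product (uea cscale (cbracket br) UNIV) \<tau>
       (carrier (uea cscale (cbracket br) (sum_carrier \<kappa> q)))
       (uea_right_mult br) (uea_act sc (inflated_rep sc \<pi> \<kappa> q))"

text \<open>Left multiplication by the class in \<open>U(\<gg>\<^sub>\<complex>)\<close> of an element \<open>p\<close> of the free algebra.\<close>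

definition induced_act ::
    "('e::real_vector \<Rightarrow> 'e \<Rightarrow> 'e) \<Rightarrow> (complex \<Rightarrow> 'v::ab_group_add \<Rightarrow> 'v) \<Rightarrow> ('e \<Rightarrow> 'v \<Rightarrow> 'v) \<Rightarrow>
      ('e \<times> 'e) set \<Rightarrow> ('e \<times> 'e) set \<Rightarrow> 'v set \<Rightarrow>
      ('e \<times> 'e) free_alg \<Rightarrow> ('e, 'v) induced \<Rightarrow> ('e, 'v) induced" where
  "induced_act br sc \<pi> \<kappa> q \<tau> p =
     tensor_map (uea cscale (cbracket br) UNIV) \<tau>
       (carrier (uea cscale (cbracket br) (sum_carrier \<kappa> q)))
       (uea_right_mult br) (uea_act sc (inflated_rep sc \<pi> \<kappa> q))
       (\<lambda>u. uea_class cscale (cbracket br) UNIV p \<otimes>\<^bsub>uea cscale (cbracket br) UNIV\<^esub> u)"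

text \<open>\<open>Hom\<close> of \<open>\<kappa>\<close>-modules from \<open>\<tau>\<close> to the induced module; only the values on \<open>\<tau>\<close> matter.\<close>

definition induced_hom ::
    "('e::real_vector \<Rightarrow> 'e \<Rightarrow> 'e) \<Rightarrow> (complex \<Rightarrow> 'v::ab_group_add \<Rightarrow> 'v) \<Rightarrow> ('e \<Rightarrow> 'v \<Rightarrow> 'v) \<Rightarrow>
      ('e \<times> 'e) set \<Rightarrow> ('e \<times> 'e) set \<Rightarrow> 'v set \<Rightarrow> ('v \<Rightarrow> ('e, 'v) induced) set" where
  "induced_hom br sc \<pi> \<kappa> q \<tau> = {f.
     (\<forall>t\<in>\<tau>. f t \<in> carrier (induced_module br sc \<pi> \<kappa> q \<tau>)) \<and>
     (\<forall>t\<in>\<tau>. \<forall>t'\<in>\<tau>. f (t + t') = f t \<otimes>\<^bsub>induced_module br sc \<pi> \<kappa> q \<tau>\<^esub> f t') \<and>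
     (\<forall>z. \<forall>t\<in>\<tau>. f (sc z t) = induced_act br sc \<pi> \<kappa> q \<tau> (free_const z) (f t)) \<and>
     (\<forall>X\<in>\<kappa>. \<forall>t\<in>\<tau>. f (crep sc \<pi> X t) = induced_act br sc \<pi> \<kappa> q \<tau> (free_var X) (f t))}"

text \<open>
  The multiplicity of \<open>\<tau>\<close> is the complex dimension of the space of homomorphisms, which is required
  to be 1: there is a non-zero homomorphism and every other one is a scalar multiple of it.
\<close>

definition occurs_exactly_once ::
    "('e::real_vector \<Rightarrow> 'e \<Rightarrow> 'e) \<Rightarrow> (complex \<Rightarrow> 'v::ab_group_add \<Rightarrow> 'v) \<Rightarrow> ('e \<Rightarrow> 'v \<Rightarrow> 'v) \<Rightarrow>
      ('e \<times> 'e) set \<Rightarrow> ('e \<times> 'e) set \<Rightarrow> 'v set \<Rightarrow> bool" where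
  "occurs_exactly_once br sc \<pi> \<kappa> q \<tau> \<longleftrightarrow>
     (\<exists>f\<in>induced_hom br sc \<pi> \<kappa> q \<tau>.
        (\<exists>t\<in>\<tau>. f t \<noteq> \<one>\<^bsub>induced_module br sc \<pi> \<kappa> q \<tau>\<^esub>) \<and>
        (\<forall>h\<in>induced_hom br sc \<pi> \<kappa> q \<tau>.
           \<exists>z. \<forall>t\<in>\<tau>. h t = induced_act br sc \<pi> \<kappa> q \<tau> (free_const z) (f t)))"

end

theory Submission
  imports
    Defs
    "HOL-Computational_Algebra.Fundamental_Theorem_Algebra"
    "HOL-Library.Function_Algebras"
begin

text \<open>
  Let \<open>\<tau>'\<close> be the space of vectors in \<open>\<tau>\<close> killed by \<open>pm\<close>; it contains \<open>v0\<close> and is stable under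
  \<open>\<kk>\<close>. Given complementary invariant subspaces \<open>W\<close> and \<open>W'\<close>, the projection \<open>P\<close> of \<open>V\<close> onto \<open>W\<close>
  along \<open>W'\<close> commutes with \<open>\<gg>\<close>. It has to be shown that \<open>v0\<close> is an eigenvector of \<open>P\<close>: then \<open>v0\<close>
  lies in \<open>W\<close> or in \<open>W'\<close>, and the subspace containing it is everything because \<open>v0\<close> generates \<open>V\<close>.

  Since \<open>C\<close> is compact and the center acts trivially on \<open>\<gg>\<close> and, by Schur's lemma, by scalars on
  \<open>\<tau>\<close>, there are inner products on \<open>\<gg>\<close> and \<open>\<tau>\<close> that \<open>\<kk>\<close> preserves up to scalars. They induce such
  an inner product on the tensors of degree at most \<open>n\<close> over \<open>\<gg>\<close>, tensored with \<open>\<tau>'\<close>. For large \<open>n\<close>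
  the evaluation map from this space to \<open>V\<close> hits \<open>P \<tau>'\<close>, and lifting orthogonally to its kernel
  turns \<open>P\<close> into a \<open>\<kk>\<close>-homomorphism from \<open>\<tau>'\<close> to the tensors, hence, after composition with the
  orthogonal projection \<open>pr\<close> of \<open>\<tau>\<close> onto \<open>\<tau>'\<close>, from \<open>\<tau>\<close> to the induced module. By multiplicity one
  it is proportional to \<open>t \<mapsto> 1 \<otimes> t\<close>. The map \<open>u \<otimes> t \<mapsto> u (pr t)\<close> from the induced module to \<open>V\<close>
  takes the two homomorphisms at \<open>v0\<close> to \<open>P v0\<close> and \<open>v0\<close>.
\<close>

section \<open>Calculus in finite-dimensional normed spaces\<close>

text \<open>The tensors are treated as a \<kk>-module only, so no averaging over \<open>K\<close> is
  available on them. Its substitute is infinitesimal: an operator \<open>T\<close> with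
  \<open>b (T u) v + b u (T v) = c * b u v\<close> that preserves a subspace also preserves its
  orthogonal complement, and this property passes from \<gg> and \<open>\<tau>\<close> to tensors.
  The constant \<open>c\<close> treats central directions and multiplication by complex numbers
  alike.

  Stability of \<open>\<tau>'\<close> under \<kk> is pure algebra, coming from
  [\<kk>, \<open>pm\<close>] in \<open>pm\<close>; that \<open>pm\<close> kills every vector of
  \<open>\<tau>\<close> would require going back from \<kk> to \<open>K\<close>. Since
  \<open>pm\<close> acts by zero in the inflated action, u \<otimes> t \<mapsto> u t respects the
  relations only on vectors that \<open>pm\<close> kills in V as well, hence the detour over
  \<open>pr\<close>.

  The analysis serves two facts. First, \<kk>, although defined through one-parameter subgroups, is
  a subspace closed under the bracket. Second, ad is the derivative of Ad; this turns invariance of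
  a form under Ad into skewness for the bracket, which is defined by left-invariant vector
  fields.\<close>

lemma independent_norm_bound:
  fixes B :: "'a::real_normed_vector set"
  assumes fin: "finite B" and ind: "independent B"
  shows "\<exists>d>0. \<forall>u. d * (\<Sum>b\<in>B. \<bar>u b\<bar>) \<le> norm (\<Sum>b\<in>B. u b *\<^sub>R b)"
proof (cases "B = {}")
  case True
  then show ?thesis by (auto intro: exI[of _ 1])
next
  case False
  let ?n = "\<lambda>u::'a \<Rightarrow> real. norm (\<Sum>b\<in>B. u b *\<^sub>R b)"
  \<comment> \<open>The coefficients live in the product over all of \<open>'a\<close>, so those
    outside \<open>B\<close> are pinned to 0. Tychonoff makes \<open>P\<close> compact, hence also
    the unit sphere \<open>S\<close> of the sum norm; the minimum of \<open>?n\<close> on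
    \<open>S\<close> is positive by independence and serves as the constant.\<close>
  define P where "P = PiE UNIV (\<lambda>b::'a. if b \<in> B then {-1..1::real} else {0})"
  define S where "S = P \<inter> {u. (\<Sum>b\<in>B. \<bar>u b\<bar>) = 1}"
  have "compactin (product_topology (\<lambda>_. euclideanreal) UNIV) P"
    unfolding P_def compactin_PiE by auto
  then have cP: "compact P"
    by (simp add: euclidean_product_topology)
  have cl: "closed {u::'a \<Rightarrow> real. (\<Sum>b\<in>B. \<bar>u b\<bar>) = 1}"
    by (intro closed_Collect_eq continuous_intros continuous_on_product_coordinates)
  have cS: "compact S"
    unfolding S_def using cP cl by (rule compact_Int_closed)
  obtain b0 where b0: "b0 \<in> B" using False by auto
  have "(\<lambda>b. if b = b0 then 1 else 0) \<in> S"
    unfolding S_def P_def using b0 fin by (auto simp: sum.remove)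
  then have ne: "S \<noteq> {}" by auto
  have cont: "continuous_on S ?n"
    by (intro continuous_intros continuous_on_product_coordinates continuous_on_subset[OF _ subset_UNIV])
  obtain u0 where u0: "u0 \<in> S" and min: "\<And>u. u \<in> S \<Longrightarrow> ?n u0 \<le> ?n u"
    using continuous_attains_inf[OF cS ne cont] by auto
  have pos: "?n u0 > 0"
  proof -
    have "\<exists>b\<in>B. u0 b \<noteq> 0"
      using u0 unfolding S_def by (force intro: ccontr simp: sum.neutral)
    then have "(\<Sum>b\<in>B. u0 b *\<^sub>R b) \<noteq> 0"
      using ind fin independent_explicit_finite_subsets[of B] by blast
    then show ?thesis by simp
  qed
  have "?n u0 * (\<Sum>b\<in>B. \<bar>u b\<bar>) \<le> ?n u" for u
  proof (cases "(\<Sum>b\<in>B. \<bar>u b\<bar>) = 0")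
    case True then show ?thesis by simp
  next
    case False
    define s where "s = (\<Sum>b\<in>B. \<bar>u b\<bar>)"
    have s: "s > 0" using False unfolding s_def by (simp add: less_le sum_nonneg)
    define v where "v b = (if b \<in> B then u b / s else 0)" for b
    have le: "\<bar>u b\<bar> \<le> s" if "b \<in> B" for b
      unfolding s_def using member_le_sum[of b B "\<lambda>b. \<bar>u b\<bar>"] that fin by auto
    have "(\<Sum>b\<in>B. \<bar>v b\<bar>) = (\<Sum>b\<in>B. \<bar>u b\<bar>) / s"
      unfolding sum_divide_distrib by (rule sum.cong) (use s in \<open>auto simp: v_def\<close>)
    then have "(\<Sum>b\<in>B. \<bar>v b\<bar>) = 1" using s by (simp add: s_def)
    moreover have "v \<in> P"
    proof -
      have "\<bar>v b\<bar> \<le> 1" if "b \<in> B" for b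
        using le[OF that] s that by (simp add: v_def)
      then have "v b \<in> (if b \<in> B then {-1..1} else {0})" for b
        by (cases "b \<in> B") (fastforce simp: abs_le_iff, simp add: v_def)
      then show ?thesis
        unfolding P_def by auto
    qed
    ultimately have "v \<in> S" by (simp add: S_def)
    then have "?n u0 \<le> ?n v" by (rule min)
    also have "(\<Sum>b\<in>B. v b *\<^sub>R b) = (1/s) *\<^sub>R (\<Sum>b\<in>B. u b *\<^sub>R b)"
      unfolding scaleR_sum_right by (rule sum.cong) (auto simp: v_def)
    also have "norm \<dots> = ?n u / s" using s by simp
    finally show ?thesis using s by (simp add: field_simps s_def)
  qed
  with pos show ?thesis by blast
qed

lemma finite_basis_exists:
  assumes "\<exists>B :: 'a::real_vector set. finite B \<and> span B = UNIV"
  obtains B :: "'a::real_vector set" where "finite B" "independent B" "span B = UNIV"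
proof -
  obtain A :: "'a set" where A: "finite A" "span A = UNIV" using assms by blast
  obtain B where B: "B \<subseteq> A" "independent B" "A \<subseteq> span B"
    using maximal_independent_subset by blast
  have "span B = UNIV" using A(2) span_mono[OF B(3)] by (metis span_span top.extremum_uniqueI)
  with B A show ?thesis using that finite_subset by blast
qed

lemma representation_sum:
  fixes B :: "'a::real_vector set"
  assumes "finite B" "independent B" "span B = UNIV"
  shows "(\<Sum>b\<in>B. representation B x b *\<^sub>R b) = x"
  using real_vector.sum_representation_eq[OF assms(2) _ assms(1) order_refl] assms(3) by simp

text \<open>The norm controls the coefficients in a basis by \<open>independent_norm_bound\<close>.
  Linear maps and functionals on the model space obtain their continuity from here.\<close>

lemma linear_bounded_finite_dim:
  fixes f :: "'a::real_normed_vector \<Rightarrow> 'b::real_normed_vector"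
  assumes fd: "\<exists>B :: 'a set. finite B \<and> span B = UNIV" and lin: "linear f"
  shows "bounded_linear f"
proof -
  obtain B :: "'a set" where B: "finite B" "independent B" "span B = UNIV"
    using finite_basis_exists[OF fd] .
  obtain d where d: "d > 0" "\<And>u. d * (\<Sum>b\<in>B. \<bar>u b\<bar>) \<le> norm (\<Sum>b\<in>B. u b *\<^sub>R b)"
    using independent_norm_bound[OF B(1,2)] by blast
  define M where "M = (\<Sum>b\<in>B. norm (f b))"
  have Mb: "norm (f b) \<le> M" if "b \<in> B" for b
    unfolding M_def using member_le_sum[of b B "\<lambda>b. norm (f b)"] that B(1) by auto
  have M0: "M \<ge> 0" unfolding M_def by (simp add: sum_nonneg)
  show ?thesis
  proof (rule bounded_linear_intro[where K = "M / d"])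
    show "f (x + y) = f x + f y" for x y using lin by (simp add: linear_add)
    show "f (r *\<^sub>R x) = r *\<^sub>R f x" for r x using lin by (simp add: linear_cmul)
    fix x
    let ?u = "representation B x"
    have "f x = f (\<Sum>b\<in>B. ?u b *\<^sub>R b)" by (simp add: representation_sum[OF B])
    also have "\<dots> = (\<Sum>b\<in>B. ?u b *\<^sub>R f b)" using lin by (simp add: linear_sum linear_cmul)
    also have "norm \<dots> \<le> (\<Sum>b\<in>B. \<bar>?u b\<bar> * M)"
      by (rule sum_norm_le) (auto intro: mult_left_mono Mb)
    also have "\<dots> = M / d * (d * (\<Sum>b\<in>B. \<bar>?u b\<bar>))" using d by (simp add: sum_distrib_left[symmetric] mult.commute)
    also have "\<dots> \<le> M / d * norm x"
      using d(2)[of ?u] d(1) M0 by (intro mult_left_mono) (auto simp: representation_sum[OF B])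
    finally show "norm (f x) \<le> norm x * (M / d)" by (simp add: mult.commute)
  qed
qed

lemma bounded_linear_representation:
  fixes B :: "'a::real_normed_vector set"
  assumes B: "finite B" "independent B" "span B = UNIV"
  shows "bounded_linear (\<lambda>x. representation B x b)"
proof (rule linear_bounded_finite_dim)
  show "\<exists>B :: 'a set. finite B \<and> span B = UNIV" using B by blast
  show "linear (\<lambda>x. representation B x b)"
    using B by (intro linearI) (auto simp: real_vector.representation_add real_vector.representation_scale)
qed

text \<open>The ball lies in the image of a cube of coefficients of half-width \<open>R\<close>
  under the continuous coordinate map; the cube is compact by Tychonoff and the ball is
  closed.\<close>

lemma compact_cball_finite_dim:
  fixes x :: "'a::real_normed_vector"
  assumes fd: "\<exists>B :: 'a set. finite B \<and> span B = UNIV"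
  shows "compact (cball x r)"
proof -
  obtain B :: "'a set" where B: "finite B" "independent B" "span B = UNIV"
    using finite_basis_exists[OF fd] .
  obtain d where d: "d > 0" "\<And>u. d * (\<Sum>b\<in>B. \<bar>u b\<bar>) \<le> norm (\<Sum>b\<in>B. u b *\<^sub>R b)"
    using independent_norm_bound[OF B(1,2)] by blast
  define R where "R = (norm x + r) / d"
  define P where "P = PiE UNIV (\<lambda>b::'a. {-R..R})"
  have "compactin (product_topology (\<lambda>_. euclideanreal) UNIV) P"
    unfolding P_def compactin_PiE by auto
  then have cP: "compact P"
    by (simp add: euclidean_product_topology)
  let ?f = "\<lambda>u. \<Sum>b\<in>B. u b *\<^sub>R b"
  have "compact (?f ` P)"
    by (intro compact_continuous_image cP continuous_intros
      continuous_on_subset[OF continuous_on_product_coordinates subset_UNIV])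
  moreover have "cball x r \<subseteq> ?f ` P"
  proof
    fix y assume y: "y \<in> cball x r"
    let ?u = "representation B y"
    have ny: "norm y \<le> norm x + r"
      using y norm_triangle_sub[of y x] by (auto simp: dist_norm norm_minus_commute)
    have bnd: "\<bar>?u b\<bar> \<le> R" for b
    proof (cases "b \<in> B")
      case True
      have "d * \<bar>?u b\<bar> \<le> d * (\<Sum>b\<in>B. \<bar>?u b\<bar>)"
        using d(1) True B(1) member_le_sum[of b B "\<lambda>b. \<bar>?u b\<bar>"] by auto
      also have "\<dots> \<le> norm y" using d(2)[of ?u] by (simp add: representation_sum[OF B])
      finally show ?thesis using ny d(1) by (simp add: R_def field_simps)
    next
      case False
      then have "?u b = 0" using real_vector.representation_ne_zero by blast
      moreover have "0 \<le> norm x + r" using ny norm_ge_zero[of y] by linarith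
      ultimately show ?thesis using d(1) by (simp add: R_def)
    qed
    have "?u \<in> P" unfolding P_def using abs_le_D1[OF bnd] abs_le_D2[OF bnd] by (auto simp: minus_le_iff)
    moreover have "y = ?f ?u" by (simp add: representation_sum[OF B])
    ultimately show "y \<in> ?f ` P" by blast
  qed
  ultimately show ?thesis
    using compact_Int_closed[of "?f ` P" "cball x r"] by (simp add: inf_absorb2)
qed

text \<open>A basis of \<open>S\<close> together with \<open>x\<close> is independent, so values on
  it can be prescribed. The functional is purely algebraic; on the finite-dimensional model space it
  is automatically continuous, which lets vector-valued identities be reduced to real ones.\<close>

lemma functional_separates:
  fixes S :: "'a::real_vector set"
  assumes "subspace S" "x \<notin> S"
  obtains L :: "'a \<Rightarrow> real" where "linear L" "\<And>y. y \<in> S \<Longrightarrow> L y = 0" "L x = 1"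
proof -
  obtain B where B: "B \<subseteq> S" "independent B" "S \<subseteq> span B"
    using maximal_independent_subset by blast
  have sB: "span B = S" using B assms(1) by (simp add: span_minimal subset_antisym)
  have "independent (insert x B)" using assms(2) sB B(2) by (simp add: independent_insert)
  from linear_independent_extend[OF this, of "\<lambda>b. if b = x then 1 else (0::real)"]
  obtain L :: "'a \<Rightarrow> real"
    where L: "linear L" "\<forall>b\<in>insert x B. L b = (if b = x then 1 else 0)" by auto
  have "x \<notin> B" using assms(2) sB span_base by blast
  then have "\<And>b. b \<in> B \<Longrightarrow> L b = 0" using L(2) by auto
  then have "L y = 0" if "y \<in> S" for y
    using linear_eq_0_on_span[OF L(1)] that sB by blast
  then show thesis using that[of L] L by auto
qed

lemma functionals_determine:
  fixes x y :: "'a::real_vector"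
  assumes "\<And>L :: 'a \<Rightarrow> real. linear L \<Longrightarrow> L x = L y"
  shows "x = y"
proof (rule ccontr)
  assume "x \<noteq> y"
  then obtain L :: "'a \<Rightarrow> real" where "linear L" "L (x - y) = 1"
    using functional_separates[of "{0}" "x - y"] by auto
  with assms[of L] show False by (metis diff_self linear_diff zero_neq_one)
qed

section \<open>Calculus of C^k maps\<close>

lemma Ck_on_subset: "Ck_on n S f \<Longrightarrow> T \<subseteq> S \<Longrightarrow> Ck_on n T f"
  by (induction n arbitrary: f) (auto intro: continuous_on_subset)

lemma Ck_on_cong_open:
  assumes "open S" "Ck_on n S f" "\<And>x. x \<in> S \<Longrightarrow> f x = g x"
  shows "Ck_on n S g"
  using assms(2,3)
proof (induction n arbitrary: f g)
  case 0
  then show ?case using continuous_on_cong by (metis Ck_on.simps(1))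
next
  case (Suc n)
  have d: "(f has_derivative D) (at x) \<longleftrightarrow> (g has_derivative D) (at x)" if "x \<in> S" for x D
    using has_derivative_transform_within_open[OF _ assms(1) that] Suc.prems(2) by metis
  have fd: "frechet_derivative f (at x) = frechet_derivative g (at x)" if "x \<in> S" for x
    unfolding frechet_derivative_def using d[OF that] by simp
  have "Ck_on n S (\<lambda>x. frechet_derivative g (at x) v)" for v
    using Suc.IH[of "\<lambda>x. frechet_derivative f (at x) v"] Suc.prems fd by simp
  moreover have "g differentiable (at x)" if "x \<in> S" for x
    using Suc.prems(1) d[OF that] that unfolding differentiable_def Ck_on.simps by metis
  ultimately show ?case by simp
qed

lemma Ck_on_Suc_imp:
  assumes "open S"
  shows "Ck_on (Suc n) S f \<Longrightarrow> Ck_on n S f"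
proof (induction n arbitrary: f)
  case 0
  then show ?case
    by (auto intro!: continuous_at_imp_continuous_on differentiable_imp_continuous_within)
next
  case (Suc n)
  then show ?case by (metis Ck_on.simps(2))
qed

lemma Ck_on_continuous_on: "Ck_on n S f \<Longrightarrow> continuous_on S f"
  by (cases n) (auto intro!: continuous_at_imp_continuous_on differentiable_imp_continuous_within)

lemma Ck_on_has_derivative:
  "Ck_on (Suc n) S f \<Longrightarrow> x \<in> S \<Longrightarrow> (f has_derivative frechet_derivative f (at x)) (at x)"
  by (simp add: frechet_derivative_works)

lemma Ck_on_SucI:
  assumes "open S" "\<And>x. x \<in> S \<Longrightarrow> (f has_derivative D x) (at x)" "\<And>v. Ck_on n S (\<lambda>x. D x v)"
  shows "Ck_on (Suc n) S f"
proof -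
  have "frechet_derivative f (at x) = D x" if "x \<in> S" for x
    using frechet_derivative_at[OF assms(2)[OF that]] by simp
  then have "Ck_on n S (\<lambda>x. frechet_derivative f (at x) v)" for v
    using Ck_on_cong_open[OF assms(1) assms(3)[of v]] by simp
  with assms(2) show ?thesis by (auto simp: differentiable_def)
qed

lemma Ck_on_const: "Ck_on n S (\<lambda>x. c)"
  by (induction n arbitrary: c) (auto simp: frechet_derivative_const)

lemma Ck_on_affine:
  assumes "open S" "bounded_linear L"
  shows "Ck_on n S (\<lambda>x. L x + c)"
proof (cases n)
  case 0
  then show ?thesis
    using bounded_linear.continuous_on[OF assms(2) continuous_on_id, of S]
    by (auto intro!: continuous_on_add continuous_on_const)
next
  case (Suc m)
  show ?thesis unfolding Suc
  proof (rule Ck_on_SucI[OF assms(1)])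
    show "((\<lambda>x. L x + c) has_derivative L) (at x)" for x
      using has_derivative_add[OF bounded_linear_imp_has_derivative[OF assms(2)] has_derivative_const[of c]]
      by simp
    show "Ck_on m S (\<lambda>x. L v)" for v by (rule Ck_on_const)
  qed
qed

lemma Ck_on_linear_comp:
  assumes "open S" "bounded_linear L"
  shows "Ck_on n S f \<Longrightarrow> Ck_on n S (\<lambda>x. L (f x))"
proof (induction n arbitrary: f)
  case 0
  then show ?case using bounded_linear.continuous_on[OF assms(2)] by simp
next
  case (Suc n)
  show ?case
  proof (rule Ck_on_SucI[OF assms(1)])
    show "((\<lambda>x. L (f x)) has_derivative (\<lambda>v. L (frechet_derivative f (at x) v))) (at x)"
      if "x \<in> S" for x
      by (rule bounded_linear.has_derivative[OF assms(2) Ck_on_has_derivative[OF Suc.prems that]])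
    show "Ck_on n S (\<lambda>x. L (frechet_derivative f (at x) v))" for v
      using Suc by simp
  qed
qed

lemma Ck_on_add:
  assumes "open S"
  shows "Ck_on n S f \<Longrightarrow> Ck_on n S g \<Longrightarrow> Ck_on n S (\<lambda>x. f x + g x)"
proof (induction n arbitrary: f g)
  case 0
  then show ?case by (simp add: continuous_on_add)
next
  case (Suc n)
  show ?case
  proof (rule Ck_on_SucI[OF assms(1)])
    show "((\<lambda>x. f x + g x) has_derivative
        (\<lambda>v. frechet_derivative f (at x) v + frechet_derivative g (at x) v)) (at x)"
      if "x \<in> S" for x
      by (intro has_derivative_add Ck_on_has_derivative[OF Suc.prems(1) that]
          Ck_on_has_derivative[OF Suc.prems(2) that])
    show "Ck_on n S (\<lambda>x. frechet_derivative f (at x) v + frechet_derivative g (at x) v)" for v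
      using Suc by simp
  qed
qed

lemma Ck_on_sum:
  assumes "open S" "\<And>i. i \<in> I \<Longrightarrow> Ck_on n S (f i)"
  shows "Ck_on n S (\<lambda>x. \<Sum>i\<in>I. f i x)"
  using assms(2)
  by (induction I rule: infinite_finite_induct) (auto intro: Ck_on_const Ck_on_add[OF assms(1)])

lemma Ck_on_scaleR:
  fixes f :: "'a::real_normed_vector \<Rightarrow> real"
  assumes "open S"
  shows "Ck_on n S f \<Longrightarrow> Ck_on n S g \<Longrightarrow> Ck_on n S (\<lambda>x. f x *\<^sub>R g x)"
proof (induction n arbitrary: f g)
  case 0
  then show ?case by (simp add: continuous_on_scaleR)
next
  case (Suc n)
  show ?case
  proof (rule Ck_on_SucI[OF assms(1)])
    show "((\<lambda>x. f x *\<^sub>R g x) has_derivative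
        (\<lambda>v. f x *\<^sub>R frechet_derivative g (at x) v + frechet_derivative f (at x) v *\<^sub>R g x)) (at x)"
      if "x \<in> S" for x
      by (intro has_derivative_scaleR Ck_on_has_derivative[OF Suc.prems(1) that]
          Ck_on_has_derivative[OF Suc.prems(2) that])
    show "Ck_on n S (\<lambda>x. f x *\<^sub>R frechet_derivative g (at x) v + frechet_derivative f (at x) v *\<^sub>R g x)" for v
      using Suc by (intro Ck_on_add assms(1) Suc.IH) (auto intro: Ck_on_Suc_imp[OF assms(1)] simp del: Ck_on.simps(2), simp_all)
  qed
qed

text \<open>By the chain rule the derivative is x \<mapsto> Dg (f x) (Df x v), whose direction moves
  with x. Expanding that direction in a basis of the middle space gives a sum of products of C^n
  functions, the factors Dg (f x) b with fixed b being covered by the induction hypothesis. This is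
  where finite dimension of the middle space enters.\<close>

lemma Ck_on_compose:
  fixes f :: "'a::real_normed_vector \<Rightarrow> 'b::real_normed_vector"
    and g :: "'b \<Rightarrow> 'c::real_normed_vector"
  assumes fd: "\<exists>B :: 'b set. finite B \<and> span B = UNIV"
    and S: "open S" and T: "open T" and sub: "f ` S \<subseteq> T"
  shows "Ck_on n S f \<Longrightarrow> Ck_on n T g \<Longrightarrow> Ck_on n S (\<lambda>x. g (f x))"
proof (induction n arbitrary: g)
  case 0
  then show ?case using continuous_on_compose2[OF _ _ sub] by simp
next
  case (Suc n)
  obtain B :: "'b set" where B: "finite B" "independent B" "span B = UNIV"
    using finite_basis_exists[OF fd] .
  let ?D = "\<lambda>x v. \<Sum>b\<in>B. representation B (frechet_derivative f (at x) v) b *\<^sub>R frechet_derivative g (at (f x)) b"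
  show ?case
  proof (rule Ck_on_SucI[OF S])
    fix x assume x: "x \<in> S"
    then have fx: "f x \<in> T" using sub by blast
    note dg = Ck_on_has_derivative[OF Suc.prems(2) fx]
    have comp: "((\<lambda>x. g (f x)) has_derivative (\<lambda>v. frechet_derivative g (at (f x)) (frechet_derivative f (at x) v))) (at x)"
      by (rule has_derivative_compose[OF Ck_on_has_derivative[OF Suc.prems(1) x] dg])
    have exp: "frechet_derivative g (at (f x)) w = (\<Sum>b\<in>B. representation B w b *\<^sub>R frechet_derivative g (at (f x)) b)" for w
    proof -
      have lin: "linear (frechet_derivative g (at (f x)))"
        using dg has_derivative_linear by blast
      have "frechet_derivative g (at (f x)) w = frechet_derivative g (at (f x)) (\<Sum>b\<in>B. representation B w b *\<^sub>R b)"
        by (simp add: representation_sum[OF B])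
      also have "\<dots> = (\<Sum>b\<in>B. representation B w b *\<^sub>R frechet_derivative g (at (f x)) b)"
        by (simp add: linear_sum[OF lin] linear_cmul[OF lin])
      finally show ?thesis .
    qed
    have "(\<lambda>v. frechet_derivative g (at (f x)) (frechet_derivative f (at x) v)) = ?D x"
      by (rule ext) (rule exp)
    with comp show "((\<lambda>x. g (f x)) has_derivative ?D x) (at x)" by (simp only:)
  next
    fix v
    have 1: "Ck_on n S (\<lambda>x. representation B (frechet_derivative f (at x) v) b)" for b
      using Suc.prems(1) by (intro Ck_on_linear_comp[OF S bounded_linear_representation[OF B]]) simp
    have 2: "Ck_on n S (\<lambda>x. frechet_derivative g (at (f x)) b)" for b
      using Suc.IH[OF Ck_on_Suc_imp[OF S Suc.prems(1)], of "\<lambda>y. frechet_derivative g (at y) b"] Suc.prems(2)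
      by simp
    show "Ck_on n S (\<lambda>x. ?D x v)"
      by (intro Ck_on_sum S Ck_on_scaleR 1 2)
  qed
qed

lemma finite_dim_prod:
  assumes "\<exists>B :: 'a::real_vector set. finite B \<and> span B = UNIV"
    "\<exists>B :: 'b::real_vector set. finite B \<and> span B = UNIV"
  shows "\<exists>B :: ('a::real_vector \<times> 'b::real_vector) set. finite B \<and> span B = UNIV"
proof -
  obtain A :: "'a set" and B :: "'b set" where AB: "finite A" "span A = UNIV" "finite B" "span B = UNIV"
    using assms by blast
  let ?C = "(\<lambda>a. (a, 0)) ` A \<union> (\<lambda>b. (0, b)) ` B"
  have 1: "(x, 0) \<in> span ?C" for x :: 'a
  proof -
    have "linear (\<lambda>a::'a. (a, 0::'b))" by (auto intro: linearI)
    then have "(x, 0) \<in> span ((\<lambda>a. (a, 0::'b)) ` A)" using AB(2) by (simp add: linear_span_image)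
    then show ?thesis using span_mono[of "(\<lambda>a. (a, 0)) ` A" ?C] by blast
  qed
  have 2: "(0, x) \<in> span ?C" for x :: 'b
  proof -
    have "linear (\<lambda>b::'b. (0::'a, b))" by (auto intro: linearI)
    then have "(0, x) \<in> span ((\<lambda>b. (0::'a, b)) ` B)" using AB(4) by (simp add: linear_span_image)
    then show ?thesis using span_mono[of "(\<lambda>b. (0, b)) ` B" ?C] by blast
  qed
  have "p \<in> span ?C" for p
    using span_add[OF 1[of "fst p"] 2[of "snd p"]] by simp
  then show ?thesis using AB by (intro exI[of _ ?C]) auto
qed

section \<open>Symmetry of second derivatives, and derivatives with moving base point\<close>

text \<open>The second difference over a square of side \<open>h\<close> is an increment of s
  \<mapsto> F s h - F s 0, so the mean value theorem applies twice, first in s and then in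
  t.\<close>

lemma mixed_derivative_mvt:
  fixes F :: "real \<Rightarrow> real \<Rightarrow> real"
  assumes h: "h > 0"
    and d1: "\<And>s t. 0 \<le> s \<Longrightarrow> s \<le> h \<Longrightarrow> 0 \<le> t \<Longrightarrow> t \<le> h \<Longrightarrow>
      ((\<lambda>s. F s t) has_real_derivative Fa s t) (at s)"
    and d2: "\<And>s t. 0 \<le> s \<Longrightarrow> s \<le> h \<Longrightarrow> 0 \<le> t \<Longrightarrow> t \<le> h \<Longrightarrow>
      ((\<lambda>t. Fa s t) has_real_derivative Fb s t) (at t)"
  shows "\<exists>s t. 0 < s \<and> s < h \<and> 0 < t \<and> t < h \<and> F h h - F h 0 - F 0 h + F 0 0 = h * h * Fb s t"
proof -
  have "\<exists>s. 0 < s \<and> s < h \<and> (F h h - F h 0) - (F 0 h - F 0 0) = (h - 0) * (Fa s h - Fa s 0)"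
    by (rule MVT2[OF h]) (use h in \<open>auto intro!: derivative_intros d1\<close>)
  then obtain s where s: "0 < s" "s < h" "(F h h - F h 0) - (F 0 h - F 0 0) = h * (Fa s h - Fa s 0)" by auto
  have "\<exists>t. 0 < t \<and> t < h \<and> Fa s h - Fa s 0 = (h - 0) * Fb s t"
    by (rule MVT2[OF h]) (use s in \<open>auto intro!: d2\<close>)
  then show ?thesis using s by (auto simp: algebra_simps) (metis mult.commute mult.assoc)
qed

text \<open>The second difference along \<open>u\<close> and \<open>v\<close> does not depend on
  their order, while \<open>mixed\<close> equates it to h^2 times a second derivative, in either
  order, at a point near \<open>x\<close>. Continuity of the second derivatives at \<open>x\<close>
  then forces them to agree there.\<close>

lemma symmetric_second_derivative_real:
  fixes H :: "'a::real_normed_vector \<Rightarrow> real"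
  assumes S: "open S" "x \<in> S" and C2: "Ck_on 2 S H"
  shows "frechet_derivative (\<lambda>y. frechet_derivative H (at y) u) (at x) v =
    frechet_derivative (\<lambda>y. frechet_derivative H (at y) v) (at x) u"
proof -
  define D where "D u v y = frechet_derivative (\<lambda>y. frechet_derivative H (at y) u) (at y) v" for u v y
  have C2': "Ck_on (Suc (Suc 0)) S H" using C2 by (simp add: numeral_2_eq_2)
  have contD: "continuous_on S (D u v)" for u v
    using C2' unfolding D_def by simp
  have der1: "(H has_derivative frechet_derivative H (at y)) (at y)" if "y \<in> S" for y
    by (rule Ck_on_has_derivative[OF C2' that])
  have der2: "((\<lambda>y. frechet_derivative H (at y) u) has_derivative (\<lambda>v. D u v y)) (at y)"
    if "y \<in> S" for y u
    using C2' that unfolding D_def by (simp add: frechet_derivative_works)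
  obtain r where r: "r > 0" "ball x r \<subseteq> S" using S openE by blast
  have line: "((\<lambda>s. x + s *\<^sub>R a + w) has_derivative (\<lambda>h. h *\<^sub>R a)) (at s)" for a w s
    by (auto intro!: derivative_eq_intros)
  have mixed: "\<exists>s t. 0 < s \<and> s < h \<and> 0 < t \<and> t < h \<and>
      H (x + h *\<^sub>R a + h *\<^sub>R b) - H (x + h *\<^sub>R a) - H (x + h *\<^sub>R b) + H x = h * h * D a b (x + s *\<^sub>R a + t *\<^sub>R b)"
    if h: "h > 0" and hr: "h * (norm a + norm b) < r" for h a b
  proof -
    have inS: "x + s *\<^sub>R a + t *\<^sub>R b \<in> S" if "0 \<le> s" "s \<le> h" "0 \<le> t" "t \<le> h" for s t
    proof -
      have "norm (s *\<^sub>R a + t *\<^sub>R b) \<le> s * norm a + t * norm b"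
        using norm_triangle_ineq[of "s *\<^sub>R a" "t *\<^sub>R b"] that by simp
      also have "\<dots> \<le> h * norm a + h * norm b"
        using that by (intro add_mono mult_right_mono) auto
      finally have "norm (s *\<^sub>R a + t *\<^sub>R b) < r" using hr by (simp add: algebra_simps)
      then have "dist (x + s *\<^sub>R a + t *\<^sub>R b) x < r" by (simp add: dist_norm add.assoc)
      then have "x + s *\<^sub>R a + t *\<^sub>R b \<in> ball x r" by (simp add: dist_commute)
      then show ?thesis using r(2) by blast
    qed
    have "\<exists>s t. 0 < s \<and> s < h \<and> 0 < t \<and> t < h \<and>
      H (x + h *\<^sub>R a + h *\<^sub>R b) - H (x + h *\<^sub>R a + 0 *\<^sub>R b) - H (x + 0 *\<^sub>R a + h *\<^sub>R b) + H (x + 0 *\<^sub>R a + 0 *\<^sub>R b) =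
      h * h * D a b (x + s *\<^sub>R a + t *\<^sub>R b)"
    proof (rule mixed_derivative_mvt[OF h, where Fa = "\<lambda>s t. frechet_derivative H (at (x + s *\<^sub>R a + t *\<^sub>R b)) a"])
      fix s t assume st: "0 \<le> s" "s \<le> h" "0 \<le> t" "t \<le> h"
      note y = inS[OF st]
      have "((\<lambda>s. H (x + s *\<^sub>R a + t *\<^sub>R b)) has_derivative
        (\<lambda>k. frechet_derivative H (at (x + s *\<^sub>R a + t *\<^sub>R b)) (k *\<^sub>R a))) (at s)"
        by (rule has_derivative_compose[OF line der1[OF y]])
      then show "((\<lambda>s. H (x + s *\<^sub>R a + t *\<^sub>R b)) has_real_derivative
          frechet_derivative H (at (x + s *\<^sub>R a + t *\<^sub>R b)) a) (at s)"
        unfolding has_field_derivative_def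
        using linear_cmul[OF has_derivative_linear[OF der1[OF y]]] by (simp add: mult_commute_abs)
      have line2: "((\<lambda>t. x + s *\<^sub>R a + t *\<^sub>R b) has_derivative (\<lambda>h. h *\<^sub>R b)) (at t)"
        by (auto intro!: derivative_eq_intros)
      have "((\<lambda>t. frechet_derivative H (at (x + s *\<^sub>R a + t *\<^sub>R b)) a) has_derivative
        (\<lambda>k. D a (k *\<^sub>R b) (x + s *\<^sub>R a + t *\<^sub>R b))) (at t)"
        by (rule has_derivative_compose[OF line2 der2[OF y]])
      then show "((\<lambda>t. frechet_derivative H (at (x + s *\<^sub>R a + t *\<^sub>R b)) a) has_real_derivative
          D a b (x + s *\<^sub>R a + t *\<^sub>R b)) (at t)"
        unfolding has_field_derivative_def
        using linear_cmul[OF has_derivative_linear[OF der2[OF y, of a]]] by (simp add: mult_commute_abs)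
    qed
    then show ?thesis by simp
  qed
  have "D u v x = D v u x"
  proof (rule ccontr)
    assume ne: "D u v x \<noteq> D v u x"
    define e where "e = \<bar>D u v x - D v u x\<bar> / 2"
    have e: "e > 0" using ne by (simp add: e_def)
    have near: "\<exists>d>0. \<forall>y. dist y x < d \<longrightarrow> \<bar>D a b y - D a b x\<bar> < e" for a b
    proof -
      have "isCont (D a b) x" using contD S continuous_on_eq_continuous_at by blast
      then show ?thesis unfolding continuous_at_eps_delta using e by (auto simp: dist_real_def)
    qed
    obtain d1 where d1: "d1 > 0" "\<And>y. dist y x < d1 \<Longrightarrow> \<bar>D u v y - D u v x\<bar> < e" using near by blast
    obtain d2 where d2: "d2 > 0" "\<And>y. dist y x < d2 \<Longrightarrow> \<bar>D v u y - D v u x\<bar> < e" using near by blast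
    \<comment> \<open>The parallelogram with sides h u and h v has to lie in the ball of radius
      \<open>r\<close> and within both continuity radii; the 1 keeps the denominator positive when u
      = v = 0.\<close>
    define h where "h = min r (min d1 d2) / (2 * (norm u + norm v + 1))"
    have np: "norm u + norm v + 1 > 0" by (simp add: add_nonneg_pos)
    have h: "h > 0" using r(1) d1(1) d2(1) np by (simp add: h_def)
    have "h * (norm u + norm v + 1) = min r (min d1 d2) / 2"
      unfolding h_def using np by (metis less_irrefl mult.commute nonzero_mult_div_cancel_left times_divide_eq_left divide_divide_eq_left)
    then have "h * (norm u + norm v) = min r (min d1 d2) / 2 - h" by (simp add: algebra_simps)
    moreover have "min r (min d1 d2) > 0" using r(1) d1(1) d2(1) by simp
    ultimately have "h * (norm u + norm v) < min r (min d1 d2)" using h by linarith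
    then have hr: "h * (norm u + norm v) < r" "h * (norm u + norm v) < d1" "h * (norm u + norm v) < d2" by auto
    have dst: "dist (x + s *\<^sub>R a + t *\<^sub>R b) x \<le> h * (norm a + norm b)"
      if "0 < s" "s < h" "0 < t" "t < h" for s t a b
    proof -
      have "dist (x + s *\<^sub>R a + t *\<^sub>R b) x = norm (s *\<^sub>R a + t *\<^sub>R b)" by (simp add: dist_norm add.assoc)
      also have "\<dots> \<le> s * norm a + t * norm b"
        using norm_triangle_ineq[of "s *\<^sub>R a" "t *\<^sub>R b"] that by simp
      also have "\<dots> \<le> h * norm a + h * norm b"
        using that by (intro add_mono mult_right_mono) auto
      finally show ?thesis by (simp add: algebra_simps)
    qed
    obtain s t where st: "0 < s" "s < h" "0 < t" "t < h"
      "H (x + h *\<^sub>R u + h *\<^sub>R v) - H (x + h *\<^sub>R u) - H (x + h *\<^sub>R v) + H x = h * h * D u v (x + s *\<^sub>R u + t *\<^sub>R v)"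
      using mixed[OF h hr(1)] by blast
    have hr': "h * (norm v + norm u) < r" using hr(1) by (simp add: add.commute)
    obtain s' t' where st': "0 < s'" "s' < h" "0 < t'" "t' < h"
      "H (x + h *\<^sub>R v + h *\<^sub>R u) - H (x + h *\<^sub>R v) - H (x + h *\<^sub>R u) + H x = h * h * D v u (x + s' *\<^sub>R v + t' *\<^sub>R u)"
      using mixed[OF h hr'] by blast
    have "h * h * D u v (x + s *\<^sub>R u + t *\<^sub>R v) = h * h * D v u (x + s' *\<^sub>R v + t' *\<^sub>R u)"
      using st(5) st'(5) by (simp add: algebra_simps)
    then have "D u v (x + s *\<^sub>R u + t *\<^sub>R v) = D v u (x + s' *\<^sub>R v + t' *\<^sub>R u)" using h by simp
    moreover have "\<bar>D u v (x + s *\<^sub>R u + t *\<^sub>R v) - D u v x\<bar> < e"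
      using d1(2) dst[OF st(1-4), of u v] hr by fastforce
    moreover have "\<bar>D v u (x + s' *\<^sub>R v + t' *\<^sub>R u) - D v u x\<bar> < e"
      using d2(2) dst[OF st'(1-4), of v u] hr by (simp add: add.commute)
    ultimately show False unfolding e_def by (auto simp: abs_if split: if_splits)
  qed
  then show ?thesis by (simp add: D_def)
qed

lemma frechet_derivative_linear_comp:
  assumes "bounded_linear L" "f differentiable (at x)"
  shows "frechet_derivative (\<lambda>y. L (f y)) (at x) v = L (frechet_derivative f (at x) v)"
proof -
  have "((\<lambda>y. L (f y)) has_derivative (\<lambda>v. L (frechet_derivative f (at x) v))) (at x)"
    using bounded_linear.has_derivative[OF assms(1)] assms(2) frechet_derivative_works by blast
  from frechet_derivative_at[OF this] show ?thesis by metis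
qed

lemma symmetric_second_derivative:
  fixes H :: "'a::real_normed_vector \<Rightarrow> 'b::real_normed_vector"
  assumes fd: "\<exists>B :: 'b set. finite B \<and> span B = UNIV"
    and S: "open S" "x \<in> S" and C2: "Ck_on 2 S H"
  shows "frechet_derivative (\<lambda>y. frechet_derivative H (at y) u) (at x) v =
    frechet_derivative (\<lambda>y. frechet_derivative H (at y) v) (at x) u"
proof (rule functionals_determine)
  fix L :: "'b \<Rightarrow> real" assume "linear L"
  then have L: "bounded_linear L" by (rule linear_bounded_finite_dim[OF fd])
  have C2': "Ck_on (Suc (Suc 0)) S H" using C2 by (simp add: numeral_2_eq_2)
  have 1: "frechet_derivative (\<lambda>y. L (H y)) (at y) w = L (frechet_derivative H (at y) w)" if "y \<in> S" for y w
    using C2' that by (intro frechet_derivative_linear_comp[OF L]) simp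
  have 2: "L (frechet_derivative (\<lambda>y. frechet_derivative H (at y) u) (at x) v) =
      frechet_derivative (\<lambda>y. frechet_derivative (\<lambda>y. L (H y)) (at y) u) (at x) v" for u v
  proof -
    have "((\<lambda>y. L (frechet_derivative H (at y) u)) has_derivative
        (\<lambda>v. L (frechet_derivative (\<lambda>y. frechet_derivative H (at y) u) (at x) v))) (at x)"
      using C2' S(2) by (intro bounded_linear.has_derivative[OF L]) (simp add: frechet_derivative_works)
    then have "((\<lambda>y. frechet_derivative (\<lambda>y. L (H y)) (at y) u) has_derivative
        (\<lambda>v. L (frechet_derivative (\<lambda>y. frechet_derivative H (at y) u) (at x) v))) (at x)"
      by (rule has_derivative_transform_within_open[OF _ S]) (simp add: 1)
    from frechet_derivative_at[OF this] show ?thesis by metis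
  qed
  show "L (frechet_derivative (\<lambda>y. frechet_derivative H (at y) u) (at x) v) =
      L (frechet_derivative (\<lambda>y. frechet_derivative H (at y) v) (at x) u)"
    unfolding 2 by (rule symmetric_second_derivative_real[OF S Ck_on_linear_comp[OF S(1) L C2]])
qed

text \<open>A product rule for q \<mapsto> DH (A q) (w q), where base point and direction both move.
  As in the chain rule above, the direction is expanded in a basis, so that only derivatives in
  fixed directions are differentiated.\<close>

lemma has_derivative_frechet_derivative_eval:
  fixes H :: "'a::real_normed_vector \<Rightarrow> 'b::real_normed_vector"
    and A w :: "'p::real_normed_vector \<Rightarrow> 'a"
  assumes fd: "\<exists>B :: 'a set. finite B \<and> span B = UNIV"
    and T: "open T" "A p \<in> T" and C2: "Ck_on 2 T H"
    and A: "(A has_derivative A') (at p)" and w: "(w has_derivative w') (at p)"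
  shows "((\<lambda>q. frechet_derivative H (at (A q)) (w q)) has_derivative
    (\<lambda>q. frechet_derivative (\<lambda>a. frechet_derivative H (at a) (w p)) (at (A p)) (A' q)
         + frechet_derivative H (at (A p)) (w' q))) (at p)"
proof -
  obtain B :: "'a set" where B: "finite B" "independent B" "span B = UNIV"
    using finite_basis_exists[OF fd] .
  have C2': "Ck_on (Suc (Suc 0)) T H" using C2 by (simp add: numeral_2_eq_2)
  have exp: "frechet_derivative H (at a) v = (\<Sum>b\<in>B. representation B v b *\<^sub>R frechet_derivative H (at a) b)"
    if "a \<in> T" for a v
  proof -
    have lin: "linear (frechet_derivative H (at a))"
      using Ck_on_has_derivative[OF C2' that] has_derivative_linear by blast
    have "frechet_derivative H (at a) v = frechet_derivative H (at a) (\<Sum>b\<in>B. representation B v b *\<^sub>R b)"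
      by (simp add: representation_sum[OF B])
    also have "\<dots> = (\<Sum>b\<in>B. representation B v b *\<^sub>R frechet_derivative H (at a) b)"
      by (simp add: linear_sum[OF lin] linear_cmul[OF lin])
    finally show ?thesis .
  qed
  have d2: "((\<lambda>a. frechet_derivative H (at a) v) has_derivative
      frechet_derivative (\<lambda>a. frechet_derivative H (at a) v) (at a)) (at a)" if "a \<in> T" for a v
    using C2' that by (simp add: frechet_derivative_works)
  let ?E = "\<lambda>v a' . frechet_derivative (\<lambda>a. frechet_derivative H (at a) v) (at (A p)) a'"
  \<comment> \<open>Linearity of the second derivative in the direction taken first: differentiate
    the expansion \<open>exp\<close>, whose coefficients do not depend on the base point.\<close>
  have lin2: "?E v q = (\<Sum>b\<in>B. representation B v b *\<^sub>R ?E b q)" for v q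
  proof -
    have "((\<lambda>a. \<Sum>b\<in>B. representation B v b *\<^sub>R frechet_derivative H (at a) b) has_derivative
        (\<lambda>q. \<Sum>b\<in>B. representation B v b *\<^sub>R ?E b q)) (at (A p))"
      by (intro has_derivative_sum has_derivative_scaleR_right d2 T)
    then have "((\<lambda>a. frechet_derivative H (at a) v) has_derivative
        (\<lambda>q. \<Sum>b\<in>B. representation B v b *\<^sub>R ?E b q)) (at (A p))"
      by (rule has_derivative_transform_within_open[OF _ T]) (rule exp[symmetric])
    from fun_cong[OF frechet_derivative_at[OF this], of q] show ?thesis by simp
  qed
  have "((\<lambda>q. \<Sum>b\<in>B. representation B (w q) b *\<^sub>R frechet_derivative H (at (A q)) b) has_derivative
      (\<lambda>q. \<Sum>b\<in>B. representation B (w p) b *\<^sub>R ?E b (A' q) + representation B (w' q) b *\<^sub>R frechet_derivative H (at (A p)) b)) (at p)"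
    by (intro has_derivative_sum has_derivative_scaleR
        bounded_linear.has_derivative[OF bounded_linear_representation[OF B] w]
        has_derivative_compose[OF A d2[OF T(2)]])
  also have "(\<lambda>q. \<Sum>b\<in>B. representation B (w p) b *\<^sub>R ?E b (A' q) + representation B (w' q) b *\<^sub>R frechet_derivative H (at (A p)) b)
     = (\<lambda>q. ?E (w p) (A' q) + frechet_derivative H (at (A p)) (w' q))"
    by (rule ext) (simp only: sum.distrib lin2[of "w p", symmetric] exp[OF T(2), symmetric])
  finally have D: "((\<lambda>q. \<Sum>b\<in>B. representation B (w q) b *\<^sub>R frechet_derivative H (at (A q)) b) has_derivative
     (\<lambda>q. ?E (w p) (A' q) + frechet_derivative H (at (A p)) (w' q))) (at p)" .
  have "isCont A p" using A has_derivative_continuous by blast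
  then have "eventually (\<lambda>q. A q \<in> T) (nhds p)"
    using T topological_tendstoD[of A "A p" "at p" T]
    by (auto simp: isCont_def eventually_at_filter elim: eventually_mono)
  then obtain N where N: "open N" "p \<in> N" "\<And>q. q \<in> N \<Longrightarrow> A q \<in> T"
    unfolding eventually_nhds by blast
  show ?thesis
    by (rule has_derivative_transform_within_open[OF D N(1,2)]) (rule exp[OF N(3), symmetric])
qed

section \<open>The bracket and the adjoint action in a chart\<close>

context lie_group
begin

lemma chart_facts:
  assumes "(W, \<theta>) \<in> atlas G"
  shows "openin (topo G) W" "W \<subseteq> carrier G" "open (\<theta> ` W)" "inj_on \<theta> W"
    "continuous_map (subtopology (topo G) W) euclidean \<theta>"
    "continuous_map (top_of_set (\<theta> ` W)) (topo G) (inv_into W \<theta>)"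
proof -
  note ch = charts[OF assms]
  show W: "openin (topo G) W" and "open (\<theta> ` W)" using ch by auto
  show sub: "W \<subseteq> carrier G" using openin_subset[OF W] topspace_eq by simp
  have top: "topspace (subtopology (topo G) W) = W" using sub topspace_eq by auto
  have hm: "homeomorphic_map (subtopology (topo G) W) (top_of_set (\<theta> ` W)) \<theta>" using ch by auto
  show inj: "inj_on \<theta> W" using homeomorphic_imp_injective_map[OF hm] top by simp
  show "continuous_map (subtopology (topo G) W) euclidean \<theta>"
    using homeomorphic_imp_continuous_map[OF hm] continuous_map_into_fulltopology by blast
  obtain g where g: "homeomorphic_maps (subtopology (topo G) W) (top_of_set (\<theta> ` W)) \<theta> g"
    using hm homeomorphic_map_maps by blast
  then have "g a = inv_into W \<theta> a" if "a \<in> \<theta> ` W" for a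
    using that inj top unfolding homeomorphic_maps_def by auto
  moreover have "continuous_map (top_of_set (\<theta> ` W)) (topo G) g"
    using g continuous_map_into_fulltopology unfolding homeomorphic_maps_def by blast
  ultimately show "continuous_map (top_of_set (\<theta> ` W)) (topo G) (inv_into W \<theta>)"
    using continuous_map_eq[of "top_of_set (\<theta> ` W)" "topo G" g "inv_into W \<theta>"] by simp
qed

lemma chart_inv_simps:
  assumes "(W, \<theta>) \<in> atlas G"
  shows "x \<in> W \<Longrightarrow> inv_into W \<theta> (\<theta> x) = x"
    and "a \<in> \<theta> ` W \<Longrightarrow> \<theta> (inv_into W \<theta> a) = a"
    and "a \<in> \<theta> ` W \<Longrightarrow> inv_into W \<theta> a \<in> W"
    and "a \<in> \<theta> ` W \<Longrightarrow> inv_into W \<theta> a \<in> carrier G"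
  using chart_facts[OF assms] by (auto simp: f_inv_into_f inv_into_into)

lemma chart_at:
  assumes "x \<in> carrier G"
  obtains W \<theta> where "(W, \<theta>) \<in> atlas G" "x \<in> W"
proof -
  obtain c where "c \<in> atlas G" "x \<in> fst c" using assms atlas_covers by blast
  then show thesis using that[of "fst c" "snd c"] by simp
qed

lemma open_chart_vimage:
  assumes c: "(W, \<theta>) \<in> atlas G" and f: "continuous_map (topo G) (topo G) f" and V: "openin (topo G) V"
  shows "open {a \<in> \<theta> ` W. f (inv_into W \<theta> a) \<in> V}"
proof -
  have "continuous_map (top_of_set (\<theta> ` W)) (topo G) (\<lambda>a. f (inv_into W \<theta> a))"
    using continuous_map_compose[OF chart_facts(6)[OF c] f] by (simp add: o_def)
  from openin_continuous_map_preimage[OF this V]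
  show ?thesis using chart_facts(3)[OF c] by (simp add: openin_open_eq)
qed

lemma open_chart_image:
  assumes "(W, \<theta>) \<in> atlas G" "openin (topo G) V"
  shows "open (\<theta> ` (V \<inter> W))"
proof -
  have "\<theta> ` (V \<inter> W) = {a \<in> \<theta> ` W. inv_into W \<theta> a \<in> V}"
    using chart_inv_simps[OF assms(1)] by force
  then show ?thesis using open_chart_vimage[OF assms(1) continuous_map_id assms(2)] by simp
qed

lemma openin_chart_preimage:
  assumes c: "(W, \<theta>) \<in> atlas G" and A: "open A"
  shows "openin (topo G) {x \<in> W. \<theta> x \<in> A}"
proof -
  have "openin (subtopology (topo G) W) {x \<in> topspace (subtopology (topo G) W). \<theta> x \<in> A}"
    using openin_continuous_map_preimage[OF chart_facts(5)[OF c], of A] A by simp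
  moreover have "topspace (subtopology (topo G) W) = W"
    using chart_facts(2)[OF c] topspace_eq by auto
  then have "{x \<in> topspace (subtopology (topo G) W). \<theta> x \<in> A} = {x \<in> W. \<theta> x \<in> A}" by simp
  ultimately show ?thesis using openin_trans_full[OF _ chart_facts(1)[OF c]] by simp
qed

lemma continuous_mult:
  assumes "continuous_map X (topo G) f" "continuous_map X (topo G) g"
  shows "continuous_map X (topo G) (\<lambda>x. f x \<otimes> g x)"
proof -
  have "continuous_map X (prod_topology (topo G) (topo G)) (\<lambda>x. (f x, g x))"
    using assms by (simp add: continuous_map_paired)
  from continuous_map_compose[OF this mult_continuous] show ?thesis by (simp add: o_def)
qed

lemma continuous_inv:
  assumes "continuous_map X (topo G) f"
  shows "continuous_map X (topo G) (\<lambda>x. inv (f x))"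
  using continuous_map_compose[OF assms inv_continuous] by (simp add: o_def)

lemma continuous_const:
  "x \<in> carrier G \<Longrightarrow> continuous_map X (topo G) (\<lambda>_. x)"
  by (simp add: topspace_eq)

lemma continuous_translations:
  assumes "x \<in> carrier G" "y \<in> carrier G"
  shows "continuous_map (topo G) (topo G) (\<lambda>a. x \<otimes> a)"
    "continuous_map (topo G) (topo G) (\<lambda>a. a \<otimes> x)"
    "continuous_map (topo G) (topo G) (\<lambda>a. x \<otimes> a \<otimes> y)"
  using assms by (auto intro!: continuous_mult continuous_const continuous_map_id[unfolded id_def])

lemma open_mult_domain:
  assumes c1: "(W1, \<theta>1) \<in> atlas G" and c2: "(W2, \<theta>2) \<in> atlas G" and V: "openin (topo G) V"
  shows "open {(\<theta>1 x, \<theta>2 y) | x y. x \<in> W1 \<and> y \<in> W2 \<and> x \<otimes> y \<in> V}"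
proof -
  let ?D = "\<theta>1 ` W1 \<times> \<theta>2 ` W2"
  have 1: "continuous_map (top_of_set ?D) (top_of_set (\<theta>1 ` W1)) fst"
    "continuous_map (top_of_set ?D) (top_of_set (\<theta>2 ` W2)) snd"
    by (auto intro!: continuous_intros)
  have "continuous_map (top_of_set ?D) (topo G) (\<lambda>p. inv_into W1 \<theta>1 (fst p) \<otimes> inv_into W2 \<theta>2 (snd p))"
    using continuous_map_compose[OF 1(1) chart_facts(6)[OF c1]]
      continuous_map_compose[OF 1(2) chart_facts(6)[OF c2]]
    by (intro continuous_mult) (auto simp: o_def)
  from openin_continuous_map_preimage[OF this V]
  have "open {p \<in> ?D. inv_into W1 \<theta>1 (fst p) \<otimes> inv_into W2 \<theta>2 (snd p) \<in> V}"
    using open_Times[OF chart_facts(3)[OF c1] chart_facts(3)[OF c2]] by (simp add: openin_open_eq)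
  moreover have "{p \<in> ?D. inv_into W1 \<theta>1 (fst p) \<otimes> inv_into W2 \<theta>2 (snd p) \<in> V} =
      {(\<theta>1 x, \<theta>2 y) | x y. x \<in> W1 \<and> y \<in> W2 \<and> x \<otimes> y \<in> V}"
  proof (intro equalityI subsetI)
    fix p assume "p \<in> {p \<in> ?D. inv_into W1 \<theta>1 (fst p) \<otimes> inv_into W2 \<theta>2 (snd p) \<in> V}"
    then show "p \<in> {(\<theta>1 x, \<theta>2 y) | x y. x \<in> W1 \<and> y \<in> W2 \<and> x \<otimes> y \<in> V}"
      using chart_inv_simps(2,3)[OF c1] chart_inv_simps(2,3)[OF c2]
      by (intro CollectI exI[of _ "inv_into W1 \<theta>1 (fst p)"] exI[of _ "inv_into W2 \<theta>2 (snd p)"]) auto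
  qed (use chart_inv_simps(1)[OF c1] chart_inv_simps(1)[OF c2] in auto)
  ultimately show ?thesis by simp
qed

text \<open>The axiom \<open>mult_smooth\<close> concerns the product in two variables. Freezing the
  first one is composition with the affine map a \<mapsto> (\<xi> x, a) into a product of two
  charts, the first of which is taken around \<open>x\<close>.\<close>

lemma left_translation_Ck:
  assumes c1: "(W, \<theta>) \<in> atlas G" and c2: "(Q, \<zeta>) \<in> atlas G" and x: "x \<in> carrier G"
  shows "Ck_on n {a \<in> \<theta> ` W. x \<otimes> inv_into W \<theta> a \<in> Q} (\<lambda>a. \<zeta> (x \<otimes> inv_into W \<theta> a))"
    (is "Ck_on n ?S _")
proof -
  obtain P \<xi> where c0: "(P, \<xi>) \<in> atlas G" "x \<in> P" using chart_at[OF x] .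
  let ?D = "{(\<xi> x, \<theta> y) | x y. x \<in> P \<and> y \<in> W \<and> x \<otimes> y \<in> Q}"
  have S: "open ?S" by (rule open_chart_vimage[OF c1 continuous_translations(1)[OF x x] chart_facts(1)[OF c2]])
  have D: "open ?D" by (rule open_mult_domain[OF c0(1) c1 chart_facts(1)[OF c2]])
  have sm: "Ck_on n ?D (\<lambda>(a, b). \<zeta> (inv_into P \<xi> a \<otimes> inv_into W \<theta> b))"
    using mult_smooth[OF c0(1) c1 c2] by (simp add: smooth_on_def)
  have af: "Ck_on n ?S (\<lambda>a. (\<xi> x, a))"
    using Ck_on_affine[OF S bounded_linear_Pair[OF bounded_linear_zero bounded_linear_ident], of n "(\<xi> x, 0)"] by simp
  have sub: "(\<lambda>a. (\<xi> x, a)) ` ?S \<subseteq> ?D"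
    using c0 chart_inv_simps[OF c1] by force
  from Ck_on_compose[OF finite_dim_prod[OF finite_dimensional finite_dimensional] S D sub af sm]
  show ?thesis using chart_inv_simps(1)[OF c0] by simp
qed

lemma right_translation_Ck:
  assumes c1: "(W, \<theta>) \<in> atlas G" and c2: "(Q, \<zeta>) \<in> atlas G" and x: "x \<in> carrier G"
  shows "Ck_on n {a \<in> \<theta> ` W. inv_into W \<theta> a \<otimes> x \<in> Q} (\<lambda>a. \<zeta> (inv_into W \<theta> a \<otimes> x))"
    (is "Ck_on n ?S _")
proof -
  obtain P \<xi> where c0: "(P, \<xi>) \<in> atlas G" "x \<in> P" using chart_at[OF x] .
  let ?D = "{(\<theta> y, \<xi> x) | y x. y \<in> W \<and> x \<in> P \<and> y \<otimes> x \<in> Q}"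
  have S: "open ?S" by (rule open_chart_vimage[OF c1 continuous_translations(2)[OF x x] chart_facts(1)[OF c2]])
  have D: "open ?D" by (rule open_mult_domain[OF c1 c0(1) chart_facts(1)[OF c2]])
  have sm: "Ck_on n ?D (\<lambda>(b, a). \<zeta> (inv_into W \<theta> b \<otimes> inv_into P \<xi> a))"
    using mult_smooth[OF c1 c0(1) c2] by (simp add: smooth_on_def)
  have af: "Ck_on n ?S (\<lambda>a. (a, \<xi> x))"
    using Ck_on_affine[OF S bounded_linear_Pair[OF bounded_linear_ident bounded_linear_zero], of n "(0, \<xi> x)"] by simp
  have sub: "(\<lambda>a. (a, \<xi> x)) ` ?S \<subseteq> ?D"
    using c0 chart_inv_simps[OF c1] by force
  from Ck_on_compose[OF finite_dim_prod[OF finite_dimensional finite_dimensional] S D sub af sm]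
  show ?thesis using chart_inv_simps(1)[OF c0] by simp
qed

lemma smooth_fun_left_translation_Ck:
  assumes c: "(U, \<phi>) \<in> atlas G" and V: "openin (topo G) V" and f: "smooth_fun_on G V f"
    and x: "x \<in> carrier G" and W: "(W, \<theta>) \<in> atlas G"
  shows "Ck_on n {a \<in> \<phi> ` U. x \<otimes> inv_into U \<phi> a \<in> V \<inter> W} (\<lambda>a. f (x \<otimes> inv_into U \<phi> a))"
    (is "Ck_on n ?S _")
proof -
  have S: "open ?S"
    by (rule open_chart_vimage[OF c continuous_translations(1)[OF x x] openin_Int[OF V chart_facts(1)[OF W]]])
  have 1: "Ck_on n ?S (\<lambda>a. \<theta> (x \<otimes> inv_into U \<phi> a))"
    by (rule Ck_on_subset[OF left_translation_Ck[OF c W x]]) auto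
  have 2: "Ck_on n (\<theta> ` (V \<inter> W)) (\<lambda>a. f (inv_into W \<theta> a))"
    using f W unfolding smooth_fun_on_def smooth_on_def by blast
  have sub: "(\<lambda>a. \<theta> (x \<otimes> inv_into U \<phi> a)) ` ?S \<subseteq> \<theta> ` (V \<inter> W)" by auto
  show ?thesis
    by (rule Ck_on_cong_open[OF S Ck_on_compose[OF finite_dimensional S open_chart_image[OF W V] sub 1 2]])
      (simp add: chart_inv_simps(1)[OF W])
qed

end

section \<open>The second-order expansion of the product in a chart at the identity\<close>

locale lie_chart = lie_group G for G :: "('g, 'e::real_normed_vector) lgroup" (structure) +
  fixes U :: "'g set" and \<phi> :: "'g \<Rightarrow> 'e"
  assumes chart: "(U, \<phi>) \<in> atlas G" and one_in: "\<one> \<in> U"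
begin

definition \<psi> where "\<psi> = inv_into U \<phi>"
definition base where "base = \<phi> \<one>"
definition mult_chart where "mult_chart = (\<lambda>(a, b). \<phi> (\<psi> a \<otimes> \<psi> b))"
definition mult_dom where "mult_dom = {(\<phi> x, \<phi> y) | x y. x \<in> U \<and> y \<in> U \<and> x \<otimes> y \<in> U}"
definition Dm where "Dm p = frechet_derivative mult_chart (at p)"
text \<open>The bilinear term mixing both factors in the Taylor expansion of the product at the
  identity. It depends on the chart; its antisymmetrisation will be the bracket.\<close>

definition hess where "hess X Y = frechet_derivative (\<lambda>p. Dm p (0, Y)) (at (base, base)) (X, 0)"

lemmas psi_simps = chart_inv_simps[OF chart, folded \<psi>_def]

lemma psi_base [simp]: "\<psi> base = \<one>"
  using psi_simps(1)[OF one_in] by (simp add: base_def)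

lemma U_carrier: "x \<in> U \<Longrightarrow> x \<in> carrier G"
  using chart_facts(2)[OF chart] by blast

lemma base_in: "base \<in> \<phi> ` U" using one_in by (simp add: base_def)

lemma open_phi_U: "open (\<phi> ` U)" using chart_facts(3)[OF chart] .

lemma open_mult_dom: "open mult_dom"
  unfolding mult_dom_def by (rule open_mult_domain[OF chart chart chart_facts(1)[OF chart]])

lemma mult_dom_iff: "(a, b) \<in> mult_dom \<longleftrightarrow> a \<in> \<phi> ` U \<and> b \<in> \<phi> ` U \<and> \<psi> a \<otimes> \<psi> b \<in> U"
  unfolding mult_dom_def using psi_simps by force

lemma mult_dom_base: "a \<in> \<phi> ` U \<Longrightarrow> (a, base) \<in> mult_dom" "a \<in> \<phi> ` U \<Longrightarrow> (base, a) \<in> mult_dom"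
  using base_in psi_simps by (auto simp: mult_dom_iff)

lemma mult_chart_base: "a \<in> \<phi> ` U \<Longrightarrow> mult_chart (a, base) = a" "a \<in> \<phi> ` U \<Longrightarrow> mult_chart (base, a) = a"
  using psi_simps by (auto simp: mult_chart_def)

lemma psi_mult_chart: "(a, b) \<in> mult_dom \<Longrightarrow> \<psi> (mult_chart (a, b)) = \<psi> a \<otimes> \<psi> b"
  using psi_simps by (auto simp: mult_dom_iff mult_chart_def)

lemma Ck_mult_chart: "Ck_on n mult_dom mult_chart"
  using mult_smooth[OF chart chart chart] unfolding smooth_on_def mult_dom_def mult_chart_def \<psi>_def by blast

lemma Dm_has_derivative: "p \<in> mult_dom \<Longrightarrow> (mult_chart has_derivative Dm p) (at p)"
  unfolding Dm_def by (rule Ck_on_has_derivative[OF Ck_mult_chart])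

lemma Dm_linear: "p \<in> mult_dom \<Longrightarrow> linear (Dm p)"
  using Dm_has_derivative has_derivative_linear by blast

lemma Dm_Dm_has_derivative:
  assumes "p \<in> mult_dom"
  shows "((\<lambda>p. Dm p v) has_derivative frechet_derivative (\<lambda>p. Dm p v) (at p)) (at p)"
proof -
  have "Ck_on (Suc 0) mult_dom (\<lambda>p. Dm p v)"
    using Ck_mult_chart[of "Suc (Suc 0)"] unfolding Dm_def Ck_on.simps(2)[of "Suc 0"] by blast
  from Ck_on_has_derivative[OF this assms] show ?thesis .
qed

lemma Dm_base_right: "a \<in> \<phi> ` U \<Longrightarrow> Dm (a, base) (X, 0) = X"
proof -
  assume a: "a \<in> \<phi> ` U"
  have "((\<lambda>a. (a, base)) has_derivative (\<lambda>X. (X, 0))) (at a)"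
    by (auto intro!: derivative_eq_intros)
  from has_derivative_compose[OF this Dm_has_derivative[OF mult_dom_base(1)[OF a]]]
  have "((\<lambda>a. a) has_derivative (\<lambda>X. Dm (a, base) (X, 0))) (at a)"
    by (rule has_derivative_transform_within_open[OF _ open_phi_U a]) (simp add: mult_chart_base)
  from fun_cong[OF has_derivative_unique[OF this has_derivative_ident]] show ?thesis by simp
qed

lemma Dm_base_left: "a \<in> \<phi> ` U \<Longrightarrow> Dm (base, a) (0, X) = X"
proof -
  assume a: "a \<in> \<phi> ` U"
  have "((\<lambda>a. (base, a)) has_derivative (\<lambda>X. (0, X))) (at a)"
    by (auto intro!: derivative_eq_intros)
  from has_derivative_compose[OF this Dm_has_derivative[OF mult_dom_base(2)[OF a]]]
  have "((\<lambda>a. a) has_derivative (\<lambda>X. Dm (base, a) (0, X))) (at a)"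
    by (rule has_derivative_transform_within_open[OF _ open_phi_U a]) (simp add: mult_chart_base)
  from fun_cong[OF has_derivative_unique[OF this has_derivative_ident]] show ?thesis by simp
qed

lemma fd_prod: "\<exists>B :: ('e \<times> 'e) set. finite B \<and> span B = UNIV"
  by (rule finite_dim_prod[OF finite_dimensional finite_dimensional])

lemma base_base: "(base, base) \<in> mult_dom"
  using mult_dom_base(1)[OF base_in] .

text \<open>A Frechet derivative is evidently linear in the direction taken last. Having both orders
  available makes \<open>hess\<close> linear in each argument.\<close>

lemma hess_symmetric: "frechet_derivative (\<lambda>p. Dm p (X, 0)) (at (base, base)) (0, Y) = hess X Y"
  unfolding hess_def Dm_def
  by (rule symmetric_second_derivative[OF finite_dimensional open_mult_dom base_base Ck_mult_chart])

lemma hess_linear_left: "linear (\<lambda>X. hess X Y)"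
proof -
  have "linear (frechet_derivative (\<lambda>p. Dm p (0, Y)) (at (base, base)))"
    using Dm_Dm_has_derivative[OF base_base] has_derivative_linear by blast
  moreover have "linear (\<lambda>X::'e. (X, 0::'e))" by (auto intro: linearI)
  ultimately show ?thesis using linear_compose unfolding hess_def o_def by fastforce
qed

lemma hess_linear_right: "linear (\<lambda>Y. hess X Y)"
proof -
  have "linear (frechet_derivative (\<lambda>p. Dm p (X, 0)) (at (base, base)))"
    using Dm_Dm_has_derivative[OF base_base] has_derivative_linear by blast
  moreover have "linear (\<lambda>Y::'e. (0::'e, Y))" by (auto intro: linearI)
  ultimately show ?thesis using linear_compose unfolding hess_symmetric[symmetric] o_def by fastforce
qed

lemma left_inv_field_eq:
  "left_inv_field G (U, \<phi>) X f x = frechet_derivative (\<lambda>u. f (x \<otimes> \<psi> u)) (at base) X"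
  by (simp add: left_inv_field_def chart_inv_def \<psi>_def base_def)

text \<open>In the chart, the inner field at x a is the derivative of \<open>h\<close> at a in the
  direction \<open>Dm (a, base) (0, Y)\<close>. Differentiating once more at the identity, the
  moving direction contributes \<open>hess X Y\<close> and the moving base point a second derivative
  of \<open>h\<close>. The latter is symmetric and will cancel in the commutator.\<close>

lemma left_inv_field_twice:
  assumes V: "openin (topo G) V" "smooth_fun_on G V f" and x: "x \<in> V"
  defines "h \<equiv> \<lambda>a. f (x \<otimes> \<psi> a)"
  shows "left_inv_field G (U, \<phi>) X (left_inv_field G (U, \<phi>) Y f) x =
      frechet_derivative (\<lambda>a. frechet_derivative h (at a) Y) (at base) X + frechet_derivative h (at base) (hess X Y)"
    and "frechet_derivative (\<lambda>a. frechet_derivative h (at a) Y) (at base) X =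
      frechet_derivative (\<lambda>a. frechet_derivative h (at a) X) (at base) Y"
    and "linear (frechet_derivative h (at base))"
proof -
  have xc: "x \<in> carrier G" using x openin_subset[OF V(1)] topspace_eq by blast
  obtain W \<theta> where W: "(W, \<theta>) \<in> atlas G" "x \<in> W" using chart_at[OF xc] .
  define N where "N = {a \<in> \<phi> ` U. x \<otimes> \<psi> a \<in> V \<inter> W}"
  have N: "open N" unfolding N_def \<psi>_def
    by (rule open_chart_vimage[OF chart continuous_translations(1)[OF xc xc] openin_Int[OF V(1) chart_facts(1)[OF W(1)]]])
  have bN: "base \<in> N" using base_in x W xc by (simp add: N_def)
  have h: "Ck_on n N h" for n
    unfolding N_def h_def \<psi>_def by (rule smooth_fun_left_translation_Ck[OF chart V xc W(1)])
  note dh = Ck_on_has_derivative[OF h]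
  show "linear (frechet_derivative h (at base))" using dh[OF bN] has_derivative_linear by blast
  show "frechet_derivative (\<lambda>a. frechet_derivative h (at a) Y) (at base) X =
      frechet_derivative (\<lambda>a. frechet_derivative h (at a) X) (at base) Y"
    by (rule symmetric_second_derivative_real[OF N bN h])
  have inner: "left_inv_field G (U, \<phi>) Y f (x \<otimes> \<psi> a) = frechet_derivative h (at a) (Dm (a, base) (0, Y))"
    if a: "a \<in> N" for a
  proof -
    have aU: "a \<in> \<phi> ` U" using a by (simp add: N_def)
    have "((\<lambda>u. (a, u)) has_derivative (\<lambda>v. (0, v))) (at base)"
      by (auto intro!: derivative_eq_intros)
    from has_derivative_compose[OF this Dm_has_derivative[OF mult_dom_base(1)[OF aU]]]
    have "((\<lambda>u. mult_chart (a, u)) has_derivative (\<lambda>v. Dm (a, base) (0, v))) (at base)" .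
    from has_derivative_compose[OF this, of h "frechet_derivative h (at a)"]
    have "((\<lambda>u. h (mult_chart (a, u))) has_derivative (\<lambda>v. frechet_derivative h (at a) (Dm (a, base) (0, v)))) (at base)"
      using dh[OF a] by (simp add: mult_chart_base[OF aU])
    moreover have "open {u. (a, u) \<in> mult_dom}"
    proof -
      have "open ((\<lambda>u. (a, u)) -` mult_dom)"
        by (rule open_vimage[OF open_mult_dom]) (intro continuous_intros)
      then show ?thesis by (simp add: vimage_def)
    qed
    moreover have "base \<in> {u. (a, u) \<in> mult_dom}" using mult_dom_base(1)[OF aU] by simp
    moreover have "h (mult_chart (a, u)) = f (x \<otimes> \<psi> a \<otimes> \<psi> u)" if "u \<in> {u. (a, u) \<in> mult_dom}" for u
      using that xc psi_simps(4) unfolding h_def by (simp add: psi_mult_chart m_assoc mult_dom_iff)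
    ultimately have "((\<lambda>u. f (x \<otimes> \<psi> a \<otimes> \<psi> u)) has_derivative (\<lambda>v. frechet_derivative h (at a) (Dm (a, base) (0, v)))) (at base)"
      by (rule has_derivative_transform_within_open)
    from fun_cong[OF frechet_derivative_at[OF this], of Y] show ?thesis
      unfolding left_inv_field_eq by simp
  qed
  have "((\<lambda>a. (a, base)) has_derivative (\<lambda>v. (v, 0))) (at base)"
    by (auto intro!: derivative_eq_intros)
  from has_derivative_compose[OF this Dm_Dm_has_derivative[OF base_base]]
  have w: "((\<lambda>a. Dm (a, base) (0, Y)) has_derivative (\<lambda>v. hess v Y)) (at base)"
    by (simp add: hess_def)
  from has_derivative_frechet_derivative_eval[OF finite_dimensional N bN h has_derivative_ident w]
  have "((\<lambda>a. frechet_derivative h (at a) (Dm (a, base) (0, Y))) has_derivative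
      (\<lambda>q. frechet_derivative (\<lambda>a. frechet_derivative h (at a) Y) (at base) q +
            frechet_derivative h (at base) (hess q Y))) (at base)"
    by (simp add: Dm_base_left[OF base_in])
  then have "((\<lambda>a. left_inv_field G (U, \<phi>) Y f (x \<otimes> \<psi> a)) has_derivative
      (\<lambda>q. frechet_derivative (\<lambda>a. frechet_derivative h (at a) Y) (at base) q +
            frechet_derivative h (at base) (hess q Y))) (at base)"
    by (rule has_derivative_transform_within_open[OF _ N bN]) (simp add: inner)
  from fun_cong[OF frechet_derivative_at[OF this], of X]
  show "left_inv_field G (U, \<phi>) X (left_inv_field G (U, \<phi>) Y f) x =
      frechet_derivative (\<lambda>a. frechet_derivative h (at a) Y) (at base) X + frechet_derivative h (at base) (hess X Y)"
    unfolding left_inv_field_eq[of X] by simp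
qed

lemma smooth_fun_functional:
  assumes "linear (L :: 'e \<Rightarrow> real)"
  shows "smooth_fun_on G U (\<lambda>x. L (\<phi> x))"
  unfolding smooth_fun_on_def smooth_on_def
proof (intro ballI allI, clarify)
  fix W \<theta> n assume W: "(W, \<theta>) \<in> atlas G"
  have "Ck_on n (\<theta> ` (W \<inter> U)) (\<lambda>a. \<phi> (inv_into W \<theta> a))"
    using transitions_smooth[OF W chart] by (simp add: smooth_on_def)
  then show "Ck_on n (\<theta> ` (U \<inter> W)) (\<lambda>a. L (\<phi> (inv_into W \<theta> a)))"
    using Ck_on_linear_comp[OF open_chart_image[OF W chart_facts(1)[OF chart]]
        linear_bounded_finite_dim[OF finite_dimensional assms]] by (simp add: Int_commute)
qed

text \<open>The definite description in \<open>lie_bracket\<close> needs uniqueness as well: on a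
  coordinate function L \<circ> \<phi> the left-invariant field of \<open>Z\<close> has the value
  \<open>L Z\<close> at the identity, and functionals separate points.\<close>

theorem lie_bracket_eq_hess: "lie_bracket G (U, \<phi>) X Y = hess X Y - hess Y X"
  unfolding lie_bracket_def
proof (rule the_equality)
  show "\<forall>V f. openin (topo G) V \<and> smooth_fun_on G V f \<longrightarrow>
      (\<forall>x\<in>V. left_inv_field G (U, \<phi>) X (left_inv_field G (U, \<phi>) Y f) x
            - left_inv_field G (U, \<phi>) Y (left_inv_field G (U, \<phi>) X f) x =
          left_inv_field G (U, \<phi>) (hess X Y - hess Y X) f x)"
  proof clarify
    fix V and f :: "'g \<Rightarrow> real" and x assume *: "openin (topo G) V" "smooth_fun_on G V f" "x \<in> V"
    show "left_inv_field G (U, \<phi>) X (left_inv_field G (U, \<phi>) Y f) x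
            - left_inv_field G (U, \<phi>) Y (left_inv_field G (U, \<phi>) X f) x =
          left_inv_field G (U, \<phi>) (hess X Y - hess Y X) f x"
      using left_inv_field_twice(1)[OF *, of X Y] left_inv_field_twice(1)[OF *, of Y X]
        left_inv_field_twice(2)[OF *, of Y X] linear_diff[OF left_inv_field_twice(3)[OF *]]
      by (simp add: left_inv_field_eq)
  qed
next
  fix Z
  assume Z: "\<forall>V f. openin (topo G) V \<and> smooth_fun_on G V f \<longrightarrow>
      (\<forall>x\<in>V. left_inv_field G (U, \<phi>) X (left_inv_field G (U, \<phi>) Y f) x
            - left_inv_field G (U, \<phi>) Y (left_inv_field G (U, \<phi>) X f) x =
          left_inv_field G (U, \<phi>) Z f x)"
  show "Z = hess X Y - hess Y X"
  proof (rule functionals_determine)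
    fix L :: "'e \<Rightarrow> real" assume L: "linear L"
    let ?f = "\<lambda>x. L (\<phi> x)"
    note * = chart_facts(1)[OF chart] smooth_fun_functional[OF L] one_in
    have bl: "bounded_linear L" by (rule linear_bounded_finite_dim[OF finite_dimensional L])
    have "((\<lambda>u. L (\<phi> (\<one> \<otimes> \<psi> u))) has_derivative L) (at base)"
      by (rule has_derivative_transform_within_open[OF bounded_linear_imp_has_derivative[OF bl] open_phi_U base_in])
        (use psi_simps in simp)
    from frechet_derivative_at[OF this]
    have ev: "left_inv_field G (U, \<phi>) Z ?f \<one> = L Z" for Z
      unfolding left_inv_field_eq by simp
    have "left_inv_field G (U, \<phi>) Z ?f \<one> = left_inv_field G (U, \<phi>) X (left_inv_field G (U, \<phi>) Y ?f) \<one>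
            - left_inv_field G (U, \<phi>) Y (left_inv_field G (U, \<phi>) X ?f) \<one>"
      using Z * by simp
    also have "\<dots> = left_inv_field G (U, \<phi>) (hess X Y - hess Y X) ?f \<one>"
      using left_inv_field_twice(1)[OF *, of X Y] left_inv_field_twice(1)[OF *, of Y X]
        left_inv_field_twice(2)[OF *, of Y X] linear_diff[OF left_inv_field_twice(3)[OF *]]
      by (simp add: left_inv_field_eq)
    finally show "L Z = L (hess X Y - hess Y X)" by (simp add: ev)
  qed
qed

end

section \<open>One-parameter subgroups and the adjoint action\<close>

lemma (in lie_group) one_param_facts:
  assumes "one_param_subgroup G c X \<gamma>"
  shows "\<gamma> t \<in> carrier G" "\<gamma> 0 = \<one>" "\<gamma> (- t) = inv (\<gamma> t)" "\<gamma> (s + t) = \<gamma> s \<otimes> \<gamma> t"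
    "continuous_map euclideanreal (topo G) \<gamma>"
    "((\<lambda>t. snd c (\<gamma> t)) has_vector_derivative X) (at 0)"
proof -
  show cont: "continuous_map euclideanreal (topo G) \<gamma>"
    and hom: "\<And>s t. \<gamma> (s + t) = \<gamma> s \<otimes> \<gamma> t"
    and "((\<lambda>t. snd c (\<gamma> t)) has_vector_derivative X) (at 0)"
    using assms unfolding one_param_subgroup_def by blast+
  show car: "\<gamma> t \<in> carrier G" for t
    using continuous_map_image_subset_topspace[OF cont] topspace_eq by auto
  have "\<gamma> 0 \<otimes> \<gamma> 0 = \<gamma> 0" using hom[of 0 0] by simp
  then show zero: "\<gamma> 0 = \<one>" using car[of 0] l_cancel_one' by metis
  show "\<gamma> (- t) = inv (\<gamma> t)"
    using hom[of "- t" t] zero car inv_equality by (metis add.left_inverse)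
qed

context lie_chart
begin

lemma Ad_eq: "Ad G (U, \<phi>) x Y = frechet_derivative (\<lambda>u. \<phi> (x \<otimes> \<psi> u \<otimes> inv x)) (at base) Y"
  by (simp add: Ad_def chart_inv_def \<psi>_def base_def)

text \<open>The point \<open>x\<close> need not lie in \<open>U\<close>, so conjugation is factored
  through a chart \<open>W\<close> around \<open>x\<close>: left translation by \<open>x\<close>
  leads from \<open>U\<close> to \<open>W\<close>, right translation by \<open>inv x\<close> leads
  back to \<open>U\<close>.\<close>

lemma conj_has_derivative:
  assumes x: "x \<in> carrier G"
  shows "((\<lambda>u. \<phi> (x \<otimes> \<psi> u \<otimes> inv x)) has_derivative Ad G (U, \<phi>) x) (at base)"
proof -
  obtain W \<theta> where W: "(W, \<theta>) \<in> atlas G" "x \<in> W" using chart_at[OF x] .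
  have ix: "inv x \<in> carrier G" using x by simp
  let ?S1 = "{a \<in> \<phi> ` U. x \<otimes> \<psi> a \<in> W}"
  let ?S2 = "{b \<in> \<theta> ` W. inv_into W \<theta> b \<otimes> inv x \<in> U}"
  have S1: "open ?S1" unfolding \<psi>_def
    by (rule open_chart_vimage[OF chart continuous_translations(1)[OF x x] chart_facts(1)[OF W(1)]])
  have b1: "base \<in> ?S1" using base_in W x by simp
  have 1: "Ck_on (Suc 0) ?S1 (\<lambda>a. \<theta> (x \<otimes> \<psi> a))"
    unfolding \<psi>_def by (rule left_translation_Ck[OF chart W(1) x])
  have 2: "Ck_on (Suc 0) ?S2 (\<lambda>b. \<phi> (inv_into W \<theta> b \<otimes> inv x))"
    by (rule right_translation_Ck[OF W(1) chart ix])
  have "\<theta> (x \<otimes> \<psi> base) \<in> ?S2"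
    using W x one_in by (simp add: chart_inv_simps(1)[OF W(1)])
  from has_derivative_compose[OF Ck_on_has_derivative[OF 1 b1] Ck_on_has_derivative[OF 2 this]]
  have "(\<lambda>a. \<phi> (inv_into W \<theta> (\<theta> (x \<otimes> \<psi> a)) \<otimes> inv x)) differentiable (at base)"
    by (auto simp: differentiable_def)
  then obtain D where "((\<lambda>a. \<phi> (inv_into W \<theta> (\<theta> (x \<otimes> \<psi> a)) \<otimes> inv x)) has_derivative D) (at base)"
    by (auto simp: differentiable_def)
  then have "((\<lambda>u. \<phi> (x \<otimes> \<psi> u \<otimes> inv x)) has_derivative D) (at base)"
    by (rule has_derivative_transform_within_open[OF _ S1 b1]) (simp add: chart_inv_simps(1)[OF W(1)])
  then have "(\<lambda>u. \<phi> (x \<otimes> \<psi> u \<otimes> inv x)) differentiable (at base)"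
    by (auto simp: differentiable_def)
  then have "((\<lambda>u. \<phi> (x \<otimes> \<psi> u \<otimes> inv x)) has_derivative
      frechet_derivative (\<lambda>u. \<phi> (x \<otimes> \<psi> u \<otimes> inv x)) (at base)) (at base)"
    by (simp add: frechet_derivative_works)
  moreover have "frechet_derivative (\<lambda>u. \<phi> (x \<otimes> \<psi> u \<otimes> inv x)) (at base) = Ad G (U, \<phi>) x"
    by (rule ext) (simp add: Ad_eq)
  ultimately show ?thesis by simp
qed

lemma Ad_linear: "x \<in> carrier G \<Longrightarrow> linear (Ad G (U, \<phi>) x)"
  using conj_has_derivative has_derivative_linear by blast

lemma Ad_central:
  assumes x: "x \<in> carrier G" and cen: "\<And>y. y \<in> carrier G \<Longrightarrow> x \<otimes> y = y \<otimes> x"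
  shows "Ad G (U, \<phi>) x Y = Y"
proof -
  have eq: "u = \<phi> (x \<otimes> \<psi> u \<otimes> inv x)" if "u \<in> \<phi> ` U" for u
  proof -
    have "x \<otimes> \<psi> u \<otimes> inv x = \<psi> u \<otimes> (x \<otimes> inv x)"
      using cen[of "\<psi> u"] psi_simps(4)[OF that] x by (simp add: m_assoc)
    then show ?thesis using x psi_simps(2,4)[OF that] by simp
  qed
  have "((\<lambda>u. \<phi> (x \<otimes> \<psi> u \<otimes> inv x)) has_derivative (\<lambda>u. u)) (at base)"
    by (rule has_derivative_transform_within_open[OF has_derivative_ident open_phi_U base_in eq])
  from has_derivative_unique[OF conj_has_derivative[OF x] this] show ?thesis by simp
qed

lemma Ad_mult:
  assumes x: "x \<in> carrier G" and y: "y \<in> carrier G"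
  shows "Ad G (U, \<phi>) (x \<otimes> y) Y = Ad G (U, \<phi>) x (Ad G (U, \<phi>) y Y)"
proof -
  let ?N = "{u \<in> \<phi> ` U. y \<otimes> \<psi> u \<otimes> inv y \<in> U}"
  have N: "open ?N" unfolding \<psi>_def
    using y by (intro open_chart_vimage[OF chart _ chart_facts(1)[OF chart]] continuous_translations) auto
  have bN: "base \<in> ?N" using base_in y one_in by simp
  have "\<phi> (y \<otimes> \<psi> base \<otimes> inv y) = base" using y by (simp add: base_def psi_simps(1)[OF one_in])
  then have "((\<lambda>u. \<phi> (x \<otimes> \<psi> (\<phi> (y \<otimes> \<psi> u \<otimes> inv y)) \<otimes> inv x)) has_derivative
      (\<lambda>Y. Ad G (U, \<phi>) x (Ad G (U, \<phi>) y Y))) (at base)"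
    using has_derivative_compose[OF conj_has_derivative[OF y], of "\<lambda>u. \<phi> (x \<otimes> \<psi> u \<otimes> inv x)"]
      conj_has_derivative[OF x] by simp
  then have "((\<lambda>u. \<phi> (x \<otimes> y \<otimes> \<psi> u \<otimes> inv (x \<otimes> y))) has_derivative
      (\<lambda>Y. Ad G (U, \<phi>) x (Ad G (U, \<phi>) y Y))) (at base)"
  proof (rule has_derivative_transform_within_open[OF _ N bN])
    fix u assume u: "u \<in> ?N"
    then have "\<psi> u \<in> carrier G" using psi_simps(4) by blast
    then show "\<phi> (x \<otimes> \<psi> (\<phi> (y \<otimes> \<psi> u \<otimes> inv y)) \<otimes> inv x) = \<phi> (x \<otimes> y \<otimes> \<psi> u \<otimes> inv (x \<otimes> y))"
      using u x y psi_simps(1) by (simp add: inv_mult_group m_assoc)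
  qed
  from fun_cong[OF has_derivative_unique[OF conj_has_derivative this]] x y show ?thesis by simp
qed

text \<open>The coordinates of a point and of its inverse are independent variables here, so that
  inversion never has to be differentiated; along a one-parameter subgroup the inverse is just the
  value at -t.\<close>

definition Ad_chart where "Ad_chart Y p = Dm p (Dm (fst p, base) (0, Y), 0)"

lemma Ad_eq_Ad_chart:
  assumes x: "x \<in> U" "inv x \<in> U"
  shows "Ad G (U, \<phi>) x Y = Ad_chart Y (\<phi> x, \<phi> (inv x))"
proof -
  have xc: "x \<in> carrier G" using U_carrier[OF x(1)] .
  let ?N = "{u \<in> \<phi> ` U. x \<otimes> \<psi> u \<in> U} \<inter> {u \<in> \<phi> ` U. x \<otimes> \<psi> u \<otimes> inv x \<in> U}"
  have N: "open ?N" unfolding \<psi>_def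
    using xc by (intro open_Int open_chart_vimage[OF chart _ chart_facts(1)[OF chart]] continuous_translations) auto
  have bN: "base \<in> ?N" using base_in x xc one_in by simp
  have p1: "(\<phi> x, base) \<in> mult_dom" using x by (intro mult_dom_base) simp
  have p2: "(\<phi> x, \<phi> (inv x)) \<in> mult_dom" using x xc one_in by (simp add: mult_dom_iff psi_simps)
  have "((\<lambda>u. (\<phi> x, u)) has_derivative (\<lambda>v. (0, v))) (at base)"
    by (auto intro!: derivative_eq_intros)
  from has_derivative_compose[OF this Dm_has_derivative[OF p1]]
  have "((\<lambda>u. (mult_chart (\<phi> x, u), \<phi> (inv x))) has_derivative (\<lambda>v. (Dm (\<phi> x, base) (0, v), 0))) (at base)"
    by (intro has_derivative_Pair has_derivative_const)
  moreover have "(mult_chart (\<phi> x, base), \<phi> (inv x)) = (\<phi> x, \<phi> (inv x))"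
    using mult_chart_base x by simp
  ultimately have "((\<lambda>u. mult_chart (mult_chart (\<phi> x, u), \<phi> (inv x))) has_derivative
      (\<lambda>v. Dm (\<phi> x, \<phi> (inv x)) (Dm (\<phi> x, base) (0, v), 0))) (at base)"
    using has_derivative_compose[of "\<lambda>u. (mult_chart (\<phi> x, u), \<phi> (inv x))"
        "\<lambda>v. (Dm (\<phi> x, base) (0, v), 0)" base UNIV mult_chart] Dm_has_derivative[OF p2] by simp
  then have "((\<lambda>u. \<phi> (x \<otimes> \<psi> u \<otimes> inv x)) has_derivative
      (\<lambda>v. Dm (\<phi> x, \<phi> (inv x)) (Dm (\<phi> x, base) (0, v), 0))) (at base)"
    by (rule has_derivative_transform_within_open[OF _ N bN])
      (use x psi_simps(1) in \<open>simp add: mult_chart_def\<close>)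
  from fun_cong[OF has_derivative_unique[OF conj_has_derivative[OF xc] this], of Y]
  show ?thesis by (simp add: Ad_chart_def)
qed

lemma Ad_chart_has_derivative:
  "(Ad_chart Y has_derivative (\<lambda>q. frechet_derivative (\<lambda>p. Dm p (Y, 0)) (at (base, base)) q + hess (fst q) Y))
    (at (base, base))"
proof -
  have fst: "((\<lambda>p. (fst p, base)) has_derivative (\<lambda>q. (fst q, 0))) (at (base, base))"
    by (auto intro!: derivative_eq_intros)
  have "((\<lambda>p. Dm (fst p, base) (0, Y)) has_derivative (\<lambda>q. hess (fst q) Y)) (at (base, base))"
    unfolding hess_def using has_derivative_compose[OF fst, of "\<lambda>p. Dm p (0, Y)"]
      Dm_Dm_has_derivative[OF base_base] by simp
  then have "((\<lambda>p. (Dm (fst p, base) (0, Y), 0)) has_derivative (\<lambda>q. (hess (fst q) Y, 0))) (at (base, base))"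
    by (intro has_derivative_Pair has_derivative_const)
  from has_derivative_frechet_derivative_eval[OF fd_prod open_mult_dom base_base Ck_mult_chart has_derivative_ident this]
  show ?thesis
    unfolding Dm_def[symmetric] Ad_chart_def
    by (simp add: Dm_base_left[OF base_in] Dm_base_right[OF base_in])
qed

lemma one_param_eventually_in_U:
  assumes "one_param_subgroup G (U, \<phi>) X \<gamma>"
  obtains T where "open T" "0 \<in> T" "\<And>t. t \<in> T \<Longrightarrow> \<gamma> t \<in> U \<and> \<gamma> (- t) \<in> U"
proof -
  note \<gamma> = one_param_facts[OF assms]
  let ?T = "{t. \<gamma> t \<in> U}"
  have "openin euclideanreal {t \<in> topspace euclideanreal. \<gamma> t \<in> U}"
    by (rule openin_continuous_map_preimage[OF \<gamma>(5) chart_facts(1)[OF chart]])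
  then have T: "open ?T" by simp
  then have "open (?T \<inter> uminus -` ?T)" by (intro open_Int open_vimage continuous_intros) auto
  moreover have "0 \<in> ?T \<inter> uminus -` ?T" using one_in \<gamma>(2) by simp
  ultimately show thesis using that by blast
qed

text \<open>The derivative of \<open>p \<mapsto> Dm p (Y, 0)\<close> vanishes on (v, 0), because
  \<open>Dm (a, base) (Y, 0) = Y\<close> for all a, and equals \<open>hess Y v\<close> on (0, v) by
  symmetry. With the second coordinate running backwards, the total is
  \<open>hess X Y - hess Y X\<close>.\<close>

theorem Ad_one_param_has_derivative:
  assumes "one_param_subgroup G (U, \<phi>) X \<gamma>"
  shows "((\<lambda>t. Ad G (U, \<phi>) (\<gamma> t) Y) has_vector_derivative lie_bracket G (U, \<phi>) X Y) (at 0)"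
proof -
  note \<gamma> = one_param_facts[OF assms]
  obtain T where T: "open T" "0 \<in> T" "\<And>t. t \<in> T \<Longrightarrow> \<gamma> t \<in> U \<and> \<gamma> (- t) \<in> U"
    using one_param_eventually_in_U[OF assms] by blast
  have d1: "((\<lambda>t. \<phi> (\<gamma> t)) has_derivative (\<lambda>h. h *\<^sub>R X)) (at 0)"
    using \<gamma>(6) by (simp add: has_vector_derivative_def)
  have "((\<lambda>t::real. - t) has_derivative (\<lambda>h. - h)) (at 0)"
    by (auto intro!: derivative_eq_intros)
  from has_derivative_compose[OF this, of "\<lambda>t. \<phi> (\<gamma> t)" "\<lambda>h. h *\<^sub>R X"] d1
  have "((\<lambda>t. \<phi> (\<gamma> (- t))) has_derivative (\<lambda>h. - (h *\<^sub>R X))) (at 0)" by simp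
  with d1 have "((\<lambda>t. (\<phi> (\<gamma> t), \<phi> (\<gamma> (- t)))) has_derivative (\<lambda>h. (h *\<^sub>R X, - (h *\<^sub>R X)))) (at 0)"
    by (rule has_derivative_Pair)
  moreover have "(Ad_chart Y has_derivative
      (\<lambda>q. frechet_derivative (\<lambda>p. Dm p (Y, 0)) (at (base, base)) q + hess (fst q) Y))
    (at (\<phi> (\<gamma> 0), \<phi> (\<gamma> (- 0))))"
    using Ad_chart_has_derivative[of Y] by (simp add: \<gamma>(2) base_def)
  ultimately  have D: "((\<lambda>t. Ad_chart Y (\<phi> (\<gamma> t), \<phi> (\<gamma> (- t)))) has_derivative
      (\<lambda>h. frechet_derivative (\<lambda>p. Dm p (Y, 0)) (at (base, base)) (h *\<^sub>R X, - (h *\<^sub>R X)) + hess (h *\<^sub>R X) Y)) (at 0)"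
    using has_derivative_compose by fastforce
  let ?E = "frechet_derivative (\<lambda>p. Dm p (Y, 0)) (at (base, base))"
  have lin: "linear ?E"
    using Dm_Dm_has_derivative[OF base_base] has_derivative_linear by blast
  have E1: "?E (v, 0) = 0" for v
  proof -
    have "((\<lambda>a. (a, base)) has_derivative (\<lambda>v. (v, 0))) (at base)"
      by (auto intro!: derivative_eq_intros)
    from has_derivative_compose[OF this Dm_Dm_has_derivative[OF base_base]]
    have "((\<lambda>a. Y) has_derivative (\<lambda>v. ?E (v, 0))) (at base)"
      by (rule has_derivative_transform_within_open[OF _ open_phi_U base_in]) (simp add: Dm_base_right)
    from fun_cong[OF has_derivative_unique[OF this has_derivative_const]] show ?thesis by simp
  qed
  have E: "?E (v, - v) = - hess Y v" for v
  proof -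
    have "?E (v, - v) = ?E (v, 0) - ?E (0, v)"
      using linear_diff[OF lin, of "(v, 0)" "(0, v)"] by simp
    then show ?thesis by (simp add: E1 hess_symmetric)
  qed
  have "?E (h *\<^sub>R X, - (h *\<^sub>R X)) + hess (h *\<^sub>R X) Y = h *\<^sub>R lie_bracket G (U, \<phi>) X Y" for h
    by (simp add: E lie_bracket_eq_hess linear_cmul[OF hess_linear_right] linear_cmul[OF hess_linear_left] algebra_simps)
  with D have "((\<lambda>t. Ad_chart Y (\<phi> (\<gamma> t), \<phi> (\<gamma> (- t)))) has_derivative
      (\<lambda>h. h *\<^sub>R lie_bracket G (U, \<phi>) X Y)) (at 0)" by simp
  then have "((\<lambda>t. Ad G (U, \<phi>) (\<gamma> t) Y) has_derivative (\<lambda>h. h *\<^sub>R lie_bracket G (U, \<phi>) X Y)) (at 0)"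
  proof (rule has_derivative_transform_within_open[OF _ T(1,2)])
    fix t assume "t \<in> T"
    from T(3)[OF this] show "Ad_chart Y (\<phi> (\<gamma> t), \<phi> (\<gamma> (- t))) = Ad G (U, \<phi>) (\<gamma> t) Y"
      using Ad_eq_Ad_chart[of "\<gamma> t" Y] by (simp add: \<gamma>(3))
  qed
  then show ?thesis by (simp add: has_vector_derivative_def)
qed

text \<open>Continuity of \<open>Ad_chart\<close> at the base point suffices, provided that the
  inverse of x is kept near the identity along with x.\<close>

lemma Ad_locally_bounded:
  obtains N C where "openin (topo G) N" "\<one> \<in> N" "\<And>x. x \<in> N \<Longrightarrow> norm (Ad G (U, \<phi>) x Y) \<le> C"
proof -
  have "isCont (Ad_chart Y) (base, base)"
    using Ad_chart_has_derivative has_derivative_continuous by blast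
  then obtain d where d: "d > 0" "\<And>p. dist p (base, base) < d \<Longrightarrow> dist (Ad_chart Y p) (Ad_chart Y (base, base)) < 1"
    unfolding continuous_at_eps_delta by (metis zero_less_one)
  let ?P = "{x \<in> U. \<phi> x \<in> ball base (d/2)}"
  let ?N = "?P \<inter> {x \<in> topspace (topo G). inv x \<in> ?P}"
  have P: "openin (topo G) ?P" by (rule openin_chart_preimage[OF chart open_ball])
  have N: "openin (topo G) ?N"
    by (intro openin_Int P openin_continuous_map_preimage[OF inv_continuous])
  have "\<one> \<in> ?N" using one_in d(1) by (simp add: base_def topspace_eq)
  moreover have "norm (Ad G (U, \<phi>) x Y) \<le> norm (Ad_chart Y (base, base)) + 1" if x: "x \<in> ?N" for x
  proof -
    have "dist (\<phi> x, \<phi> (inv x)) (base, base) \<le> dist (\<phi> x) base + dist (\<phi> (inv x)) base"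
      unfolding dist_prod_def by (simp add: sqrt_sum_squares_le_sum)
    also have "\<dots> < d" using x by (simp add: dist_commute)
    finally have "dist (Ad_chart Y (\<phi> x, \<phi> (inv x))) (Ad_chart Y (base, base)) < 1" by (rule d(2))
    then show ?thesis
      using x norm_triangle_sub[of "Ad_chart Y (\<phi> x, \<phi> (inv x))" "Ad_chart Y (base, base)"]
      by (simp add: Ad_eq_Ad_chart dist_norm)
  qed
  ultimately show thesis using that[OF N] by blast
qed

lemma Ad_bounded_on_compact:
  assumes C: "compactin (topo G) C"
  shows "\<exists>B. \<forall>x\<in>C. norm (Ad G (U, \<phi>) x Y) \<le> B"
proof -
  have sub: "C \<subseteq> carrier G" using compactin_subset_topspace[OF C] topspace_eq by simp
  obtain N B where N: "openin (topo G) N" "\<one> \<in> N" "\<And>x. x \<in> N \<Longrightarrow> norm (Ad G (U, \<phi>) x Y) \<le> B"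
    using Ad_locally_bounded[of Y] by blast
  have NG: "N \<subseteq> carrier G" using openin_subset[OF N(1)] topspace_eq by simp
  \<comment> \<open>The translate c N. On it Ad is the fixed map Ad c applied after Ad of an element
    of \<open>N\<close>, where there is a bound; finitely many translates cover
    \<open>C\<close>.\<close>
  define T where "T c = {x \<in> topspace (topo G). inv c \<otimes> x \<in> N}" for c
  have T: "openin (topo G) (T c)" if "c \<in> C" for c
    unfolding T_def using that sub
    by (intro openin_continuous_map_preimage[OF _ N(1)] continuous_translations(1)) auto
  have in_T: "c \<in> T c" if "c \<in> C" for c
    using that sub N(2) unfolding T_def by (auto simp: topspace_eq)
  have "\<exists>F. finite F \<and> F \<subseteq> T ` C \<and> C \<subseteq> \<Union>F"
    using compactinD[OF C, of "T ` C"] T in_T by blast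
  then obtain F where F: "finite F" "F \<subseteq> T ` C" "C \<subseteq> \<Union>F" by blast
  obtain D where D: "D \<subseteq> C" "finite D" "F = T ` D" using finite_subset_image[OF F(1,2)] by blast
  define M where "M = (\<Sum>c\<in>D. onorm (Ad G (U, \<phi>) c) * B)"
  have bl: "bounded_linear (Ad G (U, \<phi>) c)" if "c \<in> C" for c
    using that sub by (intro linear_bounded_finite_dim[OF finite_dimensional] Ad_linear) auto
  have B: "B \<ge> 0" using N(3)[OF N(2)] norm_ge_zero order_trans by blast
  have "norm (Ad G (U, \<phi>) x Y) \<le> M" if x: "x \<in> C" for x
  proof -
    obtain c where c: "c \<in> D" "x \<in> T c" using F(3) D(3) x by blast
    have cC: "c \<in> C" "c \<in> carrier G" using c(1) D(1) sub by auto
    have xc: "x \<in> carrier G" "inv c \<otimes> x \<in> N" using c(2) by (auto simp: T_def topspace_eq)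
    have "x = c \<otimes> (inv c \<otimes> x)" using cC xc by (simp add: m_assoc[symmetric])
    then have "Ad G (U, \<phi>) x Y = Ad G (U, \<phi>) c (Ad G (U, \<phi>) (inv c \<otimes> x) Y)"
      using Ad_mult[of c "inv c \<otimes> x" Y] cC xc by simp
    also have "norm \<dots> \<le> onorm (Ad G (U, \<phi>) c) * norm (Ad G (U, \<phi>) (inv c \<otimes> x) Y)"
      by (rule onorm[OF bl[OF cC(1)]])
    also have "\<dots> \<le> onorm (Ad G (U, \<phi>) c) * B"
      using N(3)[OF xc(2)] onorm_pos_le[OF bl[OF cC(1)]] by (rule mult_left_mono)
    also have "\<dots> \<le> M"
      unfolding M_def using c(1) D(1,2) B onorm_pos_le[OF bl]
      by (intro member_le_sum) (auto intro!: mult_nonneg_nonneg)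
    finally show ?thesis .
  qed
  then show ?thesis by blast
qed

end

section \<open>The Lie algebra of a closed subgroup\<close>

text \<open>Uniform boundedness in finite dimension: the bounds at the finitely many basis vectors,
  weighted by the norms of the coordinate functionals, add up to a common constant.\<close>

lemma pointwise_bounded_linear_family:
  fixes T :: "'i \<Rightarrow> 'a::real_normed_vector \<Rightarrow> 'b::real_normed_vector"
  assumes fd: "\<exists>B :: 'a set. finite B \<and> span B = UNIV"
    and lin: "\<And>i. i \<in> I \<Longrightarrow> linear (T i)"
    and bnd: "\<And>v. \<exists>C. \<forall>i\<in>I. norm (T i v) \<le> C"
  obtains C where "C \<ge> 0" "\<And>i v. i \<in> I \<Longrightarrow> norm (T i v) \<le> C * norm v"
proof -
  obtain B :: "'a set" where B: "finite B" "independent B" "span B = UNIV"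
    using finite_basis_exists[OF fd] .
  obtain M where M: "\<And>v i. i \<in> I \<Longrightarrow> norm (T i v) \<le> M v"
    using bnd by metis
  let ?r = "\<lambda>b v. representation B v b"
  have bl: "bounded_linear (?r b)" for b by (rule bounded_linear_representation[OF B])
  define C where "C = (\<Sum>b\<in>B. onorm (?r b) * \<bar>M b\<bar>)"
  have "C \<ge> 0" unfolding C_def by (intro sum_nonneg mult_nonneg_nonneg onorm_pos_le[OF bl]) simp
  moreover have "norm (T i v) \<le> C * norm v" if i: "i \<in> I" for i v
  proof -
    have "T i v = T i (\<Sum>b\<in>B. ?r b v *\<^sub>R b)" by (simp add: representation_sum[OF B])
    also have "\<dots> = (\<Sum>b\<in>B. ?r b v *\<^sub>R T i b)"
      by (simp add: linear_sum[OF lin[OF i]] linear_cmul[OF lin[OF i]])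
    also have "norm \<dots> \<le> (\<Sum>b\<in>B. onorm (?r b) * \<bar>M b\<bar> * norm v)"
    proof (rule sum_norm_le)
      fix b
      have "norm (?r b v *\<^sub>R T i b) \<le> (onorm (?r b) * norm v) * \<bar>M b\<bar>"
        unfolding norm_scaleR using onorm[OF bl[of b], of v] M[OF i, of b]
        by (intro mult_mono) (auto intro: order_trans[OF _ abs_ge_self] mult_nonneg_nonneg onorm_pos_le[OF bl])
      then show "norm (?r b v *\<^sub>R T i b) \<le> onorm (?r b) * \<bar>M b\<bar> * norm v" by (simp add: algebra_simps)
    qed
    also have "\<dots> = C * norm v" by (simp add: C_def sum_distrib_right)
    finally show ?thesis .
  qed
  ultimately show thesis using that by blast
qed

lemma has_vector_derivative_quadratic_bound:
  fixes f :: "real \<Rightarrow> 'a::real_normed_vector"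
  assumes "e > 0" "\<And>t. \<bar>t\<bar> < e \<Longrightarrow> norm (f t - f 0 - t *\<^sub>R Z) \<le> M * t\<^sup>2"
  shows "(f has_vector_derivative Z) (at 0)"
  unfolding has_vector_derivative_def
proof (rule has_derivativeI_sandwich[OF assms(1)])
  show "bounded_linear (\<lambda>h. h *\<^sub>R Z)" by (rule bounded_linear_scaleR_left)
  show "((\<lambda>t. M * \<bar>t\<bar>) \<longlongrightarrow> 0) (at 0)" by (auto intro!: tendsto_eq_intros)
  fix t :: real assume "t \<in> UNIV" "t \<noteq> 0" "dist t 0 < e"
  with assms(2)[of t] show "norm (f t - f 0 - (t - 0) *\<^sub>R Z) / norm (t - 0) \<le> M * \<bar>t\<bar>"
    by (simp add: field_simps power2_eq_square)
qed

context lie_chart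
begin

text \<open>At b = base the product is a, so the derivative of the error in a vanishes there; in
  general it is of size |b - base|, because the mixed second derivative is bounded on the compact
  ball. The later estimates for powers and inverses rest on this.\<close>

lemma mult_chart_increment_left:
  assumes S: "S = cball base r" "S \<times> S \<subseteq> mult_dom"
  obtains C where "C \<ge> 0"
    "\<And>a a' b. a \<in> S \<Longrightarrow> a' \<in> S \<Longrightarrow> b \<in> S \<Longrightarrow>
      norm (mult_chart (a, b) - mult_chart (a', b) - (a - a')) \<le> C * norm (b - base) * norm (a - a')"
proof (cases "r \<ge> 0")
  case False
  then show thesis using that[of 0] by (simp add: S)
next
  case True
  then have bS: "base \<in> S" by (simp add: S)
  have conv: "convex S" by (simp add: S)
  have comp: "compact (S \<times> S)"
    unfolding S by (intro compact_Times compact_cball_finite_dim finite_dimensional)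
  define H where "H v p w = frechet_derivative (\<lambda>p. Dm p (v, 0)) (at p) (0, w)" for v p w
  have S_U: "a \<in> \<phi> ` U" if "a \<in> S" for a
    using S(2) that bS mult_dom_iff by blast
  have linH: "linear (H v p)" if "p \<in> S \<times> S" for v p
  proof -
    have "linear (frechet_derivative (\<lambda>p. Dm p (v, 0)) (at p))"
      using Dm_Dm_has_derivative S(2) that has_derivative_linear by blast
    moreover have "linear (\<lambda>w::'e. (0::'e, w))" by (auto intro: linearI)
    ultimately show ?thesis using linear_compose unfolding H_def o_def by fastforce
  qed
  have bndH: "\<exists>C. \<forall>p\<in>S \<times> S. norm (H v p w) \<le> C" for v w
  proof -
    have "Ck_on 0 mult_dom (\<lambda>p. H v p w)"
      using Ck_mult_chart[of "Suc (Suc 0)"] unfolding H_def Dm_def Ck_on.simps(2) by blast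
    then have "continuous_on (S \<times> S) (\<lambda>p. H v p w)"
      using S(2) continuous_on_subset by auto
    from compact_imp_bounded[OF compact_continuous_image[OF this comp]]
    show ?thesis unfolding bounded_iff by blast
  qed
  \<comment> \<open>The constant still depends on the direction v. The family \<open>T\<close> below
    is the same difference divided by |b - base|, so that the boundedness principle makes the
    constant uniform in v.\<close>
  have step1: "\<exists>C. \<forall>a\<in>S. \<forall>b\<in>S. norm (Dm (a, b) (v, 0) - v) \<le> C * norm (b - base)" for v
  proof -
    obtain C where C: "C \<ge> 0" "\<And>p w. p \<in> S \<times> S \<Longrightarrow> norm (H v p w) \<le> C * norm w"
      using pointwise_bounded_linear_family[OF finite_dimensional, of "S \<times> S" "H v"] linH bndH by metis
    have "norm (Dm (a, b) (v, 0) - v) \<le> C * norm (b - base)" if "a \<in> S" "b \<in> S" for a b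
    proof -
      have "norm (Dm (a, b) (v, 0) - Dm (a, base) (v, 0)) \<le> C * norm (b - base)"
      proof (rule differentiable_bound[OF conv _ _ \<open>b \<in> S\<close> bS, of "\<lambda>b. Dm (a, b) (v, 0)" "\<lambda>b. H v (a, b)"])
        fix x assume x: "x \<in> S"
        have "((\<lambda>x. (a, x)) has_derivative (\<lambda>w. (0, w))) (at x)"
          by (auto intro!: derivative_eq_intros)
        from has_derivative_compose[OF this Dm_Dm_has_derivative] S(2) x that
        have "((\<lambda>b. Dm (a, b) (v, 0)) has_derivative H v (a, x)) (at x)"
          unfolding H_def by blast
        then show "((\<lambda>b. Dm (a, b) (v, 0)) has_derivative H v (a, x)) (at x within S)"
          by (rule has_derivative_at_withinI)
        show "onorm (H v (a, x)) \<le> C" using C x that by (intro onorm_bound) auto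
      qed
      then show ?thesis using Dm_base_right[OF S_U[OF that(1)]] by simp
    qed
    then show ?thesis by blast
  qed
  \<comment> \<open>For \<open>snd p = base\<close> the factor 1 / 0 is 0, so \<open>T p\<close> is
    the zero map there and the bound is trivial.\<close>
  define T where "T p v = (1 / norm (snd p - base)) *\<^sub>R (Dm p (v, 0) - v)" for p :: "'e \<times> 'e" and v
  have linT: "linear (T p)" if "p \<in> S \<times> S" for p
  proof -
    have L: "linear (Dm p)" using Dm_linear S(2) that by blast
    show ?thesis unfolding T_def
    proof (rule linearI)
      show "(1 / norm (snd p - base)) *\<^sub>R (Dm p (x + y, 0) - (x + y)) =
        (1 / norm (snd p - base)) *\<^sub>R (Dm p (x, 0) - x) + (1 / norm (snd p - base)) *\<^sub>R (Dm p (y, 0) - y)" for x y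
        using linear_add[OF L, of "(x, 0)" "(y, 0)"] by (simp add: scaleR_add_right[symmetric])
      show "(1 / norm (snd p - base)) *\<^sub>R (Dm p (s *\<^sub>R x, 0) - s *\<^sub>R x) =
        s *\<^sub>R (1 / norm (snd p - base)) *\<^sub>R (Dm p (x, 0) - x)" for s x
        using linear_cmul[OF L, of s "(x, 0)"] by (simp add: algebra_simps)
    qed
  qed
  have bndT: "\<exists>C. \<forall>p\<in>S \<times> S. norm (T p v) \<le> C" for v
  proof -
    obtain C where C: "\<forall>a\<in>S. \<forall>b\<in>S. norm (Dm (a, b) (v, 0) - v) \<le> C * norm (b - base)"
      using step1 by blast
    have "norm (T p v) \<le> \<bar>C\<bar>" if "p \<in> S \<times> S" for p
    proof (cases "snd p = base")
      case False
      have "norm (Dm p (v, 0) - v) \<le> C * norm (snd p - base)" using C that by auto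
      also have "\<dots> \<le> \<bar>C\<bar> * norm (snd p - base)" by (intro mult_right_mono) auto
      finally have "norm (Dm p (v, 0) - v) / norm (snd p - base) \<le> \<bar>C\<bar>"
        using False by (simp add: pos_divide_le_eq)
      then show ?thesis unfolding T_def norm_scaleR by simp
    qed (simp add: T_def)
    then show ?thesis by blast
  qed
  obtain C where C: "C \<ge> 0" "\<And>p v. p \<in> S \<times> S \<Longrightarrow> norm (T p v) \<le> C * norm v"
    using pointwise_bounded_linear_family[OF finite_dimensional, of "S \<times> S" T] linT bndT by metis
  have step2: "norm (Dm (a, b) (v, 0) - v) \<le> C * norm (b - base) * norm v" if "a \<in> S" "b \<in> S" for a b v
  proof (cases "b = base")
    case True
    then show ?thesis using Dm_base_right[OF S_U[OF that(1)]] by simp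
  next
    case False
    have "norm (Dm (a, b) (v, 0) - v) / norm (b - base) \<le> C * norm v"
      using C(2)[of "(a, b)" v] that unfolding T_def norm_scaleR by simp
    then show ?thesis using False by (simp add: pos_divide_le_eq mult.commute mult.left_commute)
  qed
  have "norm (mult_chart (a, b) - mult_chart (a', b) - (a - a')) \<le> C * norm (b - base) * norm (a - a')"
    if "a \<in> S" "a' \<in> S" "b \<in> S" for a a' b
  proof -
    have "norm ((mult_chart (a, b) - a) - (mult_chart (a', b) - a')) \<le> C * norm (b - base) * norm (a - a')"
    proof (rule differentiable_bound[OF conv _ _ that(1,2), of "\<lambda>a. mult_chart (a, b) - a" "\<lambda>a v. Dm (a, b) (v, 0) - v"])
      fix x assume x: "x \<in> S"
      have "((\<lambda>x. (x, b)) has_derivative (\<lambda>w. (w, 0))) (at x)"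
        by (auto intro!: derivative_eq_intros)
      from has_derivative_compose[OF this Dm_has_derivative] S(2) x that
      have "((\<lambda>a. mult_chart (a, b)) has_derivative (\<lambda>v. Dm (x, b) (v, 0))) (at x)" by blast
      then have "((\<lambda>a. mult_chart (a, b) - a) has_derivative (\<lambda>v. Dm (x, b) (v, 0) - v)) (at x)"
        by (rule has_derivative_diff[OF _ has_derivative_ident])
      then show "((\<lambda>a. mult_chart (a, b) - a) has_derivative (\<lambda>v. Dm (x, b) (v, 0) - v)) (at x within S)"
        by (rule has_derivative_at_withinI)
      show "onorm (\<lambda>v. Dm (x, b) (v, 0) - v) \<le> C * norm (b - base)"
        using step2 x that C(1) by (intro onorm_bound) auto
    qed
    then show ?thesis by (simp add: algebra_simps)
  qed
  with C(1) show thesis using that by blast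
qed

definition mult_ball :: "'e set \<Rightarrow> real \<Rightarrow> real \<Rightarrow> bool" where
  "mult_ball S r C \<longleftrightarrow> r > 0 \<and> S = cball base r \<and> S \<times> S \<subseteq> mult_dom \<and> C \<ge> 0 \<and>
    (\<forall>a\<in>S. \<forall>a'\<in>S. \<forall>b\<in>S.
      norm (mult_chart (a, b) - mult_chart (a', b) - (a - a')) \<le> C * norm (b - base) * norm (a - a'))"

lemma mult_ballD:
  assumes "mult_ball S r C"
  shows "r > 0" "S = cball base r" "S \<times> S \<subseteq> mult_dom" "C \<ge> 0"
    "\<And>a a' b. a \<in> S \<Longrightarrow> a' \<in> S \<Longrightarrow> b \<in> S \<Longrightarrow>
      norm (mult_chart (a, b) - mult_chart (a', b) - (a - a')) \<le> C * norm (b - base) * norm (a - a')"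
  using assms unfolding mult_ball_def by blast+

lemma mult_ball_exists: "\<exists>S r C. mult_ball S r C"
proof -
  obtain r where r: "r > 0" "cball (base, base) r \<subseteq> mult_dom"
    using open_contains_cball open_mult_dom base_base by blast
  \<comment> \<open>Half the radius, since a distance in the product is at most the sum of the
    distances of the components.\<close>
  define S where "S = cball base (r / 2)"
  have SS: "S \<times> S \<subseteq> mult_dom"
  proof clarify
    fix a b assume ab: "a \<in> S" "b \<in> S"
    have "dist (base, base) (a, b) \<le> dist base a + dist base b"
      unfolding dist_prod_def by (simp add: sqrt_sum_squares_le_sum)
    also have "\<dots> \<le> r" using ab by (simp add: S_def)
    finally show "(a, b) \<in> mult_dom" using r(2) by auto
  qed
  obtain C where "C \<ge> 0"
    "\<And>a a' b. a \<in> S \<Longrightarrow> a' \<in> S \<Longrightarrow> b \<in> S \<Longrightarrow>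
      norm (mult_chart (a, b) - mult_chart (a', b) - (a - a')) \<le> C * norm (b - base) * norm (a - a')"
    using mult_chart_increment_left[OF S_def SS] by blast
  then have "mult_ball S (r / 2) C" using r(1) S_def SS by (auto simp: mult_ball_def)
  then show ?thesis by blast
qed

end

section \<open>Recognising one-parameter subgroups\<close>

text \<open>For t \<ge> 0 the value has to be \<open>\<delta> (t / n) [^] n\<close> for any n with t
  / n \<le> e; two choices of n agree because each agrees with their product. Negative times are
  reached as differences of nonnegative ones, which is consistent because the values
  commute.\<close>

lemma (in group) extend_local_one_param:
  fixes \<delta> :: "real \<Rightarrow> 'a" and e :: real
  assumes K: "subgroup K G" and e: "e > 0"
    and \<delta>: "\<And>t. 0 \<le> t \<Longrightarrow> t \<le> e \<Longrightarrow> \<delta> t \<in> K"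
    and add: "\<And>s t. 0 \<le> s \<Longrightarrow> 0 \<le> t \<Longrightarrow> s + t \<le> e \<Longrightarrow> \<delta> (s + t) = \<delta> s \<otimes> \<delta> t"
  obtains \<gamma> where "\<And>s t. \<gamma> (s + t) = \<gamma> s \<otimes> \<gamma> t" "\<And>t. \<gamma> t \<in> K"
    "\<And>t. 0 \<le> t \<Longrightarrow> t \<le> e \<Longrightarrow> \<gamma> t = \<delta> t"
proof -
  have KG: "\<And>x. x \<in> K \<Longrightarrow> x \<in> carrier G" using subgroup.mem_carrier[OF K] .
  note car = KG[OF \<delta>]
  have powK: "x [^] n \<in> K" if "x \<in> K" for x and n :: nat
    using that by (induction n) (auto intro: subgroup.m_closed[OF K] subgroup.one_closed[OF K])
  have zero: "\<delta> 0 = \<one>"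
  proof -
    have "\<delta> 0 \<otimes> \<delta> 0 = \<delta> 0" using add[of 0 0] e by simp
    then show ?thesis using car[of 0] e l_cancel_one' by (metis less_eq_real_def)
  qed
  have pow: "\<delta> (real m * u) = \<delta> u [^] m" if "0 \<le> u" "real m * u \<le> e" for m u
    using that
  proof (induction m)
    case (Suc m)
    have "real m * u \<le> real (Suc m) * u" using Suc.prems(1) by (intro mult_right_mono) auto
    then have le: "real m * u \<le> e" using Suc.prems by linarith
    have "\<delta> (real (Suc m) * u) = \<delta> (real m * u + u)" by (simp add: algebra_simps)
    also have "\<dots> = \<delta> (real m * u) \<otimes> \<delta> u"
      using Suc.prems by (intro add) (auto simp: algebra_simps)
    finally show ?case using Suc.IH[OF Suc.prems(1) le] by simp
  qed (simp add: zero)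
  \<comment> \<open>Some n with t / n \<le> e; the successor keeps it positive at t = 0 too.\<close>
  define N where "N t = Suc (nat \<lceil>t / e\<rceil>)" for t
  define p where "p t = \<delta> (t / N t) [^] N t" for t
  have N: "t / N t \<le> e" "N t > 0" if "0 \<le> t" for t
  proof -
    show "N t > 0" by (simp add: N_def)
    have "t / e \<le> real (nat \<lceil>t / e\<rceil>)" by (simp add: real_nat_ceiling_ge)
    also have "\<dots> \<le> N t" by (simp add: N_def)
    finally have "t \<le> N t * e" using e by (simp add: pos_divide_le_eq)
    then show "t / N t \<le> e" using \<open>N t > 0\<close> by (simp add: pos_divide_le_eq mult.commute)
  qed
  have div_small: "0 \<le> t / (real k * real l)" "t / (real k * real l) \<le> e" "real l * (t / (real k * real l)) = t / real k"
    if "0 \<le> t" "t / real k \<le> e" "k > 0" "l > 0" for t k l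
  proof -
    show "0 \<le> t / (real k * real l)" using that by simp
    show eq: "real l * (t / (real k * real l)) = t / real k" using that by simp
    have "t / (real k * real l) \<le> t / real k"
      using that by (intro divide_left_mono) (auto simp: mult_le_cancel_left1)
    then show "t / (real k * real l) \<le> e" using that by linarith
  qed
  have refine: "\<delta> (t / real k) [^] k = \<delta> (t / (real k * real l)) [^] (k * l)"
    if "0 \<le> t" "t / real k \<le> e" "k > 0" "l > 0" for t k l
  proof -
    note ds = div_small[OF that]
    have "\<delta> (t / real k) = \<delta> (t / (real k * real l)) [^] l"
      using pow[of "t / (real k * real l)" l] ds that by simp
    then show ?thesis using car[OF ds(1,2)] by (simp add: nat_pow_pow mult.commute)
  qed
  have p_eq: "\<delta> (t / real k) [^] k = p t" if "0 \<le> t" "t / real k \<le> e" "k > 0" for t k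
    using refine[OF that N(2)[OF that(1)]] refine[OF that(1) N[OF that(1)] that(3)]
    unfolding p_def by (simp add: mult.commute)
  have pK: "p t \<in> K" if "0 \<le> t" for t
    unfolding p_def using \<delta>[of "t / N t"] N[OF that] that by (intro powK) auto
  note pc = KG[OF pK]
  have p_add: "p (s + t) = p s \<otimes> p t" if st: "0 \<le> s" "0 \<le> t" for s t
  proof -
    let ?n = "N (s + t)"
    have n: "(s + t) / ?n \<le> e" "?n > 0" using N[of "s + t"] st by auto
    have "s / ?n \<le> (s + t) / ?n" "t / ?n \<le> (s + t) / ?n" using st by (auto intro!: divide_right_mono)
    then have le: "s / ?n \<le> e" "t / ?n \<le> e" "0 \<le> s / ?n" "0 \<le> t / ?n" using n st by auto
    have eq: "(s + t) / ?n = s / ?n + t / ?n" by (rule add_divide_distrib)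
    have sum: "\<delta> (s / ?n + t / ?n) = \<delta> (s / ?n) \<otimes> \<delta> (t / ?n)"
      "\<delta> (t / ?n + s / ?n) = \<delta> (t / ?n) \<otimes> \<delta> (s / ?n)"
      using add[OF le(3,4)] add[OF le(4,3)] n(1) eq by (auto simp: add.commute)
    have "p (s + t) = (\<delta> (s / ?n) \<otimes> \<delta> (t / ?n)) [^] ?n"
      unfolding p_def eq sum(1) ..
    also have "\<dots> = \<delta> (s / ?n) [^] ?n \<otimes> \<delta> (t / ?n) [^] ?n"
      using sum le car by (intro pow_mult_distrib) (auto simp: add.commute)
    finally show ?thesis using p_eq[OF st(1) le(1) n(2)] p_eq[OF st(2) le(2) n(2)] by simp
  qed
  have p_comm: "p s \<otimes> p t = p t \<otimes> p s" if "0 \<le> s" "0 \<le> t" for s t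
    using p_add[OF that] p_add[OF that(2,1)] by (simp add: add.commute)
  \<comment> \<open>Extension from the half-line by differences. The particular choice of positive
    and negative part is immaterial by \<open>\<gamma>_eq\<close>, which is what makes additivity
    easy.\<close>
  define \<gamma> where "\<gamma> t = p (max t 0) \<otimes> inv (p (max (- t) 0))" for t
  have \<gamma>_eq: "\<gamma> (a - b) = p a \<otimes> inv (p b)" if "0 \<le> a" "0 \<le> b" for a b
  proof -
    define a' b' d where "a' = max (a - b) 0" and "b' = max (- (a - b)) 0" and "d = min a b"
    have ab: "a = a' + d" "b = b' + d" "0 \<le> a'" "0 \<le> b'" "0 \<le> d"
      using that by (auto simp: a'_def b'_def d_def)
    have "p a \<otimes> inv (p b) = p a' \<otimes> p d \<otimes> (inv (p d) \<otimes> inv (p b'))"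
      using ab pc by (simp add: p_add inv_mult_group)
    also have "\<dots> = p a' \<otimes> (p d \<otimes> inv (p d) \<otimes> inv (p b'))"
      using pc[OF ab(3)] pc[OF ab(4)] pc[OF ab(5)] by (simp only: m_assoc m_closed inv_closed)
    also have "\<dots> = p a' \<otimes> inv (p b')" using ab pc by simp
    finally show ?thesis by (simp add: \<gamma>_def a'_def b'_def)
  qed
  have \<gamma>_add: "\<gamma> (s + t) = \<gamma> s \<otimes> \<gamma> t" for s t
  proof -
    define a b a' b' where "a = max s 0" and "b = max (- s) 0" and "a' = max t 0" and "b' = max (- t) 0"
    have ab: "s = a - b" "t = a' - b'" "0 \<le> a" "0 \<le> b" "0 \<le> a'" "0 \<le> b'"
      by (auto simp: a_def b_def a'_def b'_def)
    note c = pc[OF ab(3)] pc[OF ab(4)] pc[OF ab(5)] pc[OF ab(6)]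
    have comm: "p a' \<otimes> inv (p b) = inv (p b) \<otimes> p a'"
    proof -
      have "inv (p b) \<otimes> (p b \<otimes> p a') \<otimes> inv (p b) = inv (p b) \<otimes> (p a' \<otimes> p b) \<otimes> inv (p b)"
        using p_comm[OF ab(4,5)] by simp
      then show ?thesis using c by (simp add: m_assoc inv_solve_left) (simp add: m_assoc[symmetric])
    qed
    have st: "s + t = (a + a') - (b' + b)" using ab by simp
    have "\<gamma> (s + t) = p a \<otimes> p a' \<otimes> (inv (p b) \<otimes> inv (p b'))"
      unfolding st using \<gamma>_eq[of "a + a'" "b' + b"] ab(3-6) c by (simp add: p_add inv_mult_group)
    also have "\<dots> = p a \<otimes> (p a' \<otimes> inv (p b)) \<otimes> inv (p b')" using c by (simp add: m_assoc)
    also have "\<dots> = (p a \<otimes> inv (p b)) \<otimes> (p a' \<otimes> inv (p b'))" unfolding comm using c by (simp add: m_assoc)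
    finally show ?thesis using \<gamma>_eq[of a b] \<gamma>_eq[of a' b'] ab by simp
  qed
  have p0: "p 0 = \<one>" unfolding p_def by (simp add: zero)
  have "\<gamma> t \<in> K" for t
    unfolding \<gamma>_def using pK by (intro subgroup.m_closed[OF K] subgroup.m_inv_closed[OF K]) auto
  moreover have "\<gamma> t = \<delta> t" if "0 \<le> t" "t \<le> e" for t
  proof -
    have "p t = \<delta> t" using p_eq[of t 1] that car[OF that] by simp
    then show ?thesis using \<gamma>_eq[of t 0] that car[OF that] by (simp add: p0)
  qed
  ultimately show thesis using that \<gamma>_add by blast
qed

context lie_chart
begin

text \<open>Multiplying by one more \<open>k\<close> on the left adds the coordinates of
  \<open>k\<close> up to an error of at most \<open>2 * C * A\<^sup>2 * (j * s) * s\<close>. The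
  linear bound keeps the powers in the ball \<open>S\<close>, where this estimate is valid; its
  factor 2 suffices because e is so small that each error is at most \<open>A * s\<close>. The
  errors add up to the quadratic bound.\<close>

lemma power_in_chart:
  fixes s e A C :: real and j :: nat
  assumes ball: "mult_ball S r C"
    and e: "0 < e" "2 * A * e \<le> r" "2 * C * A * e \<le> 1"
    and k: "k \<in> U" "norm (\<phi> k - base) \<le> A * s" and s: "0 < s" "s \<le> e" and A: "A \<ge> 0"
  shows "real j * s \<le> e \<Longrightarrow> k [^] j \<in> U \<and> norm (\<phi> (k [^] j) - base) \<le> 2 * A * (j * s) \<and>
    norm (\<phi> (k [^] j) - base - real j *\<^sub>R (\<phi> k - base)) \<le> 2 * C * A\<^sup>2 * (j * s)\<^sup>2"
proof (induction j)
  case 0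
  then show ?case using one_in by (simp add: base_def)
next
  case (Suc j)
  note S = mult_ballD(2,3)[OF ball] and C = mult_ballD(4,5)[OF ball]
  let ?x = "\<phi> k" and ?y = "\<phi> (k [^] j)"
  have js: "real j * s \<le> e" "real j * s \<ge> 0" using Suc.prems s by (auto simp: algebra_simps)
  note IH = Suc.IH[OF js(1)]
  have "2 * A * (real j * s) \<le> 2 * A * e" "A * s \<le> A * e" using js s A by (auto intro!: mult_left_mono)
  moreover have "0 \<le> A * e" using A e by simp
  ultimately have ys: "?y \<in> S" "?x \<in> S" "base \<in> S"
    using IH k e unfolding S by (auto simp: dist_norm norm_minus_commute)
  then have dom: "(?x, ?y) \<in> mult_dom" "(base, ?y) \<in> mult_dom" using S by auto
  have kc: "k \<in> carrier G" using U_carrier[OF k(1)] .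
  have prod: "k [^] Suc j = k \<otimes> k [^] j" by (rule nat_pow_Suc2[OF kc])
  have in_U: "k [^] Suc j \<in> U"
    using dom(1) IH k unfolding prod by (simp add: mult_dom_iff psi_simps(1))
  have y': "\<phi> (k [^] Suc j) = mult_chart (?x, ?y)"
    unfolding prod mult_chart_def using IH k by (simp add: psi_simps(1))
  have "mult_chart (base, ?y) = ?y" using IH by (intro mult_chart_base) auto
  then have "norm (\<phi> (k [^] Suc j) - ?y - (?x - base)) \<le> C * norm (?y - base) * norm (?x - base)"
    using C(2)[OF ys(2,3,1)] unfolding y' by simp
  also have "\<dots> \<le> C * (2 * A * (j * s)) * (A * s)"
    using IH k C(1) A js s by (intro mult_mono mult_nonneg_nonneg) auto
  finally have inc: "norm (\<phi> (k [^] Suc j) - ?y - (?x - base)) \<le> 2 * C * A\<^sup>2 * (j * s) * s"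
    by (simp add: power2_eq_square algebra_simps)
  have "2 * C * A\<^sup>2 * (j * s) * s = (2 * C * A * (j * s)) * (A * s)"
    by (simp add: power2_eq_square algebra_simps)
  also have "\<dots> \<le> 1 * (A * s)"
  proof (rule mult_right_mono)
    have "2 * C * A * (j * s) \<le> 2 * C * A * e" using js C(1) A by (intro mult_left_mono) auto
    then show "2 * C * A * (j * s) \<le> 1" using e by linarith
  qed (use A s in simp)
  finally have inc': "2 * C * A\<^sup>2 * (j * s) * s \<le> A * s" by simp
  have "\<phi> (k [^] Suc j) - base = (\<phi> (k [^] Suc j) - ?y - (?x - base)) + (?y - base) + (?x - base)" by simp
  then have "norm (\<phi> (k [^] Suc j) - base) \<le> norm (\<phi> (k [^] Suc j) - ?y - (?x - base)) + norm (?y - base) + norm (?x - base)"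
    by (metis norm_triangle_ineq norm_triangle_mono order_refl)
  then have b1: "norm (\<phi> (k [^] Suc j) - base) \<le> 2 * A * (Suc j * s)"
    using inc inc' IH k by (simp add: algebra_simps)
  have "\<phi> (k [^] Suc j) - base - real (Suc j) *\<^sub>R (?x - base) =
      (\<phi> (k [^] Suc j) - ?y - (?x - base)) + (?y - base - real j *\<^sub>R (?x - base))"
    by (simp add: algebra_simps)
  then have "norm (\<phi> (k [^] Suc j) - base - real (Suc j) *\<^sub>R (?x - base)) \<le>
      norm (\<phi> (k [^] Suc j) - ?y - (?x - base)) + norm (?y - base - real j *\<^sub>R (?x - base))"
    by (metis norm_triangle_ineq)
  also have "\<dots> \<le> 2 * C * A\<^sup>2 * (j * s) * s + 2 * C * A\<^sup>2 * (j * s)\<^sup>2"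
    using inc IH by linarith
  also have "\<dots> = 2 * C * A\<^sup>2 * ((j * s) * s + (j * s)\<^sup>2)" by (simp add: algebra_simps)
  also have "\<dots> \<le> 2 * C * A\<^sup>2 * (Suc j * s)\<^sup>2"
    using s C(1) js A by (intro mult_left_mono) (auto simp: power2_eq_square algebra_simps)
  finally show ?case using in_U b1 by blast
qed

text \<open>Continuity is a conclusion here: the one-sided bound yields it at 0, and the
  homomorphism property carries it to every t. The derivative from the left comes from inverses,
  whose coordinates relative to the base point are the negatives up to a quadratic error.\<close>

lemma one_paramI:
  assumes hom: "\<And>s t. \<gamma> (s + t) = \<gamma> s \<otimes> \<gamma> t" and car: "\<And>t. \<gamma> t \<in> carrier G"
    and e: "e > 0" and U: "\<And>t. 0 \<le> t \<Longrightarrow> t \<le> e \<Longrightarrow> \<gamma> t \<in> U"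
    and bnd: "\<And>t. 0 \<le> t \<Longrightarrow> t \<le> e \<Longrightarrow> norm (\<phi> (\<gamma> t) - base - t *\<^sub>R Z) \<le> M * t\<^sup>2"
  shows "one_param_subgroup G (U, \<phi>) Z \<gamma>"
proof -
  have "\<gamma> 0 \<otimes> \<gamma> 0 = \<gamma> 0" using hom[of 0 0] by simp
  then have zero: "\<gamma> 0 = \<one>" using car[of 0] l_cancel_one' by metis
  have minus: "\<gamma> (- t) = inv (\<gamma> t)" for t
    using hom[of "- t" t] zero car inv_equality by (metis add.left_inverse)
  define L where "L = norm Z + \<bar>M\<bar> * e"
  have L0: "L \<ge> 0" using e by (simp add: L_def)
  have lip: "norm (\<phi> (\<gamma> t) - base) \<le> L * t" if "0 \<le> t" "t \<le> e" for t
  proof -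
    have "norm (\<phi> (\<gamma> t) - base) \<le> norm (\<phi> (\<gamma> t) - base - t *\<^sub>R Z) + norm (t *\<^sub>R Z)"
      using norm_triangle_ineq[of "\<phi> (\<gamma> t) - base - t *\<^sub>R Z" "t *\<^sub>R Z"] by simp
    also have "\<dots> \<le> \<bar>M\<bar> * t\<^sup>2 + t * norm Z"
      using bnd[OF that] that by (auto intro!: add_mono order_trans[OF _ mult_right_mono[OF abs_ge_self]])
    also have "\<bar>M\<bar> * t\<^sup>2 \<le> \<bar>M\<bar> * (e * t)"
      using that by (intro mult_left_mono) (auto simp: power2_eq_square intro: mult_right_mono)
    finally show ?thesis by (simp add: L_def algebra_simps)
  qed
  have near: "\<exists>d>0. \<forall>t. \<bar>t\<bar> < d \<longrightarrow> \<gamma> t \<in> V" if V: "openin (topo G) V" "\<one> \<in> V" for V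
  proof -
    \<comment> \<open>Points whose inverse lies in \<open>V\<close> as well, so that the estimate
      for small t \<ge> 0 also settles -t.\<close>
    let ?V = "V \<inter> {x \<in> topspace (topo G). inv x \<in> V}"
    have V': "openin (topo G) ?V" by (intro openin_Int V openin_continuous_map_preimage[OF inv_continuous])
    have "open (\<phi> ` (?V \<inter> U))" by (rule open_chart_image[OF chart V'])
    moreover have "base \<in> \<phi> ` (?V \<inter> U)" using V(2) one_in by (auto simp: base_def topspace_eq)
    ultimately obtain r where r: "r > 0" "ball base r \<subseteq> \<phi> ` (?V \<inter> U)" using openE by blast
    define d where "d = min e (r / (L + 1))"
    have d: "d > 0" using e r(1) L0 by (simp add: d_def)
    have pos: "\<gamma> t \<in> ?V" if t: "0 \<le> t" "t < d" for t
    proof -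
      have te: "t \<le> e" using t by (simp add: d_def)
      have "t * (L + 1) < r" using t L0 by (simp add: d_def pos_less_divide_eq)
      then have "L * t < r" using t by (simp add: algebra_simps)
      then have "\<phi> (\<gamma> t) \<in> ball base r" using lip[OF t(1) te] by (simp add: dist_norm norm_minus_commute)
      then have "\<phi> (\<gamma> t) \<in> \<phi> ` (?V \<inter> U)" using r(2) by blast
      then show ?thesis using U[OF t(1) te] chart_facts(4)[OF chart] by (auto dest: inj_onD)
    qed
    have "\<gamma> t \<in> V" if "\<bar>t\<bar> < d" for t
    proof (cases "t \<ge> 0")
      case True then show ?thesis using pos[of t] that by auto
    next
      case False
      then have "\<gamma> (- t) \<in> ?V" using that by (intro pos) auto
      then show ?thesis using minus[of "- t"] by auto
    qed
    with d show ?thesis by blast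
  qed
  have cont: "continuous_map euclideanreal (topo G) \<gamma>"
    unfolding continuous_map_def
  proof (intro conjI allI impI)
    show "\<gamma> \<in> topspace euclideanreal \<rightarrow> topspace (topo G)" using car by (simp add: topspace_eq)
    fix O' assume O': "openin (topo G) O'"
    have "open {t. \<gamma> t \<in> O'}"
      unfolding open_dist
    proof safe
      fix t assume t: "\<gamma> t \<in> O'"
      have "openin (topo G) {x \<in> topspace (topo G). \<gamma> t \<otimes> x \<in> O'}"
        by (rule openin_continuous_map_preimage[OF continuous_translations(1)[OF car car] O'])
      moreover have "\<one> \<in> {x \<in> topspace (topo G). \<gamma> t \<otimes> x \<in> O'}" using t car by (simp add: topspace_eq)
      ultimately have "\<exists>d>0. \<forall>u. \<bar>u\<bar> < d \<longrightarrow> \<gamma> u \<in> {x \<in> topspace (topo G). \<gamma> t \<otimes> x \<in> O'}"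
        by (rule near)
      then obtain d where d: "d > 0" "\<And>u. \<bar>u\<bar> < d \<Longrightarrow> \<gamma> t \<otimes> \<gamma> u \<in> O'"
        by auto
      have "\<gamma> u \<in> O'" if "dist u t < d" for u
        using d(2)[of "u - t"] hom[of t "u - t"] that by (simp add: dist_real_def)
      then show "\<exists>d>0. \<forall>u. dist u t < d \<longrightarrow> u \<in> {t. \<gamma> t \<in> O'}" using d(1) by blast
    qed
    then show "openin euclideanreal {x \<in> topspace euclideanreal. \<gamma> x \<in> O'}" by simp
  qed
  obtain S r C where ball: "mult_ball S r C" using mult_ball_exists by blast
  note r = mult_ballD(1)[OF ball] and S = mult_ballD(2,3)[OF ball] and C = mult_ballD(4,5)[OF ball]
  have PS: "openin (topo G) {x \<in> U. \<phi> x \<in> ball base r}"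
    by (rule openin_chart_preimage[OF chart open_ball])
  have "\<one> \<in> {x \<in> U. \<phi> x \<in> ball base r}" using one_in r by (simp add: base_def)
  from near[OF PS this] obtain d where d: "d > 0" "\<And>t. \<bar>t\<bar> < d \<Longrightarrow> \<gamma> t \<in> {x \<in> U. \<phi> x \<in> ball base r}"
    by blast
  then have d: "d > 0" "\<And>t. \<bar>t\<bar> < d \<Longrightarrow> \<gamma> t \<in> U \<and> \<phi> (\<gamma> t) \<in> S"
    by (auto simp: S(1) less_imp_le)
  \<comment> \<open>The last bound makes C L u at most 1/2 for u = -t, so that the error in the
    product can be absorbed when the coordinates of the inverse are estimated.\<close>
  define d' where "d' = min (min d e) (1 / (2 * (C * L + 1)))"
  have CL: "C * L \<ge> 0" using C(1) L0 by simp
  have d': "d' > 0" using d(1) e CL by (simp add: d'_def)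
  have "norm (\<phi> (\<gamma> t) - \<phi> (\<gamma> 0) - t *\<^sub>R Z) \<le> (\<bar>M\<bar> + 2 * C * L\<^sup>2) * t\<^sup>2" if t: "\<bar>t\<bar> < d'" for t
  proof (cases "t \<ge> 0")
    case True
    then have "norm (\<phi> (\<gamma> t) - base - t *\<^sub>R Z) \<le> M * t\<^sup>2"
      using bnd[of t] t by (simp add: d'_def)
    also have "\<dots> \<le> (\<bar>M\<bar> + 2 * C * L\<^sup>2) * t\<^sup>2"
    proof (rule mult_right_mono)
      have "0 \<le> 2 * C * L\<^sup>2" using C(1) by simp
      then show "M \<le> \<bar>M\<bar> + 2 * C * L\<^sup>2" by linarith
    qed simp
    finally show ?thesis by (simp add: zero base_def)
  next
    case False
    define u where "u = - t"
    have u: "0 \<le> u" "u \<le> e" "\<bar>u\<bar> < d" "\<bar>- u\<bar> < d" "u * (2 * (C * L + 1)) < 1"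
      using t False CL by (auto simp: u_def d'_def pos_less_divide_eq)
    let ?F = "\<phi> (\<gamma> u)" and ?b = "\<phi> (\<gamma> (- u))"
    note uU = d(2)[OF u(3)] d(2)[OF u(4)]
    have bS: "base \<in> S" using r by (simp add: S(1))
    \<comment> \<open>The increment estimate is applied with second factor \<open>?b\<close> and
      first factors \<open>?F\<close> and \<open>base\<close>, where both products are
      known.\<close>
    have "mult_chart (?F, ?b) = base"
      unfolding mult_chart_def using uU car[of u] by (simp add: psi_simps(1) minus base_def)
    moreover have "mult_chart (base, ?b) = ?b" using uU by (intro mult_chart_base) auto
    ultimately have "norm (base - ?b - (?F - base)) \<le> C * norm (?b - base) * norm (?F - base)"
      using C(2)[of ?F base ?b] uU bS by simp
    also have "base - ?b - (?F - base) = - ((?b - base) + (?F - base))" by simp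
    finally have 1: "norm ((?b - base) + (?F - base)) \<le> C * norm (?b - base) * norm (?F - base)"
      by (simp only: norm_minus_cancel)
    have F: "norm (?F - base) \<le> L * u" by (rule lip[OF u(1,2)])
    have "C * norm (?F - base) \<le> C * (L * u)" using F C(1) by (intro mult_left_mono) auto
    also have "\<dots> \<le> 1 / 2" using u(1,5) by (simp add: algebra_simps)
    finally have "C * norm (?F - base) * norm (?b - base) \<le> 1 / 2 * norm (?b - base)"
      by (rule mult_right_mono) simp
    moreover have "norm (?b - base) \<le> norm ((?b - base) + (?F - base)) + norm (?F - base)"
      using norm_triangle_ineq4[of "(?b - base) + (?F - base)" "?F - base"] by simp
    ultimately have b: "norm (?b - base) \<le> 2 * norm (?F - base)" using 1 by (simp add: algebra_simps)
    have "C * norm (?b - base) * norm (?F - base) \<le> C * (2 * (L * u)) * (L * u)"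
      using C(1) b F L0 u(1) by (intro mult_mono mult_nonneg_nonneg) auto
    then have 2: "norm ((?b - base) + (?F - base)) \<le> 2 * C * L\<^sup>2 * u\<^sup>2"
      using 1 by (simp add: power2_eq_square algebra_simps)
    have "?b - base - (- u) *\<^sub>R Z = ((?b - base) + (?F - base)) - (?F - base - u *\<^sub>R Z)" by (simp add: algebra_simps)
    then have "norm (?b - base - (- u) *\<^sub>R Z) \<le> norm ((?b - base) + (?F - base)) + norm (?F - base - u *\<^sub>R Z)"
      by (metis norm_triangle_ineq4)
    also have "\<dots> \<le> 2 * C * L\<^sup>2 * u\<^sup>2 + \<bar>M\<bar> * u\<^sup>2"
      using 2 bnd[OF u(1,2)] by (intro add_mono) (auto intro: order_trans[OF _ mult_right_mono[OF abs_ge_self]])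
    finally show ?thesis by (simp add: u_def zero base_def algebra_simps)
  qed
  from has_vector_derivative_quadratic_bound[OF d' this]
  show ?thesis using cont hom by (simp add: one_param_subgroup_def)
qed

end

section \<open>Limits of discrete one-parameter subgroups\<close>

text \<open>It will be applied to functions from the reals into a compact ball, with pointwise
  convergence, where a sequence need not have a convergent subsequence. A cluster point and a filter
  finer than \<open>sequentially\<close> take its place.\<close>

lemma convergent_subfilter:
  fixes F :: "nat \<Rightarrow> 'a::topological_space"
  assumes S: "compact S" and F: "eventually (\<lambda>n. F n \<in> S) sequentially"
  obtains x N where "x \<in> S" "N \<le> sequentially" "N \<noteq> bot" "(F \<longlongrightarrow> x) N"
proof -
  have "filtermap F sequentially \<noteq> bot" by (simp add: filtermap_bot_iff)
  moreover have "eventually (\<lambda>x. x \<in> S) (filtermap F sequentially)"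
    using F by (simp add: eventually_filtermap)
  ultimately obtain x where x: "x \<in> S" "inf (nhds x) (filtermap F sequentially) \<noteq> bot"
    using S unfolding compact_filter by blast
  let ?N = "inf sequentially (filtercomap F (nhds x))"
  have "?N \<noteq> bot"
  proof
    assume "?N = bot"
    then have "eventually (\<lambda>_. False) ?N" by simp
    then obtain P Q where PQ: "eventually P sequentially" "eventually Q (filtercomap F (nhds x))"
      "\<And>n. P n \<Longrightarrow> Q n \<Longrightarrow> False"
      unfolding eventually_inf by blast
    obtain R where R: "eventually R (nhds x)" "\<And>n. R (F n) \<Longrightarrow> Q n"
      using PQ(2) unfolding eventually_filtercomap by blast
    have "eventually (\<lambda>y. \<exists>n. P n \<and> y = F n) (filtermap F sequentially)"
      unfolding eventually_filtermap using PQ(1) by (rule eventually_mono) blast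
    then have "eventually (\<lambda>_. False) (inf (nhds x) (filtermap F sequentially))"
      unfolding eventually_inf using R PQ(3) by blast
    with x(2) show False by (simp add: trivial_limit_def[symmetric] eventually_False)
  qed
  moreover have "(F \<longlongrightarrow> x) ?N"
    unfolding filterlim_def using filtermap_filtercomap[of F "nhds x"]
    by (metis filtermap_mono inf_le2 order_trans)
  ultimately show thesis using that[of x ?N] x(1) by simp
qed

lemma compact_functions:
  assumes "compact (S :: 'b::topological_space set)"
  shows "compact {f :: 'a \<Rightarrow> 'b. \<forall>x. f x \<in> S}"
proof -
  have "compactin (product_topology (\<lambda>_. euclidean) UNIV) (PiE UNIV (\<lambda>_::'a. S))"
    unfolding compactin_PiE using assms by auto
  moreover have "PiE UNIV (\<lambda>_::'a. S) = {f. \<forall>x. f x \<in> S}" by auto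
  ultimately show ?thesis by (simp add: euclidean_product_topology)
qed

lemma tendsto_apply:
  fixes x :: 'a
  assumes "(F \<longlongrightarrow> f) N"
  shows "((\<lambda>n. F n x) \<longlongrightarrow> f x) N"
  by (rule continuous_on_tendsto_compose[OF continuous_on_product_coordinates[of x] assms]) auto

context lie_chart
begin

text \<open>The core of the closed subgroup theorem: the powers of \<open>k n\<close> with exponent
  about t / s n lie in \<open>K\<close> and approximate exp (t Z). A pointwise limit on [0, e]
  exists by compactness; it inherits the quadratic bound and additivity, and it stays in
  \<open>K\<close> because \<open>K\<close> is closed.\<close>

lemma one_param_limit:
  assumes K: "subgroup K G" "closedin (topo G) K"
    and k: "\<And>n. k n \<in> K" "eventually (\<lambda>n. k n \<in> U) sequentially"
    and s: "\<And>n::nat. s n > 0" "s \<longlonglongrightarrow> 0"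
    and lim: "(\<lambda>n. (1 / s n) *\<^sub>R (\<phi> (k n) - base)) \<longlonglongrightarrow> Z"
  shows "Z \<in> subgroup_lie_algebra G (U, \<phi>) K"
proof -
  obtain S r C where ball: "mult_ball S r C" using mult_ball_exists by blast
  note r = mult_ballD(1)[OF ball] and S = mult_ballD(2,3)[OF ball] and C = mult_ballD(4,5)[OF ball]
  \<comment> \<open>Any number above |Z|: as the rescaled coordinates tend to \<open>Z\<close>, the
    distance of \<phi> (k n) from the base point is eventually at most A s n.\<close>
  define A where "A = norm Z + 1"
  have A: "A > 0" by (simp add: A_def add_nonneg_pos)
  \<comment> \<open>Chosen for the two smallness conditions of \<open>power_in_chart\<close>; the
    added 1 avoids a division by zero when C = 0.\<close>
  define e where "e = min (r / (2 * A)) (1 / (2 * C * A + 1))"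
  have CA: "2 * C * A \<ge> 0" using C(1) A by simp
  have e: "e > 0" "2 * A * e \<le> r" "2 * C * A * e \<le> 1"
  proof -
    show e0: "e > 0" using r A add_nonneg_pos[OF CA zero_less_one] by (simp add: e_def)
    have "e \<le> r / (2 * A)" by (simp add: e_def)
    then show "2 * A * e \<le> r" using A by (simp add: field_simps)
    have "e \<le> 1 / (2 * C * A + 1)" by (simp add: e_def)
    then have "(2 * C * A + 1) * e \<le> 1" using CA by (simp add: field_simps)
    then show "2 * C * A * e \<le> 1" using e0 by (simp add: algebra_simps)
  qed
  have kG: "k n \<in> carrier G" for n using k(1) subgroup.mem_carrier[OF K(1)] by blast
  have pK: "k n [^] (j::nat) \<in> K" for n j
    using k(1) by (induction j) (auto intro: subgroup.m_closed[OF K(1)] subgroup.one_closed[OF K(1)])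
  define good where "good n \<longleftrightarrow> k n \<in> U \<and> norm (\<phi> (k n) - base) \<le> A * s n \<and> s n \<le> e" for n
  have good: "eventually good sequentially"
  proof -
    have "eventually (\<lambda>n. norm ((1 / s n) *\<^sub>R (\<phi> (k n) - base)) < A) sequentially"
      by (rule order_tendstoD(2)[OF tendsto_norm[OF lim]]) (simp add: A_def)
    moreover have "eventually (\<lambda>n. s n < e) sequentially" using order_tendstoD(2)[OF s(2) e(1)] .
    ultimately show ?thesis using k(2)
    proof eventually_elim
      case (elim n)
      then have "norm (\<phi> (k n) - base) / s n < A" using s(1)[of n] by (simp add: abs_of_pos)
      then have "norm (\<phi> (k n) - base) \<le> A * s n" using s(1)[of n] by (simp add: pos_divide_less_eq)
      then show ?case using elim by (simp add: good_def)
    qed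
  qed
  have pw: "k n [^] j \<in> U" "norm (\<phi> (k n [^] j) - base) \<le> 2 * A * (j * s n)"
    "norm (\<phi> (k n [^] j) - base - real j *\<^sub>R (\<phi> (k n) - base)) \<le> 2 * C * A\<^sup>2 * (j * s n)\<^sup>2"
    "\<phi> (k n [^] j) \<in> S"
    if "good n" "real j * s n \<le> e" for n j
  proof -
    have p: "k n [^] j \<in> U \<and> norm (\<phi> (k n [^] j) - base) \<le> 2 * A * (j * s n) \<and>
      norm (\<phi> (k n [^] j) - base - real j *\<^sub>R (\<phi> (k n) - base)) \<le> 2 * C * A\<^sup>2 * (j * s n)\<^sup>2"
      using that A s(1)[of n] unfolding good_def
      by (intro power_in_chart[OF ball e]) auto
    then show "k n [^] j \<in> U" "norm (\<phi> (k n [^] j) - base) \<le> 2 * A * (j * s n)"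
      "norm (\<phi> (k n [^] j) - base - real j *\<^sub>R (\<phi> (k n) - base)) \<le> 2 * C * A\<^sup>2 * (j * s n)\<^sup>2" by blast+
    have "2 * A * (j * s n) \<le> 2 * A * e" using that A by (intro mult_left_mono) auto
    then show "\<phi> (k n [^] j) \<in> S" using p e(2) unfolding S by (simp add: dist_norm norm_minus_commute)
  qed
  define J where "J n t = nat \<lfloor>t / s n\<rfloor>" for n t
  have J: "real (J n t) * s n \<le> t" "t - s n \<le> real (J n t) * s n" if "0 \<le> t" for n t
  proof -
    have r: "real (J n t) = of_int \<lfloor>t / s n\<rfloor>" using that s(1)[of n] by (simp add: J_def)
    have "of_int \<lfloor>t / s n\<rfloor> * s n \<le> t"
      using s(1)[of n] of_int_floor_le[of "t / s n"] by (simp only: pos_le_divide_eq)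
    moreover have "t < (of_int \<lfloor>t / s n\<rfloor> + 1) * s n"
    proof -
      have "t / s n < of_int \<lfloor>t / s n\<rfloor> + 1" by linarith
      then show ?thesis using s(1)[of n] by (simp only: pos_divide_less_eq)
    qed
    ultimately show "real (J n t) * s n \<le> t" "t - s n \<le> real (J n t) * s n"
      unfolding r by (auto simp: algebra_simps)
  qed
  \<comment> \<open>Outside [0, e] the value is a dummy in \<open>S\<close>, so that
    \<open>F n\<close> becomes a point of the compact space of all functions into
    \<open>S\<close>.\<close>
  define F where "F n t = (if 0 \<le> t \<and> t \<le> e then \<phi> (k n [^] J n t) else base)" for n t
  have FS: "F n t \<in> S" if "good n" for n t
    using pw(4)[OF that, of "J n t"] J(1)[of t n] r unfolding F_def S by fastforce
  have "eventually (\<lambda>n. F n \<in> {f. \<forall>t. f t \<in> S}) sequentially"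
    using good by (rule eventually_mono) (use FS in blast)
  moreover have cS: "compact S" unfolding S by (rule compact_cball_finite_dim[OF finite_dimensional])
  ultimately obtain f N where f: "f \<in> {f. \<forall>t. f t \<in> S}" and N: "N \<le> sequentially" "N \<noteq> bot" and Ff: "(F \<longlongrightarrow> f) N"
    using convergent_subfilter[OF compact_functions[of S], of F] by blast
  have fS: "f t \<in> S" for t using f by blast
  have S_U: "a \<in> \<phi> ` U" if "a \<in> S" for a
    using S(2) that mult_dom_iff by blast
  have Ft: "((\<lambda>n. F n t) \<longlongrightarrow> f t) N" for t by (rule tendsto_apply[OF Ff])
  have goodN: "eventually good N" using good N(1) by (rule filter_leD[rotated])
  have sN: "(s \<longlongrightarrow> 0) N" by (rule tendsto_mono[OF N(1) s(2)])
  have limN: "((\<lambda>n. (1 / s n) *\<^sub>R (\<phi> (k n) - base)) \<longlongrightarrow> Z) N" by (rule tendsto_mono[OF N(1) lim])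
  have fK: "\<psi> (f t) \<in> K" if t: "0 \<le> t" "t \<le> e" for t
  proof (rule ccontr)
    assume nK: "\<psi> (f t) \<notin> K"
    let ?V = "{a \<in> \<phi> ` U. \<psi> a \<in> topspace (topo G) - K}"
    have oK: "openin (topo G) (topspace (topo G) - K)" using K(2) by blast
    have "open ?V" using open_chart_vimage[OF chart continuous_map_id oK] unfolding \<psi>_def by simp
    moreover have "f t \<in> ?V" using nK S_U[OF fS] psi_simps(4)[OF S_U[OF fS]] by (simp add: topspace_eq)
    ultimately have "eventually (\<lambda>n. F n t \<in> ?V) N" using Ft topological_tendstoD by blast
    with goodN have "eventually (\<lambda>n. False) N"
    proof eventually_elim
      case (elim n)
      have "F n t = \<phi> (k n [^] J n t)" "k n [^] J n t \<in> U"
        using t pw(1)[OF elim(1), of "J n t"] J(1)[OF t(1), of n] by (auto simp: F_def)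
      then have "\<psi> (F n t) = k n [^] J n t" using psi_simps(1) by simp
      then show ?case using elim(2) pK by simp
    qed
    then show False using N(2) by (simp add: trivial_limit_def)
  qed
  have bnd: "norm (f t - base - t *\<^sub>R Z) \<le> 2 * C * A\<^sup>2 * t\<^sup>2" if t: "0 \<le> t" "t \<le> e" for t
  proof (rule tendsto_upperbound[OF _ _ N(2)])
    have js: "((\<lambda>n. real (J n t) * s n) \<longlongrightarrow> t) N"
    proof (rule tendsto_sandwich[of "\<lambda>n. t - s n" _ N "\<lambda>n. t"])
      show "((\<lambda>n. t - s n) \<longlongrightarrow> t) N" using tendsto_diff[OF tendsto_const sN, of t] by simp
    qed (use J[OF t(1)] in auto)
    have "((\<lambda>n. (real (J n t) * s n) *\<^sub>R ((1 / s n) *\<^sub>R (\<phi> (k n) - base))) \<longlongrightarrow> t *\<^sub>R Z) N"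
      by (rule tendsto_scaleR[OF js limN])
    then have "((\<lambda>n. real (J n t) *\<^sub>R (\<phi> (k n) - base)) \<longlongrightarrow> t *\<^sub>R Z) N"
    proof (rule Lim_transform_eventually)
      show "eventually (\<lambda>n. (real (J n t) * s n) *\<^sub>R ((1 / s n) *\<^sub>R (\<phi> (k n) - base)) = real (J n t) *\<^sub>R (\<phi> (k n) - base)) N"
        using s(1) by (intro always_eventually allI) (metis less_irrefl mult.assoc mult.right_neutral nonzero_eq_divide_eq scaleR_scaleR)
    qed
    then show "((\<lambda>n. norm (F n t - base - real (J n t) *\<^sub>R (\<phi> (k n) - base))) \<longlongrightarrow> norm (f t - base - t *\<^sub>R Z)) N"
      by (intro tendsto_norm tendsto_diff Ft tendsto_const)
    show "eventually (\<lambda>n. norm (F n t - base - real (J n t) *\<^sub>R (\<phi> (k n) - base)) \<le> 2 * C * A\<^sup>2 * t\<^sup>2) N"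
      using goodN
    proof eventually_elim
      case (elim n)
      have "norm (F n t - base - real (J n t) *\<^sub>R (\<phi> (k n) - base)) \<le> 2 * C * A\<^sup>2 * (J n t * s n)\<^sup>2"
        using pw(3)[OF elim, of "J n t"] J(1)[OF t(1), of n] t by (simp add: F_def)
      also have "\<dots> \<le> 2 * C * A\<^sup>2 * t\<^sup>2"
        using J(1)[OF t(1), of n] C(1) s(1)[of n] by (intro mult_left_mono power_mono) auto
      finally show ?case .
    qed
  qed
  \<comment> \<open>The integer part of a sum is the sum of the integer parts or one more. Hence the
    product of the two powers misses the right power by at most one factor \<open>k n\<close>, whose
    effect on the coordinates is of order s n and disappears in the limit.\<close>
  have add: "f (t + u) = mult_chart (f t, f u)" if t: "0 \<le> t" and u: "0 \<le> u" and tu: "t + u \<le> e" for t u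
  proof -
    have dom: "(f t, f u) \<in> mult_dom" using fS S(2) by blast
    have cont: "isCont mult_chart (f t, f u)"
      using Dm_has_derivative[OF dom] has_derivative_continuous by blast
    have 1: "((\<lambda>n. mult_chart (F n t, F n u)) \<longlongrightarrow> mult_chart (f t, f u)) N"
      using isCont_tendsto_compose[OF cont tendsto_Pair[OF Ft Ft]] .
    have 2: "((\<lambda>n. F n (t + u) - mult_chart (F n t, F n u)) \<longlongrightarrow> 0) N"
    proof (rule Lim_null_comparison)
      have "((\<lambda>n. (1 + C * r) * A * s n) \<longlongrightarrow> (1 + C * r) * A * 0) N" by (intro tendsto_mult tendsto_const sN)
      then show "((\<lambda>n. (1 + C * r) * A * s n) \<longlongrightarrow> 0) N" by simp
      show "eventually (\<lambda>n. norm (F n (t + u) - mult_chart (F n t, F n u)) \<le> (1 + C * r) * A * s n) N"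
        using goodN
      proof eventually_elim
        case (elim n)
        define i j where "i = J n t" and "j = J n u"
        have i: "real i * s n \<le> e" and j: "real j * s n \<le> e" and ij: "real (i + j) * s n \<le> e"
          using J(1)[OF t, of n] J(1)[OF u, of n] t u tu by (auto simp: i_def j_def algebra_simps)
        have ij': "J n (t + u) = i + j \<or> J n (t + u) = Suc (i + j)"
        proof -
          have "0 \<le> t / s n" "0 \<le> u / s n" using t u s(1)[of n] by auto
          moreover have "(t + u) / s n = t / s n + u / s n" by (rule add_divide_distrib)
          ultimately show ?thesis unfolding i_def j_def J_def by linarith
        qed
        have Fm: "mult_chart (F n t, F n u) = \<phi> (k n [^] (i + j))"
        proof -
          have "F n t = \<phi> (k n [^] i)" "F n u = \<phi> (k n [^] j)"
            using t u tu by (auto simp: F_def i_def j_def)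
          then show ?thesis unfolding mult_chart_def
            using pw(1)[OF elim i] pw(1)[OF elim j] kG by (simp add: psi_simps(1) nat_pow_mult)
        qed
        have F': "F n (t + u) = \<phi> (k n [^] J n (t + u))" using t u tu by (simp add: F_def)
        have nn: "0 \<le> (1 + C * r) * A * s n" using C(1) r A s(1)[of n] by simp
        from ij' show ?case
        proof
          assume "J n (t + u) = i + j"
          then show ?thesis using F' Fm nn by simp
        next
          assume Suc: "J n (t + u) = Suc (i + j)"
          let ?y = "\<phi> (k n [^] (i + j))" and ?x = "\<phi> (k n)"
          have y: "?y \<in> S" "k n [^] (i + j) \<in> U" using pw(4)[OF elim ij] pw(1)[OF elim ij] by auto
          have x: "?x \<in> S" "k n \<in> U"
            using pw(4)[OF elim, of 1] elim kG[of n] by (auto simp: good_def)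
          have bS: "base \<in> S" using r by (simp add: S)
          have "F n (t + u) = mult_chart (?x, ?y)"
            unfolding F' Suc mult_chart_def using x y nat_pow_Suc2[OF kG] by (simp add: psi_simps(1))
          moreover have "mult_chart (base, ?y) = ?y" using y by (intro mult_chart_base) auto
          ultimately have d: "norm (F n (t + u) - ?y - (?x - base)) \<le> C * norm (?y - base) * norm (?x - base)"
            using C(2)[OF x(1) bS y(1)] by simp
          have "norm (F n (t + u) - ?y) \<le> norm (F n (t + u) - ?y - (?x - base)) + norm (?x - base)"
            using norm_triangle_ineq[of "F n (t + u) - ?y - (?x - base)" "?x - base"] by simp
          also have "\<dots> \<le> C * norm (?y - base) * norm (?x - base) + norm (?x - base)" using d by simp
          also have "\<dots> = (1 + C * norm (?y - base)) * norm (?x - base)" by (simp add: algebra_simps)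
          also have "\<dots> \<le> (1 + C * r) * (A * s n)"
            using y(1) C(1) elim A s(1)[of n] r unfolding S good_def
            by (intro mult_mono add_left_mono mult_left_mono) (auto simp: dist_norm norm_minus_commute)
          finally show ?thesis using Fm by (simp add: mult.assoc)
        qed
      qed
    qed
    have "((\<lambda>n. F n (t + u)) \<longlongrightarrow> mult_chart (f t, f u)) N" using tendsto_add[OF 2 1] by simp
    then show ?thesis using tendsto_unique[OF N(2) Ft[of "t + u"]] by simp
  qed
  obtain \<gamma> where \<gamma>: "\<And>s t. \<gamma> (s + t) = \<gamma> s \<otimes> \<gamma> t" "\<And>t. \<gamma> t \<in> K"
    "\<And>t. 0 \<le> t \<Longrightarrow> t \<le> e \<Longrightarrow> \<gamma> t = \<psi> (f t)"
  proof (rule extend_local_one_param[OF K(1) e(1), of "\<lambda>t. \<psi> (f t)"])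
    show "\<psi> (f t) \<in> K" if "0 \<le> t" "t \<le> e" for t by (rule fK[OF that])
    show "\<psi> (f (s + t)) = \<psi> (f s) \<otimes> \<psi> (f t)" if "0 \<le> s" "0 \<le> t" "s + t \<le> e" for s t
      unfolding add[OF that] by (rule psi_mult_chart) (use fS S(2) in blast)
  qed blast
  have "one_param_subgroup G (U, \<phi>) Z \<gamma>"
  proof (rule one_paramI[OF \<gamma>(1) _ e(1)])
    show "\<gamma> t \<in> carrier G" for t using \<gamma>(2) subgroup.mem_carrier[OF K(1)] by blast
    show "\<gamma> t \<in> U" if "0 \<le> t" "t \<le> e" for t using \<gamma>(3)[OF that] psi_simps(3)[OF S_U[OF fS]] by simp
    show "norm (\<phi> (\<gamma> t) - base - t *\<^sub>R Z) \<le> 2 * C * A\<^sup>2 * t\<^sup>2" if "0 \<le> t" "t \<le> e" for t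
      using bnd[OF that] \<gamma>(3)[OF that] psi_simps(2)[OF S_U[OF fS]] by simp
  qed
  then show ?thesis unfolding subgroup_lie_algebra_def using \<gamma>(2) by blast
qed

end

section \<open>Closedness of center times compact, and the Lie algebra of a closed subgroup\<close>

lemma (in lie_group) closedin_group_center: "closedin (topo G) (group_center G)"
proof -
  have "closedin (topo G) {z \<in> topspace (topo G). z \<otimes> x = x \<otimes> z}" if "x \<in> carrier G" for x
    by (rule closedin_continuous_maps_eq[OF hausdorff continuous_translations(2,1)[OF that that]])
  then have "closedin (topo G) (\<Inter>x\<in>carrier G. {z \<in> topspace (topo G). z \<otimes> x = x \<otimes> z})"
    by (intro closedin_INT) auto
  moreover have "(\<Inter>x\<in>carrier G. {z \<in> topspace (topo G). z \<otimes> x = x \<otimes> z}) = group_center G"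
    using one_closed unfolding group_center_def topspace_eq by blast
  ultimately show ?thesis by simp
qed

text \<open>The product set is the projection, along the compact factor \<open>C\<close>, of the
  closed set of pairs (x, y) with x y^-1 in \<open>Z\<close>; projection along a compact space is a
  closed map.\<close>

lemma (in lie_group) closedin_set_mult_compact:
  assumes Z: "closedin (topo G) Z" and C: "compactin (topo G) C"
  shows "closedin (topo G) (Z <#> C)"
proof -
  let ?P = "prod_topology (topo G) (subtopology (topo G) C)"
  have CG: "C \<subseteq> carrier G" using compactin_subset_topspace[OF C] topspace_eq by simp
  have ZG: "Z \<subseteq> carrier G" using closedin_subset[OF Z] topspace_eq by simp
  have "compact_space (subtopology (topo G) C)" using C by (simp add: compactin_subspace)
  then have cl: "closed_map ?P (topo G) fst" by (rule closed_map_fst)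
  have s: "continuous_map ?P (topo G) snd"
    using continuous_map_snd[of "topo G" "subtopology (topo G) C"] continuous_map_into_fulltopology by blast
  have "continuous_map ?P (topo G) (\<lambda>p. fst p \<otimes> inv (snd p))"
    by (intro continuous_mult continuous_inv s continuous_map_fst)
  from closedin_continuous_map_preimage[OF this Z]
  have "closedin (topo G) (fst ` {p \<in> topspace ?P. fst p \<otimes> inv (snd p) \<in> Z})"
    using cl unfolding closed_map_def by blast
  moreover have "fst ` {p \<in> topspace ?P. fst p \<otimes> inv (snd p) \<in> Z} = Z <#> C"
  proof (intro equalityI subsetI)
    fix x assume "x \<in> fst ` {p \<in> topspace ?P. fst p \<otimes> inv (snd p) \<in> Z}"
    then obtain y where y: "x \<in> carrier G" "y \<in> C" "x \<otimes> inv y \<in> Z" by (auto simp: topspace_eq)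
    then have "x = (x \<otimes> inv y) \<otimes> y" using CG by (auto simp: m_assoc)
    with y show "x \<in> Z <#> C" unfolding set_mult_def by blast
  next
    fix x assume "x \<in> Z <#> C"
    then obtain z y where zy: "z \<in> Z" "y \<in> C" "x = z \<otimes> y" unfolding set_mult_def by blast
    then have "z \<in> carrier G" "y \<in> carrier G" using ZG CG by auto
    then have "x \<otimes> inv y = z" "x \<in> carrier G" using zy by (auto simp: m_assoc)
    then have "(x, y) \<in> {p \<in> topspace ?P. fst p \<otimes> inv (snd p) \<in> Z}"
      using zy \<open>y \<in> carrier G\<close> by (simp add: topspace_eq)
    then show "x \<in> fst ` {p \<in> topspace ?P. fst p \<otimes> inv (snd p) \<in> Z}" by force
  qed
  ultimately show ?thesis by simp
qed

context lie_chart
begin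

lemma one_param_subgroup_conj:
  assumes \<gamma>: "one_param_subgroup G (U, \<phi>) Y \<gamma>" and x: "x \<in> carrier G"
  shows "one_param_subgroup G (U, \<phi>) (Ad G (U, \<phi>) x Y) (\<lambda>t. x \<otimes> \<gamma> t \<otimes> inv x)"
proof -
  note g = one_param_facts[OF \<gamma>]
  have "continuous_map euclideanreal (topo G) (\<lambda>t. x \<otimes> \<gamma> t \<otimes> inv x)"
    using x by (intro continuous_mult continuous_const g(5)) auto
  moreover have "x \<otimes> \<gamma> (s + t) \<otimes> inv x = x \<otimes> \<gamma> s \<otimes> inv x \<otimes> (x \<otimes> \<gamma> t \<otimes> inv x)" for s t
  proof -
    have "inv x \<otimes> (x \<otimes> (\<gamma> t \<otimes> inv x)) = \<gamma> t \<otimes> inv x"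
      using x g(1) by (simp add: m_assoc[symmetric])
    then show ?thesis using x g(1,4) by (simp add: m_assoc)
  qed
  moreover have "((\<lambda>t. \<phi> (x \<otimes> \<gamma> t \<otimes> inv x)) has_vector_derivative Ad G (U, \<phi>) x Y) (at 0)"
  proof -
    obtain T where T: "open T" "0 \<in> T" "\<And>t. t \<in> T \<Longrightarrow> \<gamma> t \<in> U \<and> \<gamma> (- t) \<in> U"
      using one_param_eventually_in_U[OF \<gamma>] by blast
    have "((\<lambda>t. \<phi> (\<gamma> t)) has_derivative (\<lambda>h. h *\<^sub>R Y)) (at 0)"
      using g(6) by (simp add: has_vector_derivative_def)
    moreover have "((\<lambda>u. \<phi> (x \<otimes> \<psi> u \<otimes> inv x)) has_derivative Ad G (U, \<phi>) x) (at (\<phi> (\<gamma> 0)))"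
      using conj_has_derivative[OF x] g(2) by (simp add: base_def)
    ultimately have "((\<lambda>t. \<phi> (x \<otimes> \<psi> (\<phi> (\<gamma> t)) \<otimes> inv x)) has_derivative (\<lambda>h. Ad G (U, \<phi>) x (h *\<^sub>R Y))) (at 0)"
      by (rule has_derivative_compose)
    then have "((\<lambda>t. \<phi> (x \<otimes> \<gamma> t \<otimes> inv x)) has_derivative (\<lambda>h. Ad G (U, \<phi>) x (h *\<^sub>R Y))) (at 0)"
      by (rule has_derivative_transform_within_open[OF _ T(1,2)]) (use T(3) psi_simps(1) in simp)
    then show ?thesis by (simp add: has_vector_derivative_def linear_cmul[OF Ad_linear[OF x]])
  qed
  ultimately show ?thesis unfolding one_param_subgroup_def by simp
qed

lemma Ad_subgroup_lie_algebra:
  assumes K: "subgroup K G" and x: "x \<in> K" and Y: "Y \<in> subgroup_lie_algebra G (U, \<phi>) K"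
  shows "Ad G (U, \<phi>) x Y \<in> subgroup_lie_algebra G (U, \<phi>) K"
proof -
  obtain \<gamma> where \<gamma>: "one_param_subgroup G (U, \<phi>) Y \<gamma>" "range \<gamma> \<subseteq> K"
    using Y unfolding subgroup_lie_algebra_def by blast
  have "range (\<lambda>t. x \<otimes> \<gamma> t \<otimes> inv x) \<subseteq> K"
    using \<gamma>(2) x by (auto intro!: subgroup.m_closed[OF K] subgroup.m_inv_closed[OF K])
  then show ?thesis
    using one_param_subgroup_conj[OF \<gamma>(1)] x subgroup.mem_carrier[OF K] unfolding subgroup_lie_algebra_def by blast
qed

text \<open>Scaling is reparametrisation. For sums, the curve of products \<alpha> t \<otimes>
  \<beta> t has velocity X + Y at 0 but is no homomorphism in general; sampling it at t = 1 / (n +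
  1) and passing to the limit of powers produces one.\<close>

lemma subspace_subgroup_lie_algebra:
  assumes K: "subgroup K G" "closedin (topo G) K"
  shows "subspace (subgroup_lie_algebra G (U, \<phi>) K)"
proof (rule subspaceI)
  have "one_param_subgroup G (U, \<phi>) 0 (\<lambda>t. \<one>)"
    unfolding one_param_subgroup_def by (auto simp: continuous_const topspace_eq)
  then show "0 \<in> subgroup_lie_algebra G (U, \<phi>) K"
    unfolding subgroup_lie_algebra_def using subgroup.one_closed[OF K(1)] by blast
next
  fix X and c :: real
  assume "X \<in> subgroup_lie_algebra G (U, \<phi>) K"
  then obtain \<gamma> where \<gamma>: "one_param_subgroup G (U, \<phi>) X \<gamma>" "range \<gamma> \<subseteq> K"
    unfolding subgroup_lie_algebra_def by blast
  note g = one_param_facts[OF \<gamma>(1)]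
  have "continuous_map euclideanreal euclideanreal (\<lambda>t. c * t)" by (auto intro!: continuous_intros)
  from continuous_map_compose[OF this g(5)]
  have 1: "continuous_map euclideanreal (topo G) (\<lambda>t. \<gamma> (c * t))" by (simp add: o_def)
  have "((\<lambda>t. c * t) has_derivative (\<lambda>h. c * h)) (at 0)" by (auto intro!: derivative_eq_intros)
  moreover have "((\<lambda>t. \<phi> (\<gamma> t)) has_derivative (\<lambda>h. h *\<^sub>R X)) (at (c * 0))"
    using g(6) by (simp add: has_vector_derivative_def)
  ultimately have "((\<lambda>t. \<phi> (\<gamma> (c * t))) has_derivative (\<lambda>h. (c * h) *\<^sub>R X)) (at 0)"
    by (rule has_derivative_compose)
  then have "one_param_subgroup G (U, \<phi>) (c *\<^sub>R X) (\<lambda>t. \<gamma> (c * t))"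
    unfolding one_param_subgroup_def using 1 g(4) by (simp add: has_vector_derivative_def distrib_left mult.commute)
  moreover have "range (\<lambda>t. \<gamma> (c * t)) \<subseteq> K" using \<gamma>(2) by blast
  ultimately show "c *\<^sub>R X \<in> subgroup_lie_algebra G (U, \<phi>) K"
    unfolding subgroup_lie_algebra_def by blast
next
  fix X Y
  assume "X \<in> subgroup_lie_algebra G (U, \<phi>) K" "Y \<in> subgroup_lie_algebra G (U, \<phi>) K"
  then obtain \<alpha> \<beta> where \<alpha>: "one_param_subgroup G (U, \<phi>) X \<alpha>" "range \<alpha> \<subseteq> K"
    and \<beta>: "one_param_subgroup G (U, \<phi>) Y \<beta>" "range \<beta> \<subseteq> K"
    unfolding subgroup_lie_algebra_def by blast
  note a = one_param_facts[OF \<alpha>(1)] and b = one_param_facts[OF \<beta>(1)]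
  have "((\<lambda>t. (\<phi> (\<alpha> t), \<phi> (\<beta> t))) has_derivative (\<lambda>h. (h *\<^sub>R X, h *\<^sub>R Y))) (at 0)"
    using a(6) b(6) by (intro has_derivative_Pair) (auto simp: has_vector_derivative_def)
  moreover have "(mult_chart has_derivative Dm (base, base)) (at (\<phi> (\<alpha> 0), \<phi> (\<beta> 0)))"
    using Dm_has_derivative[OF base_base] a(2) b(2) by (simp add: base_def)
  ultimately have "((\<lambda>t. mult_chart (\<phi> (\<alpha> t), \<phi> (\<beta> t))) has_derivative (\<lambda>h. Dm (base, base) (h *\<^sub>R X, h *\<^sub>R Y))) (at 0)"
    by (rule has_derivative_compose)
  moreover have "Dm (base, base) (h *\<^sub>R X, h *\<^sub>R Y) = h *\<^sub>R (X + Y)" for h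
    using linear_add[OF Dm_linear[OF base_base], of "(h *\<^sub>R X, 0)" "(0, h *\<^sub>R Y)"]
      Dm_base_right[OF base_in] Dm_base_left[OF base_in] by (simp add: scaleR_add_right)
  ultimately have D: "((\<lambda>t. mult_chart (\<phi> (\<alpha> t), \<phi> (\<beta> t))) has_derivative (\<lambda>h. h *\<^sub>R (X + Y))) (at 0)"
    by simp
  obtain S T where ST: "open S" "0 \<in> S" "\<And>t. t \<in> S \<Longrightarrow> \<alpha> t \<in> U" "open T" "0 \<in> T" "\<And>t. t \<in> T \<Longrightarrow> \<beta> t \<in> U"
    using one_param_eventually_in_U[OF \<alpha>(1)] one_param_eventually_in_U[OF \<beta>(1)] by metis
  have D': "((\<lambda>t. \<phi> (\<alpha> t \<otimes> \<beta> t)) has_derivative (\<lambda>h. h *\<^sub>R (X + Y))) (at 0)"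
    by (rule has_derivative_transform_within_open[OF D open_Int[OF ST(1,4)]])
      (use ST psi_simps(1) in \<open>auto simp: mult_chart_def\<close>)
  have "openin euclideanreal {t \<in> topspace euclideanreal. \<alpha> t \<otimes> \<beta> t \<in> U}"
    by (rule openin_continuous_map_preimage[OF continuous_mult[OF a(5) b(5)] chart_facts(1)[OF chart]])
  then have oU: "open {t. \<alpha> t \<otimes> \<beta> t \<in> U}" by simp
  define s where "s n = inverse (real (Suc n))" for n
  have s: "s \<longlonglongrightarrow> 0" "\<And>n. s n > 0"
    unfolding s_def by (rule LIMSEQ_inverse_real_of_nat) simp
  show "X + Y \<in> subgroup_lie_algebra G (U, \<phi>) K"
  proof (rule one_param_limit[OF K, of "\<lambda>n. \<alpha> (s n) \<otimes> \<beta> (s n)" s])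
    show "\<alpha> (s n) \<otimes> \<beta> (s n) \<in> K" for n using \<alpha>(2) \<beta>(2) by (auto intro!: subgroup.m_closed[OF K(1)])
    have "eventually (\<lambda>n. s n \<in> {t. \<alpha> t \<otimes> \<beta> t \<in> U}) sequentially"
      by (rule topological_tendstoD[OF s(1) oU]) (use a(2) b(2) one_in in simp)
    then show "eventually (\<lambda>n. \<alpha> (s n) \<otimes> \<beta> (s n) \<in> U) sequentially" by simp
    have "((\<lambda>t. (1 / t) *\<^sub>R (\<phi> (\<alpha> t \<otimes> \<beta> t) - base)) \<longlongrightarrow> X + Y) (at 0)"
    proof (rule LIM_zero_cancel, rule tendsto_norm_zero_cancel)
      let ?f = "\<lambda>t. \<phi> (\<alpha> t \<otimes> \<beta> t)"
      have "((\<lambda>t. norm (?f t - ?f 0 - (t - 0) *\<^sub>R (X + Y)) / norm (t - 0)) \<longlongrightarrow> 0) (at 0)"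
        using D' unfolding has_derivative_iff_norm by blast
      then show "((\<lambda>t. norm ((1 / t) *\<^sub>R (?f t - base) - (X + Y))) \<longlongrightarrow> 0) (at 0)"
      proof (rule Lim_transform_eventually)
        have "norm (?f t - ?f 0 - (t - 0) *\<^sub>R (X + Y)) / norm (t - 0) = norm ((1 / t) *\<^sub>R (?f t - base) - (X + Y))"
          if "t \<noteq> 0" for t
        proof -
          have "(1 / t) *\<^sub>R (?f t - base) - (X + Y) = (1 / t) *\<^sub>R (?f t - base - t *\<^sub>R (X + Y))"
            using that by (simp add: scaleR_diff_right)
          then show ?thesis using a(2) b(2) by (simp add: base_def)
        qed
        then show "eventually (\<lambda>t. norm (?f t - ?f 0 - (t - 0) *\<^sub>R (X + Y)) / norm (t - 0) =
            norm ((1 / t) *\<^sub>R (?f t - base) - (X + Y))) (at 0)"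
          by (simp add: eventually_at_filter)
      qed
    qed
    moreover have "filterlim s (at 0) sequentially"
      using s by (auto simp: filterlim_at intro!: always_eventually) (metis less_irrefl)
    ultimately show "(\<lambda>n. (1 / s n) *\<^sub>R (\<phi> (\<alpha> (s n) \<otimes> \<beta> (s n)) - base)) \<longlonglongrightarrow> X + Y"
      by (rule filterlim_compose)
  qed (use s in auto)
qed

text \<open>The curve Ad (\<gamma> t) Y stays in the subspace, so a functional that vanishes on the
  subspace also vanishes on the derivative of the curve at 0, which is the bracket.\<close>

lemma lie_bracket_subgroup_lie_algebra:
  assumes K: "subgroup K G" "closedin (topo G) K"
    and X: "X \<in> subgroup_lie_algebra G (U, \<phi>) K" and Y: "Y \<in> subgroup_lie_algebra G (U, \<phi>) K"
  shows "lie_bracket G (U, \<phi>) X Y \<in> subgroup_lie_algebra G (U, \<phi>) K" (is "_ \<in> ?k")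
proof (rule ccontr)
  assume n: "lie_bracket G (U, \<phi>) X Y \<notin> ?k"
  obtain \<gamma> where \<gamma>: "one_param_subgroup G (U, \<phi>) X \<gamma>" "range \<gamma> \<subseteq> K"
    using X unfolding subgroup_lie_algebra_def by blast
  obtain L :: "'e \<Rightarrow> real" where L: "linear L" "\<And>y. y \<in> ?k \<Longrightarrow> L y = 0" "L (lie_bracket G (U, \<phi>) X Y) = 1"
    using functional_separates[OF subspace_subgroup_lie_algebra[OF K] n] by blast
  have "((\<lambda>t. L (Ad G (U, \<phi>) (\<gamma> t) Y)) has_vector_derivative L (lie_bracket G (U, \<phi>) X Y)) (at 0)"
    by (rule bounded_linear.has_vector_derivative[OF linear_bounded_finite_dim[OF finite_dimensional L(1)]
        Ad_one_param_has_derivative[OF \<gamma>(1)]])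
  moreover have "L (Ad G (U, \<phi>) (\<gamma> t) Y) = 0" for t
    using L(2) Ad_subgroup_lie_algebra[OF K(1) _ Y] \<gamma>(2) by blast
  ultimately have "((\<lambda>t::real. 0) has_vector_derivative L (lie_bracket G (U, \<phi>) X Y)) (at 0)" by simp
  from vector_derivative_unique_at[OF this has_vector_derivative_const] L(3) show False by simp
qed

end

section \<open>Invariant inner products\<close>

text \<open>Real scalar multiplication is a parameter because the same theory is applied to \<gg>,
  to V with its complex scalars restricted to the reals, and to functions from words to V.\<close>

locale real_scaled = vector_space s for s :: "real \<Rightarrow> 'v::ab_group_add \<Rightarrow> 'v"
begin

definition bilinear_form_on :: "'v set \<Rightarrow> ('v \<Rightarrow> 'v \<Rightarrow> real) \<Rightarrow> bool" where
  "bilinear_form_on W b \<longleftrightarrow> subspace W \<and>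
     (\<forall>u\<in>W. \<forall>v\<in>W. b u v = b v u) \<and>
     (\<forall>u\<in>W. \<forall>v\<in>W. \<forall>w\<in>W. b (u + v) w = b u w + b v w) \<and>
     (\<forall>r. \<forall>u\<in>W. \<forall>w\<in>W. b (s r u) w = r * b u w)"

definition inner_product_on :: "'v set \<Rightarrow> ('v \<Rightarrow> 'v \<Rightarrow> real) \<Rightarrow> bool" where
  "inner_product_on W b \<longleftrightarrow> bilinear_form_on W b \<and> (\<forall>u\<in>W. u \<noteq> 0 \<longrightarrow> b u u > 0)"

lemma bilinear_form_onD:
  assumes "bilinear_form_on W b"
  shows "subspace W"
    and "u \<in> W \<Longrightarrow> v \<in> W \<Longrightarrow> b u v = b v u"
    and "u \<in> W \<Longrightarrow> v \<in> W \<Longrightarrow> w \<in> W \<Longrightarrow> b (u + v) w = b u w + b v w"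
    and "u \<in> W \<Longrightarrow> v \<in> W \<Longrightarrow> w \<in> W \<Longrightarrow> b w (u + v) = b w u + b w v"
    and "u \<in> W \<Longrightarrow> w \<in> W \<Longrightarrow> b (s r u) w = r * b u w"
    and "u \<in> W \<Longrightarrow> w \<in> W \<Longrightarrow> b w (s r u) = r * b w u"
proof -
  show W: "subspace W" using assms unfolding bilinear_form_on_def by blast
  have sym: "\<And>u v. u \<in> W \<Longrightarrow> v \<in> W \<Longrightarrow> b u v = b v u"
    and add: "\<And>u v w. u \<in> W \<Longrightarrow> v \<in> W \<Longrightarrow> w \<in> W \<Longrightarrow> b (u + v) w = b u w + b v w"
    and scale: "\<And>u w r. u \<in> W \<Longrightarrow> w \<in> W \<Longrightarrow> b (s r u) w = r * b u w"
    using assms unfolding bilinear_form_on_def by blast+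
  show "u \<in> W \<Longrightarrow> v \<in> W \<Longrightarrow> b u v = b v u" by (rule sym)
  show "u \<in> W \<Longrightarrow> v \<in> W \<Longrightarrow> w \<in> W \<Longrightarrow> b (u + v) w = b u w + b v w" by (rule add)
  show "u \<in> W \<Longrightarrow> w \<in> W \<Longrightarrow> b (s r u) w = r * b u w" by (rule scale)
  show "u \<in> W \<Longrightarrow> v \<in> W \<Longrightarrow> w \<in> W \<Longrightarrow> b w (u + v) = b w u + b w v"
    using sym[of w "u + v"] sym[of u w] sym[of v w] add[of u v w] subspace_add[OF W] by simp
  show "u \<in> W \<Longrightarrow> w \<in> W \<Longrightarrow> b w (s r u) = r * b w u"
    using sym[of w "s r u"] sym[of u w] scale[of u w r] subspace_scale[OF W] by simp
qed

lemma bilinear_form_on_zero: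
  assumes b: "bilinear_form_on W b" and u: "u \<in> W"
  shows "b 0 u = 0" "b u 0 = 0"
  using bilinear_form_onD(5)[OF b u u, of 0] bilinear_form_onD(6)[OF b u u, of 0] by simp_all

lemma bilinear_form_on_diff:
  assumes b: "bilinear_form_on W b" and uvw: "u \<in> W" "v \<in> W" "w \<in> W"
  shows "b (u - v) w = b u w - b v w"
proof -
  have "u - v \<in> W" using bilinear_form_onD(1)[OF b] uvw by (rule_tac subspace_diff)
  from bilinear_form_onD(3)[OF b this uvw(2,3)] show ?thesis by simp
qed

lemma bilinear_form_on_sum:
  assumes b: "bilinear_form_on W b" and x: "\<And>i. i \<in> I \<Longrightarrow> x i \<in> W" and w: "w \<in> W"
  shows "b (\<Sum>i\<in>I. s (r i) (x i)) w = (\<Sum>i\<in>I. r i * b (x i) w)"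
    and "b w (\<Sum>i\<in>I. s (r i) (x i)) = (\<Sum>i\<in>I. r i * b w (x i))"
proof -
  note W = bilinear_form_onD(1)[OF b]
  have "b (\<Sum>i\<in>I. s (r i) (x i)) w = (\<Sum>i\<in>I. r i * b (x i) w) \<and>
      b w (\<Sum>i\<in>I. s (r i) (x i)) = (\<Sum>i\<in>I. r i * b w (x i))"
    using x
  proof (induction I rule: infinite_finite_induct)
    case (insert i I)
    have "(\<Sum>i\<in>I. s (r i) (x i)) \<in> W" "s (r i) (x i) \<in> W" "x i \<in> W"
      using insert.prems W by (auto intro!: subspace_sum subspace_scale)
    then show ?case
      using insert w bilinear_form_onD(3-6)[OF b] by simp
  qed (auto simp: bilinear_form_on_zero[OF b w])
  then show "b (\<Sum>i\<in>I. s (r i) (x i)) w = (\<Sum>i\<in>I. r i * b (x i) w)"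
    "b w (\<Sum>i\<in>I. s (r i) (x i)) = (\<Sum>i\<in>I. r i * b w (x i))" by auto
qed

lemma representation_expand:
  assumes B: "finite B" "independent B" and v: "v \<in> span B"
  shows "(\<Sum>i\<in>B. s (representation B v i) i) = v"
  using sum_representation_eq[OF B(2) v B(1)] by simp

lemma bilinear_form_on_expand:
  assumes b: "bilinear_form_on (span B) b" and B: "finite B" "independent B"
    and uv: "u \<in> span B" "v \<in> span B"
  shows "b u v = (\<Sum>i\<in>B. \<Sum>j\<in>B. representation B u i * representation B v j * b i j)"
proof -
  have "b u v = b (\<Sum>i\<in>B. s (representation B u i) i) (\<Sum>j\<in>B. s (representation B v j) j)"
    using uv by (simp add: representation_expand[OF B])
  also have "\<dots> = (\<Sum>i\<in>B. representation B u i * b i (\<Sum>j\<in>B. s (representation B v j) j))"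
    using uv(2) by (intro bilinear_form_on_sum(1)[OF b]) (auto simp: representation_expand[OF B] span_base)
  also have "\<dots> = (\<Sum>i\<in>B. representation B u i * (\<Sum>j\<in>B. representation B v j * b i j))"
    by (intro sum.cong refl arg_cong2[of _ _ _ _ "(*)"] bilinear_form_on_sum(2)[OF b]) (auto simp: span_base)
  finally show ?thesis by (simp add: sum_distrib_left mult.assoc)
qed

text \<open>
  The form is found by minimising the largest squared norm along the orbit over all symmetric forms
  that dominate a fixed inner product after every group element; by the parallelogram law the
  minimiser is unique, hence invariant.
\<close>

theorem invariant_inner_product:
  assumes B: "finite B" "independent B" and W: "W = span B"
    and lin: "\<And>g u v. g \<in> \<G> \<Longrightarrow> u \<in> W \<Longrightarrow> v \<in> W \<Longrightarrow> g (u + v) = g u + g v"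
      "\<And>g r u. g \<in> \<G> \<Longrightarrow> u \<in> W \<Longrightarrow> g (s r u) = s r (g u)"
    and stable: "\<And>g u. g \<in> \<G> \<Longrightarrow> u \<in> W \<Longrightarrow> g u \<in> W"
    and ident: "(\<lambda>u. u) \<in> \<G>"
    and comp: "\<And>g h. g \<in> \<G> \<Longrightarrow> h \<in> \<G> \<Longrightarrow> (\<lambda>u. g (h u)) \<in> \<G>"
    and inverse: "\<And>g. g \<in> \<G> \<Longrightarrow> \<exists>h\<in>\<G>. \<forall>u\<in>W. g (h u) = u"
    and bounded: "\<And>i j. i \<in> B \<Longrightarrow> j \<in> B \<Longrightarrow> \<exists>M. \<forall>g\<in>\<G>. \<bar>representation B (g j) i\<bar> \<le> M"
  shows "\<exists>b. inner_product_on W b \<and> (\<forall>g\<in>\<G>. \<forall>u\<in>W. \<forall>v\<in>W. b (g u) (g v) = b u v)"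
proof -
  let ?r = "representation B"
  have subW: "subspace W" by (simp add: W)
  have BW: "i \<in> W" if "i \<in> B" for i using that W by (simp add: span_base)
  obtain M0 where M0: "\<And>i j g. i \<in> B \<Longrightarrow> j \<in> B \<Longrightarrow> g \<in> \<G> \<Longrightarrow> \<bar>?r (g j) i\<bar> \<le> M0 i j"
    using bounded by metis
  define M where "M = (\<Sum>i\<in>B. \<Sum>j\<in>B. \<bar>M0 i j\<bar>)"
  have M: "\<bar>?r (g j) i\<bar> \<le> M" if "i \<in> B" "j \<in> B" "g \<in> \<G>" for i j g
  proof -
    have "\<bar>?r (g j) i\<bar> \<le> \<bar>M0 i j\<bar>" using M0[OF that] by linarith
    also have "\<dots> \<le> (\<Sum>j\<in>B. \<bar>M0 i j\<bar>)" using that B by (intro member_le_sum) auto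
    also have "\<dots> \<le> M" unfolding M_def
      using that B by (intro member_le_sum[of i B "\<lambda>i. \<Sum>j\<in>B. \<bar>M0 i j\<bar>"]) (auto intro: sum_nonneg)
    finally show ?thesis .
  qed
  have M_nonneg: "M \<ge> 0" unfolding M_def by (intro sum_nonneg) auto
  define n where "n = real (card B)"
  define form where "form b \<longleftrightarrow> bilinear_form_on W b" for b
  \<comment> \<open>The squared Hilbert-Schmidt norm, relative to \<open>B\<close>, of the form
    moved by g. A sum of squares is chosen so that the parallelogram law holds exactly.\<close>
  define E where "E b g = (\<Sum>i\<in>B. \<Sum>j\<in>B. (b (g i) (g j))\<^sup>2)" for b :: "'v \<Rightarrow> 'v \<Rightarrow> real" and g
  define id' where "id' = (\<lambda>u::'v. u)"
  have E_nonneg: "E b g \<ge> 0" for b g unfolding E_def by (intro sum_nonneg) auto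
  have E_bound: "\<bar>b (g i) (g j)\<bar> \<le> M\<^sup>2 * (\<Sum>k\<in>B. \<Sum>l\<in>B. \<bar>b k l\<bar>)" if "form b" "g \<in> \<G>" "i \<in> B" "j \<in> B" for b g i j
  proof -
    have "\<bar>b (g i) (g j)\<bar> = \<bar>\<Sum>k\<in>B. \<Sum>l\<in>B. ?r (g i) k * ?r (g j) l * b k l\<bar>"
      using that stable[OF that(2)] BW by (subst bilinear_form_on_expand[OF _ B]) (auto simp: W form_def)
    also have "\<dots> \<le> (\<Sum>k\<in>B. \<Sum>l\<in>B. \<bar>?r (g i) k * ?r (g j) l * b k l\<bar>)"
      by (rule order_trans[OF sum_abs]) (intro sum_mono sum_abs)
    also have "\<dots> \<le> (\<Sum>k\<in>B. \<Sum>l\<in>B. M\<^sup>2 * \<bar>b k l\<bar>)"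
      unfolding abs_mult power2_eq_square
      using M that M_nonneg by (intro sum_mono mult_mono mult_nonneg_nonneg) auto
    finally show ?thesis by (simp add: sum_distrib_left)
  qed
  \<comment> \<open>A constant, independent of g, that compares the norms of a form before and after
    moving it: the entries of g are bounded by \<open>M\<close>, and Cauchy-Schwarz bounds the
    square of the sum of |b k l| by n^2 E. The 1 makes it positive.\<close>
  define K where "K = n\<^sup>2 * (M\<^sup>2)\<^sup>2 * n\<^sup>2 + 1"
  have K_pos: "K > 0" unfolding K_def by (intro add_nonneg_pos) auto
  have E_le: "E b g \<le> K * E b id'" if "form b" "g \<in> \<G>" for b g
  proof -
    let ?S = "\<Sum>k\<in>B. \<Sum>l\<in>B. \<bar>b k l\<bar>"
    have "?S\<^sup>2 = (\<Sum>p\<in>B \<times> B. \<bar>b (fst p) (snd p)\<bar>)\<^sup>2" by (simp add: sum.cartesian_product case_prod_unfold)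
    also have "\<dots> \<le> real (card (B \<times> B)) * (\<Sum>p\<in>B \<times> B. \<bar>b (fst p) (snd p)\<bar>\<^sup>2)"
      using sum_squared_le_sum_of_squares[of "\<lambda>p. \<bar>b (fst p) (snd p)\<bar>" "B \<times> B"] by (simp add: mult.commute)
    also have "\<dots> = n\<^sup>2 * E b id'"
      by (simp add: E_def id'_def sum.cartesian_product case_prod_unfold card_cartesian_product n_def power2_eq_square)
    finally have S: "?S\<^sup>2 \<le> n\<^sup>2 * E b id'" .
    have "E b g \<le> (\<Sum>i\<in>B. \<Sum>j\<in>B. (M\<^sup>2 * ?S)\<^sup>2)"
      unfolding E_def
    proof (intro sum_mono)
      fix i j assume "i \<in> B" "j \<in> B"
      from power_mono[OF E_bound[OF that this] abs_ge_zero, of 2]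
      show "(b (g i) (g j))\<^sup>2 \<le> (M\<^sup>2 * ?S)\<^sup>2" by simp
    qed
    also have "\<dots> = n\<^sup>2 * (M\<^sup>2)\<^sup>2 * ?S\<^sup>2" by (simp add: n_def power2_eq_square)
    also have "\<dots> \<le> n\<^sup>2 * (M\<^sup>2)\<^sup>2 * (n\<^sup>2 * E b id')" using S by (intro mult_left_mono) auto
    also have "\<dots> \<le> K * E b id'" using E_nonneg[of b id'] by (simp add: K_def algebra_simps)
    finally show ?thesis .
  qed
  have form_comp: "form (\<lambda>u v. b (g u) (g v))" if "form b" "g \<in> \<G>" for b g
    using that(1) lin[OF that(2)] stable[OF that(2)] unfolding form_def bilinear_form_on_def by simp
  have E_ge: "E b id' \<le> K * E b g" if b: "form b" and g: "g \<in> \<G>" for b g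
  proof -
    obtain h where h: "h \<in> \<G>" "\<And>u. u \<in> W \<Longrightarrow> g (h u) = u" using inverse[OF g] by blast
    have "E b id' = E (\<lambda>u v. b (g u) (g v)) h"
      unfolding E_def id'_def using h(2) BW by (intro sum.cong refl) simp
    also have "\<dots> \<le> K * E (\<lambda>u v. b (g u) (g v)) id'"
      by (rule E_le[OF form_comp[OF b g] h(1)])
    finally show ?thesis by (simp add: E_def id'_def)
  qed
  define q where "q u v = (\<Sum>i\<in>B. ?r u i * ?r v i)" for u v
  have form_q: "form q"
    unfolding form_def bilinear_form_on_def
    using subW B by (auto simp: q_def W representation_add representation_scale algebra_simps sum.distrib sum_distrib_left)
  have q_pos: "q u u > 0" if "u \<in> W" "u \<noteq> 0" for u
  proof -
    have "\<exists>i\<in>B. ?r u i \<noteq> 0"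
      using representation_expand[OF B, of u] that by (force intro: ccontr simp: W)
    then obtain i where "i \<in> B" "?r u i \<noteq> 0" by blast
    then show ?thesis unfolding q_def
      by (intro sum_pos2[OF B(1), of i]) (auto simp: zero_less_mult_iff linorder_neq_iff)
  qed
  \<comment> \<open>Without the lower bound by \<open>q\<close> the zero form would be the
    minimiser. Demanding the bound after every g keeps the set stable under the group.\<close>
  define A where "A = {b. form b \<and> (\<forall>g\<in>\<G>. \<forall>u\<in>W. b (g u) (g u) \<ge> q u u)}"
  have A_mid: "(\<lambda>u v. (b u v + b' u v) / 2) \<in> A" if "b \<in> A" "b' \<in> A" for b b'
  proof -
    have f: "form b" "form b'" and q: "\<And>g u. g \<in> \<G> \<Longrightarrow> u \<in> W \<Longrightarrow> q u u \<le> b (g u) (g u)"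
      "\<And>g u. g \<in> \<G> \<Longrightarrow> u \<in> W \<Longrightarrow> q u u \<le> b' (g u) (g u)"
      using that unfolding A_def by auto
    have "form (\<lambda>u v. (b u v + b' u v) / 2)"
      using f unfolding form_def bilinear_form_on_def by (simp add: add_divide_distrib distrib_left)
    moreover have "q u u \<le> (b (g u) (g u) + b' (g u) (g u)) / 2" if "g \<in> \<G>" "u \<in> W" for g u
      using q(1)[OF that] q(2)[OF that] by simp
    ultimately show ?thesis unfolding A_def by blast
  qed
  have form_scale: "form (\<lambda>u v. c * b u v)" if "form b" for b c
    using that unfolding form_def bilinear_form_on_def by (auto simp: algebra_simps)
  have form_diff: "form (\<lambda>u v. b u v - b' u v)" if "form b" "form b'" for b b'
    using that unfolding form_def bilinear_form_on_def by (auto simp: algebra_simps)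
  \<comment> \<open>A large multiple of \<open>q\<close> qualifies: with h inverse to g, the value
    of \<open>q\<close> at u = h (g u) is bounded by its value at g u, since the entries of h are
    bounded by \<open>M\<close>.\<close>
  have A_nonempty: "(\<lambda>u v. (n * M\<^sup>2 * n + 1) * q u v) \<in> A"
  proof -
    have "q u u \<le> (n * M\<^sup>2 * n + 1) * q (g u) (g u)" if g: "g \<in> \<G>" and u: "u \<in> W" for g u
    proof -
      obtain h where h: "h \<in> \<G>" "\<And>u. u \<in> W \<Longrightarrow> g (h u) = u" using inverse[OF g] by blast
      \<comment> \<open>Inverses are given on one side only; inverting \<open>h\<close> once more
        shows that it is inverse to g on the other side too.\<close>
      obtain h' where h': "h' \<in> \<G>" "\<And>u. u \<in> W \<Longrightarrow> h (h' u) = u" using inverse[OF h(1)] by blast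
      have hg: "h (g u) = u"
        using h(2)[OF stable[OF h'(1) u]] h'(2)[OF u] by simp
      define w where "w = g u"
      have wW: "w \<in> W" unfolding w_def by (rule stable[OF g u])
      have hw: "?r (h w) i = (\<Sum>j\<in>B. ?r w j * ?r (h j) i)" for i
      proof -
        have "h (\<Sum>j\<in>J. s (?r w j) j) = (\<Sum>j\<in>J. s (?r w j) (h j))" if "J \<subseteq> B" "finite J" for J
          using that(2,1)
        proof (induction J rule: finite_induct)
          case empty
          then show ?case using lin(2)[OF h(1), of 0 0] subspace_0[OF subW] by simp
        next
          case (insert j J)
          have "(\<Sum>j\<in>J. s (?r w j) j) \<in> W" "s (?r w j) j \<in> W" "j \<in> W"
            using insert.prems BW subW by (auto intro!: subspace_sum subspace_scale)
          then show ?case using insert lin[OF h(1)] by simp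
        qed
        from this[of B] have "h w = (\<Sum>j\<in>B. s (?r w j) (h j))"
          using representation_expand[OF B, of w] wW B by (simp add: W)
        moreover have "?r (\<Sum>j\<in>B. s (?r w j) (h j)) i = (\<Sum>j\<in>B. ?r (s (?r w j) (h j)) i)"
          using stable[OF h(1)] BW B subW by (subst representation_sum) (auto simp: W intro!: span_scale)
        moreover have "?r (s (?r w j) (h j)) i = ?r w j * ?r (h j) i" if "j \<in> B" for j
          using stable[OF h(1) BW[OF that]] B by (simp add: representation_scale W)
        ultimately show ?thesis by simp
      qed
      have "(?r (h w) i)\<^sup>2 \<le> M\<^sup>2 * n * q w w" if "i \<in> B" for i
      proof -
        have "\<bar>?r (h w) i\<bar> \<le> (\<Sum>j\<in>B. \<bar>?r w j\<bar> * M)"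
          unfolding hw using M[OF that _ h(1)]
          by (intro order_trans[OF sum_abs] sum_mono) (auto simp: abs_mult intro: mult_left_mono)
        also have "\<dots> = M * (\<Sum>j\<in>B. \<bar>?r w j\<bar>)" by (simp add: sum_distrib_left mult.commute)
        finally have "\<bar>?r (h w) i\<bar>\<^sup>2 \<le> (M * (\<Sum>j\<in>B. \<bar>?r w j\<bar>))\<^sup>2" by (intro power_mono) auto
        also have "\<dots> = M\<^sup>2 * (\<Sum>j\<in>B. \<bar>?r w j\<bar>)\<^sup>2" by (simp add: power_mult_distrib)
        also have "\<dots> \<le> M\<^sup>2 * (n * (\<Sum>j\<in>B. \<bar>?r w j\<bar>\<^sup>2))"
          using sum_squared_le_sum_of_squares[of "\<lambda>j. \<bar>?r w j\<bar>" B]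
          by (intro mult_left_mono) (auto simp: n_def mult.commute)
        finally show ?thesis by (simp add: q_def power2_eq_square mult.assoc)
      qed
      then have "(\<Sum>i\<in>B. (?r (h w) i)\<^sup>2) \<le> (\<Sum>i\<in>B. M\<^sup>2 * n * q w w)" by (rule sum_mono)
      then have "q u u \<le> n * M\<^sup>2 * n * q w w"
        using hg by (simp add: w_def q_def power2_eq_square n_def algebra_simps)
      also have "\<dots> \<le> (n * M\<^sup>2 * n + 1) * q w w"
        unfolding q_def by (intro mult_right_mono sum_nonneg) auto
      finally show ?thesis by (simp add: w_def)
    qed
    then show ?thesis unfolding A_def using form_scale[OF form_q] by simp
  qed
  \<comment> \<open>Here \<open>c\<close> bounds the norms along the whole orbit of
    \<open>b\<close>, so \<open>I\<close> is the infimum over all forms of the supremum over the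
    orbit.\<close>
  define P where "P b c \<longleftrightarrow> b \<in> A \<and> (\<forall>g\<in>\<G>. E b g \<le> c) \<and> c \<ge> 0" for b c
  define I where "I = Inf {c. \<exists>b. P b c}"
  have bdd: "bdd_below {c. \<exists>b. P b c}" unfolding bdd_below_def P_def by blast
  have ne: "{c. \<exists>b. P b c} \<noteq> {}"
  proof -
    let ?b = "\<lambda>u v. (n * M\<^sup>2 * n + 1) * q u v"
    have "P ?b (K * E ?b id')" unfolding P_def
      using A_nonempty E_le[OF form_scale[OF form_q]] K_pos E_nonneg[of ?b id'] by simp
    then show ?thesis by blast
  qed
  have I_le: "I \<le> c" if "P b c" for b c
    unfolding I_def using that by (intro cInf_lower[OF _ bdd]) blast
  \<comment> \<open>The midpoint belongs to the set again, and at each g its norm lies below the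
    average of the bounds by a quarter of the norm of the difference. Uniformly in g the latter is
    at least 1 / K times its value at the identity, so nearly minimal forms are close to each
    other.\<close>
  have near: "E (\<lambda>u v. b u v - b' u v) id' \<le> 4 * K * ((c + c') / 2 - I)" if b: "P b c" and b': "P b' c'" for b b' c c'
  proof -
    let ?d = "\<lambda>u v. b u v - b' u v" and ?m = "\<lambda>u v. (b u v + b' u v) / 2"
    have fd: "form ?d" using b b' unfolding P_def A_def by (intro form_diff) auto
    have Em: "E ?m g \<le> (c + c') / 2 - E ?d id' / (4 * K)" if g: "g \<in> \<G>" for g
    proof -
      have "E ?m g = E b g / 2 + E b' g / 2 - E ?d g / 4"
        unfolding E_def sum_divide_distrib sum.distrib[symmetric] sum_subtractf[symmetric]
        by (intro sum.cong refl) (simp add: power2_eq_square field_simps)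
      moreover have "E ?d id' / K \<le> E ?d g" using E_ge[OF fd g] K_pos by (simp add: pos_divide_le_eq mult.commute)
      moreover have "E b g \<le> c" "E b' g \<le> c'" using b b' g unfolding P_def by auto
      ultimately show ?thesis by (simp add: field_simps)
    qed
    have "P ?m ((c + c') / 2 - E ?d id' / (4 * K))"
      unfolding P_def
    proof (intro conjI ballI)
      show "?m \<in> A" using A_mid b b' unfolding P_def by blast
      show "0 \<le> (c + c') / 2 - E ?d id' / (4 * K)" using Em[OF ident] E_nonneg[of ?m] order_trans by blast
    qed (rule Em)
    from I_le[OF this] show ?thesis using K_pos by (simp add: field_simps)
  qed
  have "\<exists>b c. P b c \<and> c < I + inverse (real (Suc m))" for m
    using cInf_lessD[OF ne, of "I + inverse (real (Suc m))"] unfolding I_def by auto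
  then obtain \<beta> c where \<beta>: "\<And>m. P (\<beta> m) (c m)" and c: "\<And>m. c m < I + inverse (real (Suc m))"
    by metis
  have \<beta>_form: "form (\<beta> m)" for m using \<beta>[of m] unfolding P_def A_def by blast
  have "Cauchy (\<lambda>m. \<beta> m i j)" if ij: "i \<in> B" "j \<in> B" for i j
  proof (rule metric_CauchyI)
    fix e :: real assume e: "e > 0"
    define \<delta> where "\<delta> = e\<^sup>2 / (4 * K)"
    have "\<delta> > 0" using e K_pos by (simp add: \<delta>_def)
    then obtain N where N: "inverse (real (Suc N)) < \<delta>" using reals_Archimedean by blast
    have "dist (\<beta> m i j) (\<beta> l i j) < e" if "m \<ge> N" "l \<ge> N" for m l
    proof -
      have small: "inverse (real (Suc k)) < \<delta>" if "k \<ge> N" for k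
        using that N by (meson le_imp_inverse_le of_nat_0_less_iff of_nat_le_iff Suc_le_mono order.strict_trans1 zero_less_Suc)
      have "(\<beta> m i j - \<beta> l i j)\<^sup>2 \<le> (\<Sum>j\<in>B. (\<beta> m i j - \<beta> l i j)\<^sup>2)"
        using ij B by (intro member_le_sum) auto
      also have "\<dots> \<le> E (\<lambda>u v. \<beta> m u v - \<beta> l u v) id'"
        unfolding E_def id'_def using ij B
        by (intro member_le_sum[of i B "\<lambda>i. \<Sum>j\<in>B. (\<beta> m i j - \<beta> l i j)\<^sup>2"]) (auto intro: sum_nonneg)
      also have "\<dots> \<le> 4 * K * ((c m + c l) / 2 - I)" by (rule near[OF \<beta> \<beta>])
      also have "\<dots> < 4 * K * \<delta>"
      proof (rule mult_strict_left_mono)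
        show "(c m + c l) / 2 - I < \<delta>"
          using c[of m] c[of l] small[OF that(1)] small[OF that(2)] by argo
      qed (use K_pos in simp)
      also have "\<dots> = e\<^sup>2" using K_pos by (simp add: \<delta>_def)
      finally have "\<bar>\<beta> m i j - \<beta> l i j\<bar>\<^sup>2 < e\<^sup>2" by simp
      then have "\<bar>\<beta> m i j - \<beta> l i j\<bar> < e" by (rule power2_less_imp_less) (use e in simp)
      then show ?thesis by (simp add: dist_real_def)
    qed
    then show "\<exists>N. \<forall>m\<ge>N. \<forall>l\<ge>N. dist (\<beta> m i j) (\<beta> l i j) < e" by blast
  qed
  then have "\<exists>L. (\<lambda>m. \<beta> m i j) \<longlonglongrightarrow> L" if "i \<in> B" "j \<in> B" for i j
    using that Cauchy_convergent_iff convergent_def by blast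
  then obtain L where L: "\<And>i j. i \<in> B \<Longrightarrow> j \<in> B \<Longrightarrow> (\<lambda>m. \<beta> m i j) \<longlonglongrightarrow> L i j" by metis
  define b where "b u v = (\<Sum>i\<in>B. \<Sum>j\<in>B. ?r u i * ?r v j * L i j)" for u v
  have lim: "(\<lambda>m. \<beta> m u v) \<longlonglongrightarrow> b u v" if "u \<in> W" "v \<in> W" for u v
  proof -
    have "(\<lambda>m. \<beta> m u v) = (\<lambda>m. \<Sum>i\<in>B. \<Sum>j\<in>B. ?r u i * ?r v j * \<beta> m i j)"
      using that \<beta>_form by (intro ext bilinear_form_on_expand[OF _ B]) (auto simp: W form_def)
    then show ?thesis unfolding b_def by (auto intro!: tendsto_sum tendsto_mult tendsto_const L)
  qed
  have form_b: "form b"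
    unfolding form_def bilinear_form_on_def
  proof (intro conjI ballI allI)
    fix u v w and r :: real assume uvw: "u \<in> W" "v \<in> W"
    have *: "bilinear_form_on W (\<beta> m)" for m using \<beta>_form[of m] by (simp add: form_def)
    show "b u v = b v u"
      by (rule LIMSEQ_unique[OF lim[OF uvw]]) (use lim[OF uvw(2,1)] bilinear_form_onD(2)[OF *, OF uvw] in simp)
    show "b (s r u) v = r * b u v"
      by (rule LIMSEQ_unique[OF lim])
        (use uvw subW tendsto_mult[OF tendsto_const lim[OF uvw], of r] bilinear_form_onD(5)[OF * uvw] in \<open>auto simp: subspace_scale\<close>)
    assume w: "w \<in> W"
    show "b (u + v) w = b u w + b v w"
      by (rule LIMSEQ_unique[OF lim])
        (use uvw w subW tendsto_add[OF lim[OF uvw(1) w] lim[OF uvw(2) w]] bilinear_form_onD(3)[OF * uvw w] in \<open>auto simp: subspace_add\<close>)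
  qed (rule subW)
  have bA: "b \<in> A" unfolding A_def
  proof (intro CollectI conjI ballI form_b)
    fix g u assume g: "g \<in> \<G>" and u: "u \<in> W"
    have "q u u \<le> \<beta> m (g u) (g u)" for m using \<beta>[of m] g u unfolding P_def A_def by blast
    then show "q u u \<le> b (g u) (g u)"
      using LIMSEQ_le_const[OF lim[OF stable[OF g u] stable[OF g u]]] by blast
  qed
  have bE: "E b g \<le> I" if g: "g \<in> \<G>" for g
  proof (rule LIMSEQ_le)
    show "(\<lambda>m. E (\<beta> m) g) \<longlonglongrightarrow> E b g"
      unfolding E_def using stable[OF g] BW by (intro tendsto_sum tendsto_power lim) auto
    show "(\<lambda>m. I + inverse (real (Suc m))) \<longlonglongrightarrow> I"
      using tendsto_add[OF tendsto_const LIMSEQ_inverse_real_of_nat, of I] by simp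
    have "E (\<beta> m) g \<le> I + inverse (real (Suc m))" for m
      using \<beta>[of m] c[of m] g unfolding P_def by fastforce
    then show "\<exists>N. \<forall>m\<ge>N. E (\<beta> m) g \<le> I + inverse (real (Suc m))" by blast
  qed
  have I0: "I \<ge> 0" using bE[OF ident] E_nonneg[of b] order_trans by blast
  have Pb: "P b I" unfolding P_def using bA bE I0 by blast
  \<comment> \<open>The orbit of the moved form is contained in that of \<open>b\<close>, so the
    moved form satisfies the bound \<open>I\<close> as well; by \<open>near\<close> the two forms
    have distance 0.\<close>
  have inv: "b (g u) (g v) = b u v" if g: "g \<in> \<G>" and uv: "u \<in> W" "v \<in> W" for g u v
  proof -
    let ?b = "\<lambda>u v. b (g u) (g v)"
    have "?b \<in> A"
      unfolding A_def using form_comp[OF form_b g] bA comp[OF g] unfolding A_def by auto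
    moreover have "E ?b h \<le> I" if "h \<in> \<G>" for h
      using bE[OF comp[OF g that]] by (simp add: E_def)
    ultimately have "P ?b I" unfolding P_def using I0 by blast
    from near[OF Pb this] have "E (\<lambda>u v. b u v - ?b u v) id' \<le> 0" by simp
    then have z: "(\<Sum>i\<in>B. \<Sum>j\<in>B. (b i j - ?b i j)\<^sup>2) = 0"
      using E_nonneg[of "\<lambda>u v. b u v - ?b u v" id'] unfolding E_def id'_def by simp
    have "b i j = ?b i j" if "i \<in> B" "j \<in> B" for i j
    proof -
      have "(\<Sum>j\<in>B. (b i j - ?b i j)\<^sup>2) = 0"
        using z B(1) that sum_nonneg_eq_0_iff[of B "\<lambda>i. \<Sum>j\<in>B. (b i j - ?b i j)\<^sup>2"] by (auto simp: sum_nonneg)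
      then show ?thesis using B(1) that sum_nonneg_eq_0_iff[of B "\<lambda>j. (b i j - ?b i j)\<^sup>2"] by auto
    qed
    moreover have "bilinear_form_on (span B) b" "bilinear_form_on (span B) ?b"
      using form_b form_comp[OF form_b g] by (simp_all add: form_def W)
    ultimately show ?thesis
      using uv bilinear_form_on_expand[OF _ B, of b u v] bilinear_form_on_expand[OF _ B, of ?b u v] by (simp add: W)
  qed
  have "b u u > 0" if "u \<in> W" "u \<noteq> 0" for u
  proof -
    have "\<forall>g\<in>\<G>. q u u \<le> b (g u) (g u)" using bA that(1) unfolding A_def by blast
    from bspec[OF this ident] have "q u u \<le> b u u" .
    then show ?thesis using q_pos[OF that] by linarith
  qed
  then show ?thesis
    using form_b inv unfolding inner_product_on_def form_def by blast
qed

end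

section \<open>Orthonormal bases and orthogonal projections\<close>

context real_scaled
begin

definition orthonormal_on :: "('v \<Rightarrow> 'v \<Rightarrow> real) \<Rightarrow> 'v set \<Rightarrow> bool" where
  "orthonormal_on b E \<longleftrightarrow> finite E \<and> (\<forall>u\<in>E. \<forall>v\<in>E. b u v = (if u = v then 1 else 0))"

lemma inner_product_onD:
  assumes "inner_product_on W b"
  shows "bilinear_form_on W b" "u \<in> W \<Longrightarrow> u \<noteq> 0 \<Longrightarrow> b u u > 0"
  using assms unfolding inner_product_on_def by blast+

lemma orthonormal_expand:
  assumes b: "bilinear_form_on W b" and E: "orthonormal_on b E" "E \<subseteq> W" and e: "e \<in> E"
  shows "b (\<Sum>i\<in>E. s (r i) i) e = r e"
proof -
  have "b (\<Sum>i\<in>E. s (r i) i) e = (\<Sum>i\<in>E. r i * b i e)"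
    using E e by (intro bilinear_form_on_sum(1)[OF b]) auto
  also have "\<dots> = (\<Sum>i\<in>E. if i = e then r i else 0)"
    using E e unfolding orthonormal_on_def by (intro sum.cong) auto
  also have "\<dots> = r e" using E e by (simp add: orthonormal_on_def)
  finally show ?thesis .
qed

lemma orthonormal_independent:
  assumes b: "bilinear_form_on W b" and E: "orthonormal_on b E" "E \<subseteq> W"
  shows "independent E"
proof (rule independent_if_scalars_zero)
  show "finite E" using E by (simp add: orthonormal_on_def)
  fix f x assume "(\<Sum>x\<in>E. s (f x) x) = 0" "x \<in> E"
  then show "f x = 0"
    using orthonormal_expand[OF b E, of x f] bilinear_form_on_zero[OF b, of x] E by auto
qed

text \<open>An orthonormal subset of maximal cardinality spans \<open>N\<close>, since otherwise one
  Gram-Schmidt step would enlarge it. A maximum exists because orthonormal sets are independent,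
  which bounds their size by that of \<open>B\<close>.\<close>

lemma orthonormal_basis_exists:
  assumes b: "inner_product_on W b" and N: "subspace N" "N \<subseteq> W" and B: "finite B" "W \<subseteq> span B"
  obtains E where "orthonormal_on b E" "E \<subseteq> N" "span E = N"
proof -
  note bf = inner_product_onD(1)[OF b]
  let ?P = "\<lambda>E. orthonormal_on b E \<and> E \<subseteq> N"
  have bound: "card E \<le> card B" if "?P E" for E
  proof -
    have "independent E" using orthonormal_independent[OF bf] that N by blast
    moreover have "E \<subseteq> span B" using that N B by blast
    ultimately show ?thesis using independent_span_bound[OF B(1)] by blast
  qed
  have "?P {}" by (simp add: orthonormal_on_def)
  then obtain E where E: "?P E" "\<And>E'. ?P E' \<Longrightarrow> card E' \<le> card E"
    using ex_has_greatest_nat[of ?P "{}" card "Suc (card B)"] bound by (metis le_imp_less_Suc)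
  have fE: "finite E" using E by (simp add: orthonormal_on_def)
  have "N \<subseteq> span E"
  proof
    fix x assume x: "x \<in> N"
    show "x \<in> span E"
    proof (rule ccontr)
      assume n: "x \<notin> span E"
      define y where "y = (\<Sum>e\<in>E. s (b x e) e)"
      have y: "y \<in> span E" unfolding y_def by (intro span_sum span_scale span_base)
      have yN: "y \<in> N" using y span_minimal[of E N] E N by blast
      define z where "z = x - y"
      have zN: "z \<in> N" unfolding z_def using x yN N by (intro subspace_diff)
      have "z \<noteq> 0" using n y by (auto simp: z_def)
      then have zz: "b z z > 0" using inner_product_onD(2)[OF b] zN N by blast
      have orth: "b z e = 0" if e: "e \<in> E" for e
      proof -
        have "b z e = b x e - b y e"
          unfolding z_def using bilinear_form_on_diff[OF bf] x yN e E N by blast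
        then show ?thesis using orthonormal_expand[OF bf _ _ e, of "b x"] E N unfolding y_def by auto
      qed
      define w where "w = s (1 / sqrt (b z z)) z"
      have wN: "w \<in> N" unfolding w_def using zN N by (intro subspace_scale)
      have we: "b w e = 0" "b e w = 0" if e: "e \<in> E" for e
      proof -
        have zW: "z \<in> W" "e \<in> W" using e zN E N by auto
        show "b w e = 0" unfolding w_def using bilinear_form_onD(5)[OF bf zW] orth[OF e] by simp
        then show "b e w = 0" using bilinear_form_onD(2)[OF bf, of w e] wN zW N by auto
      qed
      have ww: "b w w = 1"
      proof -
        have W: "z \<in> W" "w \<in> W" using zN wN N by auto
        have "b w w = 1 / sqrt (b z z) * b z w"
          using bilinear_form_onD(5)[OF bf W, of "1 / sqrt (b z z)"] by (simp add: w_def[symmetric])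
        also have "b z w = 1 / sqrt (b z z) * b z z"
          using bilinear_form_onD(6)[OF bf W(1) W(1), of "1 / sqrt (b z z)"] by (simp add: w_def[symmetric])
        finally show ?thesis using zz by (simp add: field_simps)
      qed
      have "w \<notin> E" using we(1) ww by force
      moreover have "?P (insert w E)"
        using E(1) wN we ww unfolding orthonormal_on_def by auto
      ultimately show False using E(2)[of "insert w E"] fE by simp
    qed
  qed
  moreover have "span E \<subseteq> N" using span_minimal[of E N] E N by blast
  ultimately show thesis using that E by blast
qed

definition orth_proj :: "('v \<Rightarrow> 'v \<Rightarrow> real) \<Rightarrow> 'v set \<Rightarrow> 'v \<Rightarrow> 'v" where
  "orth_proj b N v = (THE x. x \<in> N \<and> (\<forall>n\<in>N. b (v - x) n = 0))"

context
  fixes W N B b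
  assumes b: "inner_product_on W b" and N: "subspace N" "N \<subseteq> W" and B: "finite B" "W \<subseteq> span B"
begin

lemma orth_proj_unique:
  assumes "v \<in> W" "x \<in> N" "\<And>n. n \<in> N \<Longrightarrow> b (v - x) n = 0" "y \<in> N" "\<And>n. n \<in> N \<Longrightarrow> b (v - y) n = 0"
  shows "x = y"
proof (rule ccontr)
  assume ne: "x \<noteq> y"
  note bf = inner_product_onD(1)[OF b] and W = bilinear_form_onD(1)[OF inner_product_onD(1)[OF b]]
  have xyN: "x - y \<in> N" using assms N by (intro subspace_diff)
  have in_W: "x \<in> W" "y \<in> W" "x - y \<in> W" using assms xyN N by auto
  have "b (v - y) (x - y) - b (v - x) (x - y) = b ((v - y) - (v - x)) (x - y)"
    using bilinear_form_on_diff[OF bf, of "v - y" "v - x" "x - y"] in_W assms(1) W by (simp add: subspace_diff)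
  then have "b (x - y) (x - y) = 0" using assms(3,5)[OF xyN] by simp
  moreover have "b (x - y) (x - y) > 0" using inner_product_onD(2)[OF b in_W(3)] ne by simp
  ultimately show False by simp
qed

lemma orth_proj:
  assumes v: "v \<in> W"
  shows "orth_proj b N v \<in> N" "\<And>n. n \<in> N \<Longrightarrow> b (v - orth_proj b N v) n = 0"
proof -
  note bf = inner_product_onD(1)[OF b] and W = bilinear_form_onD(1)[OF inner_product_onD(1)[OF b]]
  obtain E where E: "orthonormal_on b E" "E \<subseteq> N" "span E = N"
    using orthonormal_basis_exists[OF b N B] by blast
  have EW: "E \<subseteq> W" using E N by blast
  define x where "x = (\<Sum>e\<in>E. s (b v e) e)"
  have x: "x \<in> N" unfolding x_def E(3)[symmetric] by (intro span_sum span_scale span_base)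
  have "b (v - x) n = 0" if "n \<in> N" for n
  proof -
    have vx: "v - x \<in> W" using v x N W by (auto intro: subspace_diff)
    have e: "b (v - x) e = 0" if "e \<in> E" for e
    proof -
      have "b (v - x) e = b v e - b x e" using bilinear_form_on_diff[OF bf v] x that N EW by blast
      then show ?thesis using orthonormal_expand[OF bf E(1) EW that, of "b v"] by (simp add: x_def)
    qed
    have "n \<in> range (\<lambda>r. \<Sum>e\<in>E. s (r e) e)"
      using that E span_finite[of E] by (simp add: orthonormal_on_def)
    then obtain r where "n = (\<Sum>e\<in>E. s (r e) e)" by (rule rangeE)
    then have "b (v - x) n = (\<Sum>e\<in>E. r e * b (v - x) e)"
      using bilinear_form_on_sum(2)[OF bf _ vx, of E "\<lambda>e. e" r] EW by auto
    then show ?thesis using e by simp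
  qed
  with x have "\<exists>!x. x \<in> N \<and> (\<forall>n\<in>N. b (v - x) n = 0)"
    using orth_proj_unique[OF v] by blast
  from theI'[OF this] show "orth_proj b N v \<in> N" "\<And>n. n \<in> N \<Longrightarrow> b (v - orth_proj b N v) n = 0"
    unfolding orth_proj_def by blast+
qed

lemma orth_proj_eqI:
  assumes "v \<in> W" "x \<in> N" "\<And>n. n \<in> N \<Longrightarrow> b (v - x) n = 0"
  shows "orth_proj b N v = x"
  using orth_proj_unique[OF assms(1) orth_proj(1)[OF assms(1)] orth_proj(2)[OF assms(1)] assms(2,3)] by simp

lemma orth_proj_id: "v \<in> N \<Longrightarrow> orth_proj b N v = v"
  using N bilinear_form_on_zero(1)[OF inner_product_onD(1)[OF b]] by (intro orth_proj_eqI) auto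

lemma orth_proj_add:
  assumes u: "u \<in> W" and v: "v \<in> W"
  shows "orth_proj b N (u + v) = orth_proj b N u + orth_proj b N v"
proof (rule orth_proj_eqI)
  note bf = inner_product_onD(1)[OF b] and W = bilinear_form_onD(1)[OF inner_product_onD(1)[OF b]]
  let ?p = "orth_proj b N"
  show "u + v \<in> W" using u v W by (rule_tac subspace_add)
  show "?p u + ?p v \<in> N" using orth_proj(1)[OF u] orth_proj(1)[OF v] N by (intro subspace_add)
  fix n assume n: "n \<in> N"
  have "u - ?p u \<in> W" "v - ?p v \<in> W" "n \<in> W"
    using orth_proj(1)[OF u] orth_proj(1)[OF v] u v n N W by (auto intro!: subspace_diff)
  then have "b ((u - ?p u) + (v - ?p v)) n = 0"
    using bilinear_form_onD(3)[OF bf] orth_proj(2)[OF u n] orth_proj(2)[OF v n] by simp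
  then show "b (u + v - (?p u + ?p v)) n = 0" by (simp add: algebra_simps)
qed

text \<open>Orthogonality to \<open>N\<close> is preserved by \<open>T\<close>, because
  \<open>b (T x) n\<close> equals \<open>c * b x n - b x (T n)\<close> and \<open>T n\<close> is in
  \<open>N\<close> again. Both components of a vector are thus respected.\<close>

lemma orth_proj_commute:
  assumes T: "\<And>u v. u \<in> W \<Longrightarrow> v \<in> W \<Longrightarrow> T (u + v) = T u + T v"
    and TW: "\<And>u. u \<in> W \<Longrightarrow> T u \<in> W" and TN: "\<And>u. u \<in> N \<Longrightarrow> T u \<in> N"
    and skew: "\<And>u v. u \<in> W \<Longrightarrow> v \<in> W \<Longrightarrow> b (T u) v + b u (T v) = c * b u v"
    and v: "v \<in> W"
  shows "orth_proj b N (T v) = T (orth_proj b N v)"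
proof (rule orth_proj_eqI)
  note W = bilinear_form_onD(1)[OF inner_product_onD(1)[OF b]]
  let ?p = "orth_proj b N v"
  have pW: "?p \<in> W" "v - ?p \<in> W" using orth_proj(1)[OF v] v N W by (auto intro: subspace_diff)
  show "T v \<in> W" by (rule TW[OF v])
  show "T ?p \<in> N" by (rule TN[OF orth_proj(1)[OF v]])
  fix n assume n: "n \<in> N"
  have "T v = T (v - ?p) + T ?p" using T[OF pW(2,1)] by simp
  then have "b (T v - T ?p) n = b (T (v - ?p)) n" by simp
  also have "\<dots> = c * b (v - ?p) n - b (v - ?p) (T n)" using skew[OF pW(2), of n] n N by auto
  also have "\<dots> = 0" using orth_proj(2)[OF v n] orth_proj(2)[OF v TN[OF n]] by simp
  finally show "b (T v - T ?p) n = 0" .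
qed

end

end

section \<open>Schur's lemma\<close>

context vector_space
begin

text \<open>Here \<open>fold_coeffs\<close> runs Horner's scheme, so the expression is p(T) v. A
  linear relation among the first n + 1 iterates of \<open>v\<close> is a polynomial of degree at
  most n that annihilates \<open>v\<close>.\<close>

lemma independent_powers_poly:
  assumes "\<And>p::'a poly. p \<noteq> 0 \<Longrightarrow> degree p \<le> n \<Longrightarrow> fold_coeffs (\<lambda>a x. scale a v + T x) p 0 \<noteq> 0"
    and T: "\<And>x y. T (x + y) = T x + T y" "\<And>a x. T (scale a x) = scale a (T x)"
  shows "\<exists>S. finite S \<and> card S = Suc n \<and> independent S \<and> S \<subseteq> range (\<lambda>i. (T ^^ i) v)"
proof -
  define act where "act p = fold_coeffs (\<lambda>a x. scale a v + T x) p 0" for p :: "'a poly"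
  have T0: "T 0 = 0" using T(2)[of 0 0] by simp
  have act_pCons: "act (pCons a p) = scale a v + T (act p)" for a p
    unfolding act_def by (cases "a = 0 \<and> p = 0") (auto simp: T0)
  have act0: "act 0 = 0" by (simp add: act_def)
  have act_add: "act (p + q) = act p + act q" for p q
    by (induction p q rule: poly_induct2) (simp_all add: act0 act_pCons T scale_left_distrib)
  have act_monom: "act (monom a i) = scale a ((T ^^ i) v)" for a i
    by (induction i) (simp_all add: monom_0 monom_Suc act_pCons act0 T0 T)
  have act_sum: "act (\<Sum>i\<in>I. f i) = (\<Sum>i\<in>I. act (f i))" for f and I :: "nat set"
    by (induction I rule: infinite_finite_induct) (simp_all add: act0 act_add)
  have key: "\<forall>i\<le>n. a i = 0" if "(\<Sum>i\<le>n. scale (a i) ((T ^^ i) v)) = 0" for a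
  proof (rule ccontr)
    assume "\<not> (\<forall>i\<le>n. a i = 0)"
    then obtain i where i: "i \<le> n" "a i \<noteq> 0" by blast
    define p where "p = (\<Sum>i\<le>n. monom (a i) i)"
    have "coeff p i = a i" using i by (simp add: p_def coeff_sum)
    then have "p \<noteq> 0" using i by auto
    moreover have "degree p \<le> n"
      unfolding p_def by (intro degree_sum_le) (auto intro: order_trans[OF degree_monom_le])
    moreover have "act p = 0" unfolding p_def act_sum act_monom using that .
    ultimately show False using assms(1)[of p] by (simp add: act_def)
  qed
  let ?f = "\<lambda>i. (T ^^ i) v"
  have inj: "inj_on ?f {..n}"
  proof (rule inj_onI, rule ccontr)
    fix i j assume ij: "i \<in> {..n}" "j \<in> {..n}" "?f i = ?f j" "i \<noteq> j"
    \<comment> \<open>Equality of two iterates is also a relation, with coefficients 1 and -1; hence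
      the iterates are distinct and their number is as claimed.\<close>
    let ?a = "\<lambda>k. if k = i then 1 else if k = j then - 1 else (0::'a)"
    have "(\<Sum>k\<le>n. scale (?a k) (?f k)) = (\<Sum>k\<in>{i, j}. scale (?a k) (?f k))"
      using ij by (intro sum.mono_neutral_right) auto
    also have "\<dots> = 0" using ij by simp
    finally have "?a i = 0" using key[of ?a] ij by blast
    then show False by simp
  qed
  have "independent (?f ` {..n})"
  proof (rule independent_if_scalars_zero)
    fix g x assume g: "(\<Sum>x\<in>?f ` {..n}. scale (g x) x) = 0" and x: "x \<in> ?f ` {..n}"
    have "(\<Sum>i\<le>n. scale (g (?f i)) (?f i)) = 0" using g by (simp add: sum.reindex[OF inj])
    from key[OF this] x show "g x = 0" by auto
  qed simp
  moreover have "card (?f ` {..n}) = Suc n" using inj by (simp add: card_image)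
  ultimately show ?thesis by (intro exI[of _ "?f ` {..n}"]) auto
qed

end

text \<open>Some nonzero p has p(T) v = 0, because the iterates of \<open>v\<close> stay in a
  finite-dimensional space. Take p of minimal degree and split off a root z: the cofactor q has
  smaller degree, so q(T) v is nonzero, and it is an eigenvector for z.\<close>

lemma eigenvector_exists:
  fixes sc :: "complex \<Rightarrow> 'v::ab_group_add \<Rightarrow> 'v"
  assumes vs: "vector_space sc" and B: "finite B" and W: "module.subspace sc W" "W \<subseteq> module.span sc B"
    and T: "Vector_Spaces.linear sc sc T" and TW: "\<And>x. x \<in> W \<Longrightarrow> T x \<in> W" and v: "v \<in> W" "v \<noteq> 0"
  obtains z x where "x \<in> W" "x \<noteq> 0" "T x = sc z x"
proof -
  interpret vector_space sc by fact
  interpret T: Vector_Spaces.linear sc sc T by fact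
  note T_add = T.add and T_scale = T.scale
  have T0: "T 0 = 0" using T_scale[of 0 0] by simp
  define act where "act p = fold_coeffs (\<lambda>a x. sc a v + T x) p 0" for p :: "complex poly"
  have act_pCons: "act (pCons a p) = sc a v + T (act p)" for a p
    unfolding act_def by (cases "a = 0 \<and> p = 0") (auto simp: T0)
  have act0: "act 0 = 0" by (simp add: act_def)
  have act_add: "act (p + q) = act p + act q" for p q
    by (induction p q rule: poly_induct2) (simp_all add: act0 act_pCons T_add scale_left_distrib)
  have act_smult: "act (smult a p) = sc a (act p)" for a p
    by (induction p) (simp_all add: act0 act_pCons T_scale scale_right_distrib)
  have act_W: "act p \<in> W" for p
    by (induction p) (auto simp: act0 act_pCons intro!: subspace_0[OF W(1)] subspace_add[OF W(1)] subspace_scale[OF W(1)] TW v)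
  have "\<exists>p. p \<noteq> 0 \<and> act p = 0"
  proof (rule ccontr)
    assume "\<nexists>p. p \<noteq> 0 \<and> act p = 0"
    then obtain S where S: "finite S" "card S = Suc (card B)" "independent S" "S \<subseteq> range (\<lambda>i. (T ^^ i) v)"
      using independent_powers_poly[of "card B" v T] T_add T_scale unfolding act_def by metis
    have "(T ^^ i) v \<in> W" for i by (induction i) (auto intro: v TW)
    then have "S \<subseteq> span B" using S(4) W(2) by blast
    then show False using independent_span_bound[OF B S(3)] S(2) by simp
  qed
  then obtain p where p: "p \<noteq> 0" "act p = 0" and min: "\<And>q. q \<noteq> 0 \<Longrightarrow> act q = 0 \<Longrightarrow> degree p \<le> degree q"
    using arg_min_nat_lemma[of "\<lambda>p. p \<noteq> 0 \<and> act p = 0" _ degree] by (metis (mono_tags, lifting))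
  have "degree p \<noteq> 0"
  proof
    assume "degree p = 0"
    then obtain a where a: "p = [:a:]" using degree_eq_zeroE by blast
    then have "sc a v = 0" using p(2) by (simp add: act_pCons act0 T0)
    then show False using v(2) a p(1) by simp
  qed
  then have "\<not> constant (poly p)" by (simp add: constant_degree)
  then obtain z where "poly p z = 0" using fundamental_theorem_of_algebra by blast
  then obtain q where q: "p = [:- z, 1:] * q" by (auto simp: poly_eq_0_iff_dvd elim: dvdE)
  have q0: "q \<noteq> 0" using p(1) q by auto
  have "degree q < degree p" using q0 degree_mult_eq[of "[:- z, 1:]" q] unfolding q by simp
  then have x0: "act q \<noteq> 0" using min[OF q0] by fastforce
  have "p = smult (- z) q + pCons 0 q" using q by simp
  then have "act p = sc (- z) (act q) + T (act q)" by (simp only: act_add act_smult act_pCons) simp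
  then have "T (act q) = sc z (act q)" using p(2) by (simp add: add_eq_0_iff)
  with x0 act_W that show thesis by blast
qed

section \<open>Enveloping algebras and induced modules\<close>

lemma sum_keys_superset:
  assumes "finite S" "Poly_Mapping.keys p \<subseteq> S" "\<And>k. f k 0 = 0"
  shows "(\<Sum>k\<in>Poly_Mapping.keys p. f k (Poly_Mapping.lookup p k)) = (\<Sum>k\<in>S. f k (Poly_Mapping.lookup p k))"
  using assms by (intro sum.mono_neutral_left) (auto simp: in_keys_iff)

lemma sum_keys_add:
  assumes "\<And>k. f k 0 = 0" "\<And>k a b. f k (a + b) = f k a + f k b"
  shows "(\<Sum>k\<in>Poly_Mapping.keys (p + q). f k (Poly_Mapping.lookup (p + q) k)) =
    (\<Sum>k\<in>Poly_Mapping.keys p. f k (Poly_Mapping.lookup p k)) + (\<Sum>k\<in>Poly_Mapping.keys q. f k (Poly_Mapping.lookup q k))"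
proof -
  let ?S = "Poly_Mapping.keys p \<union> Poly_Mapping.keys q"
  have "(\<Sum>k\<in>Poly_Mapping.keys r. f k (Poly_Mapping.lookup r k)) = (\<Sum>k\<in>?S. f k (Poly_Mapping.lookup r k))"
    if "Poly_Mapping.keys r \<subseteq> ?S" for r
    using that by (intro sum_keys_superset assms(1)) auto
  from this[of p] this[of q] this[of "p + q"] show ?thesis
    using keys_add[of p q] by (simp add: lookup_add assms(2) sum.distrib)
qed

lemma poly_mapping_single_induct:
  fixes p :: "'a \<Rightarrow>\<^sub>0 'b::comm_monoid_add"
  assumes "P 0" "\<And>k a. P (Poly_Mapping.single k a)" "\<And>p q. P p \<Longrightarrow> P q \<Longrightarrow> P (p + q)"
  shows "P p"
proof (induction p rule: update_induct)
  case (update f a b)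
  have "Poly_Mapping.update a b f = f + Poly_Mapping.single a b"
    using update(1) by (intro poly_mapping_eqI) (auto simp: lookup_update lookup_add lookup_single in_keys_iff when_def)
  then show ?case using assms(2,3) update by simp
qed (rule assms(1))

lemma free_algebra_simps [simp]:
  "carrier (free_algebra H) = {p. \<forall>w\<in>Poly_Mapping.keys p. set (letters w) \<subseteq> H}"
  "x \<otimes>\<^bsub>free_algebra H\<^esub> y = x * y" "\<one>\<^bsub>free_algebra H\<^esub> = 1"
  "x \<oplus>\<^bsub>free_algebra H\<^esub> y = x + y" "\<zero>\<^bsub>free_algebra H\<^esub> = 0"
  by (simp_all add: free_algebra_def)

lemma letters_simps [simp]: "letters (0 :: 'a free_monoid) = []" "letters (u + v) = letters u @ letters v"
  by (simp_all add: zero_free_monoid_def plus_free_monoid_def)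

lemma ring_free_algebra: "ring (free_algebra H)"
proof -
  have add: "p + q \<in> carrier (free_algebra H)" if "p \<in> carrier (free_algebra H)" "q \<in> carrier (free_algebra H)" for p q
    using that keys_add[of p q] by fastforce
  have mult: "p * q \<in> carrier (free_algebra H)" if "p \<in> carrier (free_algebra H)" "q \<in> carrier (free_algebra H)" for p q
    using that keys_mult[of p q] by fastforce
  show ?thesis
  proof (rule ringI)
    show "abelian_group (free_algebra H)"
    proof (rule abelian_groupI)
      fix p assume "p \<in> carrier (free_algebra H)"
      then have "- p \<in> carrier (free_algebra H)" by simp
      then show "\<exists>q\<in>carrier (free_algebra H). q \<oplus>\<^bsub>free_algebra H\<^esub> p = \<zero>\<^bsub>free_algebra H\<^esub>"
        by (intro bexI[of _ "- p"]) simp_all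
    next
      show "p \<oplus>\<^bsub>free_algebra H\<^esub> q \<in> carrier (free_algebra H)"
        if "p \<in> carrier (free_algebra H)" "q \<in> carrier (free_algebra H)" for p q
        using add[OF that] by (simp only: free_algebra_simps(4))
    qed (simp_all add: add.assoc add.commute)
    show "Group.monoid (free_algebra H)"
    proof (rule monoidI)
      show "p \<otimes>\<^bsub>free_algebra H\<^esub> q \<in> carrier (free_algebra H)"
        if "p \<in> carrier (free_algebra H)" "q \<in> carrier (free_algebra H)" for p q
        using mult[OF that] by (simp only: free_algebra_simps(2))
    qed (simp_all add: mult.assoc)
  qed (simp_all add: distrib_left distrib_right)
qed

lemma free_algebra_minus [simp]:
  assumes "p \<in> carrier (free_algebra H)"
  shows "\<ominus>\<^bsub>free_algebra H\<^esub> p = - p"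
proof -
  interpret ring "free_algebra H" by (rule ring_free_algebra)
  have "- p \<in> carrier (free_algebra H)" using assms by simp
  then show ?thesis using minus_equality[of "- p" p] assms by simp
qed

lemma free_var_in [simp]: "free_var X \<in> carrier (free_algebra H) \<longleftrightarrow> X \<in> H"
  by (simp add: free_var_def)

lemma free_const_in [simp]: "free_const z \<in> carrier (free_algebra H)"
  by (simp add: free_const_def)

lemma free_const_one: "free_const 1 = 1"
  by (simp add: free_const_def)

lemma free_const_commute: "free_const z * p = p * free_const z"
  by (induction p rule: poly_mapping_single_induct)
    (simp_all add: free_const_def mult_single algebra_simps mult.commute)

lemma free_act_single: 
  assumes "vector_space sc"
  shows "free_act sc \<rho> (Poly_Mapping.single w a) v = sc a (foldr \<rho> (letters w) v)"
proof -
  interpret vector_space sc by fact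
  show ?thesis by (simp add: free_act_def)
qed

text \<open>Nothing is required of the dependence of \<open>\<rho> X\<close> on X. Therefore
  \<open>inflated_rep\<close> qualifies on the whole type, although outside the sum of
  \<open>\<kappa>\<close> and \<open>q\<close> its value rests on an unspecified choice.\<close>

locale free_action = vector_space sc for sc :: "complex \<Rightarrow> 'v::ab_group_add \<Rightarrow> 'v" +
  fixes \<rho> :: "'a \<Rightarrow> 'v \<Rightarrow> 'v"
  assumes \<rho>_linear: "\<And>X. Vector_Spaces.linear sc sc (\<rho> X)"
begin

abbreviation act where "act \<equiv> free_act sc \<rho>"

lemmas act_single = free_act_single[OF vector_space_axioms]

lemma \<rho>_add: "\<rho> X (u + v) = \<rho> X u + \<rho> X v"
  and \<rho>_scale: "\<rho> X (sc z v) = sc z (\<rho> X v)"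
proof -
  interpret Vector_Spaces.linear sc sc "\<rho> X" by (rule \<rho>_linear)
  show "\<rho> X (u + v) = \<rho> X u + \<rho> X v" "\<rho> X (sc z v) = sc z (\<rho> X v)" by (rule add, rule scale)
qed

lemma \<rho>_zero [simp]: "\<rho> X 0 = 0"
  using \<rho>_scale[of X 0 0] by simp

lemma foldr_add: "foldr \<rho> w (u + v) = foldr \<rho> w u + foldr \<rho> w v"
  by (induction w) (simp_all add: \<rho>_add)

lemma foldr_scale: "foldr \<rho> w (sc z v) = sc z (foldr \<rho> w v)"
  by (induction w) (simp_all add: \<rho>_scale)

lemma act_zero [simp]: "act 0 v = 0"
  by (simp add: free_act_def)

lemma act_add: "act (p + q) v = act p v + act q v"
  unfolding free_act_def by (rule sum_keys_add) (simp_all add: scale_left_distrib)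

lemma act_uminus: "act (- p) v = - act p v"
  using act_add[of p "- p" v] by (simp add: eq_neg_iff_add_eq_0 add.commute)

lemma act_diff: "act (p - q) v = act p v - act q v"
  using act_add[of p "- q" v] by (simp add: act_uminus)

lemma act_add_right: "act p (u + v) = act p u + act p v"
  by (simp add: free_act_def foldr_add scale_right_distrib sum.distrib)

lemma act_zero_right [simp]: "act p 0 = 0"
  using act_add_right[of p 0 0] by simp

lemma act_mult: "act (p * q) v = act p (act q v)"
proof (induction p rule: poly_mapping_single_induct)
  case (2 w a)
  show ?case
  proof (induction q rule: poly_mapping_single_induct)
    case (2 u b)
    then show ?case by (simp add: mult_single act_single foldr_scale)
  qed (simp_all add: distrib_left act_add act_add_right)
qed (simp_all add: distrib_right act_add)

lemma act_var: "act (free_var X) v = \<rho> X v"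
  by (simp add: free_var_def act_single)

lemma act_const: "act (free_const z) v = sc z v"
  by (simp add: free_const_def act_single)

lemma act_stable:
  assumes "subspace \<tau>" "\<And>X t. X \<in> H \<Longrightarrow> t \<in> \<tau> \<Longrightarrow> \<rho> X t \<in> \<tau>" "p \<in> carrier (free_algebra H)" "t \<in> \<tau>"
  shows "act p t \<in> \<tau>"
proof -
  have "foldr \<rho> w t \<in> \<tau>" if "set w \<subseteq> H" for w
    using that by (induction w) (auto intro: assms)
  then show ?thesis
    unfolding free_act_def using assms(1,3) by (intro subspace_sum subspace_scale) auto
qed

end

locale enveloping =
  fixes s :: "complex \<Rightarrow> 'a::ab_group_add \<Rightarrow> 'a" and br :: "'a \<Rightarrow> 'a \<Rightarrow> 'a" and H :: "'a set"
  assumes H_add: "\<And>X Y. X \<in> H \<Longrightarrow> Y \<in> H \<Longrightarrow> X + Y \<in> H" and H_scale: "\<And>z X. X \<in> H \<Longrightarrow> s z X \<in> H"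
    and H_bracket: "\<And>X Y. X \<in> H \<Longrightarrow> Y \<in> H \<Longrightarrow> br X Y \<in> H"
begin

abbreviation I where "I \<equiv> uea_ideal s br H"
abbreviation A where "A \<equiv> free_algebra H"
abbreviation cls where "cls \<equiv> uea_class s br H"

lemma uea_relations_in:
  shows "{free_var (X + Y) - free_var X - free_var Y | X Y. X \<in> H \<and> Y \<in> H} \<union>
      {free_var (s z X) - free_const z * free_var X | z X. X \<in> H} \<union>
      {free_var X * free_var Y - free_var Y * free_var X - free_var (br X Y) | X Y. X \<in> H \<and> Y \<in> H}
    \<subseteq> carrier A"
proof -
  have minus: "p - q \<in> carrier A" if "p \<in> carrier A" "q \<in> carrier A" for p q
    using that keys_diff[of p q] by fastforce
  have mult: "p * q \<in> carrier A" if "p \<in> carrier A" "q \<in> carrier A" for p q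
    using that keys_mult[of p q] by fastforce
  have "free_var (X + Y) - free_var X - free_var Y \<in> carrier A"
    "free_var X * free_var Y - free_var Y * free_var X - free_var (br X Y) \<in> carrier A"
    if "X \<in> H" "Y \<in> H" for X Y
    using that H_add H_bracket by (intro minus mult iffD2[OF free_var_in]; blast)+
  moreover have "free_var (s z X) - free_const z * free_var X \<in> carrier A" if "X \<in> H" for z X
    by (intro minus mult iffD2[OF free_var_in] free_const_in H_scale that)
  ultimately show ?thesis by blast
qed

lemma ideal_I: "ideal I A"
  unfolding uea_ideal_def
  by (rule ring.genideal_ideal[OF ring_free_algebra uea_relations_in])

lemma relations_in_I:
  "X \<in> H \<Longrightarrow> Y \<in> H \<Longrightarrow> free_var (X + Y) - free_var X - free_var Y \<in> I"
  "X \<in> H \<Longrightarrow> free_var (s z X) - free_const z * free_var X \<in> I"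
  "X \<in> H \<Longrightarrow> Y \<in> H \<Longrightarrow> free_var X * free_var Y - free_var Y * free_var X - free_var (br X Y) \<in> I"
proof -
  note sub = subsetD[OF ring.genideal_self[OF ring_free_algebra uea_relations_in], folded uea_ideal_def]
  show "X \<in> H \<Longrightarrow> Y \<in> H \<Longrightarrow> free_var (X + Y) - free_var X - free_var Y \<in> I"
    by (rule sub, rule UnI1, rule UnI1) blast
  show "X \<in> H \<Longrightarrow> free_var (s z X) - free_const z * free_var X \<in> I"
    by (rule sub, rule UnI1, rule UnI2) blast
  show "X \<in> H \<Longrightarrow> Y \<in> H \<Longrightarrow> free_var X * free_var Y - free_var Y * free_var X - free_var (br X Y) \<in> I"
    by (rule sub, rule UnI2) blast
qed

lemma I_sub: "p \<in> I \<Longrightarrow> p \<in> carrier A"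
  using ideal.Icarr[OF ideal_I] .

lemma I_add: "p \<in> I \<Longrightarrow> q \<in> I \<Longrightarrow> p + q \<in> I"
  using additive_subgroup.a_closed[OF ideal.axioms(1)[OF ideal_I]] by simp

lemma I_zero: "0 \<in> I"
  using additive_subgroup.zero_closed[OF ideal.axioms(1)[OF ideal_I]] by simp

lemma I_uminus: "p \<in> I \<Longrightarrow> - p \<in> I"
proof -
  assume p: "p \<in> I"
  have "(- 1) * p \<in> I" using ideal.I_l_closed[OF ideal_I p, of "- 1"] by simp
  then show ?thesis by simp
qed

lemma I_mult: "p \<in> I \<Longrightarrow> x \<in> carrier A \<Longrightarrow> x * p \<in> I" "p \<in> I \<Longrightarrow> x \<in> carrier A \<Longrightarrow> p * x \<in> I"
  using ideal.I_l_closed[OF ideal_I, of p x] ideal.I_r_closed[OF ideal_I, of p x] by simp_all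

lemma cls_eq: "cls p = {i + p | i. i \<in> I}"
  unfolding uea_class_def a_r_coset_def' by auto

lemma cls_self: "p \<in> cls p"
  unfolding cls_eq using I_zero by (intro CollectI exI[of _ 0]) simp

lemma cls_eq_iff: "cls p = cls q \<longleftrightarrow> p - q \<in> I"
proof
  assume "cls p = cls q"
  then have "p \<in> cls q" using cls_self[of p] by simp
  then show "p - q \<in> I" unfolding cls_eq by auto
next
  have sub: "cls p \<subseteq> cls q" if "p - q \<in> I" for p q
  proof
    fix x assume "x \<in> cls p"
    then obtain i where i: "i \<in> I" "x = i + p" unfolding cls_eq by blast
    then have "x = (i + (p - q)) + q" by simp
    moreover have "i + (p - q) \<in> I" using I_add[OF i(1) that] .
    ultimately show "x \<in> cls q" unfolding cls_eq by blast
  qed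
  assume "p - q \<in> I"
  moreover from this have "q - p \<in> I" using I_uminus[of "p - q"] by simp
  ultimately show "cls p = cls q" using sub by blast
qed

text \<open>The definitions pass from a class to some representative; this is how such choices are
  removed, once the ideal is known to act by zero.\<close>

lemma cls_some: "(SOME p'. p' \<in> cls p) - p \<in> I"
proof -
  have "(SOME p'. p' \<in> cls p) \<in> cls p" using cls_self by (rule someI)
  then show ?thesis unfolding cls_eq by auto
qed

lemma uea_simps:
  shows "carrier (uea s br H) = cls ` carrier A"
    and "p \<in> carrier A \<Longrightarrow> q \<in> carrier A \<Longrightarrow> cls p \<otimes>\<^bsub>uea s br H\<^esub> cls q = cls (p * q)"
    and "p \<in> carrier A \<Longrightarrow> q \<in> carrier A \<Longrightarrow> cls p \<oplus>\<^bsub>uea s br H\<^esub> cls q = cls (p + q)"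
proof -
  show "carrier (uea s br H) = cls ` carrier A"
    unfolding uea_def FactRing_def A_RCOSETS_def' uea_class_def by auto
  assume pq: "p \<in> carrier A" "q \<in> carrier A"
  show "cls p \<otimes>\<^bsub>uea s br H\<^esub> cls q = cls (p * q)"
    using ideal.rcoset_mult_add[OF ideal_I pq] unfolding uea_def FactRing_def uea_class_def by simp
  show "cls p \<oplus>\<^bsub>uea s br H\<^esub> cls q = cls (p + q)"
    using ideal.a_rcos_sum[OF ideal_I pq] unfolding uea_def FactRing_def uea_class_def by simp
qed

lemma I_minimal:
  assumes "ideal J A"
    "\<And>X Y. X \<in> H \<Longrightarrow> Y \<in> H \<Longrightarrow> free_var (X + Y) - free_var X - free_var Y \<in> J"
    "\<And>z X. X \<in> H \<Longrightarrow> free_var (s z X) - free_const z * free_var X \<in> J"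
    "\<And>X Y. X \<in> H \<Longrightarrow> Y \<in> H \<Longrightarrow> free_var X * free_var Y - free_var Y * free_var X - free_var (br X Y) \<in> J"
  shows "I \<subseteq> J"
  unfolding uea_ideal_def by (rule ring.genideal_minimal[OF ring_free_algebra assms(1)]) (use assms(2-4) in blast)

text \<open>The elements that annihilate \<open>\<tau>\<close> form a two-sided ideal, where
  stability of \<open>\<tau>\<close> accounts for multiplication from the right, and this ideal
  contains the defining relations.\<close>

lemma I_annihilates:
  assumes act: "free_action sc \<rho>" and \<tau>: "module.subspace sc \<tau>"
    and stable: "\<And>X t. X \<in> H \<Longrightarrow> t \<in> \<tau> \<Longrightarrow> \<rho> X t \<in> \<tau>"
    and add: "\<And>X Y t. X \<in> H \<Longrightarrow> Y \<in> H \<Longrightarrow> t \<in> \<tau> \<Longrightarrow> \<rho> (X + Y) t = \<rho> X t + \<rho> Y t"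
    and scale: "\<And>z X t. X \<in> H \<Longrightarrow> t \<in> \<tau> \<Longrightarrow> \<rho> (s z X) t = sc z (\<rho> X t)"
    and bracket: "\<And>X Y t. X \<in> H \<Longrightarrow> Y \<in> H \<Longrightarrow> t \<in> \<tau> \<Longrightarrow> \<rho> (br X Y) t = \<rho> X (\<rho> Y t) - \<rho> Y (\<rho> X t)"
    and p: "p \<in> I" and t: "t \<in> \<tau>"
  shows "free_act sc \<rho> p t = 0"
proof -
  interpret free_action sc \<rho> by fact
  interpret R: ring A by (rule ring_free_algebra)
  let ?J = "{p \<in> carrier A. \<forall>t\<in>\<tau>. act p t = 0}"
  have J: "ideal ?J A"
  proof (rule idealI[OF ring_free_algebra])
    show "subgroup ?J (add_monoid A)"
    proof (rule group.subgroupI[OF abelian_group.a_group[OF R.is_abelian_group]])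
      show "?J \<noteq> {}" by (rule ex_in_conv[THEN iffD1]) (rule exI[of _ 0], simp)
      fix p assume p: "p \<in> ?J"
      then have "inv\<^bsub>add_monoid A\<^esub> p = - p" using free_algebra_minus[of p H] unfolding a_inv_def by auto
      then show "inv\<^bsub>add_monoid A\<^esub> p \<in> ?J" using p by (simp add: act_uminus)
      fix q assume q: "q \<in> ?J"
      show "p \<otimes>\<^bsub>add_monoid A\<^esub> q \<in> ?J" using p q R.a_closed[of p q] by (simp del: free_algebra_simps(1) add: act_add)
    qed auto
    fix p x assume p: "p \<in> ?J" and x: "x \<in> carrier A"
    have "act x t \<in> \<tau>" if "t \<in> \<tau>" for t by (rule act_stable[OF \<tau> stable x that])
    then show "x \<otimes>\<^bsub>A\<^esub> p \<in> ?J" "p \<otimes>\<^bsub>A\<^esub> x \<in> ?J"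
      using p R.m_closed[OF x, of p] R.m_closed[OF _ x, of p] by (simp_all del: free_algebra_simps(1) add: act_mult)
  qed
  have "I \<subseteq> ?J"
  proof (rule I_minimal)
    show "ideal ?J A" by (rule J)
    fix X assume X: "X \<in> H"
    show "free_var (s z X) - free_const z * free_var X \<in> ?J" for z
      using I_sub[OF relations_in_I(2)[OF X]] X
      by (auto simp del: free_algebra_simps(1) simp: act_diff act_mult act_var act_const scale)
    fix Y assume Y: "Y \<in> H"
    show "free_var (X + Y) - free_var X - free_var Y \<in> ?J"
      using I_sub[OF relations_in_I(1)[OF X Y]] X Y
      by (auto simp del: free_algebra_simps(1) simp: act_diff act_var add)
    show "free_var X * free_var Y - free_var Y * free_var X - free_var (br X Y) \<in> ?J"
      using I_sub[OF relations_in_I(3)[OF X Y]] X Y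
      by (auto simp del: free_algebra_simps(1) simp: act_diff act_mult act_var bracket)
  qed
  then show ?thesis using p t by blast
qed

end

section \<open>Complexified representations and the subalgebra \<kappa> + q\<close>

lemma vector_space_cscale: "vector_space (cscale :: complex \<Rightarrow> 'e::real_vector \<times> 'e \<Rightarrow> _)"
  by unfold_locales (auto simp: cscale_def algebra_simps prod_eq_iff)

lemma crep_simps:
  assumes "vector_space sc" "\<And>X. Vector_Spaces.linear sc sc (\<pi> X)"
    and add: "\<And>X Y v. \<pi> (X + Y) v = \<pi> X v + \<pi> Y v"
    and scale: "\<And>r X v. \<pi> (r *\<^sub>R X) v = sc (complex_of_real r) (\<pi> X v)"
  shows "crep sc \<pi> (X + Y) v = crep sc \<pi> X v + crep sc \<pi> Y v"
    and "crep sc \<pi> (cscale z X) v = sc z (crep sc \<pi> X v)"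
    and "Vector_Spaces.linear sc sc (crep sc \<pi> X)"
    and "(\<And>X Y v. \<pi> (br X Y) v = \<pi> X (\<pi> Y v) - \<pi> Y (\<pi> X v)) \<Longrightarrow>
      crep sc \<pi> (cbracket br X Y) v = crep sc \<pi> X (crep sc \<pi> Y v) - crep sc \<pi> Y (crep sc \<pi> X v)"
    and "crep sc \<pi> (e, 0) v = \<pi> e v"
proof -
  interpret vector_space sc by fact
  have lin: "\<pi> X (u + v) = \<pi> X u + \<pi> X v" "\<pi> X (sc z v) = sc z (\<pi> X v)" for X u v z
  proof -
    interpret Vector_Spaces.linear sc sc "\<pi> X" by fact
    show "\<pi> X (u + v) = \<pi> X u + \<pi> X v" "\<pi> X (sc z v) = sc z (\<pi> X v)" by (rule add, rule scale)
  qed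
  have zero: "\<pi> 0 v = 0" for v using scale[of 0 0 v] by simp
  have minus: "\<pi> (X - Y) v = \<pi> X v - \<pi> Y v" for X Y v
    using add[of "X - Y" Y v] by (simp add: algebra_simps)
  show "crep sc \<pi> (X + Y) v = crep sc \<pi> X v + crep sc \<pi> Y v"
    by (simp add: crep_def add scale_right_distrib)
  have ii: "sc \<i> (sc \<i> u) = - u" for u by simp
  show "crep sc \<pi> (cscale z X) v = sc z (crep sc \<pi> X v)"
  proof -
    have "sc z (crep sc \<pi> X v) = sc (of_real (Re z) + \<i> * of_real (Im z)) (crep sc \<pi> X v)"
      by (simp add: complex_eq[symmetric])
    also have "\<dots> = crep sc \<pi> (cscale z X) v"
      by (simp add: crep_def cscale_def add minus scale scale_right_distrib scale_left_distrib scale_right_diff_distrib mult.commute algebra_simps)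
    finally show ?thesis by simp
  qed
  show "Vector_Spaces.linear sc sc (crep sc \<pi> X)"
    by (unfold_locales) (simp_all add: crep_def lin scale_right_distrib mult.commute algebra_simps)
  show "crep sc \<pi> (cbracket br X Y) v = crep sc \<pi> X (crep sc \<pi> Y v) - crep sc \<pi> Y (crep sc \<pi> X v)"
    if "\<And>X Y v. \<pi> (br X Y) v = \<pi> X (\<pi> Y v) - \<pi> Y (\<pi> X v)"
    by (simp add: crep_def cbracket_def add minus that lin scale_right_distrib scale_right_diff_distrib algebra_simps)
  show "crep sc \<pi> (e, 0) v = \<pi> e v" by (simp add: crep_def zero)
qed

locale induced_setup = vector_space sc for sc :: "complex \<Rightarrow> 'v::ab_group_add \<Rightarrow> 'v" +
  fixes br :: "'e::real_vector \<Rightarrow> 'e \<Rightarrow> 'e" and \<pi> :: "'e \<Rightarrow> 'v \<Rightarrow> 'v"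
    and \<kappa> q :: "('e \<times> 'e) set" and \<tau> :: "'v set"
  assumes \<pi>_linear: "\<And>X. Vector_Spaces.linear sc sc (\<pi> X)"
    and \<pi>_add: "\<And>X Y v. \<pi> (X + Y) v = \<pi> X v + \<pi> Y v"
    and \<pi>_scaleR: "\<And>r X v. \<pi> (r *\<^sub>R X) v = sc (complex_of_real r) (\<pi> X v)"
    and \<pi>_bracket: "\<And>X Y v. \<pi> (br X Y) v = \<pi> X (\<pi> Y v) - \<pi> Y (\<pi> X v)"
    and br_add: "\<And>X Y Z. br (X + Y) Z = br X Z + br Y Z" "\<And>X Y Z. br Z (X + Y) = br Z X + br Z Y"
    and \<kappa>_subspace: "module.subspace cscale \<kappa>" and q_subspace: "module.subspace cscale q"
    and \<kappa>_q: "\<And>X. X \<in> \<kappa> \<Longrightarrow> X \<in> q \<Longrightarrow> X = 0"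
    and \<kappa>_\<kappa>: "\<And>X Y. X \<in> \<kappa> \<Longrightarrow> Y \<in> \<kappa> \<Longrightarrow> cbracket br X Y \<in> \<kappa>"
    and \<kappa>_q_br: "\<And>X Y. X \<in> \<kappa> \<Longrightarrow> Y \<in> q \<Longrightarrow> cbracket br X Y \<in> q"
    and q_\<kappa>_br: "\<And>X Y. X \<in> q \<Longrightarrow> Y \<in> \<kappa> \<Longrightarrow> cbracket br X Y \<in> q"
    and q_q: "\<And>X Y. X \<in> q \<Longrightarrow> Y \<in> q \<Longrightarrow> cbracket br X Y \<in> q"
    and \<tau>_subspace: "subspace \<tau>"
    and \<kappa>_stable: "\<And>X t. X \<in> \<kappa> \<Longrightarrow> t \<in> \<tau> \<Longrightarrow> crep sc \<pi> X t \<in> \<tau>"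
begin

abbreviation H where "H \<equiv> sum_carrier \<kappa> q"

lemmas crep_add = crep_simps(1)[OF vector_space_axioms \<pi>_linear \<pi>_add \<pi>_scaleR]
  and crep_cscale = crep_simps(2)[OF vector_space_axioms \<pi>_linear \<pi>_add \<pi>_scaleR]
  and crep_linear = crep_simps(3)[OF vector_space_axioms \<pi>_linear \<pi>_add \<pi>_scaleR]
  and crep_bracket = crep_simps(4)[OF vector_space_axioms \<pi>_linear \<pi>_add \<pi>_scaleR \<pi>_bracket]
  and crep_real = crep_simps(5)[OF vector_space_axioms \<pi>_linear \<pi>_add \<pi>_scaleR]

sublocale cs: vector_space "cscale :: complex \<Rightarrow> 'e \<times> 'e \<Rightarrow> 'e \<times> 'e"
  by (rule vector_space_cscale)

lemma cbracket_add:
  "cbracket br (X + Y) Z = cbracket br X Z + cbracket br Y Z"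
  "cbracket br Z (X + Y) = cbracket br Z X + cbracket br Z Y"
  by (simp_all add: cbracket_def br_add prod_eq_iff)

lemma HE: "Z \<in> H \<Longrightarrow> (\<And>X Q. Z = X + Q \<Longrightarrow> X \<in> \<kappa> \<Longrightarrow> Q \<in> q \<Longrightarrow> P) \<Longrightarrow> P"
  unfolding sum_carrier_def by blast

lemma HI: "X \<in> \<kappa> \<Longrightarrow> Q \<in> q \<Longrightarrow> X + Q \<in> H"
  unfolding sum_carrier_def by blast

lemma H_add: "X \<in> H \<Longrightarrow> Y \<in> H \<Longrightarrow> X + Y \<in> H"
proof (elim HE)
  fix A B C D assume *: "X = A + B" "Y = C + D" "A \<in> \<kappa>" "B \<in> q" "C \<in> \<kappa>" "D \<in> q"
  have "(A + C) + (B + D) \<in> H"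
    by (intro HI cs.subspace_add \<kappa>_subspace q_subspace *)
  then show ?thesis using * by (simp add: algebra_simps)
qed

lemma H_cscale: "X \<in> H \<Longrightarrow> cscale z X \<in> H"
proof (elim HE)
  fix A B assume *: "X = A + B" "A \<in> \<kappa>" "B \<in> q"
  have "cscale z A + cscale z B \<in> H"
    by (intro HI cs.subspace_scale \<kappa>_subspace q_subspace *)
  then show ?thesis using * by (simp add: cs.scale_right_distrib)
qed

text \<open>Modulo \<open>q\<close> the bracket is that of the components in
  \<open>\<kappa>\<close>, so the projection to \<open>\<kappa>\<close> is a Lie homomorphism; this
  makes the inflated action a representation.\<close>

lemma cbracket_decomp:
  assumes "A \<in> \<kappa>" "B \<in> q" "C \<in> \<kappa>" "D \<in> q"
  shows "\<exists>Q\<in>q. cbracket br (A + B) (C + D) = cbracket br A C + Q"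
proof
  show "cbracket br (A + B) (C + D) = cbracket br A C + (cbracket br A D + (cbracket br B C + cbracket br B D))"
    by (simp add: cbracket_add algebra_simps)
  show "cbracket br A D + (cbracket br B C + cbracket br B D) \<in> q"
    by (intro cs.subspace_add q_subspace \<kappa>_q_br q_\<kappa>_br q_q assms)
qed

lemma H_bracket: "X \<in> H \<Longrightarrow> Y \<in> H \<Longrightarrow> cbracket br X Y \<in> H"
proof (elim HE)
  fix A B C D assume *: "X = A + B" "Y = C + D" "A \<in> \<kappa>" "B \<in> q" "C \<in> \<kappa>" "D \<in> q"
  then show ?thesis using cbracket_decomp[of A B C D] HI[OF \<kappa>_\<kappa>[of A C]] by auto
qed

sublocale E: enveloping cscale "cbracket br" "UNIV :: ('e \<times> 'e) set"
  by unfold_locales auto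

sublocale EH: enveloping cscale "cbracket br" H
  by unfold_locales (auto intro: H_add H_cscale H_bracket)

lemma carrier_UNIV [simp]: "p \<in> carrier (free_algebra UNIV)"
  by simp

abbreviation "cr \<equiv> crep sc \<pi>"
abbreviation "infl \<equiv> inflated_rep sc \<pi> \<kappa> q"

sublocale C: free_action sc cr
  by (intro free_action.intro vector_space_axioms free_action_axioms.intro crep_linear)

sublocale N: free_action sc infl
  by (intro free_action.intro vector_space_axioms free_action_axioms.intro) (simp add: inflated_rep_def crep_linear)

lemma infl_eq: "X \<in> \<kappa> \<Longrightarrow> Q \<in> q \<Longrightarrow> infl (X + Q) = cr X"
proof -
  assume X: "X \<in> \<kappa>" and Q: "Q \<in> q"
  have "(THE Y. Y \<in> \<kappa> \<and> X + Q - Y \<in> q) = X"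
  proof (rule the_equality)
    show "X \<in> \<kappa> \<and> X + Q - X \<in> q" using X Q by simp
    fix Y assume Y: "Y \<in> \<kappa> \<and> X + Q - Y \<in> q"
    have "X - Y \<in> \<kappa>" using X Y cs.subspace_diff[OF \<kappa>_subspace] by blast
    moreover have "(X + Q - Y) - Q \<in> q" using Q Y cs.subspace_diff[OF q_subspace] by blast
    ultimately have "X - Y = 0" using \<kappa>_q[of "X - Y"] by simp
    then show "Y = X" by simp
  qed
  then show ?thesis by (simp add: inflated_rep_def)
qed

lemma infl_\<kappa>: "X \<in> \<kappa> \<Longrightarrow> infl X = cr X"
  using infl_eq[of X 0] cs.subspace_0[OF q_subspace] by simp

lemma infl_stable: "X \<in> H \<Longrightarrow> t \<in> \<tau> \<Longrightarrow> infl X t \<in> \<tau>"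
  by (erule HE) (simp add: infl_eq \<kappa>_stable)

lemma act_infl_stable: "p \<in> carrier (free_algebra H) \<Longrightarrow> t \<in> \<tau> \<Longrightarrow> N.act p t \<in> \<tau>"
  by (rule N.act_stable[OF \<tau>_subspace infl_stable])

lemma IH_annihilates: "p \<in> EH.I \<Longrightarrow> t \<in> \<tau> \<Longrightarrow> N.act p t = 0"
proof (rule EH.I_annihilates[OF N.free_action_axioms \<tau>_subspace infl_stable])
  fix X Y t assume "X \<in> H" "Y \<in> H"
  then show "infl (X + Y) t = infl X t + infl Y t"
  proof (elim HE)
    fix A B C D assume *: "X = A + B" "Y = C + D" "A \<in> \<kappa>" "B \<in> q" "C \<in> \<kappa>" "D \<in> q"
    have "X + Y = (A + C) + (B + D)" using * by (simp add: algebra_simps)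
    moreover have "A + C \<in> \<kappa>" "B + D \<in> q" using * by (auto intro: cs.subspace_add \<kappa>_subspace q_subspace)
    ultimately show ?thesis using * by (simp only: infl_eq crep_add)
  qed
next
  fix z X t assume "X \<in> H"
  then show "infl (cscale z X) t = sc z (infl X t)"
  proof (elim HE)
    fix A B assume *: "X = A + B" "A \<in> \<kappa>" "B \<in> q"
    have "cscale z A \<in> \<kappa>" "cscale z B \<in> q" using * by (auto intro: cs.subspace_scale \<kappa>_subspace q_subspace)
    then show ?thesis using * by (simp only: cs.scale_right_distrib infl_eq crep_cscale)
  qed
next
  fix X Y t assume "X \<in> H" "Y \<in> H"
  then show "infl (cbracket br X Y) t = infl X (infl Y t) - infl Y (infl X t)"
  proof (elim HE)
    fix A B C D assume *: "X = A + B" "Y = C + D" "A \<in> \<kappa>" "B \<in> q" "C \<in> \<kappa>" "D \<in> q"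
    obtain Q where "Q \<in> q" "cbracket br X Y = cbracket br A C + Q"
      using cbracket_decomp[of A B C D] * by auto
    then show ?thesis using * \<kappa>_\<kappa>[of A C] by (simp only: infl_eq crep_bracket)
  qed
qed

lemma I_annihilates: "p \<in> E.I \<Longrightarrow> C.act p v = 0"
  by (rule E.I_annihilates[OF C.free_action_axioms subspace_UNIV])
    (auto simp: crep_add crep_cscale crep_bracket)

lemma act_cls_some: "C.act (SOME p'. p' \<in> E.cls p) v = C.act p v"
  using I_annihilates[OF E.cls_some[of p], of v] by (simp add: C.act_diff)

lemma uea_act_cls: "uea_act sc cr (E.cls p) v = C.act p v"
  by (simp add: uea_act_def act_cls_some)

text \<open>The defining relations over the subalgebra are among those over the full Lie algebra.
  Hence the map between the enveloping algebras is well defined, and right multiplication does not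
  depend on the chosen representative.\<close>

lemma IH_sub: "p \<in> EH.I \<Longrightarrow> p \<in> E.I"
proof -
  interpret R: ring "free_algebra H" by (rule ring_free_algebra)
  let ?J = "{p \<in> carrier (free_algebra H). p \<in> E.I}"
  have "ideal ?J (free_algebra H)"
  proof (rule idealI[OF ring_free_algebra])
    show "subgroup ?J (add_monoid (free_algebra H))"
    proof (rule group.subgroupI[OF abelian_group.a_group[OF R.is_abelian_group]])
      show "?J \<noteq> {}" by (rule ex_in_conv[THEN iffD1]) (rule exI[of _ 0], simp add: E.I_zero)
      fix p assume p: "p \<in> ?J"
      then have "inv\<^bsub>add_monoid (free_algebra H)\<^esub> p = - p" using free_algebra_minus[of p H] unfolding a_inv_def by auto
      then show "inv\<^bsub>add_monoid (free_algebra H)\<^esub> p \<in> ?J" using p by (simp add: E.I_uminus)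
      fix r assume r: "r \<in> ?J"
      show "p \<otimes>\<^bsub>add_monoid (free_algebra H)\<^esub> r \<in> ?J"
        using p r R.a_closed[of p r] by (simp del: free_algebra_simps(1) add: E.I_add)
    qed auto
    fix p x assume p: "p \<in> ?J" and x: "x \<in> carrier (free_algebra H)"
    then show "x \<otimes>\<^bsub>free_algebra H\<^esub> p \<in> ?J" "p \<otimes>\<^bsub>free_algebra H\<^esub> x \<in> ?J"
      using R.m_closed[OF x, of p] R.m_closed[OF _ x, of p] by (simp_all del: free_algebra_simps(1) add: E.I_mult)
  qed
  from EH.I_minimal[OF this] have "EH.I \<subseteq> ?J"
    using EH.I_sub[OF EH.relations_in_I(1)] EH.I_sub[OF EH.relations_in_I(2)] EH.I_sub[OF EH.relations_in_I(3)]
      E.relations_in_I by blast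
  then show "p \<in> EH.I \<Longrightarrow> p \<in> E.I" by blast
qed

lemma right_mult_cls:
  assumes "r \<in> carrier (free_algebra H)"
  shows "uea_right_mult br (E.cls p) (EH.cls r) = E.cls (p * r)"
proof -
  let ?r = "SOME r'. r' \<in> EH.cls r"
  have "uea_right_mult br (E.cls p) (EH.cls r) = E.cls (p * ?r)"
    unfolding uea_right_mult_def by (rule E.uea_simps(2)) simp_all
  also have "\<dots> = E.cls (p * r)"
    unfolding E.cls_eq_iff right_diff_distrib[symmetric]
    by (intro E.I_mult IH_sub EH.cls_some) simp
  finally show ?thesis .
qed

lemma uea_act_infl_cls:
  assumes "r \<in> carrier (free_algebra H)" "t \<in> \<tau>"
  shows "uea_act sc infl (EH.cls r) t = N.act r t"
  using IH_annihilates[OF EH.cls_some[of r] assms(2)] by (simp add: uea_act_def N.act_diff)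

end

section \<open>The induced module in terms of representatives\<close>

context induced_setup
begin

abbreviation U where "U \<equiv> uea cscale (cbracket br) (UNIV :: ('e \<times> 'e) set)"
abbreviation UH where "UH \<equiv> uea cscale (cbracket br) H"
abbreviation F where "F \<equiv> free_Abelian_group (carrier U \<times> \<tau>)"
abbreviation L where "L \<equiv> induced_module br sc \<pi> \<kappa> q \<tau>"
abbreviation L_act where "L_act \<equiv> induced_act br sc \<pi> \<kappa> q \<tau>"
abbreviation Rel where
  "Rel \<equiv> tensor_relations U \<tau> (carrier UH) (uea_right_mult br) (uea_act sc infl)"

text \<open>A representative of the pure tensor of p and t, indexed by p itself and not by its
  class, so that products can be computed in the free algebra.\<close>

definition ten :: "('e \<times> 'e) free_alg \<Rightarrow> 'v \<Rightarrow> (('e \<times> 'e) free_alg set \<times> 'v) \<Rightarrow>\<^sub>0 int" where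
  "ten p t = frag_of (E.cls p, t)"

definition gens where
  "gens = {ten (p + p') t - ten p t - ten p' t | p p' t. t \<in> \<tau>} \<union>
     {ten p (t + t') - ten p t - ten p t' | p t t'. t \<in> \<tau> \<and> t' \<in> \<tau>} \<union>
     {ten (p * r) t - ten p (N.act r t) | p r t. r \<in> carrier (free_algebra H) \<and> t \<in> \<tau>}"

lemma U_simps: "carrier U = range E.cls" "E.cls p \<otimes>\<^bsub>U\<^esub> E.cls r = E.cls (p * r)" "E.cls p \<oplus>\<^bsub>U\<^esub> E.cls r = E.cls (p + r)"
  using E.uea_simps by simp_all

lemma gens_cases [consumes 1, case_names add_left add_right mult]:
  assumes "x \<in> gens"
  obtains p p' t where "x = ten (p + p') t - ten p t - ten p' t" "t \<in> \<tau>"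
    | p t t' where "x = ten p (t + t') - ten p t - ten p t'" "t \<in> \<tau>" "t' \<in> \<tau>"
    | p r t where "x = ten (p * r) t - ten p (N.act r t)" "r \<in> carrier (free_algebra H)" "t \<in> \<tau>"
  using assms unfolding gens_def by blast

lemma gensI:
  "t \<in> \<tau> \<Longrightarrow> ten (p + p') t - ten p t - ten p' t \<in> gens"
  "t \<in> \<tau> \<Longrightarrow> t' \<in> \<tau> \<Longrightarrow> ten p (t + t') - ten p t - ten p t' \<in> gens"
  "r \<in> carrier (free_algebra H) \<Longrightarrow> t \<in> \<tau> \<Longrightarrow> ten (p * r) t - ten p (N.act r t) \<in> gens"
  unfolding gens_def by blast+

text \<open>Classes and their chosen representatives are eliminated from the tensor relations here
  once and for all; later arguments about relations go through \<open>gens\<close>.\<close>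

lemma Rel_eq: "Rel = generate F gens"
proof -
  let ?g = "frag_of :: (('e \<times> 'e) free_alg set \<times> 'v) \<Rightarrow> _"
  let ?A1 = "{?g (m \<oplus>\<^bsub>U\<^esub> m', n) - ?g (m, n) - ?g (m', n) | m m' n.
         m \<in> carrier U \<and> m' \<in> carrier U \<and> n \<in> \<tau>}"
  let ?A2 = "{?g (m, n + n') - ?g (m, n) - ?g (m, n') | m n n'. m \<in> carrier U \<and> n \<in> \<tau> \<and> n' \<in> \<tau>}"
  let ?A3 = "{?g (uea_right_mult br m r, n) - ?g (m, uea_act sc infl r n) | m r n.
         m \<in> carrier U \<and> r \<in> carrier UH \<and> n \<in> \<tau>}"
  have cls_in: "E.cls p \<in> carrier U" for p by (simp add: U_simps(1))
  have clsH_in: "EH.cls r \<in> carrier UH" if "r \<in> carrier (free_algebra H)" for r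
    unfolding EH.uea_simps(1) using that by (rule imageI)
  have U_obtain: "\<exists>p. m = E.cls p" if "m \<in> carrier U" for m
    using that by (auto simp: U_simps(1))
  have UH_obtain: "\<exists>r. r \<in> carrier (free_algebra H) \<and> m = EH.cls r" if "m \<in> carrier UH" for m
    using that unfolding EH.uea_simps(1) by (elim imageE) blast
  have e3: "?g (uea_right_mult br (E.cls p) (EH.cls r), n) - ?g (E.cls p, uea_act sc infl (EH.cls r) n) =
      ten (p * r) n - ten p (N.act r n)" if "r \<in> carrier (free_algebra H)" "n \<in> \<tau>" for p r n
    using right_mult_cls[OF that(1), of p] uea_act_infl_cls[OF that] by (simp add: ten_def)
  have e1: "?g (E.cls p \<oplus>\<^bsub>U\<^esub> E.cls p', n) - ?g (E.cls p, n) - ?g (E.cls p', n) =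
      ten (p + p') n - ten p n - ten p' n" for p p' n
    by (simp add: ten_def U_simps(3))
  have e2: "?g (E.cls p, n + n') - ?g (E.cls p, n) - ?g (E.cls p, n') = ten p (n + n') - ten p n - ten p n'" for p n n'
    by (simp add: ten_def)
  have a1: "x \<in> gens" if xA: "x \<in> ?A1" for x
  proof -
    obtain m m' n where *: "m \<in> carrier U" "m' \<in> carrier U" "n \<in> \<tau>" "x = ?g (m \<oplus>\<^bsub>U\<^esub> m', n) - ?g (m, n) - ?g (m', n)"
      using xA by blast
    obtain p p' where "m = E.cls p" "m' = E.cls p'" using U_obtain[OF *(1)] U_obtain[OF *(2)] by blast
    with * e1[of p p' n] show ?thesis unfolding gens_def by blast
  qed
  have a2: "x \<in> gens" if xA: "x \<in> ?A2" for x
  proof -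
    obtain m n n' where *: "m \<in> carrier U" "n \<in> \<tau>" "n' \<in> \<tau>" "x = ?g (m, n + n') - ?g (m, n) - ?g (m, n')"
      using xA by blast
    obtain p where "m = E.cls p" using U_obtain[OF *(1)] by blast
    with * e2[of p n n'] show ?thesis unfolding gens_def by blast
  qed
  have a3: "x \<in> gens" if xA: "x \<in> ?A3" for x
  proof -
    obtain m r' n where *: "m \<in> carrier U" "r' \<in> carrier UH" "n \<in> \<tau>"
      "x = ?g (uea_right_mult br m r', n) - ?g (m, uea_act sc infl r' n)"
      using xA by blast
    obtain p where p: "m = E.cls p" using U_obtain[OF *(1)] by blast
    obtain r where r: "r \<in> carrier (free_algebra H)" "r' = EH.cls r" using UH_obtain[OF *(2)] by blast
    with p * e3[OF r(1) *(3), of p] show ?thesis unfolding gens_def by blast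
  qed
  have a4: "x \<in> ?A1 \<union> ?A2 \<union> ?A3" if "x \<in> gens" for x
  proof -
    from that show ?thesis
    proof (cases rule: gens_cases)
      case a: (add_left p p' t)
      with e1[of p p' t] cls_in[of p] cls_in[of p'] have "x \<in> ?A1" by (intro CollectI) metis
      then show ?thesis by (rule UnI1[OF UnI1])
    next
      case b: (add_right p t t')
      with e2[of p t t'] cls_in[of p] have "x \<in> ?A2" by (intro CollectI) metis
      then show ?thesis by (rule UnI1[OF UnI2])
    next
      case c: (mult p r t)
      with e3[OF c(2,3), of p] cls_in[of p] clsH_in[OF c(2)] have "x \<in> ?A3" by (intro CollectI) metis
      then show ?thesis by (rule UnI2)
    qed
  qed
  have "?A1 \<union> ?A2 \<union> ?A3 = gens"
  proof (rule subset_antisym)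
    show "?A1 \<union> ?A2 \<union> ?A3 \<subseteq> gens"
      by (rule Un_least[OF Un_least]; rule subsetI) (rule a1 a2 a3, assumption)+
    show "gens \<subseteq> ?A1 \<union> ?A2 \<union> ?A3" by (rule subsetI) (rule a4)
  qed
  then show ?thesis unfolding tensor_relations_def by simp
qed

lemma ten_in: "t \<in> \<tau> \<Longrightarrow> ten p t \<in> carrier F"
  unfolding ten_def U_simps(1) by simp

lemma F_add: "x \<in> carrier F \<Longrightarrow> y \<in> carrier F \<Longrightarrow> x + y \<in> carrier F"
  using keys_add[of x y] by auto

lemma F_diff: "x \<in> carrier F \<Longrightarrow> y \<in> carrier F \<Longrightarrow> x - y \<in> carrier F"
  using keys_diff[of x y] by auto

lemma gens_in: "gens \<subseteq> carrier F"
proof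
  fix x assume "x \<in> gens"
  then show "x \<in> carrier F"
    by (cases rule: gens_cases)
      (simp_all only: F_diff ten_in act_infl_stable subspace_add[OF \<tau>_subspace])
qed

lemma Rel_subgroup: "subgroup Rel F"
  unfolding Rel_eq by (rule group.generate_is_subgroup[OF group_free_Abelian_group gens_in])

lemma Rel_in: "x \<in> Rel \<Longrightarrow> x \<in> carrier F"
  using subgroup.mem_carrier[OF Rel_subgroup] .

lemma Rel_zero: "0 \<in> Rel"
  using subgroup.one_closed[OF Rel_subgroup] by simp

lemma Rel_add: "x \<in> Rel \<Longrightarrow> y \<in> Rel \<Longrightarrow> x + y \<in> Rel"
  using subgroup.m_closed[OF Rel_subgroup] by simp

lemma Rel_uminus: "x \<in> Rel \<Longrightarrow> - x \<in> Rel"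
  using subgroup.m_inv_closed[OF Rel_subgroup] Rel_in inv_free_Abelian_group by fastforce

lemma Rel_sum: "(\<And>i. i \<in> J \<Longrightarrow> f i \<in> Rel) \<Longrightarrow> (\<Sum>i\<in>J. f i) \<in> Rel"
  by (induction J rule: infinite_finite_induct) (auto intro: Rel_zero Rel_add)

lemma gens_Rel: "x \<in> gens \<Longrightarrow> x \<in> Rel"
  unfolding Rel_eq by (rule generate.incl)

lemma Rel_induct [consumes 1]:
  assumes x: "x \<in> Rel" and "P 0" "\<And>x. x \<in> gens \<Longrightarrow> P x" "\<And>x y. P x \<Longrightarrow> P y \<Longrightarrow> P (x + y)" "\<And>x. P x \<Longrightarrow> P (- x)"
  shows "P x"
  using x unfolding Rel_eq
proof (induction rule: generate.induct)
  case one
  then show ?case using assms(2) by simp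
next
  case (incl h)
  then show ?case by (rule assms(3))
next
  case (inv h)
  then have "inv\<^bsub>F\<^esub> h = - h" using subsetD[OF gens_in inv] inv_free_Abelian_group by simp
  then show ?case using assms(3,5) inv by simp
next
  case (eng h1 h2)
  then show ?case using assms(4) by simp
qed

definition coset where "coset x = Rel #>\<^bsub>F\<^esub> x"

lemma coset_eq: "coset x = {r + x | r. r \<in> Rel}"
  unfolding coset_def r_coset_def by auto

lemma coset_self: "x \<in> coset x"
  unfolding coset_eq using Rel_zero by (intro CollectI exI[of _ 0]) simp

lemma coset_eq_iff: "coset x = coset y \<longleftrightarrow> x - y \<in> Rel"
proof
  assume "coset x = coset y"
  then have "x \<in> coset y" using coset_self[of x] by simp
  then show "x - y \<in> Rel" unfolding coset_eq by auto
next
  have sub: "coset x \<subseteq> coset y" if "x - y \<in> Rel" for x y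
  proof
    fix z assume "z \<in> coset x"
    then obtain r where r: "r \<in> Rel" "z = r + x" unfolding coset_eq by blast
    then have "z = (r + (x - y)) + y" by simp
    moreover have "r + (x - y) \<in> Rel" using Rel_add[OF r(1) that] .
    ultimately show "z \<in> coset y" unfolding coset_eq by blast
  qed
  assume "x - y \<in> Rel"
  moreover from this have "y - x \<in> Rel" using Rel_uminus[of "x - y"] by simp
  ultimately show "coset x = coset y" using sub by blast
qed

lemma L_eq: "L = F Mod Rel"
  unfolding induced_module_def tensor_product_def ..

lemma L_carrier: "carrier L = coset ` carrier F"
  unfolding L_eq FactGroup_def RCOSETS_def coset_def by auto

lemma L_mult: "x \<in> carrier F \<Longrightarrow> y \<in> carrier F \<Longrightarrow> coset x \<otimes>\<^bsub>L\<^esub> coset y = coset (x + y)"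
proof -
  assume xy: "x \<in> carrier F" "y \<in> carrier F"
  have "Rel \<lhd> F" using comm_group.normal_iff_subgroup[OF abelian_free_Abelian_group] Rel_subgroup by blast
  from normal.rcos_sum[OF this xy] show ?thesis
    unfolding L_eq FactGroup_def coset_def by simp
qed

definition left_mult where
  "left_mult p = frag_extend (\<lambda>(m, n). frag_of (E.cls p \<otimes>\<^bsub>U\<^esub> m, n))"

lemma left_mult_ten: "left_mult p (ten r t) = ten (p * r) t"
  by (simp add: left_mult_def ten_def U_simps(2))

lemma left_mult_simps:
  "left_mult p 0 = 0" "left_mult p (x + y) = left_mult p x + left_mult p y"
  "left_mult p (x - y) = left_mult p x - left_mult p y" "left_mult p (- x) = - left_mult p x"
  by (simp_all add: left_mult_def frag_extend_add frag_extend_diff frag_extend_minus)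

lemma left_mult_sum: "left_mult p (\<Sum>i\<in>J. f i) = (\<Sum>i\<in>J. left_mult p (f i))"
  by (induction J rule: infinite_finite_induct) (simp_all add: left_mult_simps)

lemma left_mult_Rel: "x \<in> Rel \<Longrightarrow> left_mult p x \<in> Rel"
proof (induction rule: Rel_induct)
  case (2 x)
  then have "left_mult p x \<in> gens"
  proof (cases rule: gens_cases)
    case (add_left r r' t)
    then show ?thesis using gensI(1)[of t "p * r" "p * r'"]
      by (simp add: left_mult_simps left_mult_ten distrib_left)
  next
    case (add_right r t t')
    then show ?thesis using gensI(2)[of t t' "p * r"] by (simp add: left_mult_simps left_mult_ten)
  next
    case (mult r s t)
    then show ?thesis using gensI(3)[of s t "p * r"]
      by (simp del: free_algebra_simps(1) add: left_mult_simps left_mult_ten mult.assoc)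
  qed
  then show ?case by (rule gens_Rel)
qed (auto simp: left_mult_simps intro: Rel_zero Rel_add Rel_uminus)

text \<open>The union in \<open>tensor_map\<close> runs over all representatives of a coset. They
  lead to a single coset because left multiplication maps relations to relations.\<close>

lemma L_act: "L_act p (coset x) = coset (left_mult p x)"
proof -
  have "L_act p (coset x) = (\<Union>a\<in>coset x. coset (left_mult p a))"
    unfolding induced_act_def tensor_map_def coset_def left_mult_def ..
  also have "\<dots> = coset (left_mult p x)"
  proof -
    have "coset (left_mult p a) = coset (left_mult p x)" if "a \<in> coset x" for a
    proof -
      have "a - x \<in> Rel" using that unfolding coset_eq by auto
      then show ?thesis unfolding coset_eq_iff using left_mult_Rel[of "a - x" p] by (simp add: left_mult_simps)
    qed
    then show ?thesis using coset_self[of x] by blast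
  qed
  finally show ?thesis .
qed

lemma ten_cong: "p - p' \<in> E.I \<Longrightarrow> ten p t = ten p' t"
  using E.cls_eq_iff[of p p'] by (simp add: ten_def)

lemma ten_add_left: "t \<in> \<tau> \<Longrightarrow> ten (p + p') t - (ten p t + ten p' t) \<in> Rel"
proof -
  assume "t \<in> \<tau>"
  then have "ten (p + p') t - ten p t - ten p' t \<in> gens" by (rule gensI)
  from gens_Rel[OF this] show ?thesis by (simp add: algebra_simps)
qed

lemma ten_add_right: "t \<in> \<tau> \<Longrightarrow> t' \<in> \<tau> \<Longrightarrow> ten p (t + t') - (ten p t + ten p t') \<in> Rel"
proof -
  assume "t \<in> \<tau>" "t' \<in> \<tau>"
  then have "ten p (t + t') - ten p t - ten p t' \<in> gens" by (rule gensI)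
  from gens_Rel[OF this] show ?thesis by (simp add: algebra_simps)
qed

lemma ten_zero: "ten 0 t \<in> Rel" if "t \<in> \<tau>"
  using ten_add_left[OF that, of 0 0] Rel_uminus by fastforce

lemma ten_zero_right: "ten p 0 \<in> Rel"
  using ten_add_right[of 0 0 p] subspace_0[OF \<tau>_subspace] Rel_uminus by fastforce

lemma ten_sum_left: "t \<in> \<tau> \<Longrightarrow> ten (\<Sum>i\<in>J. f i) t - (\<Sum>i\<in>J. ten (f i) t) \<in> Rel"
proof (induction J rule: infinite_finite_induct)
  case (insert i J)
  have "ten (f i + (\<Sum>i\<in>J. f i)) t - (ten (f i) t + ten (\<Sum>i\<in>J. f i) t) +
      (ten (\<Sum>i\<in>J. f i) t - (\<Sum>i\<in>J. ten (f i) t)) \<in> Rel"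
    using insert by (intro Rel_add ten_add_left) auto
  then show ?case using insert by (simp add: algebra_simps)
qed (auto intro: ten_zero)

lemma ten_sum_right: "(\<And>i. i \<in> J \<Longrightarrow> f i \<in> \<tau>) \<Longrightarrow> ten p (\<Sum>i\<in>J. f i) - (\<Sum>i\<in>J. ten p (f i)) \<in> Rel"
proof (induction J rule: infinite_finite_induct)
  case (insert i J)
  have "ten p (f i + (\<Sum>i\<in>J. f i)) - (ten p (f i) + ten p (\<Sum>i\<in>J. f i)) +
      (ten p (\<Sum>i\<in>J. f i) - (\<Sum>i\<in>J. ten p (f i))) \<in> Rel"
    using insert by (intro Rel_add ten_add_right subspace_sum[OF \<tau>_subspace]) auto
  then show ?case using insert by (simp add: algebra_simps)
qed (auto intro: ten_zero_right)

lemma ten_\<kappa>: "X \<in> \<kappa> \<Longrightarrow> t \<in> \<tau> \<Longrightarrow> ten (p * free_var X) t - ten p (cr X t) \<in> Rel"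
proof -
  assume X: "X \<in> \<kappa>" and t: "t \<in> \<tau>"
  have "X \<in> H" using HI[OF X cs.subspace_0[OF q_subspace]] by simp
  then have "ten (p * free_var X) t - ten p (N.act (free_var X) t) \<in> gens"
    using t by (intro gensI iffD2[OF free_var_in])
  from gens_Rel[OF this] show ?thesis by (simp add: N.act_var infl_\<kappa>[OF X])
qed

text \<open>The tensor product is built from integer combinations. Complex scalars nevertheless pass
  to the right factor, because the constants belong to the enveloping algebra of the subalgebra over
  which the tensor product is formed.\<close>

lemma ten_const: "t \<in> \<tau> \<Longrightarrow> ten (p * free_const z) t - ten p (sc z t) \<in> Rel"
proof -
  assume t: "t \<in> \<tau>"
  then have "ten (p * free_const z) t - ten p (N.act (free_const z) t) \<in> gens"
    by (intro gensI free_const_in)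
  from gens_Rel[OF this] show ?thesis by (simp add: N.act_const)
qed

text \<open>
  A \<open>\<kappa>\<close>-equivariant retraction \<open>pr\<close> of \<open>\<tau>\<close> onto vectors killed by \<open>q\<close> makes \<open>u \<otimes> t \<mapsto> u (pr t)\<close>
  compatible with the relations.
\<close>

definition eval :: "('v \<Rightarrow> 'v) \<Rightarrow> ((('e \<times> 'e) free_alg set \<times> 'v) \<Rightarrow>\<^sub>0 int) \<Rightarrow> 'v" where
  "eval pr x = (\<Sum>k\<in>Poly_Mapping.keys x. sc (of_int (Poly_Mapping.lookup x k)) (uea_act sc cr (fst k) (pr (snd k))))"

lemma eval_simps:
  "eval pr 0 = 0" "eval pr (x + y) = eval pr x + eval pr y"
  "eval pr (- x) = - eval pr x" "eval pr (x - y) = eval pr x - eval pr y"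
proof -
  show z: "eval pr 0 = 0" by (simp add: eval_def)
  show a: "eval pr (x + y) = eval pr x + eval pr y" for x y
    unfolding eval_def by (rule sum_keys_add) (simp_all add: scale_left_distrib)
  show m: "eval pr (- x) = - eval pr x" for x
    using a[of x "- x"] z by (simp add: eq_neg_iff_add_eq_0 add.commute)
  show "eval pr (x - y) = eval pr x - eval pr y" using a[of x "- y"] m by simp
qed

lemma eval_sum: "eval pr (\<Sum>i\<in>J. f i) = (\<Sum>i\<in>J. eval pr (f i))"
  by (induction J rule: infinite_finite_induct) (simp_all add: eval_simps)

lemma eval_ten: "eval pr (ten p t) = C.act p (pr t)"
  by (simp add: eval_def ten_def uea_act_cls)

lemma eval_left_mult: "x \<in> carrier F \<Longrightarrow> eval pr (left_mult p x) = C.act p (eval pr x)"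
proof -
  assume "x \<in> carrier F"
  then have "Poly_Mapping.keys x \<subseteq> carrier U \<times> \<tau>" by simp
  then show ?thesis
  proof (induction rule: frag_induction)
    case (one k)
    then obtain r t where "frag_of k = ten r t" unfolding U_simps(1) ten_def by auto
    then show ?case by (simp add: left_mult_ten eval_ten C.act_mult)
  next
    case (diff a b)
    then show ?case using C.act_add_right[of p "eval pr a - eval pr b" "eval pr b"]
      by (simp add: left_mult_simps eval_simps algebra_simps)
  qed (simp add: left_mult_simps eval_simps)
qed

lemma eval_Rel:
  assumes pr: "\<And>t t'. t \<in> \<tau> \<Longrightarrow> t' \<in> \<tau> \<Longrightarrow> pr (t + t') = pr t + pr t'"
    "\<And>z t. t \<in> \<tau> \<Longrightarrow> pr (sc z t) = sc z (pr t)"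
    "\<And>X t. X \<in> \<kappa> \<Longrightarrow> t \<in> \<tau> \<Longrightarrow> pr (cr X t) = cr X (pr t)"
    "\<And>Q t. Q \<in> q \<Longrightarrow> t \<in> \<tau> \<Longrightarrow> cr Q (pr t) = 0"
  shows "x \<in> Rel \<Longrightarrow> eval pr x = 0"
proof (induction rule: Rel_induct)
  case (2 x)
  have pr0: "pr 0 = 0" using pr(2)[of 0 0] subspace_0[OF \<tau>_subspace] by simp
  \<comment> \<open>A letter X = A + B with B in \<open>q\<close> acts on \<open>\<tau>\<close>
    through A alone; on the image of \<open>pr\<close> the part B acts by zero in V as well. Hence
    \<open>pr\<close> intertwines the inflated action with the actual one.\<close>
  have w: "pr (foldr infl w t) = foldr cr w (pr t) \<and> foldr infl w t \<in> \<tau>" if "set w \<subseteq> H" "t \<in> \<tau>" for w t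
    using that
  proof (induction w)
    case (Cons X w)
    then obtain A B where AB: "X = A + B" "A \<in> \<kappa>" "B \<in> q" by (auto elim: HE)
    let ?u = "foldr infl w t"
    have u: "?u \<in> \<tau>" "pr ?u = foldr cr w (pr t)" using Cons by auto
    have "pr (infl X ?u) = cr A (pr ?u)" using AB u pr(3) by (simp add: infl_eq)
    also have "\<dots> = cr X (pr ?u)" using AB pr(4)[OF AB(3) u(1)] by (simp add: crep_add)
    finally show ?case using u infl_stable[of X ?u] Cons.prems by simp
  qed simp
  have prs: "pr (\<Sum>i\<in>J. sc (c i) (f i)) = (\<Sum>i\<in>J. sc (c i) (pr (f i))) \<and> (\<Sum>i\<in>J. sc (c i) (f i)) \<in> \<tau>"
    if "\<And>i. i \<in> J \<Longrightarrow> f i \<in> \<tau>" for J and f :: "('e \<times> 'e) free_monoid \<Rightarrow> 'v" and c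
    using that
  proof (induction J rule: infinite_finite_induct)
    case (insert i J)
    then have "sc (c i) (f i) \<in> \<tau>" using subspace_scale[OF \<tau>_subspace] by auto
    then show ?case using insert pr(1,2) subspace_add[OF \<tau>_subspace] by auto
  qed (auto simp: pr0 subspace_0[OF \<tau>_subspace])
  have key: "pr (N.act r t) = C.act r (pr t)" if "r \<in> carrier (free_algebra H)" "t \<in> \<tau>" for r t
    unfolding free_act_def using prs[of "Poly_Mapping.keys r" "\<lambda>w. foldr infl (letters w) t"] w that
    by simp
  from 2 show ?case
    by (cases rule: gens_cases)
      (simp_all del: free_algebra_simps(1) add: eval_simps eval_ten C.act_add C.act_add_right C.act_mult pr(1) key)
qed (auto simp: eval_simps)

lemma induced_homI:
  assumes "\<And>t. t \<in> \<tau> \<Longrightarrow> h t \<in> carrier F"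
    and "\<And>t t'. t \<in> \<tau> \<Longrightarrow> t' \<in> \<tau> \<Longrightarrow> h (t + t') - (h t + h t') \<in> Rel"
    and "\<And>z t. t \<in> \<tau> \<Longrightarrow> h (sc z t) - left_mult (free_const z) (h t) \<in> Rel"
    and "\<And>X t. X \<in> \<kappa> \<Longrightarrow> t \<in> \<tau> \<Longrightarrow> h (cr X t) - left_mult (free_var X) (h t) \<in> Rel"
  shows "(\<lambda>t. coset (h t)) \<in> induced_hom br sc \<pi> \<kappa> q \<tau>"
  unfolding induced_hom_def using assms
  by (auto simp: L_carrier L_mult L_act coset_eq_iff simp del: carrier_free_Abelian_group_iff)

text \<open>\<open>coset \<circ> h\<close> is compared with the homomorphism \<open>t \<mapsto> 1 \<otimes> t\<close>, which evaluates to \<open>v\<close> at \<open>v\<close>.\<close>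

lemma multiplicity_one_eval:
  assumes pr: "\<And>t t'. t \<in> \<tau> \<Longrightarrow> t' \<in> \<tau> \<Longrightarrow> pr (t + t') = pr t + pr t'"
    "\<And>z t. t \<in> \<tau> \<Longrightarrow> pr (sc z t) = sc z (pr t)"
    "\<And>X t. X \<in> \<kappa> \<Longrightarrow> t \<in> \<tau> \<Longrightarrow> pr (cr X t) = cr X (pr t)"
    "\<And>Q t. Q \<in> q \<Longrightarrow> t \<in> \<tau> \<Longrightarrow> cr Q (pr t) = 0"
    and h: "\<And>t. t \<in> \<tau> \<Longrightarrow> h t \<in> carrier F" "(\<lambda>t. coset (h t)) \<in> induced_hom br sc \<pi> \<kappa> q \<tau>"
    and once: "occurs_exactly_once br sc \<pi> \<kappa> q \<tau>"
    and v: "v \<in> \<tau>" "pr v = v" "v \<noteq> 0"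
  shows "\<exists>z. eval pr (h v) = sc z v"
proof -
  obtain f where f: "f \<in> induced_hom br sc \<pi> \<kappa> q \<tau>"
    "\<And>h. h \<in> induced_hom br sc \<pi> \<kappa> q \<tau> \<Longrightarrow> \<exists>z. \<forall>t\<in>\<tau>. h t = L_act (free_const z) (f t)"
    using once unfolding occurs_exactly_once_def by blast
  have "f v \<in> carrier L" using f(1) v(1) unfolding induced_hom_def by blast
  then obtain x where x: "x \<in> carrier F" "f v = coset x" unfolding L_carrier by blast
  have ev: "\<exists>z. eval pr (g v) = sc z (eval pr x)"
    if g: "(\<lambda>t. coset (g t)) \<in> induced_hom br sc \<pi> \<kappa> q \<tau>" for g
  proof -
    obtain z where "coset (g v) = L_act (free_const z) (f v)" using f(2)[OF g] v(1) by blast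
    then have "g v - left_mult (free_const z) x \<in> Rel" by (simp add: x(2) L_act coset_eq_iff)
    from eval_Rel[OF pr this] have "eval pr (g v) = sc z (eval pr x)"
      by (simp add: eval_simps eval_left_mult[OF x(1)] C.act_const)
    then show ?thesis by blast
  qed
  have "(\<lambda>t. coset (ten 1 t)) \<in> induced_hom br sc \<pi> \<kappa> q \<tau>"
  proof (rule induced_homI)
    fix t assume t: "t \<in> \<tau>"
    show "ten 1 t \<in> carrier F" by (rule ten_in[OF t])
    show "ten 1 (sc z t) - left_mult (free_const z) (ten 1 t) \<in> Rel" for z
      using Rel_uminus[OF ten_const[OF t, of 1 z]] by (simp add: left_mult_ten)
    show "ten 1 (cr X t) - left_mult (free_var X) (ten 1 t) \<in> Rel" if "X \<in> \<kappa>" for X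
      using Rel_uminus[OF ten_\<kappa>[OF that t, of 1]] by (simp add: left_mult_ten)
    show "ten 1 (t + t') - (ten 1 t + ten 1 t') \<in> Rel" if "t' \<in> \<tau>" for t'
      by (rule ten_add_right[OF t that])
  qed
  \<comment> \<open>The scalar \<open>a\<close> compares 1 \<otimes> v with \<open>f\<close> after
    evaluation. It is nonzero because 1 \<otimes> v evaluates to v \<noteq> 0, so the unknown
    \<open>f\<close> can be eliminated.\<close>
  from ev[OF this] obtain a where a: "v = sc a (eval pr x)"
    using v(2) C.act_const[of 1 v] by (auto simp: eval_ten free_const_one)
  then have "a \<noteq> 0" using v(3) by auto
  obtain b where "eval pr (h v) = sc b (eval pr x)" using ev[OF h(2)] by blast
  also have "eval pr x = sc (inverse a) v" unfolding a using \<open>a \<noteq> 0\<close> by simp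
  finally have "eval pr (h v) = sc (b * inverse a) v" by simp
  then show ?thesis by blast
qed

end

section \<open>Lifting to the induced module\<close>

text \<open>The triples (w, i, e) are permuted by the involution that exchanges the letter
  \<open>w ! i\<close> with e. For an operator acting on single letters this is passage to the
  transposed matrix.\<close>

lemma sum_list_update_swap:
  fixes f :: "'a list \<Rightarrow> nat \<Rightarrow> 'a \<Rightarrow> 'b::comm_monoid_add"
  assumes W: "finite W" "finite E" "\<And>w i e. w \<in> W \<Longrightarrow> i < length w \<Longrightarrow> e \<in> E \<Longrightarrow> w[i := e] \<in> W \<and> w ! i \<in> E"
  shows "(\<Sum>w\<in>W. \<Sum>i<length w. \<Sum>e\<in>E. f w i e) = (\<Sum>w\<in>W. \<Sum>i<length w. \<Sum>e\<in>E. f (w[i := e]) i (w ! i))"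
proof -
  let ?S = "SIGMA w:W. {..<length w} \<times> E"
  have eq: "(\<Sum>w\<in>W. \<Sum>i<length w. \<Sum>e\<in>E. g w i e) = (\<Sum>(w, i, e)\<in>?S. g w i e)" for g :: "'a list \<Rightarrow> nat \<Rightarrow> 'a \<Rightarrow> 'b"
    using W by (simp add: sum.Sigma sum.cartesian_product)
  have "(\<Sum>(w, i, e)\<in>?S. f w i e) = (\<Sum>(w, i, e)\<in>?S. f (w[i := e]) i (w ! i))"
    by (rule sum.reindex_bij_witness[where i = "\<lambda>(w, i, e). (w[i := e], i, w ! i)" and j = "\<lambda>(w, i, e). (w[i := e], i, w ! i)"])
      (use W in auto)
  then show ?thesis by (simp only: eq)
qed

text \<open>Over the reals a spanning set is doubled by its multiples with \<i>, so spaces of finite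
  complex dimension remain finite-dimensional for the real forms.\<close>

lemma complex_span_subset_real_span:
  fixes sc :: "complex \<Rightarrow> 'v::ab_group_add \<Rightarrow> 'v"
  assumes "vector_space sc"
  shows "module.span sc B \<subseteq> module.span (\<lambda>r. sc (complex_of_real r)) (B \<union> sc \<i> ` B)"
proof
  interpret vector_space sc by fact
  interpret RV: real_scaled "\<lambda>r. sc (complex_of_real r)"
    by unfold_locales (simp_all add: scale_right_distrib scale_left_distrib)
  let ?B = "B \<union> sc \<i> ` B"
  have i: "sc \<i> x \<in> RV.span ?B" if "x \<in> RV.span ?B" for x
    using that
  proof (induction rule: RV.span_induct_alt)
    case base
    then show ?case using RV.span_zero by simp
  next
    case (step c x y)
    have "sc \<i> x \<in> RV.span ?B"
    proof (cases "x \<in> B")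
      case False
      then obtain y where "y \<in> B" "x = sc \<i> y" using step by blast
      then have "sc \<i> x = - y" by simp
      then show ?thesis using \<open>y \<in> B\<close> RV.span_neg[OF RV.span_base[of y ?B]] by simp
    qed (auto intro: RV.span_base)
    then have "sc (complex_of_real c) (sc \<i> x) + sc \<i> y \<in> RV.span ?B"
      using step by (intro RV.span_add RV.span_scale) auto
    then show ?case by (simp add: scale_right_distrib mult.commute)
  qed
  have z: "sc z x \<in> RV.span ?B" if "x \<in> RV.span ?B" for z x
  proof -
    have "sc z x = sc (complex_of_real (Re z)) x + sc (complex_of_real (Im z)) (sc \<i> x)"
      by (simp add: scale_left_distrib[symmetric] mult.commute complex_eq[symmetric])
    then show ?thesis using RV.span_add[OF RV.span_scale[OF that] RV.span_scale[OF i[OF that]]] by simp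
  qed
  fix t assume "t \<in> span B"
  then show "t \<in> RV.span ?B"
    by (induction rule: span_induct_alt) (auto intro: RV.span_zero RV.span_add z RV.span_base)
qed

text \<open>The center acts trivially on \<gg>, so \<open>bg_skew\<close> is exact; on
  \<open>\<tau>\<close> it acts by scalars, so \<open>b_skew\<close> allows a constant. By
  \<open>b_i\<close> the real form \<open>b\<close> is the real part of a Hermitian one.
  Orthonormality of \<open>E\<close> enters in the form of \<open>E_expand\<close>.\<close>

locale word_setup = induced_setup sc br \<pi> \<kappa> q \<tau>
  for sc :: "complex \<Rightarrow> 'v::ab_group_add \<Rightarrow> 'v" and br :: "'e::real_vector \<Rightarrow> 'e \<Rightarrow> 'e" and \<pi> \<kappa> q \<tau> +
  fixes k :: "'e set" and bg :: "'e \<Rightarrow> 'e \<Rightarrow> real" and E :: "'e set" and b :: "'v \<Rightarrow> 'v \<Rightarrow> real" and B :: "'v set"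
  assumes \<kappa>_eq: "\<kappa> = k \<times> k" and E_fin: "finite E"
    and E_expand: "\<And>Y. (\<Sum>e\<in>E. bg Y e *\<^sub>R e) = Y"
    and bg_sym: "\<And>Y Z. bg Y Z = bg Z Y"
    and bg_skew: "\<And>X Y Z. X \<in> k \<Longrightarrow> bg (br X Y) Z = - bg Y (br X Z)"
    and b_inner: "real_scaled.inner_product_on (\<lambda>r. sc (complex_of_real r)) \<tau> b"
    and b_i: "\<And>u v. u \<in> \<tau> \<Longrightarrow> v \<in> \<tau> \<Longrightarrow> b (sc \<i> u) v + b u (sc \<i> v) = 0"
    and b_skew: "\<And>X. X \<in> k \<Longrightarrow> \<exists>c. \<forall>u\<in>\<tau>. \<forall>v\<in>\<tau>. b (\<pi> X u) v + b u (\<pi> X v) = c * b u v"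
    and B_fin: "finite B" "\<tau> \<subseteq> span B"
begin

sublocale RV: real_scaled "\<lambda>r. sc (complex_of_real r)"
  by unfold_locales (simp_all add: scale_right_distrib scale_left_distrib)

sublocale FS: real_scaled "\<lambda>r (m :: 'e list \<Rightarrow> 'v) w. sc (complex_of_real r) (m w)"
  by unfold_locales (simp_all add: fun_eq_iff scale_right_distrib scale_left_distrib)

definition \<tau>' where "\<tau>' = {t \<in> \<tau>. \<forall>Q\<in>q. cr Q t = 0}"

lemma \<tau>'_sub: "\<tau>' \<subseteq> \<tau>"
  by (auto simp: \<tau>'_def)

lemma \<tau>'_subspace: "subspace \<tau>'"
  using \<tau>_subspace
  by (auto intro!: subspaceI simp: \<tau>'_def C.\<rho>_add C.\<rho>_scale subspace_0 subspace_add subspace_scale)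

text \<open>On V the operators \<open>cr X\<close> and \<open>cr Q\<close> commute up to the action
  of an element of \<open>q\<close>, by \<open>\<kappa>_q_br\<close>, and this kills t too.\<close>

lemma \<tau>'_stable: "X \<in> \<kappa> \<Longrightarrow> t \<in> \<tau>' \<Longrightarrow> cr X t \<in> \<tau>'"
proof -
  assume X: "X \<in> \<kappa>" and t: "t \<in> \<tau>'"
  have "cr Q (cr X t) = 0" if Q: "Q \<in> q" for Q
  proof -
    have "cr (cbracket br X Q) t = cr X (cr Q t) - cr Q (cr X t)" by (rule crep_bracket)
    moreover have "cr (cbracket br X Q) t = 0" "cr Q t = 0" using t \<kappa>_q_br[OF X Q] Q by (auto simp: \<tau>'_def)
    ultimately show ?thesis by simp
  qed
  then show ?thesis using t \<kappa>_stable[OF X] by (auto simp: \<tau>'_def)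
qed

lemma k_\<kappa>: "X \<in> k \<Longrightarrow> (X, 0) \<in> \<kappa>"
  using cs.subspace_0[OF \<kappa>_subspace] by (auto simp: \<kappa>_eq prod_eq_iff)

lemma \<pi>_\<tau>': "X \<in> k \<Longrightarrow> t \<in> \<tau>' \<Longrightarrow> \<pi> X t \<in> \<tau>'"
  using \<tau>'_stable[OF k_\<kappa>] by (simp add: crep_real)

lemma \<pi>_\<tau>: "X \<in> k \<Longrightarrow> t \<in> \<tau> \<Longrightarrow> \<pi> X t \<in> \<tau>"
  using \<kappa>_stable[OF k_\<kappa>] by (simp add: crep_real)

lemma \<pi>_lin: "\<pi> X (u + v) = \<pi> X u + \<pi> X v" "\<pi> X (sc z v) = sc z (\<pi> X v)"
  using C.\<rho>_add[of "(X, 0)" u v] C.\<rho>_scale[of "(X, 0)" z v] by (simp_all add: crep_real)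

lemma real_subspace: "subspace S \<Longrightarrow> RV.subspace S"
  by (auto intro!: RV.subspaceI simp: subspace_0 subspace_add subspace_scale)

lemma real_span: "\<tau> \<subseteq> RV.span (B \<union> sc \<i> ` B)"
  using complex_span_subset_real_span[OF vector_space_axioms, of B] B_fin(2) by blast

lemma fin_real: "finite (B \<union> sc \<i> ` B)"
  using B_fin by simp

lemma b_form: "RV.bilinear_form_on \<tau> b"
  using RV.inner_product_onD(1)[OF b_inner] .

text \<open>Complex scalars are thereby put into the same framework as \<kk>, with constant 2 Re z.
  Projections and lifts formed with the real form \<open>b\<close> turn out complex linear for this
  reason.\<close>

lemma b_scale: "u \<in> \<tau> \<Longrightarrow> v \<in> \<tau> \<Longrightarrow> b (sc z u) v + b u (sc z v) = 2 * Re z * b u v"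
proof -
  assume u: "u \<in> \<tau>" and v: "v \<in> \<tau>"
  have dec: "sc z w = sc (complex_of_real (Re z)) w + sc (complex_of_real (Im z)) (sc \<i> w)" for w
    by (simp add: scale_left_distrib[symmetric] mult.commute complex_eq[symmetric])
  have st: "sc a w \<in> \<tau>" if "w \<in> \<tau>" for a w using subspace_scale[OF \<tau>_subspace that] .
  have "b (sc z u) v = Re z * b u v + Im z * b (sc \<i> u) v"
    unfolding dec[of u] using u v st by (simp only: RV.bilinear_form_onD(3,5)[OF b_form])
  moreover have "b u (sc z v) = Re z * b u v + Im z * b u (sc \<i> v)"
    unfolding dec[of v] using u v st by (simp only: RV.bilinear_form_onD(4,6)[OF b_form])
  ultimately have "b (sc z u) v + b u (sc z v) = 2 * Re z * b u v + Im z * (b (sc \<i> u) v + b u (sc \<i> v))"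
    by (simp add: algebra_simps)
  then show ?thesis using b_i[OF u v] by simp
qed

definition pr where "pr = RV.orth_proj b \<tau>'"

lemmas proj = RV.orth_proj[OF b_inner real_subspace[OF \<tau>'_subspace] \<tau>'_sub fin_real real_span, folded pr_def]
lemmas proj_add = RV.orth_proj_add[OF b_inner real_subspace[OF \<tau>'_subspace] \<tau>'_sub fin_real real_span, folded pr_def]
lemmas proj_id = RV.orth_proj_id[OF b_inner real_subspace[OF \<tau>'_subspace] \<tau>'_sub fin_real real_span, folded pr_def]
lemmas proj_commute = RV.orth_proj_commute[OF b_inner real_subspace[OF \<tau>'_subspace] \<tau>'_sub fin_real real_span, folded pr_def]

lemma proj_scale: "t \<in> \<tau> \<Longrightarrow> pr (sc z t) = sc z (pr t)"
  by (rule proj_commute[where c = "2 * Re z"])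
    (auto simp: scale_right_distrib b_scale intro: subspace_scale[OF \<tau>_subspace] subspace_scale[OF \<tau>'_subspace])

lemma proj_\<pi>: "X \<in> k \<Longrightarrow> t \<in> \<tau> \<Longrightarrow> pr (\<pi> X t) = \<pi> X (pr t)"
proof -
  assume X: "X \<in> k" and t: "t \<in> \<tau>"
  obtain c where "\<forall>u\<in>\<tau>. \<forall>v\<in>\<tau>. b (\<pi> X u) v + b u (\<pi> X v) = c * b u v" using b_skew[OF X] by blast
  then show ?thesis using X t
    by (intro proj_commute[where c = c]) (auto simp: \<pi>_lin intro: \<pi>_\<tau> \<pi>_\<tau>')
qed

lemma proj_cr: "X \<in> \<kappa> \<Longrightarrow> t \<in> \<tau> \<Longrightarrow> pr (cr X t) = cr X (pr t)"
proof -
  assume X: "X \<in> \<kappa>" and t: "t \<in> \<tau>"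
  then have k: "fst X \<in> k" "snd X \<in> k" by (auto simp: \<kappa>_eq)
  have "\<pi> (snd X) t \<in> \<tau>" "\<pi> (fst X) t \<in> \<tau>" using \<pi>_\<tau> k t by auto
  then show ?thesis
    using proj_add[of "\<pi> (fst X) t" "sc \<i> (\<pi> (snd X) t)"] proj_scale[of "\<pi> (snd X) t" \<i>] proj_\<pi> k t
      subspace_scale[OF \<tau>_subspace] by (simp add: crep_def)
qed

lemma proj_q: "Q \<in> q \<Longrightarrow> t \<in> \<tau> \<Longrightarrow> cr Q (pr t) = 0"
  using proj(1)[of t] by (auto simp: \<tau>'_def)

lemmas eval_Rel' = eval_Rel[of pr, OF proj_add proj_scale proj_cr proj_q]

definition words where "words n = {w. set w \<subseteq> E \<and> length w \<le> n}"
definition word :: "'e list \<Rightarrow> ('e \<times> 'e) free_alg" where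
  "word w = Poly_Mapping.single (Word (map (\<lambda>e. (e, 0)) w)) 1"

text \<open>\<open>M n\<close> stands for the tensors of degree at most \<open>n\<close> over the real Lie algebra, tensored with \<open>\<tau>'\<close>;
  \<open>m w\<close> is the coefficient of the word \<open>w\<close> in the orthonormal basis \<open>E\<close>, and \<open>D n X\<close> is the diagonal action of \<open>X\<close>.\<close>

definition M where "M n = {m. \<forall>w. (w \<in> words n \<longrightarrow> m w \<in> \<tau>') \<and> (w \<notin> words n \<longrightarrow> m w = 0)}"
definition bM where "bM n m m' = (\<Sum>w\<in>words n. b (m w) (m' w))"
definition D where
  "D n X m w = (if w \<in> words n
     then \<pi> X (m w) + (\<Sum>i<length w. \<Sum>e\<in>E. sc (complex_of_real (bg (w ! i) (br X e))) (m (w[i := e])))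
     else 0)"
definition embed where "embed n m = (\<Sum>w\<in>words n. ten (word w) (m w))"

lemma finite_words: "finite (words n)"
  unfolding words_def using finite_lists_length_le[OF E_fin] .

lemma words_update: "w \<in> words n \<Longrightarrow> i < length w \<Longrightarrow> e \<in> E \<Longrightarrow> w[i := e] \<in> words n \<and> w ! i \<in> E"
  unfolding words_def using set_update_subset_insert[of w i e] nth_mem by auto

lemma words_swap:
  fixes f :: "'e list \<Rightarrow> nat \<Rightarrow> 'e \<Rightarrow> 'c::comm_monoid_add"
  shows "(\<Sum>w\<in>words n. \<Sum>i<length w. \<Sum>e\<in>E. f w i e) =
    (\<Sum>w\<in>words n. \<Sum>i<length w. \<Sum>e\<in>E. f (w[i := e]) i (w ! i))"
  by (rule sum_list_update_swap[OF finite_words E_fin]) (rule words_update)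

lemma M_D: "m \<in> M n \<Longrightarrow> w \<in> words n \<Longrightarrow> m w \<in> \<tau>'" "m \<in> M n \<Longrightarrow> w \<in> words n \<Longrightarrow> m w \<in> \<tau>'"
  "m \<in> M n \<Longrightarrow> w \<notin> words n \<Longrightarrow> m w = 0" "m \<in> M n \<Longrightarrow> m w \<in> \<tau>'"
  unfolding M_def using subspace_0[OF \<tau>'_subspace] by force+

lemma M_subspace: "FS.subspace (M n)"
  using \<tau>'_subspace by (auto intro!: FS.subspaceI simp: M_def subspace_0 subspace_add subspace_scale)

lemma M_scale: "m \<in> M n \<Longrightarrow> (\<lambda>w. sc z (m w)) \<in> M n"
  using \<tau>'_subspace by (auto simp: M_def subspace_scale)

lemma M_inner: "FS.inner_product_on (M n) (bM n)"
  unfolding FS.inner_product_on_def FS.bilinear_form_on_def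
proof (intro conjI ballI allI impI M_subspace)
  fix m m' m'' r assume m: "m \<in> M n" and m': "m' \<in> M n"
  note in_\<tau> = subsetD[OF \<tau>'_sub M_D(4)]
  show "bM n m m' = bM n m' m" unfolding bM_def
    using RV.bilinear_form_onD(2)[OF b_form] in_\<tau> m m' by (intro sum.cong refl) auto
  show "bM n (\<lambda>w. sc (complex_of_real r) (m w)) m' = r * bM n m m'" unfolding bM_def sum_distrib_left
    using RV.bilinear_form_onD(5)[OF b_form] in_\<tau> m m' by (intro sum.cong refl) auto
  show "bM n (m + m') m'' = bM n m m'' + bM n m' m''" if "m'' \<in> M n"
    unfolding bM_def sum.distrib[symmetric]
    using RV.bilinear_form_onD(3)[OF b_form] in_\<tau> m m' that by (intro sum.cong refl) auto
next
  fix m assume m: "m \<in> M n" "m \<noteq> 0"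
  then obtain w where w: "m w \<noteq> 0" by (auto simp: fun_eq_iff)
  then have "w \<in> words n" using M_D(3)[OF m(1)] by blast
  moreover have nn: "0 \<le> b (m w) (m w)" for w
    using RV.inner_product_onD(2)[OF b_inner, of "m w"] subsetD[OF \<tau>'_sub M_D(4)[OF m(1)], of w]
      RV.bilinear_form_on_zero(1)[OF b_form, of "m w"] by (cases "m w = 0") auto
  ultimately show "0 < bM n m m" unfolding bM_def
    using RV.inner_product_onD(2)[OF b_inner _ w] subsetD[OF \<tau>'_sub M_D(4)[OF m(1)]]
    by (intro sum_pos2[OF finite_words, of w]) auto
qed

definition single_word :: "'e list \<Rightarrow> 'v \<Rightarrow> 'e list \<Rightarrow> 'v" where "single_word w t u = (if u = w then t else 0)"

lemma M_span: "\<exists>S. finite S \<and> M n \<subseteq> FS.span S"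
proof (intro exI conjI)
  let ?R = "B \<union> sc \<i> ` B"
  let ?S = "\<Union>w\<in>words n. single_word w ` ?R"
  show "finite ?S" using finite_words fin_real by auto
  have s: "single_word w t \<in> FS.span ?S" if w: "w \<in> words n" and t: "t \<in> RV.span ?R" for w t
    using t
  proof (induction rule: RV.span_induct_alt)
    case base
    have "single_word w 0 = 0" by (auto simp: single_word_def)
    then show ?case by (metis FS.span_zero)
  next
    case (step c x y)
    have eq: "single_word w (sc (complex_of_real c) x + y) = (\<lambda>u. sc (complex_of_real c) (single_word w x u)) + single_word w y"
      by (auto simp: single_word_def)
    have "single_word w x \<in> FS.span ?S" using step(1) w by (intro FS.span_base) blast
    then show ?case unfolding eq by (intro FS.span_add FS.span_scale step(2))
  qed
  show "M n \<subseteq> FS.span ?S"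
  proof
    fix m assume m: "m \<in> M n"
    have "m = (\<Sum>w\<in>words n. single_word w (m w))"
    proof
      fix u
      have "(\<Sum>w\<in>J. single_word w (m w)) u = (\<Sum>w\<in>J. single_word w (m w) u)" for J
        by (induction J rule: infinite_finite_induct) auto
      from this[of "words n"]
      have "(\<Sum>w\<in>words n. single_word w (m w)) u = (\<Sum>w\<in>words n. single_word w (m w) u)" .
      also have "\<dots> = (\<Sum>w\<in>words n. if u = w then m w else 0)" by (simp add: single_word_def)
      also have "\<dots> = m u" using finite_words M_D(3)[OF m, of u] by simp
      finally show "m u = (\<Sum>w\<in>words n. single_word w (m w)) u" by simp
    qed
    moreover have "(\<Sum>w\<in>words n. single_word w (m w)) \<in> FS.span ?S"
      using s real_span \<tau>'_sub M_D(4)[OF m] by (intro FS.span_sum) blast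
    ultimately show "m \<in> FS.span ?S" by simp
  qed
qed

lemma D_M: "X \<in> k \<Longrightarrow> m \<in> M n \<Longrightarrow> D n X m \<in> M n"
  unfolding M_def[of n]
  by (auto simp: D_def intro!: subspace_add[OF \<tau>'_subspace] subspace_sum[OF \<tau>'_subspace] subspace_scale[OF \<tau>'_subspace] \<pi>_\<tau>' M_D(4)[of m n])
    (auto simp: M_def)

text \<open>In the part acting on words, exchanging letters transposes the matrix
  \<open>bg (w ! i) (br X e)\<close>, and \<open>bg_skew\<close> makes the transpose its negative,
  so these contributions cancel. The constant stems from the action on the coefficients
  alone.\<close>

lemma D_skew:
  assumes X: "X \<in> k"
  shows "\<exists>c. \<forall>m\<in>M n. \<forall>m'\<in>M n. bM n (D n X m) m' + bM n m (D n X m') = c * bM n m m'"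
proof -
  obtain c where c: "\<And>u v. u \<in> \<tau> \<Longrightarrow> v \<in> \<tau> \<Longrightarrow> b (\<pi> X u) v + b u (\<pi> X v) = c * b u v"
    using b_skew[OF X] by blast
  have "bM n (D n X m) m' + bM n m (D n X m') = c * bM n m m'" if m: "m \<in> M n" and m': "m' \<in> M n" for m m'
  proof -
    note in_\<tau> = subsetD[OF \<tau>'_sub M_D(4)]
    note bf = RV.bilinear_form_onD[OF b_form]
    let ?c = "\<lambda>w i e. bg (w ! i) (br X e)"
    have in': "(\<Sum>i<length w. \<Sum>e\<in>E. sc (complex_of_real (f i e)) (m (w[i := e]))) \<in> \<tau>" if "m \<in> M n" for f m w
      using that in_\<tau> by (intro subspace_sum[OF \<tau>_subspace] subspace_scale[OF \<tau>_subspace]) auto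
    have sum1: "b (\<Sum>i<length w. \<Sum>e\<in>E. sc (complex_of_real (f i e)) (m (w[i := e]))) v =
        (\<Sum>i<length w. \<Sum>e\<in>E. f i e * b (m (w[i := e])) v)" 
      "b v (\<Sum>i<length w. \<Sum>e\<in>E. sc (complex_of_real (f i e)) (m (w[i := e]))) =
        (\<Sum>i<length w. \<Sum>e\<in>E. f i e * b v (m (w[i := e])))" if "m \<in> M n" "v \<in> \<tau>" for f m w v
    proof -
      let ?G = "\<lambda>i. \<Sum>e\<in>E. sc (complex_of_real (f i e)) (m (w[i := e]))"
      note im = in_\<tau>[OF that(1)]
      have G: "?G i \<in> \<tau>" for i
        using im by (intro subspace_sum[OF \<tau>_subspace] subspace_scale[OF \<tau>_subspace]) auto
      have one: "(\<Sum>i<length w. ?G i) = (\<Sum>i<length w. sc (complex_of_real 1) (?G i))" by simp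
      have "b (?G i) v = (\<Sum>e\<in>E. f i e * b (m (w[i := e])) v)" for i
        by (rule RV.bilinear_form_on_sum(1)[OF b_form im that(2)])
      moreover have "b (\<Sum>i<length w. ?G i) v = (\<Sum>i<length w. 1 * b (?G i) v)"
        unfolding one by (rule RV.bilinear_form_on_sum(1)[OF b_form G that(2)])
      ultimately show "b (\<Sum>i<length w. ?G i) v = (\<Sum>i<length w. \<Sum>e\<in>E. f i e * b (m (w[i := e])) v)"
        by simp
      have "b v (?G i) = (\<Sum>e\<in>E. f i e * b v (m (w[i := e])))" for i
        by (rule RV.bilinear_form_on_sum(2)[OF b_form im that(2)])
      moreover have "b v (\<Sum>i<length w. ?G i) = (\<Sum>i<length w. 1 * b v (?G i))"
        unfolding one by (rule RV.bilinear_form_on_sum(2)[OF b_form G that(2)])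
      ultimately show "b v (\<Sum>i<length w. ?G i) = (\<Sum>i<length w. \<Sum>e\<in>E. f i e * b v (m (w[i := e])))"
        by simp
    qed
    have "bM n (D n X m) m' = (\<Sum>w\<in>words n. b (\<pi> X (m w)) (m' w)) +
        (\<Sum>w\<in>words n. \<Sum>i<length w. \<Sum>e\<in>E. ?c w i e * b (m (w[i := e])) (m' w))"
      unfolding bM_def sum.distrib[symmetric]
      using in_\<tau>[OF m] in_\<tau>[OF m'] \<pi>_\<tau>[OF X] in'[OF m] by (intro sum.cong refl) (simp add: D_def bf(3) sum1[OF m])
    moreover have "bM n m (D n X m') = (\<Sum>w\<in>words n. b (m w) (\<pi> X (m' w))) +
        (\<Sum>w\<in>words n. \<Sum>i<length w. \<Sum>e\<in>E. ?c w i e * b (m w) (m' (w[i := e])))"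
      unfolding bM_def sum.distrib[symmetric]
      using in_\<tau>[OF m] in_\<tau>[OF m'] \<pi>_\<tau>[OF X] in'[OF m'] by (intro sum.cong refl) (simp add: D_def bf(4) sum1[OF m'])
    moreover have "(\<Sum>w\<in>words n. \<Sum>i<length w. \<Sum>e\<in>E. ?c w i e * b (m w) (m' (w[i := e]))) =
        (\<Sum>w\<in>words n. \<Sum>i<length w. \<Sum>e\<in>E. - (?c w i e * b (m (w[i := e])) (m' w)))"
    proof (subst words_swap, intro sum.cong refl)
      fix w i e assume "w \<in> words n" "i \<in> {..<length w}" "e \<in> E"
      moreover have "bg e (br X (w ! i)) = - bg (w ! i) (br X e)"
        using bg_skew[OF X, of e "w ! i"] bg_sym[of "br X e" "w ! i"] by simp
      ultimately show "bg (w[i := e] ! i) (br X (w ! i)) * b (m (w[i := e])) (m' (w[i := e, i := w ! i])) =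
          - (bg (w ! i) (br X e) * b (m (w[i := e])) (m' w))" by simp
    qed
    moreover have "(\<Sum>w\<in>words n. b (\<pi> X (m w)) (m' w)) + (\<Sum>w\<in>words n. b (m w) (\<pi> X (m' w))) = c * bM n m m'"
      unfolding bM_def sum.distrib[symmetric] sum_distrib_left
      using c in_\<tau>[OF m] in_\<tau>[OF m'] by simp
    ultimately show ?thesis by (simp add: sum_negf)
  qed
  then show ?thesis by blast
qed

end

section \<open>Left multiplication on tensors, and equivariant lifts\<close>

context word_setup
begin

lemma word_simps: "word [] = 1" "word (e # w) = free_var (e, 0) * word w" "word (u @ w) = word u * word w"
proof -
  show "word [] = 1" by (simp add: word_def zero_free_monoid_def[symmetric])
  show "word (e # w) = free_var (e, 0) * word w" "word (u @ w) = word u * word w"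
    by (simp_all add: word_def free_var_def mult_single plus_free_monoid_def)
qed

lemma cbracket_real: "cbracket br (X, 0) (Y, 0) = (br X Y, 0)"
proof -
  have "br 0 Y = 0" "br X 0 = 0" for X Y
    using br_add(1)[of 0 0 Y] br_add(2)[of X 0 0] by simp_all
  then show ?thesis by (simp add: cbracket_def)
qed

text \<open>Commutation with a fixed element is a derivation and acts letter by letter; the
  commutator with a single letter becomes the variable of the bracket modulo the enveloping
  ideal.\<close>

lemma word_commutator:
  "free_var (X, 0) * word w - word w * free_var (X, 0) - (\<Sum>i<length w. word (w[i := br X (w ! i)])) \<in> E.I"
proof (induction w)
  case Nil
  then show ?case by (simp add: word_simps E.I_zero)
next
  case (Cons a w)
  let ?x = "free_var (X, 0)" and ?A = "free_var (a, 0)" and ?C = "free_var (br X a, 0)"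
  let ?S = "\<Sum>i<length w. word (w[i := br X (w ! i)])"
  have 1: "?x * ?A - ?A * ?x - ?C \<in> E.I"
    using E.relations_in_I(3)[of "(X, 0)" "(a, 0)"] by (simp add: cbracket_real)
  have "(?x * ?A - ?A * ?x - ?C) * word w + ?A * (?x * word w - word w * ?x - ?S) \<in> E.I"
    by (intro E.I_add E.I_mult 1 Cons.IH carrier_UNIV)
  moreover have "(\<Sum>i<length (a # w). word ((a # w)[i := br X ((a # w) ! i)])) = ?C * word w + ?A * ?S"
    by (simp only: list.size(4) add_Suc_right add_0_right sum.lessThan_Suc_shift) (simp add: word_simps sum_distrib_left)
  ultimately show ?case by (simp add: word_simps algebra_simps)
qed

lemma var_expand:
  "finite S \<Longrightarrow> free_var (\<Sum>e\<in>S. c e *\<^sub>R e, 0) - (\<Sum>e\<in>S. free_const (complex_of_real (c e)) * free_var (e, 0)) \<in> E.I"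
proof (induction S rule: finite_induct)
  case empty
  \<comment> \<open>For the empty sum the variable of 0 must lie in the ideal, which is the scaling
    relation with z = 0.\<close>
  have "cscale 0 (0 :: 'e \<times> 'e) = 0" by simp
  then show ?case using E.relations_in_I(2)[of 0 0] by (simp add: free_const_def zero_prod_def)
next
  case (insert a S)
  let ?Y = "\<Sum>e\<in>S. c e *\<^sub>R e" and ?c = "complex_of_real (c a)"
  have "cscale ?c (a, 0) = (c a *\<^sub>R a, 0)" by (simp add: cscale_def)
  then have 1: "free_var (c a *\<^sub>R a, 0) - free_const ?c * free_var (a, 0) \<in> E.I"
    using E.relations_in_I(2)[of "(a, 0)" ?c] by simp
  have 2: "free_var (c a *\<^sub>R a + ?Y, 0) - free_var (c a *\<^sub>R a, 0) - free_var (?Y, 0) \<in> E.I"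
    using E.relations_in_I(1)[of "(c a *\<^sub>R a, 0)" "(?Y, 0)"] by simp
  from E.I_add[OF E.I_add[OF 2 1] insert.IH] show ?case using insert by (simp add: algebra_simps)
qed

text \<open>Linearity in one letter, valid modulo the ideal. The coefficients are collected to the
  right of the word, from where they can cross the tensor sign.\<close>

lemma word_expand:
  assumes "i < length w"
  shows "word (w[i := Y]) - (\<Sum>e\<in>E. word (w[i := e]) * free_const (complex_of_real (bg Y e))) \<in> E.I"
proof -
  let ?P = "word (take i w)" and ?Q = "word (drop (Suc i) w)" and ?c = "\<lambda>e. free_const (complex_of_real (bg Y e))"
  have up: "word (w[i := e]) = ?P * (free_var (e, 0) * ?Q)" for e
    using assms by (simp add: upd_conv_take_nth_drop word_simps)
  have "free_var (Y, 0) - (\<Sum>e\<in>E. ?c e * free_var (e, 0)) \<in> E.I"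
    using var_expand[OF E_fin, of "bg Y"] by (simp add: E_expand)
  then have "?P * ((free_var (Y, 0) - (\<Sum>e\<in>E. ?c e * free_var (e, 0))) * ?Q) \<in> E.I"
    by (intro E.I_mult carrier_UNIV)
  moreover have "?P * ((?c e * free_var (e, 0)) * ?Q) = word (w[i := e]) * ?c e" for e
  proof -
    have "(?c e * free_var (e, 0)) * ?Q = (free_var (e, 0) * ?Q) * ?c e"
      unfolding mult.assoc[of "?c e"] by (rule free_const_commute)
    then show ?thesis unfolding up by (simp only: mult.assoc)
  qed
  ultimately show ?thesis
    unfolding up[of Y] by (simp add: left_diff_distrib right_diff_distrib sum_distrib_left sum_distrib_right)
qed

definition req where "req x y \<longleftrightarrow> x - y \<in> Rel"

lemma req_refl: "req x x" by (simp add: req_def Rel_zero)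
lemma req_sym: "req x y \<Longrightarrow> req y x" using Rel_uminus[of "x - y"] by (simp add: req_def)
lemma req_trans [trans]: "req x y \<Longrightarrow> req y z \<Longrightarrow> req x z" using Rel_add[of "x - y" "y - z"] by (simp add: req_def)
lemma req_eq_trans [trans]: "x = y \<Longrightarrow> req y z \<Longrightarrow> req x z" "req x y \<Longrightarrow> y = z \<Longrightarrow> req x z" by simp_all
lemma req_add: "req x y \<Longrightarrow> req x' y' \<Longrightarrow> req (x + x') (y + y')"
  using Rel_add[of "x - y" "x' - y'"] by (simp add: req_def algebra_simps)
lemma req_sum: "(\<And>i. i \<in> J \<Longrightarrow> req (f i) (g i)) \<Longrightarrow> req (\<Sum>i\<in>J. f i) (\<Sum>i\<in>J. g i)"
  using Rel_sum[of J "\<lambda>i. f i - g i"] by (simp add: req_def sum_subtractf)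
lemma req_left_mult: "req x y \<Longrightarrow> req (left_mult p x) (left_mult p y)"
  using left_mult_Rel[of "x - y" p] by (simp add: req_def left_mult_simps)
lemma req_eval: "req x y \<Longrightarrow> eval pr x = eval pr y"
  using eval_Rel'[of "x - y"] by (simp add: req_def eval_simps)

text \<open>\<open>X\<close> is moved through the word to its right end, where, as an element of
  \<kk>, it crosses the tensor sign and acts on \<open>t\<close>. The commutators met on the way are
  re-expanded in words over \<open>E\<close> and form the sum.\<close>

lemma ten_word_commute:
  assumes X: "X \<in> k" and t: "t \<in> \<tau>'"
  shows "req (ten (free_var (X, 0) * word w) t) (ten (word w) (\<pi> X t) +
    (\<Sum>i<length w. \<Sum>e\<in>E. ten (word (w[i := e])) (sc (complex_of_real (bg (br X (w ! i)) e)) t)))"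
proof -
  let ?x = "free_var (X, 0)" and ?c = "\<lambda>i e. complex_of_real (bg (br X (w ! i)) e)"
  let ?p = "word w * ?x + (\<Sum>i<length w. \<Sum>e\<in>E. word (w[i := e]) * free_const (?c i e))"
  have t\<tau>: "t \<in> \<tau>" using t \<tau>'_sub by blast
  have "(\<Sum>i\<in>J. word (w[i := br X (w ! i)]) - (\<Sum>e\<in>E. word (w[i := e]) * free_const (?c i e))) \<in> E.I"
    if "J \<subseteq> {..<length w}" for J
    using that by (induction J rule: infinite_finite_induct) (auto intro: E.I_zero E.I_add word_expand)
  from E.I_add[OF word_commutator[of X w] this[OF order_refl]]
  have "?x * word w - ?p \<in> E.I" by (simp add: sum_subtractf algebra_simps)
  then have "ten (?x * word w) t = ten ?p t" by (rule ten_cong)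
  also have "req \<dots> (ten (word w * ?x) t + ten (\<Sum>i<length w. \<Sum>e\<in>E. word (w[i := e]) * free_const (?c i e)) t)"
    unfolding req_def by (rule ten_add_left[OF t\<tau>])
  also have "req \<dots> (ten (word w) (\<pi> X t) + (\<Sum>i<length w. \<Sum>e\<in>E. ten (word (w[i := e])) (sc (?c i e) t)))"
  proof (rule req_add)
    show "req (ten (word w * ?x) t) (ten (word w) (\<pi> X t))"
      using ten_\<kappa>[OF k_\<kappa>[OF X] t\<tau>] by (simp add: req_def crep_real)
    have "req (ten (\<Sum>i<length w. \<Sum>e\<in>E. word (w[i := e]) * free_const (?c i e)) t)
        (\<Sum>i<length w. ten (\<Sum>e\<in>E. word (w[i := e]) * free_const (?c i e)) t)"
      unfolding req_def by (rule ten_sum_left[OF t\<tau>])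
    also have "req \<dots> (\<Sum>i<length w. \<Sum>e\<in>E. ten (word (w[i := e])) (sc (?c i e) t))"
    proof (rule req_sum)
      fix i
      have "req (ten (\<Sum>e\<in>E. word (w[i := e]) * free_const (?c i e)) t) (\<Sum>e\<in>E. ten (word (w[i := e]) * free_const (?c i e)) t)"
        unfolding req_def by (rule ten_sum_left[OF t\<tau>])
      also have "req \<dots> (\<Sum>e\<in>E. ten (word (w[i := e])) (sc (?c i e) t))"
        by (rule req_sum) (use ten_const[OF t\<tau>] in \<open>simp add: req_def\<close>)
      finally show "req (ten (\<Sum>e\<in>E. word (w[i := e]) * free_const (?c i e)) t) (\<Sum>e\<in>E. ten (word (w[i := e])) (sc (?c i e) t))" .
    qed
    finally show "req (ten (\<Sum>i<length w. \<Sum>e\<in>E. word (w[i := e]) * free_const (?c i e)) t)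
        (\<Sum>i<length w. \<Sum>e\<in>E. ten (word (w[i := e])) (sc (?c i e) t))" .
  qed
  finally show ?thesis .
qed

lemma embed_in: "m \<in> M n \<Longrightarrow> embed n m \<in> carrier F"
proof -
  assume m: "m \<in> M n"
  have "(\<Sum>w\<in>J. ten (word w) (m w)) \<in> carrier F" for J
  proof (induction J rule: infinite_finite_induct)
    case (insert w J)
    have "ten (word w) (m w) \<in> carrier F" by (rule ten_in) (use M_D(4)[OF m] \<tau>'_sub in blast)
    then show ?case unfolding sum.insert[OF insert.hyps] by (intro F_add insert.IH)
  qed simp_all
  then show ?thesis unfolding embed_def .
qed

lemma embed_add: "m \<in> M n \<Longrightarrow> m' \<in> M n \<Longrightarrow> req (embed n (m + m')) (embed n m + embed n m')"
  unfolding embed_def sum.distrib[symmetric]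
  by (rule req_sum) (use ten_add_right M_D(4) \<tau>'_sub in \<open>auto simp: req_def subset_iff\<close>)

lemma embed_scale: "m \<in> M n \<Longrightarrow> req (embed n (\<lambda>w. sc z (m w))) (left_mult (free_const z) (embed n m))"
  unfolding embed_def left_mult_sum left_mult_ten free_const_commute
  by (rule req_sum, rule req_sym) (use ten_const M_D(4) \<tau>'_sub in \<open>auto simp: req_def subset_iff\<close>)

text \<open>\<open>D\<close> recombines the coefficients of a fixed word, whereas commutation
  changes the words; \<open>words_swap\<close> converts one into the other. Changing a letter keeps
  the length, so the degree bound is respected.\<close>

lemma embed_D:
  assumes X: "X \<in> k" and m: "m \<in> M n"
  shows "req (embed n (D n X m)) (left_mult (free_var (X, 0)) (embed n m))"
proof -
  let ?f = "\<lambda>w i e. ten (word w) (sc (complex_of_real (bg (w ! i) (br X e))) (m (w[i := e])))"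
  have m\<tau>: "m w \<in> \<tau>" for w using M_D(4)[OF m] \<tau>'_sub by blast
  have "req (embed n (D n X m)) (\<Sum>w\<in>words n. ten (word w) (\<pi> X (m w)) + (\<Sum>i<length w. \<Sum>e\<in>E. ?f w i e))"
    unfolding embed_def
  proof (rule req_sum)
    fix w assume w: "w \<in> words n"
    let ?g = "\<lambda>i e. sc (complex_of_real (bg (w ! i) (br X e))) (m (w[i := e]))"
    have g: "?g i e \<in> \<tau>" for i e using subspace_scale[OF \<tau>_subspace m\<tau>] .
    have gs: "(\<Sum>e\<in>E. ?g i e) \<in> \<tau>" for i by (rule subspace_sum[OF \<tau>_subspace g])
    have "ten (word w) (D n X m w) = ten (word w) (\<pi> X (m w) + (\<Sum>i<length w. \<Sum>e\<in>E. ?g i e))"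
      using w by (simp add: D_def)
    also have "req \<dots> (ten (word w) (\<pi> X (m w)) + ten (word w) (\<Sum>i<length w. \<Sum>e\<in>E. ?g i e))"
      unfolding req_def by (rule ten_add_right[OF \<pi>_\<tau>[OF X m\<tau>] subspace_sum[OF \<tau>_subspace gs]])
    also have "req \<dots> (ten (word w) (\<pi> X (m w)) + (\<Sum>i<length w. \<Sum>e\<in>E. ten (word w) (?g i e)))"
    proof (rule req_add[OF req_refl])
      have "req (ten (word w) (\<Sum>i<length w. \<Sum>e\<in>E. ?g i e)) (\<Sum>i<length w. ten (word w) (\<Sum>e\<in>E. ?g i e))"
        unfolding req_def by (rule ten_sum_right[OF gs])
      also have "req \<dots> (\<Sum>i<length w. \<Sum>e\<in>E. ten (word w) (?g i e))"
        by (rule req_sum, unfold req_def, rule ten_sum_right[OF g])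
      finally show "req (ten (word w) (\<Sum>i<length w. \<Sum>e\<in>E. ?g i e)) (\<Sum>i<length w. \<Sum>e\<in>E. ten (word w) (?g i e))" .
    qed
    finally show "req (ten (word w) (D n X m w)) (ten (word w) (\<pi> X (m w)) + (\<Sum>i<length w. \<Sum>e\<in>E. ?f w i e))" .
  qed
  also have "\<dots> = (\<Sum>w\<in>words n. ten (word w) (\<pi> X (m w)) +
      (\<Sum>i<length w. \<Sum>e\<in>E. ten (word (w[i := e])) (sc (complex_of_real (bg (br X (w ! i)) e)) (m w))))"
    unfolding sum.distrib
  proof (subst words_swap, intro arg_cong2[of _ _ _ _ "(+)"] sum.cong refl)
    fix w :: "'e list" and i e assume "i \<in> {..<length w}"
    then show "ten (word (w[i := e])) (sc (complex_of_real (bg (w[i := e] ! i) (br X (w ! i)))) (m (w[i := e, i := w ! i]))) =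
      ten (word (w[i := e])) (sc (complex_of_real (bg (br X (w ! i)) e)) (m w))"
      by (simp add: bg_sym[of e])
  qed
  also have "req \<dots> (left_mult (free_var (X, 0)) (embed n m))"
    unfolding embed_def left_mult_sum left_mult_ten
    by (rule req_sum, rule req_sym, rule ten_word_commute[OF X M_D(4)[OF m]])
  finally show ?thesis .
qed

definition ev where "ev n m = eval pr (embed n m)"

lemma ev_simps:
  "m \<in> M n \<Longrightarrow> m' \<in> M n \<Longrightarrow> ev n (m + m') = ev n m + ev n m'"
  "m \<in> M n \<Longrightarrow> ev n (\<lambda>w. sc z (m w)) = sc z (ev n m)"
  "X \<in> k \<Longrightarrow> m \<in> M n \<Longrightarrow> ev n (D n X m) = \<pi> X (ev n m)"
  using req_eval[OF embed_add] req_eval[OF embed_scale] req_eval[OF embed_D] eval_left_mult[OF embed_in]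
  by (simp_all add: ev_def eval_simps C.act_const C.act_var crep_real)

text \<open>The projection disappears because the coefficients already lie in
  \<open>\<tau>'\<close>.\<close>

lemma ev_eq: "m \<in> M n \<Longrightarrow> ev n m = (\<Sum>w\<in>words n. foldr \<pi> w (m w))"
proof -
  assume m: "m \<in> M n"
  have f: "foldr cr (map (\<lambda>e. (e, 0)) w) t = foldr \<pi> w t" for w t
    by (induction w) (simp_all add: crep_real)
  have "C.act (word w) (pr (m w)) = foldr \<pi> w (m w)" for w
    using proj_id[OF M_D(4)[OF m]] by (simp add: word_def C.act_single f)
  then show ?thesis unfolding ev_def embed_def eval_sum by (simp add: eval_ten)
qed

text \<open>A lift orthogonal to the kernel of \<open>ev n\<close> is unique, so that lifting is linear and equivariant.\<close>

definition ker where "ker n = {m \<in> M n. ev n m = 0}"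
definition lifts where "lifts n v m \<longleftrightarrow> m \<in> M n \<and> ev n m = v \<and> (\<forall>x\<in>ker n. bM n m x = 0)"

lemma ker_sub: "ker n \<subseteq> M n"
  by (auto simp: ker_def)

lemma ker_subspace: "FS.subspace (ker n)"
proof (rule FS.subspaceI)
  have z: "(0 :: 'e list \<Rightarrow> 'v) \<in> M n" by (rule FS.subspace_0[OF M_subspace])
  show "0 \<in> ker n" using ev_simps(1)[OF z z] z by (simp add: ker_def)
  show "x + y \<in> ker n" if "x \<in> ker n" "y \<in> ker n" for x y
    using that FS.subspace_add[OF M_subspace] by (auto simp: ker_def ev_simps)
  show "(\<lambda>w. sc (complex_of_real r) (x w)) \<in> ker n" if "x \<in> ker n" for r x
    using that M_scale by (auto simp: ker_def ev_simps)
qed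

lemma bM_form: "FS.bilinear_form_on (M n) (bM n)"
  using FS.inner_product_onD(1)[OF M_inner] .

lemma lifts_exists: "m \<in> M n \<Longrightarrow> \<exists>m'. lifts n (ev n m) m'"
proof -
  assume m: "m \<in> M n"
  obtain S where S: "finite S" "M n \<subseteq> FS.span S" using M_span by blast
  let ?p = "FS.orth_proj (bM n) (ker n) m"
  have p: "?p \<in> ker n" "\<And>x. x \<in> ker n \<Longrightarrow> bM n (m - ?p) x = 0"
    using FS.orth_proj[OF M_inner ker_subspace ker_sub S m] by blast+
  have d: "m - ?p \<in> M n" using FS.subspace_diff[OF M_subspace m] p(1) ker_sub by blast
  have "ev n m = ev n (m - ?p) + ev n ?p" using ev_simps(1)[OF d, of ?p] p(1) ker_sub by auto
  then have "ev n (m - ?p) = ev n m" using p(1) by (simp add: ker_def)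
  then show ?thesis unfolding lifts_def using d p(2) by blast
qed

lemma lifts_unique: "lifts n v m \<Longrightarrow> lifts n v m' \<Longrightarrow> m = m'"
proof (rule ccontr)
  assume *: "lifts n v m" "lifts n v m'" and ne: "m \<noteq> m'"
  then have mm: "m \<in> M n" "m' \<in> M n" by (auto simp: lifts_def)
  have d: "m - m' \<in> M n" using FS.subspace_diff[OF M_subspace mm] .
  have "ev n m = ev n (m - m') + ev n m'" using ev_simps(1)[OF d mm(2)] by simp
  then have k: "m - m' \<in> ker n" using * d by (simp add: ker_def lifts_def)
  have "bM n (m - m') (m - m') = bM n m (m - m') - bM n m' (m - m')"
    by (rule FS.bilinear_form_on_diff[OF bM_form mm d])
  also have "\<dots> = 0" using * k by (simp add: lifts_def)
  finally show False using FS.inner_product_onD(2)[OF M_inner d] ne by simp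
qed

lemma lifts_add: "lifts n u m \<Longrightarrow> lifts n v m' \<Longrightarrow> lifts n (u + v) (m + m')"
  using FS.subspace_add[OF M_subspace] FS.bilinear_form_onD(3)[OF bM_form] ker_sub
  by (auto simp: lifts_def ev_simps subset_iff)

text \<open>Skewness moves \<open>D n X\<close> onto the kernel element, which remains in the kernel
  because \<open>ev\<close> intertwines \<open>D n X\<close> with \<open>\<pi> X\<close>; the term
  with the constant vanishes by orthogonality.\<close>

lemma lifts_D: "X \<in> k \<Longrightarrow> lifts n v m \<Longrightarrow> lifts n (\<pi> X v) (D n X m)"
proof -
  assume X: "X \<in> k" and l: "lifts n v m"
  then have m: "m \<in> M n" by (simp add: lifts_def)
  obtain c where c: "\<forall>m\<in>M n. \<forall>m'\<in>M n. bM n (D n X m) m' + bM n m (D n X m') = c * bM n m m'"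
    using D_skew[OF X] by blast
  have "bM n (D n X m) x = 0" if x: "x \<in> ker n" for x
  proof -
    have xM: "x \<in> M n" using x ker_sub by blast
    have "D n X x \<in> ker n" using x D_M[OF X xM] ev_simps(3)[OF X xM] \<pi>_lin(2)[of X 0 0] by (simp add: ker_def)
    then show ?thesis using c[rule_format, OF m xM] l x by (simp add: lifts_def)
  qed
  then show ?thesis using l D_M[OF X m] ev_simps(3)[OF X m] by (simp add: lifts_def)
qed

text \<open>Orthogonality refers to a real form, but the kernel is closed under complex scalars, so
  the argument for \<kk> applies with the constant 2 Re z.\<close>

lemma lifts_scale: "lifts n v m \<Longrightarrow> lifts n (sc z v) (\<lambda>w. sc z (m w))"
proof -
  assume l: "lifts n v m"
  then have m: "m \<in> M n" by (simp add: lifts_def)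
  have "bM n (\<lambda>w. sc z (m w)) x = 0" if x: "x \<in> ker n" for x
  proof -
    have xM: "x \<in> M n" using x ker_sub by blast
    have "(\<lambda>w. sc z (x w)) \<in> ker n" using x M_scale[OF xM] ev_simps(2)[OF xM] by (simp add: ker_def)
    then have "bM n m (\<lambda>w. sc z (x w)) = 0" "bM n m x = 0" using l x by (auto simp: lifts_def)
    moreover have "bM n (\<lambda>w. sc z (m w)) x + bM n m (\<lambda>w. sc z (x w)) = 2 * Re z * bM n m x"
      unfolding bM_def sum.distrib[symmetric] sum_distrib_left
      using b_scale subsetD[OF \<tau>'_sub M_D(4)[OF m]] subsetD[OF \<tau>'_sub M_D(4)[OF xM]] by simp
    ultimately show ?thesis by simp
  qed
  then show ?thesis using l M_scale[OF m] ev_simps(2)[OF m] by (simp add: lifts_def)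
qed

theorem scalar_on_invariants:
  assumes P: "\<And>u v. P (u + v) = P u + P v" "\<And>z v. P (sc z v) = sc z (P v)"
    "\<And>X v. X \<in> k \<Longrightarrow> P (\<pi> X v) = \<pi> X (P v)"
    and range: "\<And>t. t \<in> \<tau>' \<Longrightarrow> P t \<in> ev n ` M n"
    and once: "occurs_exactly_once br sc \<pi> \<kappa> q \<tau>"
    and v: "v \<in> \<tau>'" "v \<noteq> 0"
  shows "\<exists>z. P v = sc z v"
proof -
  \<comment> \<open>Composing with \<open>pr\<close> defines the lift on all of
    \<open>\<tau>\<close>, the source of the homomorphisms counted by the multiplicity, while values
    of \<open>P\<close> have to be reached on \<open>\<tau>'\<close> only.\<close>
  define lift where "lift t = (THE m. lifts n (P (pr t)) m)" for t
  have lift: "lifts n (P (pr t)) (lift t)" if "t \<in> \<tau>" for t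
  proof -
    have "pr t \<in> \<tau>'" using proj(1)[OF that] .
    then obtain m where "m \<in> M n" "P (pr t) = ev n m" using range by blast
    then have "\<exists>!m. lifts n (P (pr t)) m" using lifts_exists lifts_unique by metis
    then show ?thesis unfolding lift_def by (rule theI')
  qed
  have lift_eq: "lift t = m" if "t \<in> \<tau>" "lifts n (P (pr t)) m" for t m
    using lifts_unique[OF lift[OF that(1)] that(2)] .
  have liftM: "lift t \<in> M n" if "t \<in> \<tau>" for t using lift[OF that] by (simp add: lifts_def)
  have lift_add: "lift (t + t') = lift t + lift t'" if "t \<in> \<tau>" "t' \<in> \<tau>" for t t'
    using lifts_add[OF lift[OF that(1)] lift[OF that(2)]] subspace_add[OF \<tau>_subspace that]
    by (intro lift_eq) (simp_all add: proj_add[OF that] P)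
  have lift_scale: "lift (sc z t) = (\<lambda>w. sc z (lift t w))" if "t \<in> \<tau>" for z t
    using lifts_scale[OF lift[OF that]] subspace_scale[OF \<tau>_subspace that]
    by (intro lift_eq) (simp_all add: proj_scale[OF that] P)
  have lift_\<pi>: "lift (\<pi> X t) = D n X (lift t)" if "X \<in> k" "t \<in> \<tau>" for X t
    using lifts_D[OF that(1) lift[OF that(2)]] \<pi>_\<tau>[OF that]
    by (intro lift_eq) (simp_all add: proj_\<pi>[OF that] P that)
  define h where "h t = embed n (lift t)" for t
  have h_in: "h t \<in> carrier F" if "t \<in> \<tau>" for t unfolding h_def by (rule embed_in[OF liftM[OF that]])
  have h_add: "req (h (t + t')) (h t + h t')" if "t \<in> \<tau>" "t' \<in> \<tau>" for t t'
    unfolding h_def lift_add[OF that] by (intro embed_add liftM that)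
  have h_scale: "req (h (sc z t)) (left_mult (free_const z) (h t))" if "t \<in> \<tau>" for z t
    unfolding h_def lift_scale[OF that] by (intro embed_scale liftM that)
  have h_\<pi>: "req (h (\<pi> X t)) (left_mult (free_var (X, 0)) (h t))" if "X \<in> k" "t \<in> \<tau>" for X t
    unfolding h_def lift_\<pi>[OF that] by (intro embed_D liftM that)
  have "(\<lambda>t. coset (h t)) \<in> induced_hom br sc \<pi> \<kappa> q \<tau>"
  proof (rule induced_homI[folded req_def])
    fix X t assume X: "X \<in> \<kappa>" and t: "t \<in> \<tau>"
    obtain Y Z where X_eq: "X = (Y, Z)" "Y \<in> k" "Z \<in> k" using X by (auto simp: \<kappa>_eq)
    \<comment> \<open>Only real elements of \<kk> act through \<open>D\<close>. For Y + \<i> Z the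
      variable is split modulo the enveloping ideal, and the factor \<i> is handled by
      \<open>h_scale\<close>.\<close>
    let ?y = "free_var (Y, 0)" and ?z = "free_const \<i> * free_var (Z, 0)"
    have "X = (Y, 0) + cscale \<i> (Z, 0)" by (simp add: X_eq cscale_def)
    then have I: "free_var X - (?y + ?z) \<in> E.I"
      using E.I_add[OF E.relations_in_I(1)[of "(Y, 0)" "cscale \<i> (Z, 0)"] E.relations_in_I(2)[of "(Z, 0)" \<i>]]
      by (simp add: algebra_simps)
    have m: "lift t \<in> M n" by (rule liftM[OF t])
    have "h (cr X t) = h (\<pi> Y t + sc \<i> (\<pi> Z t))" by (simp add: crep_def X_eq)
    also have "req \<dots> (h (\<pi> Y t) + h (sc \<i> (\<pi> Z t)))"
      using \<pi>_\<tau> X_eq t by (intro h_add subspace_scale[OF \<tau>_subspace]) auto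
    also have "req \<dots> (left_mult ?y (h t) + left_mult (free_const \<i>) (left_mult (free_var (Z, 0)) (h t)))"
      using X_eq t \<pi>_\<tau> by (intro req_add h_\<pi> req_trans[OF h_scale req_left_mult[OF h_\<pi>]]) auto
    also have "\<dots> = (\<Sum>w\<in>words n. ten (?y * word w) (lift t w) + ten (?z * word w) (lift t w))"
      by (simp add: h_def embed_def left_mult_sum left_mult_ten sum.distrib mult.assoc)
    also have "req \<dots> (\<Sum>w\<in>words n. ten ((?y + ?z) * word w) (lift t w))"
      by (rule req_sum, rule req_sym, unfold req_def distrib_right, rule ten_add_left)
        (use M_D(4)[OF m] \<tau>'_sub in blast)
    also have "\<dots> = left_mult (free_var X) (h t)"
      unfolding h_def embed_def left_mult_sum left_mult_ten
    proof (intro sum.cong refl ten_cong)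
      fix w
      have "(?y + ?z - free_var X) * word w \<in> E.I"
        using E.I_uminus[OF I] by (intro E.I_mult carrier_UNIV) simp
      then show "(?y + ?z) * word w - free_var X * word w \<in> E.I" by (simp add: left_diff_distrib)
    qed
    finally show "req (h (cr X t)) (left_mult (free_var X) (h t))" .
  qed (auto intro: h_add h_scale h_in simp del: carrier_free_Abelian_group_iff)
  then have "\<exists>z. eval pr (h v) = sc z v"
    using v \<tau>'_sub by (intro multiplicity_one_eval[OF proj_add proj_scale proj_cr proj_q h_in _ once] proj_id) auto
  \<comment> \<open>The lift of v evaluates to P (pr v) by construction, and \<open>pr\<close> fixes
    v.\<close>
  moreover have "eval pr (h v) = P v"
    using lift[of v] v \<tau>'_sub proj_id[OF v(1)] by (auto simp: h_def ev_def[symmetric] lifts_def)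
  ultimately show ?thesis by simp
qed

end

section \<open>The filtration of V by degree\<close>

context word_setup
begin

sublocale Pi: free_action sc \<pi>
  by (intro free_action.intro vector_space_axioms free_action_axioms.intro \<pi>_linear)

text \<open>The span of what products of at most n elements of \<gg> make of \<open>\<tau>'\<close>:
  the degree filtration of V.\<close>

definition R where "R n = ev n ` M n"

lemma words_mono: "n \<le> n' \<Longrightarrow> words n \<subseteq> words n'"
  by (auto simp: words_def)

lemma foldr_0: "foldr \<pi> w 0 = 0"
  by (induction w) simp_all

lemma R_mono: "n \<le> n' \<Longrightarrow> R n \<subseteq> R n'"
proof
  fix v assume n: "n \<le> n'" and "v \<in> R n"
  then obtain m where m: "m \<in> M n" "v = ev n m" by (auto simp: R_def)
  have m': "m \<in> M n'"
    unfolding M_def using M_D(3)[OF m(1)] M_D(4)[OF m(1)] words_mono[OF n] by blast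
  have "ev n m = ev n' m"
    unfolding ev_eq[OF m(1)] ev_eq[OF m']
    by (rule sum.mono_neutral_left[OF finite_words words_mono[OF n]]) (use M_D(3)[OF m(1)] in \<open>simp add: foldr_0\<close>)
  then show "v \<in> R n'" using m m' by (simp add: R_def)
qed

lemma R_subspace: "subspace (R n)"
proof (rule subspaceI)
  have z: "(0 :: 'e list \<Rightarrow> 'v) \<in> M n" by (rule FS.subspace_0[OF M_subspace])
  show "0 \<in> R n" using ev_simps(1)[OF z z] z by (auto simp: R_def intro: image_eqI[of _ _ 0])
  show "x + y \<in> R n" if "x \<in> R n" "y \<in> R n" for x y
    using that FS.subspace_add[OF M_subspace] by (auto simp: R_def ev_simps(1)[symmetric])
  show "sc z x \<in> R n" if "x \<in> R n" for z x
    using that M_scale by (auto simp: R_def ev_simps(2)[symmetric])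
qed

lemma word_in_R: "set w \<subseteq> E \<Longrightarrow> t \<in> \<tau>' \<Longrightarrow> foldr \<pi> w t \<in> R (length w)"
proof -
  assume w: "set w \<subseteq> E" and t: "t \<in> \<tau>'"
  let ?n = "length w"
  have ww: "w \<in> words ?n" using w by (simp add: words_def)
  have m: "single_word w t \<in> M ?n"
    unfolding M_def using ww t subspace_0[OF \<tau>'_subspace] by (auto simp: single_word_def)
  have "ev ?n (single_word w t) = (\<Sum>u\<in>words ?n. if u = w then foldr \<pi> w t else 0)"
    unfolding ev_eq[OF m] by (intro sum.cong) (auto simp: single_word_def foldr_0)
  also have "\<dots> = foldr \<pi> w t" using ww finite_words by simp
  finally show ?thesis using m unfolding R_def by (metis image_eqI)
qed

lemma union_R_subspace: "subspace (\<Union>n. R n)"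
proof (rule subspaceI)
  show "0 \<in> (\<Union>n. R n)" using subspace_0[OF R_subspace] by blast
  show "x + y \<in> (\<Union>n. R n)" if xy: "x \<in> (\<Union>n. R n)" "y \<in> (\<Union>n. R n)" for x y
  proof -
    obtain i j where "x \<in> R i" "y \<in> R j" using xy by blast
    then have "x \<in> R (max i j)" "y \<in> R (max i j)"
      using R_mono[of i "max i j"] R_mono[of j "max i j"] by auto
    then show ?thesis using subspace_add[OF R_subspace] by blast
  qed
  show "sc z x \<in> (\<Union>n. R n)" if "x \<in> (\<Union>n. R n)" for z x
    using that subspace_scale[OF R_subspace] by blast
qed

lemma \<pi>_expand: "\<pi> X v = (\<Sum>e\<in>E. sc (complex_of_real (bg X e)) (\<pi> e v))"
proof -
  have s: "\<pi> (\<Sum>e\<in>J. bg X e *\<^sub>R e) v = (\<Sum>e\<in>J. sc (complex_of_real (bg X e)) (\<pi> e v))" if "finite J" for J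
    using that
  proof (induction J)
    case empty
    show ?case using \<pi>_scaleR[of 0 0 v] by simp
  qed (simp add: \<pi>_add \<pi>_scaleR)
  from s[OF E_fin] show ?thesis by (simp add: E_expand)
qed

lemma union_R_stable: "v \<in> (\<Union>n. R n) \<Longrightarrow> \<pi> X v \<in> (\<Union>n. R n)"
proof -
  assume "v \<in> (\<Union>n. R n)"
  then obtain n m where m: "m \<in> M n" "v = ev n m" by (auto simp: R_def)
  have "foldr \<pi> (e # w) (m w) \<in> R (Suc n)" if "e \<in> E" "w \<in> words n" for e w
    using word_in_R[of "e # w" "m w"] R_mono[of "length (e # w)" "Suc n"] that M_D(4)[OF m(1)]
    by (auto simp: words_def)
  moreover have "\<pi> e (\<Sum>w\<in>J. f w) = (\<Sum>w\<in>J. \<pi> e (f w))" for e f and J :: "'e list set"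
    by (induction J rule: infinite_finite_induct) (simp_all add: Pi.\<rho>_add)
  ultimately have e: "\<pi> e v \<in> R (Suc n)" if "e \<in> E" for e
    unfolding m(2) ev_eq[OF m(1)] using that by (auto intro!: subspace_sum[OF R_subspace])
  have "\<pi> X v \<in> R (Suc n)" unfolding \<pi>_expand[of X]
    by (intro subspace_sum[OF R_subspace] subspace_scale[OF R_subspace] e)
  then show ?thesis by blast
qed

text \<open>The union of all \<open>R n\<close> is stable under \<gg> and contains
  \<open>v0\<close>, so it is V. As \<open>\<tau>'\<close> is finite-dimensional and the filtration
  increases, one n serves the images of a whole basis.\<close>

lemma range_bounded:
  assumes P: "\<And>u v. P (u + v) = P u + P v" "\<And>z v. P (sc z v) = sc z (P v)"
    and gen: "\<And>S. subspace S \<Longrightarrow> v0 \<in> S \<Longrightarrow> (\<And>X v. v \<in> S \<Longrightarrow> \<pi> X v \<in> S) \<Longrightarrow> S = UNIV"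
    and v0: "v0 \<in> \<tau>'"
  shows "\<exists>n. \<forall>t\<in>\<tau>'. P t \<in> ev n ` M n"
proof -
  have "v0 \<in> R 0" using word_in_R[of "[]" v0] v0 by simp
  then have U: "(\<Union>n. R n) = UNIV"
    using gen[OF union_R_subspace _ union_R_stable] by blast
  obtain B' where B': "B' \<subseteq> \<tau>'" "independent B'" "\<tau>' \<subseteq> span B'"
    using basis_exists[of \<tau>'] by metis
  have "finite B'"
    using independent_span_bound[OF B_fin(1) B'(2)] B'(1) \<tau>'_sub B_fin(2) by blast
  moreover have "\<exists>n. \<forall>x\<in>J. P x \<in> R n" if "finite J" for J
    using that
  proof (induction J)
    case (insert x J)
    then obtain n where n: "\<forall>x\<in>J. P x \<in> R n" by blast
    obtain i where i: "P x \<in> R i" using U by blast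
    then have "\<forall>y\<in>insert x J. P y \<in> R (max i n)"
      using n R_mono[of i "max i n"] R_mono[of n "max i n"] by auto
    then show ?case by blast
  qed simp
  ultimately obtain n where n: "\<forall>x\<in>B'. P x \<in> R n" by blast
  have P0: "P 0 = 0" using P(1)[of 0 0] by simp
  have "P t \<in> R n" if "t \<in> span B'" for t
    using that
    by (induction rule: span_induct_alt)
      (auto simp: P P0 subspace_0[OF R_subspace] n intro!: subspace_add[OF R_subspace] subspace_scale[OF R_subspace])
  then show ?thesis using B'(3) unfolding R_def by blast
qed

lemma scalar_on_vector:
  assumes P: "\<And>u v. P (u + v) = P u + P v" "\<And>z v. P (sc z v) = sc z (P v)"
    "\<And>X v. X \<in> k \<Longrightarrow> P (\<pi> X v) = \<pi> X (P v)"
    and gen: "\<And>S. subspace S \<Longrightarrow> v0 \<in> S \<Longrightarrow> (\<And>X v. v \<in> S \<Longrightarrow> \<pi> X v \<in> S) \<Longrightarrow> S = UNIV"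
    and once: "occurs_exactly_once br sc \<pi> \<kappa> q \<tau>"
    and v0: "v0 \<in> \<tau>" "\<And>Q. Q \<in> q \<Longrightarrow> cr Q v0 = 0" "v0 \<noteq> 0"
  shows "\<exists>z. P v0 = sc z v0"
proof -
  have v: "v0 \<in> \<tau>'" using v0 by (simp add: \<tau>'_def)
  obtain n where "\<forall>t\<in>\<tau>'. P t \<in> ev n ` M n" using range_bounded[OF P(1,2) gen v] by blast
  then show ?thesis using scalar_on_invariants[OF P _ once v v0(3)] by blast
qed

end

text \<open>Cyclicity in the form in which it is applied: a complex subspace stable under \<gg> is
  stable under the complexification, hence under words in it and under the enveloping
  algebra.\<close>

lemma enveloping_span_stable:
  assumes "induced_setup sc br \<pi> \<kappa> q \<tau>"
    and cyclic: "module.span sc {uea_act sc (crep sc \<pi>) u v0 | u. u \<in> carrier (uea cscale (cbracket br) UNIV)} = UNIV"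
    and S: "module.subspace sc S" "v0 \<in> S" "\<And>X v. v \<in> S \<Longrightarrow> \<pi> X v \<in> S"
  shows "S = UNIV"
proof -
  interpret induced_setup sc br \<pi> \<kappa> q \<tau> by fact
  have cr: "cr X v \<in> S" if "v \<in> S" for X v
    using S(3)[OF that] subspace_add[OF S(1)] subspace_scale[OF S(1)] by (simp add: crep_def)
  have "uea_act sc cr u v0 \<in> S" for u
    unfolding uea_act_def by (rule C.act_stable[OF S(1) cr carrier_UNIV S(2)])
  then have "span {uea_act sc cr u v0 | u. u \<in> carrier (uea cscale (cbracket br) UNIV)} \<subseteq> S"
    by (intro span_minimal S(1)) blast
  then show ?thesis using cyclic by blast
qed

section \<open>Invariant forms for \<open>K\<close>\<close>

interpretation scaleR_scaled: real_scaled "scaleR :: real \<Rightarrow> 'a::real_vector \<Rightarrow> 'a"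
  by unfold_locales

lemma (in lie_group) central_Ad:
  assumes "z \<in> group_center G"
  shows "z \<in> carrier G" "\<And>y. y \<in> carrier G \<Longrightarrow> z \<otimes> y = y \<otimes> z"
  using assms by (auto simp: group_center_def)

lemma inner_product_scaleR:
  assumes "scaleR_scaled.inner_product_on UNIV b"
  shows "linear (\<lambda>u. b u v)" "linear (b u)" "b u v = b v u"
proof -
  note D = scaleR_scaled.bilinear_form_onD[OF scaleR_scaled.inner_product_onD(1)[OF assms], simplified]
  show "linear (\<lambda>u. b u v)" "linear (b u)" by (intro linearI; simp add: D)+
  show "b u v = b v u" by (rule D(2))
qed

context lie_chart
begin

abbreviation AD where "AD \<equiv> Ad G (U, \<phi>)"
abbreviation BR where "BR \<equiv> lie_bracket G (U, \<phi>)"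

lemma Ad_invariant_form:
  assumes C: "subgroup C G" "compactin (topo G) C"
  shows "\<exists>b. scaleR_scaled.inner_product_on UNIV b \<and> (\<forall>x\<in>C. \<forall>Y Z. b (AD x Y) (AD x Z) = b Y Z)"
proof -
  obtain B :: "'e set" where B: "finite B" "independent B" "span B = UNIV"
    using finite_basis_exists[OF finite_dimensional] by blast
  have car: "x \<in> carrier G" if "x \<in> C" for x using subgroup.mem_carrier[OF C(1) that] .
  have one: "AD \<one> Y = Y" for Y by (rule Ad_central) auto
  note iip = scaleR_scaled.invariant_inner_product[of B UNIV "AD ` C", folded dependent_raw_def span_raw_def representation_raw_def]
  have "\<exists>b. scaleR_scaled.inner_product_on UNIV b \<and> (\<forall>g\<in>AD ` C. \<forall>u\<in>UNIV. \<forall>v\<in>UNIV. b (g u) (g v) = b u v)"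
  proof (rule iip[OF B(1,2)])
    show "UNIV = span B" using B(3) by simp
    show "g (u + v) = g u + g v" "g (r *\<^sub>R u) = r *\<^sub>R g u" if "g \<in> AD ` C" for g u v r
      using that linear_add[OF Ad_linear] linear_scale[OF Ad_linear] car by auto
    show "(\<lambda>u. u) \<in> AD ` C"
      using subgroup.one_closed[OF C(1)] one by (intro image_eqI[of _ _ \<one>]) auto
    show "(\<lambda>u. g (h u)) \<in> AD ` C" if gh: "g \<in> AD ` C" "h \<in> AD ` C" for g h
    proof -
      obtain x y where xy: "x \<in> C" "y \<in> C" "g = AD x" "h = AD y" using gh by blast
      then have "(\<lambda>u. g (h u)) = AD (x \<otimes> y)" using Ad_mult[OF car car] by (auto simp: fun_eq_iff)
      then show ?thesis using subgroup.m_closed[OF C(1) xy(1,2)] by blast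
    qed
    show "\<exists>h\<in>AD ` C. \<forall>u\<in>UNIV. g (h u) = u" if g: "g \<in> AD ` C" for g
    proof -
      obtain x where x: "x \<in> C" "g = AD x" using g by blast
      have "g (AD (inv x) u) = u" for u
        using Ad_mult[of x "inv x" u] car[OF x(1)] one x by simp
      then show ?thesis using subgroup.m_inv_closed[OF C(1) x(1)] by blast
    qed
    show "\<exists>M. \<forall>g\<in>AD ` C. \<bar>representation B (g j) i\<bar> \<le> M" if "i \<in> B" "j \<in> B" for i j
    proof -
      have "linear (\<lambda>v. representation B v i)"
        by (intro linearI) (simp_all add: real_vector.representation_add real_vector.representation_scale B)
      then have bl: "bounded_linear (\<lambda>v. representation B v i)"
        by (rule linear_bounded_finite_dim[OF finite_dimensional])
      then obtain K where K: "K \<ge> 0" "\<And>v. \<bar>representation B v i\<bar> \<le> norm v * K"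
        using bounded_linear.nonneg_bounded[OF bl] by auto
      obtain M where M: "\<And>x. x \<in> C \<Longrightarrow> norm (AD x j) \<le> M" using Ad_bounded_on_compact[OF C(2)] by blast
      have "\<bar>representation B (AD x j) i\<bar> \<le> M * K" if "x \<in> C" for x
        using K(2)[of "AD x j"] mult_right_mono[OF M[OF that] K(1)] by linarith
      then show ?thesis by blast
    qed
  qed auto
  then show ?thesis by simp
qed

lemma has_vector_derivative_reverse:
  assumes "(f has_vector_derivative D) (at 0)"
  shows "((\<lambda>t. f (- t :: real)) has_vector_derivative - D) (at 0)"
proof -
  have "((\<lambda>t. - t :: real) has_vector_derivative - 1) (at 0)" by (auto intro!: derivative_eq_intros)
  from vector_diff_chain_at[OF this, of f D] show ?thesis using assms by (simp add: o_def)
qed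

lemma has_vector_derivative_linear:
  fixes f :: "real \<Rightarrow> 'e" and L :: "'e \<Rightarrow> real"
  assumes "(f has_vector_derivative D) (at t)" "linear L"
  shows "((\<lambda>t. L (f t)) has_vector_derivative L D) (at t)"
  using bounded_linear.has_vector_derivative[OF linear_bounded_finite_dim[OF finite_dimensional assms(2)] assms(1)] .

text \<open>Invariance lets Ad (\<gamma> t) in the first argument be replaced by Ad (\<gamma> (-t))
  in the second; both sides are then differentiated at t = 0.\<close>

lemma invariant_form_skew:
  assumes b: "scaleR_scaled.inner_product_on UNIV b" and inv: "\<And>x Y Z. x \<in> K \<Longrightarrow> b (AD x Y) (AD x Z) = b Y Z"
    and K: "subgroup K G" and X: "X \<in> subgroup_lie_algebra G (U, \<phi>) K"
  shows "b (BR X Y) Z = - b Y (BR X Z)"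
proof -
  obtain \<gamma> where \<gamma>: "one_param_subgroup G (U, \<phi>) X \<gamma>" "range \<gamma> \<subseteq> K"
    using X unfolding subgroup_lie_algebra_def by blast
  note g = one_param_facts[OF \<gamma>(1)] and l = inner_product_scaleR[OF b]
  have one: "AD \<one> Y = Y" for Y by (rule Ad_central) auto
  have eq: "(\<lambda>t. b (AD (\<gamma> t) Y) Z) = (\<lambda>t. b Y (AD (\<gamma> (- t)) Z))"
  proof
    fix t
    have "AD (\<gamma> t) (AD (\<gamma> (- t)) Z) = Z"
      using Ad_mult[OF g(1)[of t] g(1)[of "- t"], of Z] one by (simp add: g(4)[symmetric] g(2))
    then show "b (AD (\<gamma> t) Y) Z = b Y (AD (\<gamma> (- t)) Z)"
      using inv[of "\<gamma> t" Y "AD (\<gamma> (- t)) Z"] \<gamma>(2) by auto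
  qed
  have "((\<lambda>t. b (AD (\<gamma> t) Y) Z) has_vector_derivative b (BR X Y) Z) (at 0)"
    by (rule has_vector_derivative_linear[OF Ad_one_param_has_derivative[OF \<gamma>(1)] l(1)])
  moreover have "((\<lambda>t. b Y (AD (\<gamma> (- t)) Z)) has_vector_derivative b Y (- BR X Z)) (at 0)"
    by (rule has_vector_derivative_linear[OF has_vector_derivative_reverse[OF Ad_one_param_has_derivative[OF \<gamma>(1)]] l(2)])
  ultimately have "b (BR X Y) Z = b Y (- BR X Z)"
    unfolding eq by (rule vector_derivative_unique_at)
  then show ?thesis using linear_neg[OF l(2)] by simp
qed

lemma Ad_invariant_skew_basis:
  assumes C: "subgroup C G" "compactin (topo G) C" and K: "subgroup K G" "K = group_center G <#> C"
  obtains b E where "finite E" "\<And>Y. (\<Sum>e\<in>E. b Y e *\<^sub>R e) = Y" "\<And>Y Z. b Y Z = b Z Y"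
    "\<And>X Y Z. X \<in> subgroup_lie_algebra G (U, \<phi>) K \<Longrightarrow> b (BR X Y) Z = - b Y (BR X Z)"
proof -
  obtain b where b: "scaleR_scaled.inner_product_on UNIV b" and inv: "\<And>x Y Z. x \<in> C \<Longrightarrow> b (AD x Y) (AD x Z) = b Y Z"
    using Ad_invariant_form[OF C] by blast
  \<comment> \<open>Central elements act trivially under Ad, so invariance under the compact factor
    already is invariance under \<open>K\<close>.\<close>
  have invK: "b (AD x Y) (AD x Z) = b Y Z" if "x \<in> K" for x Y Z
  proof -
    obtain z c where zc: "z \<in> group_center G" "c \<in> C" "x = z \<otimes> c" using \<open>x \<in> K\<close> unfolding K(2) set_mult_def by blast
    have c: "c \<in> carrier G" using subgroup.mem_carrier[OF C(1) zc(2)] .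
    have "AD x Y = AD c Y" for Y
      using Ad_mult[OF central_Ad(1)[OF zc(1)] c] Ad_central[OF central_Ad[OF zc(1)]] zc(3) by simp
    then show ?thesis using inv[OF zc(2)] by simp
  qed
  obtain B :: "'e set" where B: "finite B" "span B = UNIV" using finite_dimensional by blast
  obtain E where E: "scaleR_scaled.orthonormal_on b E" "span E = UNIV"
    using scaleR_scaled.orthonormal_basis_exists[OF b, of UNIV B, folded span_raw_def subspace_raw_def] B by auto
  have "finite E" using E(1) by (simp add: scaleR_scaled.orthonormal_on_def)
  note bf = scaleR_scaled.inner_product_onD(1)[OF b]
  have ex: "(\<Sum>e\<in>E. b Y e *\<^sub>R e) = Y" for Y
  proof -
    obtain r where r: "Y = (\<Sum>e\<in>E. r e *\<^sub>R e)"
      using UNIV_I[of Y] unfolding E(2)[symmetric] span_finite[OF \<open>finite E\<close>] by blast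
    have "b Y e = r e" if "e \<in> E" for e
      unfolding r by (rule scaleR_scaled.orthonormal_expand[OF bf E(1) subset_UNIV that])
    then show ?thesis using r by simp
  qed
  show ?thesis
  proof (rule that[OF \<open>finite E\<close> ex])
    show "b Y Z = b Z Y" for Y Z by (rule inner_product_scaleR(3)[OF b])
    show "b (BR X Y) Z = - b Y (BR X Z)" if "X \<in> subgroup_lie_algebra G (U, \<phi>) K" for X Y Z
      by (rule invariant_form_skew[OF b _ K(1) that]) (rule invK)
  qed
qed

end

section \<open>Functionals on V and bounds on compact sets\<close>

text \<open>The axioms on smoothness and on the differential of the \<open>K\<close>-action are
  phrased with functionals on all of V, whereas forms and coordinates live on a subspace and have to
  be extended first.\<close>

lemma complex_functional_extend:
  fixes sc :: "complex \<Rightarrow> 'v::ab_group_add \<Rightarrow> 'v"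
  assumes vs: "vector_space sc" and W: "module.subspace sc W"
    and f: "\<And>u v. u \<in> W \<Longrightarrow> v \<in> W \<Longrightarrow> f (u + v) = f u + f v" "\<And>z v. v \<in> W \<Longrightarrow> f (sc z v) = z * f v"
  shows "\<exists>L. Vector_Spaces.linear sc (*) L \<and> (\<forall>v\<in>W. L v = f v)"
proof -
  interpret vector_space_pair sc "(*) :: complex \<Rightarrow> complex \<Rightarrow> complex"
    by (intro vector_space_pair.intro vs) (unfold_locales, simp_all add: algebra_simps)
  obtain B where B: "B \<subseteq> W" "vs1.independent B" "W \<subseteq> vs1.span B"
    using vs1.basis_exists[of W] by metis
  obtain L where L: "Vector_Spaces.linear sc (*) L" "\<forall>x\<in>B. L x = f x"
    using linear_independent_extend[OF B(2), of f] by blast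
  interpret L: Vector_Spaces.linear sc "(*)" L by fact
  have f0: "f 0 = 0" using f(2)[OF vs1.subspace_0[OF W], of 0] by simp
  have "v \<in> W \<and> L v = f v" if "v \<in> vs1.span B" for v
    using that
  proof (induction rule: vs1.span_induct_alt)
    case (step c x y)
    then show ?case using B(1) L(2) vs1.subspace_add[OF W] vs1.subspace_scale[OF W]
      by (auto simp: L.add L.scale f subset_iff)
  qed (simp add: vs1.subspace_0[OF W] f0 L.zero)
  then show ?thesis using L(1) B(3) by blast
qed

text \<open>A real-linear functional \<open>f\<close> is the real part of the complex-linear functional \<open>v \<mapsto> f v - \<i> f (\<i> v)\<close>.\<close>

lemma real_functional_extend:
  fixes sc :: "complex \<Rightarrow> 'v::ab_group_add \<Rightarrow> 'v"
  assumes vs: "vector_space sc" and W: "module.subspace sc W"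
    and f: "\<And>u v. u \<in> W \<Longrightarrow> v \<in> W \<Longrightarrow> f (u + v) = f u + f v"
      "\<And>r v. v \<in> W \<Longrightarrow> f (sc (complex_of_real r) v) = r * f v"
  shows "\<exists>L. Vector_Spaces.linear sc (*) L \<and> (\<forall>v\<in>W. Re (L v) = f v)"
proof -
  interpret vector_space sc by fact
  define F where "F v = Complex (f v) (- f (sc \<i> v))" for v
  have st: "sc z v \<in> W" if "v \<in> W" for z v using subspace_scale[OF W that] .
  have dec: "sc z w = sc (complex_of_real (Re z)) w + sc (complex_of_real (Im z)) (sc \<i> w)" for z w
    by (simp add: scale_left_distrib[symmetric] mult.commute complex_eq[symmetric])
  have fz: "f (sc z v) = Re z * f v + Im z * f (sc \<i> v)" if "v \<in> W" for z v
    unfolding dec[of z] by (simp only: f st that)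
  have "F (u + v) = F u + F v" if "u \<in> W" "v \<in> W" for u v
    using that st by (simp add: F_def f scale_right_distrib complex_eq_iff)
  moreover have "F (sc z v) = z * F v" if "v \<in> W" for z v
    using fz[OF that, of z] fz[OF that, of "\<i> * z"] by (simp add: F_def complex_eq_iff algebra_simps)
  ultimately obtain L where "Vector_Spaces.linear sc (*) L" "\<forall>v\<in>W. L v = F v"
    using complex_functional_extend[OF vs W, of F] by blast
  then show ?thesis by (intro exI[of _ L]) (simp add: F_def)
qed

lemma complex_functional_separates:
  fixes sc :: "complex \<Rightarrow> 'v::ab_group_add \<Rightarrow> 'v"
  assumes vs: "vector_space sc" and W: "module.subspace sc W" and x: "x \<notin> W"
  shows "\<exists>L. Vector_Spaces.linear sc (*) L \<and> (\<forall>v\<in>W. L v = 0) \<and> L x = (1 :: complex)"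
proof -
  interpret vector_space_pair sc "(*) :: complex \<Rightarrow> complex \<Rightarrow> complex"
    by (intro vector_space_pair.intro vs) (unfold_locales, simp_all add: algebra_simps)
  obtain B where B: "B \<subseteq> W" "vs1.independent B" "W \<subseteq> vs1.span B"
    using vs1.basis_exists[of W] by metis
  have "x \<notin> vs1.span B" using vs1.span_minimal[OF B(1) W] x by blast
  then have "vs1.independent (insert x B)" using vs1.independent_insertI[OF _ B(2)] by blast
  then obtain L where L: "Vector_Spaces.linear sc (*) L" "\<forall>y\<in>insert x B. L y = (if y = x then 1 else 0 :: complex)"
    using linear_independent_extend[of "insert x B" "\<lambda>y. if y = x then 1 else 0"] by blast
  interpret L: Vector_Spaces.linear sc "(*)" L by fact
  have "L v = 0" if "v \<in> vs1.span B" for v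
    using that
    by (induction rule: vs1.span_induct_alt) (use L(2) B(1) x in \<open>auto simp: L.add L.scale L.zero\<close>)
  then show ?thesis using L B(3) by auto
qed

text \<open>Near each point the function agrees on \<open>K\<close> with a smooth function on an
  open set, which is bounded on a smaller neighbourhood by continuity in a chart; finitely many such
  neighbourhoods cover \<open>C\<close>.\<close>

lemma (in lie_group) smooth_bounded_on_compact:
  fixes f :: "'g \<Rightarrow> 'c::real_normed_vector"
  assumes f: "smooth_fun_on_subset G K f" and C: "compactin (topo G) C" "C \<subseteq> K"
  shows "\<exists>M. \<forall>x\<in>C. norm (f x) \<le> M"
proof -
  have "\<exists>N M. openin (topo G) N \<and> x \<in> N \<and> (\<forall>y\<in>N \<inter> C. norm (f y) \<le> M)" if x: "x \<in> C" for x
  proof -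
    have "\<exists>V F. openin (topo G) V \<and> x \<in> V \<and> smooth_fun_on G V F \<and> (\<forall>y\<in>V \<inter> K. F y = f y)"
      by (rule bspec[OF f[unfolded smooth_fun_on_subset_def] subsetD[OF C(2) x]])
    then obtain V F where V: "openin (topo G) V" "x \<in> V" "smooth_fun_on G V F" "\<forall>y\<in>V \<inter> K. F y = f y"
      by (elim exE conjE)
    have xG: "x \<in> carrier G" using openin_subset[OF V(1)] V(2) topspace_eq by auto
    obtain W \<theta> where c: "(W, \<theta>) \<in> atlas G" "x \<in> W"
      using chart_at[OF xG] by blast
    let ?g = "\<lambda>a. F (inv_into W \<theta> a)" and ?S = "\<theta> ` (V \<inter> W)"
    have S: "open ?S" by (rule open_chart_image[OF c(1) V(1)])
    have "smooth_on ?S ?g" using V(3) c(1) unfolding smooth_fun_on_def by blast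
    then have "continuous_on ?S ?g" unfolding smooth_on_def using Ck_on_continuous_on by blast
    from continuous_open_preimage[OF continuous_on_norm[OF this] S open_lessThan, of "norm (F x) + 1"]
    have "open {a \<in> ?S. norm (?g a) < norm (F x) + 1}" by (simp add: vimage_def Int_def)
    from openin_chart_preimage[OF c(1) this]
    have "openin (topo G) {y \<in> W. \<theta> y \<in> {a \<in> ?S. norm (?g a) < norm (F x) + 1}}" .
    moreover have "x \<in> {y \<in> W. \<theta> y \<in> {a \<in> ?S. norm (?g a) < norm (F x) + 1}}"
      using c(2) V(2) chart_inv_simps(1)[OF c] by auto
    moreover have "norm (f y) \<le> norm (F x) + 1"
      if "y \<in> {y \<in> W. \<theta> y \<in> {a \<in> ?S. norm (?g a) < norm (F x) + 1}} \<inter> C" for y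
    proof -
      have y: "y \<in> W" "\<theta> y \<in> ?S" "norm (?g (\<theta> y)) < norm (F x) + 1" "y \<in> K" using that C(2) by auto
      obtain y' where "y' \<in> V" "y' \<in> W" "\<theta> y = \<theta> y'" using y(2) by blast
      then have "y \<in> V" using chart_facts(4)[OF c(1)] y(1) by (auto dest: inj_onD)
      then show ?thesis using y V(4) chart_inv_simps(1)[OF c(1) y(1)] by simp
    qed
    ultimately show ?thesis by blast
  qed
  then obtain N M where NM: "\<And>x. x \<in> C \<Longrightarrow> openin (topo G) (N x) \<and> x \<in> N x \<and> (\<forall>y\<in>N x \<inter> C. norm (f y) \<le> M x)"
    by metis
  have "\<exists>\<F>. finite \<F> \<and> \<F> \<subseteq> N ` C \<and> C \<subseteq> \<Union>\<F>"
    using compactinD[OF C(1), of "N ` C"] NM by blast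
  then obtain D where D: "D \<subseteq> C" "finite D" "C \<subseteq> \<Union>(N ` D)" by (metis finite_subset_image)
  have "norm (f x) \<le> (\<Sum>d\<in>D. \<bar>M d\<bar>)" if x: "x \<in> C" for x
  proof -
    obtain d where d: "d \<in> D" "x \<in> N d" using D(3) x by blast
    then have "norm (f x) \<le> \<bar>M d\<bar>" using NM[of d] D(1) x by force
    also have "\<dots> \<le> (\<Sum>d\<in>D. \<bar>M d\<bar>)" using d(1) D(2) by (intro member_le_sum) auto
    finally show ?thesis .
  qed
  then show ?thesis by blast
qed

section \<open>The K-type generated by v0\<close>

locale gK_type = gK_module G sc c K \<pi> \<Phi>
  for G :: "('g, 'e::real_normed_vector) lgroup" (structure) and sc :: "complex \<Rightarrow> 'v::ab_group_add \<Rightarrow> 'v"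
    and c K \<pi> \<Phi> +
  fixes C :: "'g set" and \<tau> :: "'v set" and v0 :: 'v
  assumes K_subgroup: "subgroup K G"
    and C_subgroup: "subgroup C G" and C_compact: "compactin (topo G) C"
    and K_form: "K = group_center G <#> C"
    and \<tau>_def: "\<tau> = span {\<Phi> k v0 | k. k \<in> K}"
    and \<tau>_irreducible: "K_irreducible sc K \<Phi> \<tau>"
begin

lemma center_subset: "group_center G \<subseteq> K" and C_subset: "C \<subseteq> K"
proof -
  have "\<one> \<in> group_center G" by (simp add: group_center_def)
  then have "\<one> \<otimes> x \<in> K" if "x \<in> C" for x using that unfolding K_form set_mult_def by blast
  then show "C \<subseteq> K" using subgroup.mem_carrier[OF C_subgroup] by fastforce
  have "z \<otimes> \<one> \<in> K" if "z \<in> group_center G" for z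
    using that subgroup.one_closed[OF C_subgroup] unfolding K_form set_mult_def by blast
  then show "group_center G \<subseteq> K" by (fastforce simp: group_center_def)
qed

lemma \<Phi>_add: "k \<in> K \<Longrightarrow> \<Phi> k (u + v) = \<Phi> k u + \<Phi> k v"
  and \<Phi>_scale: "k \<in> K \<Longrightarrow> \<Phi> k (sc z v) = sc z (\<Phi> k v)"
  and \<Phi>_zero: "k \<in> K \<Longrightarrow> \<Phi> k 0 = 0"
proof -
  assume "k \<in> K"
  then interpret \<Phi>: Vector_Spaces.linear sc sc "\<Phi> k" by (rule K_linear)
  show "\<Phi> k (u + v) = \<Phi> k u + \<Phi> k v" "\<Phi> k (sc z v) = sc z (\<Phi> k v)" "\<Phi> k 0 = 0"
    by (rule \<Phi>.add, rule \<Phi>.scale, rule \<Phi>.zero)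
qed

lemma \<Phi>_inv: "k \<in> K \<Longrightarrow> \<Phi> k (\<Phi> (inv k) v) = v" "k \<in> K \<Longrightarrow> \<Phi> (inv k) (\<Phi> k v) = v"
  using K_mult[of k "inv k"] K_mult[of "inv k" k] subgroup.m_inv_closed[OF K_subgroup]
    subgroup.mem_carrier[OF K_subgroup] by (simp_all add: K_one)

lemma \<tau>_subspace: "subspace \<tau>"
  by (simp add: \<tau>_def)

lemma \<Phi>_\<tau>: "k \<in> K \<Longrightarrow> v \<in> \<tau> \<Longrightarrow> \<Phi> k v \<in> \<tau>"
  using \<tau>_irreducible by (simp add: K_irreducible_def K_invariant_def image_subset_iff)

lemma \<tau>_finite: obtains B where "finite B" "\<tau> \<subseteq> span B"
proof -
  obtain B where B: "finite B" "(\<lambda>k. \<Phi> k v0) ` K \<subseteq> span B" using K_locally_finite[of v0] by blast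
  have "\<tau> \<subseteq> span B" unfolding \<tau>_def using B(2) by (intro span_minimal subspace_span) blast
  then show thesis using that B(1) by blast
qed

lemma v0_\<tau>: "v0 \<in> \<tau>"
  unfolding \<tau>_def using subgroup.one_closed[OF K_subgroup] K_one[of v0, symmetric] by (intro span_base) blast

lemma v0_nonzero: "v0 \<noteq> 0"
proof
  assume "v0 = 0"
  then have "{\<Phi> k v0 | k. k \<in> K} \<subseteq> {0}" using \<Phi>_zero by auto
  then have "\<tau> \<subseteq> {0}" unfolding \<tau>_def by (intro span_minimal) (simp_all add: subspace_single_0)
  then have "\<tau> = {0}" using subspace_0[OF \<tau>_subspace] by blast
  then show False using \<tau>_irreducible by (simp add: K_irreducible_def)
qed

text \<open>A functional vanishing on \<open>\<tau>\<close> with value 1 at \<pi> X v would vanish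
  along the curve \<Phi> (\<gamma> t) v and yet have derivative 1 at t = 0.\<close>

lemma \<pi>_\<tau>:
  assumes X: "X \<in> subgroup_lie_algebra G c K" and v: "v \<in> \<tau>"
  shows "\<pi> X v \<in> \<tau>"
proof (rule ccontr)
  assume "\<pi> X v \<notin> \<tau>"
  then obtain L where L: "Vector_Spaces.linear sc (*) L" "\<forall>v\<in>\<tau>. L v = 0" "L (\<pi> X v) = (1 :: complex)"
    using complex_functional_separates[OF vector_space_axioms \<tau>_subspace] by blast
  obtain \<gamma> where \<gamma>: "one_param_subgroup G c X \<gamma>" "range \<gamma> \<subseteq> K"
    using X unfolding subgroup_lie_algebra_def by blast
  have "((\<lambda>t. L (\<Phi> (\<gamma> t) v)) has_vector_derivative 1) (at 0)"
    using K_differential[OF \<gamma> L(1), of v] L(3) by simp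
  moreover have "L (\<Phi> (\<gamma> t) v) = 0" for t
    using L(2) \<Phi>_\<tau>[OF _ v, of "\<gamma> t"] \<gamma>(2) by blast
  ultimately have "((\<lambda>t :: real. 0 :: complex) has_vector_derivative 1) (at 0)" by simp
  from vector_derivative_unique_at[OF this has_vector_derivative_const] show False by simp
qed

text \<open>An eigenspace of a central element in \<open>\<tau>\<close> is nonzero and
  \<open>K\<close>-invariant, hence everything.\<close>

lemma central_scalar:
  assumes z: "z \<in> group_center G"
  shows "\<exists>a. \<forall>v\<in>\<tau>. \<Phi> z v = sc a v"
proof -
  have zK: "z \<in> K" using z center_subset by blast
  obtain B where B: "finite B" "\<tau> \<subseteq> span B" by (rule \<tau>_finite)
  obtain a x where x: "x \<in> \<tau>" "x \<noteq> 0" "\<Phi> z x = sc a x"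
    by (rule eigenvector_exists[OF vector_space_axioms B(1) \<tau>_subspace B(2) K_linear[OF zK] \<Phi>_\<tau>[OF zK] v0_\<tau> v0_nonzero])
  let ?W = "{v \<in> \<tau>. \<Phi> z v = sc a v}"
  have "subspace ?W"
    using \<tau>_subspace
    by (auto intro!: subspaceI simp: subspace_0 subspace_add subspace_scale \<Phi>_zero[OF zK] \<Phi>_add[OF zK] \<Phi>_scale[OF zK]
        scale_right_distrib mult.commute)
  moreover have "\<Phi> k v \<in> ?W" if "k \<in> K" "v \<in> ?W" for k v
  proof -
    have "z \<otimes> k = k \<otimes> z" using z subgroup.mem_carrier[OF K_subgroup \<open>k \<in> K\<close>] by (simp add: group_center_def)
    then have "\<Phi> z (\<Phi> k v) = \<Phi> k (\<Phi> z v)" using K_mult[OF zK that(1), of v] K_mult[OF that(1) zK, of v] by simp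
    then show ?thesis using that \<Phi>_\<tau> \<Phi>_scale by simp
  qed
  ultimately have "K_invariant sc K \<Phi> ?W" unfolding K_invariant_def by blast
  moreover have "?W \<noteq> {0}" using x by blast
  ultimately have "?W = \<tau>" using \<tau>_irreducible unfolding K_irreducible_def by blast
  then show ?thesis by blast
qed

sublocale RV: real_scaled "\<lambda>r. sc (complex_of_real r)"
  by unfold_locales (simp_all add: scale_right_distrib scale_left_distrib)

lemma real_subspace: "subspace W \<Longrightarrow> RV.subspace W"
  by (auto intro!: RV.subspaceI simp: subspace_0 subspace_add subspace_scale)

text \<open>A real functional is controlled through the complex one of which it is the real part,
  because a factor of modulus 1 does not change the absolute value of the latter; compactness of
  \<open>C\<close> does the rest.\<close>

lemma real_functional_bounded:
  assumes f: "\<And>u v. u \<in> \<tau> \<Longrightarrow> v \<in> \<tau> \<Longrightarrow> f (u + v) = f u + f v"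
      "\<And>r v. v \<in> \<tau> \<Longrightarrow> f (sc (complex_of_real r) v) = r * f v" and v: "v \<in> \<tau>"
  shows "\<exists>M. \<forall>a k. cmod a = 1 \<longrightarrow> k \<in> C \<longrightarrow> \<bar>f (sc a (\<Phi> k v))\<bar> \<le> M"
proof -
  obtain L where L: "Vector_Spaces.linear sc (*) L" "\<forall>v\<in>\<tau>. Re (L v) = f v"
    using real_functional_extend[OF vector_space_axioms \<tau>_subspace, of f] f by blast
  interpret L: Vector_Spaces.linear sc "(*)" L by fact
  obtain M where M: "\<forall>k\<in>C. cmod (L (\<Phi> k v)) \<le> M"
    using smooth_bounded_on_compact[OF K_smooth[OF L(1)] C_compact C_subset] by blast
  have "\<bar>f (sc a (\<Phi> k v))\<bar> \<le> M" if "cmod a = 1" "k \<in> C" for a k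
  proof -
    have "sc a (\<Phi> k v) \<in> \<tau>" using that C_subset v by (intro subspace_scale[OF \<tau>_subspace] \<Phi>_\<tau>) auto
    then have "\<bar>f (sc a (\<Phi> k v))\<bar> = \<bar>Re (a * L (\<Phi> k v))\<bar>" using L(2) L.scale by force
    also have "\<dots> \<le> cmod (a * L (\<Phi> k v))" by (rule abs_Re_le_cmod)
    also have "\<dots> \<le> M" using M that by (simp add: norm_mult)
    finally show ?thesis .
  qed
  then show ?thesis by blast
qed

text \<open>The compact group is enlarged by the complex numbers of modulus 1; invariance under
  these is what later makes multiplication by \<i> skew.\<close>

lemma invariant_form:
  obtains b where "RV.inner_product_on \<tau> b"
    "\<And>a k u v. cmod a = 1 \<Longrightarrow> k \<in> C \<Longrightarrow> u \<in> \<tau> \<Longrightarrow> v \<in> \<tau> \<Longrightarrow> b (sc a (\<Phi> k u)) (sc a (\<Phi> k v)) = b u v"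
proof -
  obtain B0 where B0: "finite B0" "\<tau> \<subseteq> span B0" by (rule \<tau>_finite)
  have R: "\<tau> \<subseteq> RV.span (B0 \<union> sc \<i> ` B0)"
    using complex_span_subset_real_span[OF vector_space_axioms, of B0] B0(2) by blast
  obtain B where B: "B \<subseteq> \<tau>" "RV.independent B" "\<tau> \<subseteq> RV.span B"
    using RV.basis_exists[of \<tau>] by metis
  have fin: "finite B"
    using RV.independent_span_bound[OF _ B(2), of "B0 \<union> sc \<i> ` B0"] B(1) R B0(1) by blast
  have \<tau>_span: "\<tau> = RV.span B"
    using B RV.span_minimal[OF B(1) real_subspace[OF \<tau>_subspace]] by blast
  define \<G> where "\<G> = {g. \<exists>a k. cmod a = 1 \<and> k \<in> C \<and> g = (\<lambda>u. sc a (\<Phi> k u))}"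
  have \<G>I: "(\<lambda>u. sc a (\<Phi> k u)) \<in> \<G>" if "cmod a = 1" "k \<in> C" for a k using that unfolding \<G>_def by blast
  have \<G>E: thesis if "g \<in> \<G>" "\<And>a k. cmod a = 1 \<Longrightarrow> k \<in> C \<Longrightarrow> k \<in> K \<Longrightarrow> g = (\<lambda>u. sc a (\<Phi> k u)) \<Longrightarrow> thesis" for g thesis
    using that C_subset unfolding \<G>_def by blast
  have "\<exists>b. RV.inner_product_on \<tau> b \<and> (\<forall>g\<in>\<G>. \<forall>u\<in>\<tau>. \<forall>v\<in>\<tau>. b (g u) (g v) = b u v)"
  proof (rule RV.invariant_inner_product[OF fin B(2) \<tau>_span])
    show "g (u + v) = g u + g v" "g (sc (complex_of_real r) u) = sc (complex_of_real r) (g u)" if "g \<in> \<G>" for g u v r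
      using that by (auto elim!: \<G>E simp: \<Phi>_add \<Phi>_scale scale_right_distrib mult.commute)
    show "g u \<in> \<tau>" if "g \<in> \<G>" "u \<in> \<tau>" for g u
      using that by (auto elim!: \<G>E intro: subspace_scale[OF \<tau>_subspace] \<Phi>_\<tau>)
    show "(\<lambda>u. u) \<in> \<G>"
      using \<G>I[of 1 \<one>] subgroup.one_closed[OF C_subgroup] by (simp add: K_one)
    show "(\<lambda>u. g (h u)) \<in> \<G>" if gh: "g \<in> \<G>" "h \<in> \<G>" for g h
    proof (rule \<G>E[OF gh(1)], rule \<G>E[OF gh(2)])
      fix a k a' k' assume *: "cmod a = 1" "k \<in> C" "k \<in> K" "g = (\<lambda>u. sc a (\<Phi> k u))"
        "cmod a' = 1" "k' \<in> C" "k' \<in> K" "h = (\<lambda>u. sc a' (\<Phi> k' u))"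
      have "(\<lambda>u. g (h u)) = (\<lambda>u. sc (a * a') (\<Phi> (k \<otimes> k') u))"
        using * by (simp add: \<Phi>_scale K_mult)
      then show ?thesis using * \<G>I[of "a * a'" "k \<otimes> k'"] subgroup.m_closed[OF C_subgroup] by (simp add: norm_mult)
    qed
    show "\<exists>h\<in>\<G>. \<forall>u\<in>\<tau>. g (h u) = u" if g: "g \<in> \<G>" for g
    proof (rule \<G>E[OF g])
      fix a k assume *: "cmod a = 1" "k \<in> C" "k \<in> K" "g = (\<lambda>u. sc a (\<Phi> k u))"
      then have "a \<noteq> 0" by auto
      with * have "g (sc (inverse a) (\<Phi> (inv k) u)) = u" for u
        by (simp add: \<Phi>_scale \<Phi>_inv)
      moreover have "(\<lambda>u. sc (inverse a) (\<Phi> (inv k) u)) \<in> \<G>"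
        using * subgroup.m_inv_closed[OF C_subgroup] by (intro \<G>I) (auto simp: norm_inverse)
      ultimately show ?thesis by (intro bexI[of _ "\<lambda>u. sc (inverse a) (\<Phi> (inv k) u)"] ballI)
    qed
    show "\<exists>M. \<forall>g\<in>\<G>. \<bar>RV.representation B (g j) i\<bar> \<le> M" if ij: "i \<in> B" "j \<in> B" for i j
    proof -
      have "\<exists>M. \<forall>a k. cmod a = 1 \<longrightarrow> k \<in> C \<longrightarrow> \<bar>RV.representation B (sc a (\<Phi> k j)) i\<bar> \<le> M"
        by (rule real_functional_bounded[of "\<lambda>v. RV.representation B v i"])
          (use B(1) ij(2) in \<open>auto simp: \<tau>_span RV.representation_add[OF B(2)] RV.representation_scale[OF B(2)]\<close>)
      then obtain M where "\<bar>RV.representation B (sc a (\<Phi> k j)) i\<bar> \<le> M" if "cmod a = 1" "k \<in> C" for a k by blast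
      then show ?thesis by (intro exI[of _ M]) (auto elim!: \<G>E)
    qed
  qed
  then obtain b where b: "RV.inner_product_on \<tau> b" "\<And>g u v. g \<in> \<G> \<Longrightarrow> u \<in> \<tau> \<Longrightarrow> v \<in> \<tau> \<Longrightarrow> b (g u) (g v) = b u v"
    by blast
  show thesis
  proof (rule that[OF b(1)])
    show "b (sc a (\<Phi> k u)) (sc a (\<Phi> k v)) = b u v"
      if "cmod a = 1" "k \<in> C" "u \<in> \<tau>" "v \<in> \<tau>" for a k u v
      using b(2)[OF \<G>I[OF that(1,2)] that(3,4)] .
  qed
qed

text \<open>The factorisation of the points of a one-parameter subgroup into central and compact
  parts is chosen pointwise, so nothing is known about how the scalar of the central part varies
  with t. It is therefore eliminated before differentiating, by comparing the pair u, v with the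
  pair v0, v0.\<close>

lemma skew_form:
  obtains b where "RV.inner_product_on \<tau> b"
    "\<And>u v. u \<in> \<tau> \<Longrightarrow> v \<in> \<tau> \<Longrightarrow> b (sc \<i> u) v + b u (sc \<i> v) = 0"
    "\<And>X. X \<in> subgroup_lie_algebra G c K \<Longrightarrow> \<exists>a. \<forall>u\<in>\<tau>. \<forall>v\<in>\<tau>. b (\<pi> X u) v + b u (\<pi> X v) = a * b u v"
proof -
  obtain b where b: "RV.inner_product_on \<tau> b"
    and inv: "\<And>a k u v. cmod a = 1 \<Longrightarrow> k \<in> C \<Longrightarrow> u \<in> \<tau> \<Longrightarrow> v \<in> \<tau> \<Longrightarrow> b (sc a (\<Phi> k u)) (sc a (\<Phi> k v)) = b u v"
    by (rule invariant_form) blast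
  note bf = RV.bilinear_form_onD[OF RV.inner_product_onD(1)[OF b]]
  have st: "sc a v \<in> \<tau>" if "v \<in> \<tau>" for a v by (rule subspace_scale[OF \<tau>_subspace that])
  have unit: "b (sc a u) (sc a v) = b u v" if "cmod a = 1" "u \<in> \<tau>" "v \<in> \<tau>" for a u v
    using inv[OF that(1) subgroup.one_closed[OF C_subgroup] that(2,3)] by (simp add: K_one)
  have ii: "b (sc \<i> u) v + b u (sc \<i> v) = 0" if "u \<in> \<tau>" "v \<in> \<tau>" for u v
  proof -
    have "b (sc \<i> u) v = b (sc \<i> (sc \<i> u)) (sc \<i> v)" using unit[of \<i> "sc \<i> u" v] that st by simp
    also have "\<dots> = b (sc (complex_of_real (- 1)) u) (sc \<i> v)" by simp
    also have "\<dots> = - b u (sc \<i> v)" using bf(5)[OF that(1) st[OF that(2)], of "- 1" \<i>] by simp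
    finally show ?thesis by simp
  qed
  \<comment> \<open>Polar form: the phase preserves \<open>b\<close>, and the modulus is real and
    comes out of both arguments.\<close>
  have scal: "b (sc a u) (sc a v) = (cmod a)\<^sup>2 * b u v" if uv: "u \<in> \<tau>" "v \<in> \<tau>" for a u v
  proof -
    have eq: "sc a w = sc (complex_of_real (cmod a)) (sc (cis (Arg a)) w)" for w
      by (simp add: rcis_def[symmetric] rcis_cmod_Arg)
    have "b (sc a u) (sc a v) = cmod a * (cmod a * b (sc (cis (Arg a)) u) (sc (cis (Arg a)) v))"
      unfolding eq using st uv by (simp only: bf(5,6))
    then show ?thesis using unit[of "cis (Arg a)" u v] uv by (simp add: power2_eq_square)
  qed
  have kb: "\<exists>s. \<forall>u\<in>\<tau>. \<forall>v\<in>\<tau>. b (\<Phi> k u) v = s * b u (\<Phi> (inv k) v)" if k: "k \<in> K" for k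
  proof -
    obtain z x where zx: "z \<in> group_center G" "x \<in> C" "k = z \<otimes> x" using k unfolding K_form set_mult_def by blast
    have K: "z \<in> K" "x \<in> K" using zx center_subset C_subset by auto
    obtain a where a: "\<forall>v\<in>\<tau>. \<Phi> z v = sc a v" using central_scalar[OF zx(1)] by blast
    have 1: "b (\<Phi> k u) (\<Phi> k v) = (cmod a)\<^sup>2 * b u v" if uv: "u \<in> \<tau>" "v \<in> \<tau>" for u v
    proof -
      have "\<Phi> k w = sc a (\<Phi> x w)" if "w \<in> \<tau>" for w
        using a \<Phi>_\<tau>[OF K(2) that] K_mult[OF K] by (simp add: zx(3))
      then show ?thesis using scal[OF \<Phi>_\<tau>[OF K(2) uv(1)] \<Phi>_\<tau>[OF K(2) uv(2)]] inv[of 1, OF _ zx(2) uv] uv by simp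
    qed
    have "b (\<Phi> k u) v = (cmod a)\<^sup>2 * b u (\<Phi> (inv k) v)" if "u \<in> \<tau>" "v \<in> \<tau>" for u v
      using 1[OF that(1) \<Phi>_\<tau>[OF subgroup.m_inv_closed[OF K_subgroup k] that(2)]] by (simp add: \<Phi>_inv[OF k])
    then show ?thesis by blast
  qed
  have skew: "\<exists>a. \<forall>u\<in>\<tau>. \<forall>v\<in>\<tau>. b (\<pi> X u) v + b u (\<pi> X v) = a * b u v" if X: "X \<in> subgroup_lie_algebra G c K" for X
  proof -
    obtain \<gamma> where \<gamma>: "one_param_subgroup G c X \<gamma>" "range \<gamma> \<subseteq> K"
      using X unfolding subgroup_lie_algebra_def by blast
    note g = one_param_facts[OF \<gamma>(1)]
    have gK: "\<gamma> t \<in> K" for t using \<gamma>(2) by blast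
    have diff: "((\<lambda>t. b (\<Phi> (\<gamma> t) u) v) has_real_derivative b (\<pi> X u) v) (at 0)" if u: "u \<in> \<tau>" and v: "v \<in> \<tau>" for u v
    proof -
      obtain L where L: "Vector_Spaces.linear sc (*) L" "\<forall>w\<in>\<tau>. Re (L w) = b w v"
        using real_functional_extend[OF vector_space_axioms \<tau>_subspace, of "\<lambda>w. b w v"] bf(3,5) v by metis
      have "((\<lambda>t. Re (L (\<Phi> (\<gamma> t) u))) has_vector_derivative Re (L (\<pi> X u))) (at 0)"
        by (rule bounded_linear.has_vector_derivative[OF bounded_linear_Re K_differential[OF \<gamma> L(1)]])
      then show ?thesis
        using L(2) \<Phi>_\<tau>[OF gK u] \<pi>_\<tau>[OF X u] by (simp add: has_real_derivative_iff_has_vector_derivative)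
    qed
    have diff': "((\<lambda>t. b u (\<Phi> (\<gamma> (- t)) v)) has_real_derivative - b u (\<pi> X v)) (at 0)" if u: "u \<in> \<tau>" and v: "v \<in> \<tau>" for u v
    proof -
      have "((\<lambda>t. b (\<Phi> (\<gamma> (- t)) v) u) has_real_derivative b (\<pi> X v) u * - 1) (at 0)"
        by (rule DERIV_chain2[of "\<lambda>t. b (\<Phi> (\<gamma> t) v) u"]) (use diff[OF v u] in \<open>auto intro!: derivative_eq_intros\<close>)
      then show ?thesis
        using bf(2)[OF u \<Phi>_\<tau>[OF gK v]] bf(2)[OF u \<pi>_\<tau>[OF X v]] by simp
    qed
    have at0: "\<gamma> 0 = \<one>" "\<gamma> (- 0) = \<one>" using g(2) by simp_all
    let ?B = "b v0 v0" and ?d = "\<lambda>u v. b (\<pi> X u) v + b u (\<pi> X v)"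
    have B: "?B > 0" using RV.inner_product_onD(2)[OF b v0_\<tau> v0_nonzero] .
    have "?d u v = ?d v0 v0 / ?B * b u v" if u: "u \<in> \<tau>" and v: "v \<in> \<tau>" for u v
    proof -
      \<comment> \<open>Both sides contain the same unknown factor from \<open>kb\<close>. The
        product rule at t = 0 then expresses \<open>?d u v\<close> through \<open>?d v0 v0\<close>,
        and division by the positive number \<open>?B\<close> yields the constant.\<close>
      have "b (\<Phi> (\<gamma> t) u) v * b v0 (\<Phi> (\<gamma> (- t)) v0) = b (\<Phi> (\<gamma> t) v0) v0 * b u (\<Phi> (\<gamma> (- t)) v)" for t
        using kb[OF gK[of t]] u v v0_\<tau> by (auto simp: g(3))
      then have eq: "(\<lambda>t. b (\<Phi> (\<gamma> t) u) v * b v0 (\<Phi> (\<gamma> (- t)) v0)) = (\<lambda>t. b (\<Phi> (\<gamma> t) v0) v0 * b u (\<Phi> (\<gamma> (- t)) v))"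
        by (rule ext)
      have "b (\<pi> X u) v * ?B + - b v0 (\<pi> X v0) * b u v = b (\<pi> X v0) v0 * b u v + - b u (\<pi> X v) * ?B"
        using DERIV_unique[OF DERIV_mult[OF diff[OF u v] diff'[OF v0_\<tau> v0_\<tau>], unfolded eq]
            DERIV_mult[OF diff[OF v0_\<tau> v0_\<tau>] diff'[OF u v]]]
        by (simp add: at0 K_one)
      then show ?thesis using B by (simp add: field_simps)
    qed
    then show ?thesis by blast
  qed
  show thesis by (rule that[OF b ii skew])
qed

end

section \<open>Projections along invariant complements, and irreducibility\<close>

text \<open>All properties follow from uniqueness of the decomposition, including commutation with
  any additive \<open>T\<close> that preserves both summands.\<close>

lemma complement_projection:
  assumes vs: "vector_space sc" and W: "module.subspace sc W" and W': "module.subspace sc W'"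
    and int: "W \<inter> W' = {0}" and sum: "sum_carrier W W' = UNIV"
  obtains P where "\<And>u v. P (u + v) = P u + P v" "\<And>z v. P (sc z v) = sc z (P v)"
    "\<And>v. P v \<in> W" "\<And>v. v - P v \<in> W'"
    "\<And>T v. \<forall>u v. T (u + v) = T u + T v \<Longrightarrow> T ` W \<subseteq> W \<Longrightarrow> T ` W' \<subseteq> W' \<Longrightarrow> P (T v) = T (P v)"
proof -
  interpret vector_space sc by fact
  have "\<exists>w. w \<in> W \<and> v - w \<in> W'" for v
  proof -
    have "v \<in> sum_carrier W W'" using sum by blast
    then show ?thesis unfolding sum_carrier_def by force
  qed
  then obtain P where P: "\<And>v. P v \<in> W" "\<And>v. v - P v \<in> W'" by metis
  have unique: "P v = w" if "w \<in> W" "v - w \<in> W'" for v w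
  proof -
    have "P v - w \<in> W" using subspace_diff[OF W P(1) that(1)] .
    moreover have "P v - w \<in> W'" using subspace_diff[OF W' that(2) P(2)[of v]] by simp
    ultimately have "P v - w \<in> {0}" unfolding int[symmetric] by (rule IntI)
    then show ?thesis by simp
  qed
  show thesis
  proof (rule that[OF _ _ P])
    show "P (u + v) = P u + P v" for u v
      using subspace_add[OF W P(1) P(1)] subspace_add[OF W' P(2)[of u] P(2)[of v]]
      by (intro unique) (simp_all add: algebra_simps)
    show "P (sc z v) = sc z (P v)" for z v
      using subspace_scale[OF W P(1)] subspace_scale[OF W' P(2)[of v], of z]
      by (intro unique) (simp_all add: scale_right_diff_distrib)
    show "P (T v) = T (P v)" if T: "\<forall>u v. T (u + v) = T u + T v" "T ` W \<subseteq> W" "T ` W' \<subseteq> W'" for T v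
    proof (rule unique)
      show "T (P v) \<in> W" using T(2) P(1) by blast
      have "T v = T (v - P v) + T (P v)" using T(1)[rule_format, of "v - P v" "P v"] by simp
      then show "T v - T (P v) \<in> W'" using T(3) P(2)[of v] by auto
    qed
  qed
qed

theorem proposition2p2:
  fixes G :: "('g, 'e::real_normed_vector) lgroup"
    and c :: "('g, 'e) chart"
    and K C :: "'g set"
    and br :: "'e \<Rightarrow> 'e \<Rightarrow> 'e"
    and kC pp pm :: "('e \<times> 'e) set"
    and sc :: "complex \<Rightarrow> 'v::ab_group_add \<Rightarrow> 'v"
    and \<pi> :: "'e \<Rightarrow> 'v \<Rightarrow> 'v"
    and \<Phi> :: "'g \<Rightarrow> 'v \<Rightarrow> 'v"
    and v0 :: 'v
    and \<tau> :: "'v set"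
  assumes lie_group: "lie_group G"
    and identity_chart: "c \<in> atlas G" "\<one>\<^bsub>G\<^esub> \<in> fst c"
    and K_subgroup: "subgroup K G"
    and K_connected: "connectedin (topo G) K"
    and C_compact: "subgroup C G" "compactin (topo G) C"
    and K_form: "K = group_center G <#>\<^bsub>G\<^esub> C"
    and br_def: "br = lie_bracket G c"
    and kC_def: "kC = subgroup_lie_algebra G c K \<times> subgroup_lie_algebra G c K"
    and pp_subalgebra: "clie_subalgebra br pp"
    and pm_subalgebra: "clie_subalgebra br pm"
    and direct_sum: "\<And>Z. \<exists>!(P, X, Q). P \<in> pp \<and> X \<in> kC \<and> Q \<in> pm \<and> Z = P + X + Q"
    and kC_pp: "\<And>X P. X \<in> kC \<Longrightarrow> P \<in> pp \<Longrightarrow> cbracket br X P \<in> pp"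
    and kC_pm: "\<And>X Q. X \<in> kC \<Longrightarrow> Q \<in> pm \<Longrightarrow> cbracket br X Q \<in> pm"
    and gK_module: "gK_module G sc c K \<pi> \<Phi>"
    and complements: "\<And>W. gK_invariant sc K \<pi> \<Phi> W \<Longrightarrow>
          \<exists>W'. gK_invariant sc K \<pi> \<Phi> W' \<and> W \<inter> W' = {0} \<and> sum_carrier W W' = UNIV"
    and cyclic: "module.span sc
          {uea_act sc (crep sc \<pi>) u v0 | u. u \<in> carrier (uea cscale (cbracket br) UNIV)} = UNIV"
    and \<tau>_def: "\<tau> = module.span sc {\<Phi> k v0 | k. k \<in> K}"
    and \<tau>_irreducible: "K_irreducible sc K \<Phi> \<tau>"
    and \<tau>_once: "occurs_exactly_once br sc \<pi> kC pm \<tau>"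
    and pm_annihilates: "\<And>Q. Q \<in> pm \<Longrightarrow> crep sc \<pi> Q v0 = 0"
  shows "gK_irreducible sc K \<pi> \<Phi>"
proof -
  obtain U \<phi> where c: "c = (U, \<phi>)" by (cases c)
  interpret T: gK_type G sc c K \<pi> \<Phi> C \<tau> v0
    by (intro gK_type.intro gK_module gK_type_axioms.intro K_subgroup C_compact K_form \<tau>_def \<tau>_irreducible)
  interpret L: lie_chart G U \<phi>
    using identity_chart unfolding c by (intro lie_chart.intro lie_group lie_chart_axioms.intro) simp_all
  let ?k = "subgroup_lie_algebra G c K"
  \<comment> \<open>Closedness lets the limit argument for one-parameter subgroups be applied, so
    that \<kk> is a subspace and closed under the bracket.\<close>
  have K_closed: "closedin (topo G) K"
    unfolding K_form by (rule T.closedin_set_mult_compact[OF T.closedin_group_center C_compact(2)])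
  have br: "br X Y = L.hess X Y - L.hess Y X" for X Y
    unfolding br_def c by (rule L.lie_bracket_eq_hess)
  have br_add: "br (X + Y) Z = br X Z + br Y Z" "br Z (X + Y) = br Z X + br Z Y" for X Y Z
    by (simp_all add: br linear_add[OF L.hess_linear_left] linear_add[OF L.hess_linear_right])
  \<comment> \<open>Used for the bracket of \<open>pm\<close> with \<open>kC\<close>; the hypothesis
    \<open>kC_pm\<close> has the factors in the other order.\<close>
  have anti: "cbracket br Y X = - cbracket br X Y" for X Y
    by (simp add: cbracket_def br algebra_simps)
  have k_subspace: "subspace ?k"
    unfolding c by (rule L.subspace_subgroup_lie_algebra[OF K_subgroup K_closed])
  have k_br: "br X Y \<in> ?k" if "X \<in> ?k" "Y \<in> ?k" for X Y
    using L.lie_bracket_subgroup_lie_algebra[OF K_subgroup K_closed] that unfolding c br_def by blast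
  interpret cs: vector_space "cscale :: complex \<Rightarrow> 'e \<times> 'e \<Rightarrow> 'e \<times> 'e"
    by (rule vector_space_cscale)
  have kC_subspace: "cs.subspace kC"
    unfolding kC_def
    by (rule cs.subspaceI) (auto simp: cscale_def zero_prod_def intro!: subspace_add[OF k_subspace]
        subspace_diff[OF k_subspace] subspace_scale[OF k_subspace] subspace_0[OF k_subspace])
  have pp: "cs.subspace pp" and pm: "cs.subspace pm" "\<And>X Y. X \<in> pm \<Longrightarrow> Y \<in> pm \<Longrightarrow> cbracket br X Y \<in> pm"
    using pp_subalgebra pm_subalgebra unfolding clie_subalgebra_def by blast+
  \<comment> \<open>An element of both summands has two decompositions, with itself in the middle or
    in the last place, so uniqueness makes it 0.\<close>
  have kC_pm_0: "X = 0" if "X \<in> kC" "X \<in> pm" for X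
  proof -
    have "(case (0, X, 0) of (P, Y, Q) \<Rightarrow> P \<in> pp \<and> Y \<in> kC \<and> Q \<in> pm \<and> X = P + Y + Q)"
      "(case (0, 0, X) of (P, Y, Q) \<Rightarrow> P \<in> pp \<and> Y \<in> kC \<and> Q \<in> pm \<and> X = P + Y + Q)"
      using that cs.subspace_0[OF pp] cs.subspace_0[OF pm(1)] cs.subspace_0[OF kC_subspace] by simp_all
    note the1_equality[OF direct_sum this(1)] the1_equality[OF direct_sum this(2)]
    then show ?thesis by simp
  qed
  have ind: "induced_setup sc br \<pi> kC pm \<tau>"
  proof (intro induced_setup.intro T.vector_space_axioms induced_setup_axioms.intro)
    show "\<pi> (br X Y) v = \<pi> X (\<pi> Y v) - \<pi> Y (\<pi> X v)" for X Y v
      unfolding br_def by (rule T.lie_bracket)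
    show "cbracket br X Y \<in> kC" if "X \<in> kC" "Y \<in> kC" for X Y
      using that by (auto simp: kC_def cbracket_def intro!: subspace_add[OF k_subspace] subspace_diff[OF k_subspace] k_br)
    show "cbracket br X Y \<in> pm" if "X \<in> pm" "Y \<in> kC" for X Y
      using cs.subspace_neg[OF pm(1) kC_pm[OF that(2,1)]] anti[of X Y] by simp
    show "crep sc \<pi> X t \<in> \<tau>" if "X \<in> kC" "t \<in> \<tau>" for X t
      using that T.\<pi>_\<tau>[OF _ that(2)]
      by (auto simp: kC_def crep_def intro!: T.subspace_add[OF T.\<tau>_subspace] T.subspace_scale[OF T.\<tau>_subspace])
  qed (fact T.lie_linear T.lie_add T.lie_scaleR br_add kC_subspace pm kC_pm_0 kC_pm T.\<tau>_subspace)+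
  obtain bg E where bg: "finite E" "\<And>Y. (\<Sum>e\<in>E. bg Y e *\<^sub>R e) = Y" "\<And>Y Z. bg Y Z = bg Z Y"
    "\<And>X Y Z. X \<in> subgroup_lie_algebra G (U, \<phi>) K \<Longrightarrow> bg (L.BR X Y) Z = - bg Y (L.BR X Z)"
    by (rule L.Ad_invariant_skew_basis[OF C_compact K_subgroup K_form]) (rule that)
  obtain b where b: "T.RV.inner_product_on \<tau> b"
    "\<And>u v. u \<in> \<tau> \<Longrightarrow> v \<in> \<tau> \<Longrightarrow> b (sc \<i> u) v + b u (sc \<i> v) = 0"
    "\<And>X. X \<in> ?k \<Longrightarrow> \<exists>a. \<forall>u\<in>\<tau>. \<forall>v\<in>\<tau>. b (\<pi> X u) v + b u (\<pi> X v) = a * b u v"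
    by (rule T.skew_form) (rule that)
  obtain B where B: "finite B" "\<tau> \<subseteq> T.span B" by (rule T.\<tau>_finite)
  interpret WS: word_setup sc br \<pi> kC pm \<tau> ?k bg E b B
    by (intro word_setup.intro ind word_setup_axioms.intro kC_def bg[folded c, folded br_def] b B)
  have gen: "S = UNIV" if "T.subspace S" "v0 \<in> S" "\<And>X v. v \<in> S \<Longrightarrow> \<pi> X v \<in> S" for S
    by (rule enveloping_span_stable[OF ind cyclic that])
  have "W = {0} \<or> W = UNIV" if W: "gK_invariant sc K \<pi> \<Phi> W" for W
  proof -
    have inv: "T.subspace W" "\<And>X. \<pi> X ` W \<subseteq> W" if "gK_invariant sc K \<pi> \<Phi> W" for W
      using that by (simp_all add: gK_invariant_def K_invariant_def)
    obtain W' where W': "gK_invariant sc K \<pi> \<Phi> W'" "W \<inter> W' = {0}" "sum_carrier W W' = UNIV"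
      using complements[OF W] by blast
    obtain P where P: "\<And>u v. P (u + v) = P u + P v" "\<And>z v. P (sc z v) = sc z (P v)"
      "\<And>v. P v \<in> W" "\<And>v. v - P v \<in> W'"
      "\<And>T v. \<forall>u v. T (u + v) = T u + T v \<Longrightarrow> T ` W \<subseteq> W \<Longrightarrow> T ` W' \<subseteq> W' \<Longrightarrow> P (T v) = T (P v)"
      by (rule complement_projection[OF T.vector_space_axioms inv(1)[OF W] inv(1)[OF W'(1)] W'(2,3)]) (rule that)
    have P\<pi>: "P (\<pi> X v) = \<pi> X (P v)" for X v
      by (rule P(5)[OF _ inv(2)[OF W] inv(2)[OF W'(1)]]) (simp add: WS.\<pi>_lin(1))
    obtain z where z: "P v0 = sc z v0"
      using WS.scalar_on_vector[OF P(1,2) P\<pi> gen \<tau>_once T.v0_\<tau> pm_annihilates T.v0_nonzero] by blast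
    show ?thesis
    proof (cases "z = 0")
      case True
      then have "v0 \<in> W'" using P(4)[of v0] z by simp
      then have "W' = UNIV" using gen[OF inv(1)[OF W'(1)]] inv(2)[OF W'(1)] by blast
      then show ?thesis using W'(2) by simp
    next
      case False
      then have "v0 = sc (inverse z) (P v0)" by (simp add: z)
      then have "v0 \<in> W" using T.subspace_scale[OF inv(1)[OF W] P(3)[of v0], of "inverse z"] by simp
      then show ?thesis using gen[OF inv(1)[OF W]] inv(2)[OF W] by blast
    qed
  qed
  moreover have "(UNIV :: 'v set) \<noteq> {0}" using T.v0_nonzero by blast
  ultimately show ?thesis by (simp add: gK_irreducible_def)
qed

end
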